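(* Let $0\le\vartheta\le1$, $0\le n,j<+\infty$, $0\le\vartheta n-j\le\frac d2$, with $\vartheta\ne1$ if $n=j+\frac d2$; let $r\in[2,+\infty]$ be defined by $\frac1r=\frac12-\frac{\vartheta n-j}d$. Then $H^n\subset\mathcal L^{2,r,j}$ and both the Gagliardo-Nirenberg and the Sobolev inequality hold, i.e., there are constants $G,S\in[0,+\infty)$ such that for all $f\in H^n$ $$\|D^jf\|_{\mathcal L^r}\le G\,\|f\|^{1-\vartheta}_{\mathcal L^2}\|D^nf\|^\vartheta_{\mathcal L^2},\qquad \|D^jf\|_{\mathcal L^r}\le S\,\sqrt{\|f\|^2_{\mathcal L^2}+\|D^nf\|^2_{\mathcal L^2}}.$$
   Context: Fix $d\in\{1,2,3,\dots\}$; functions are complex-valued on $\mathbb R^d$. $\mathcal S$ is the Schwartz space; the Fourier transform is $\mathcal F\varphi(k)=(2\pi)^{-d/2}\int_{\mathbb R^d}e^{-ik\cdot x}\varphi(x)\,dx$. $\Phi:=\{\phi\in\mathcal S:\int x_{i_1}\cdots x_{i_m}\phi(x)dx=0 \text{ for all } m\ge 0, i_1,\dots,i_m\}$ and $\Psi:=\{\psi\in\mathcal S: \partial_{i_1\cdots i_m}\psi(0)=0\text{ for all } m\ge0,i_1,\dots,i_m\}$ are closed subspaces of $\mathcal S$ with $\mathcal F\Phi=\Psi$; $\Phi',\Psi'$ are their topological duals. $\mathcal F:\Phi'\to\Psi'$ is the bijection $\langle\mathcal Ff,\psi\rangle:=\langle f,\mathcal F^{-1}\psi_R\rangle$, $\psi_R(k)=\psi(-k)$.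 For $s\in\mathbb R$ and $g\in\Psi'$, $|k|^sg\in\Psi'$ is $\langle|k|^sg,\psi\rangle:=\langle g,|k|^s\psi\rangle$, and $D^s:\Phi'\to\Phi'$ is the bijection $D^sf:=\mathcal F^{-1}(|k|^s\mathcal Ff)$ (so $D=\sqrt{-\Delta}$). $\mathcal L^p:=L^p(\mathbb R^d,\mathbb C)$ for $p\in[1,+\infty)$, while $\mathcal L^\infty:=C_0(\mathbb R^d,\mathbb C)$ (continuous functions vanishing at infinity, sup norm). A function $f\in\mathcal L^p$ is identified with the element $\phi\mapsto\int f\phi$ of $\Phi'$ (this map is injective). $H^n:=\{f\in\mathcal L^2:D^nf\in\mathcal L^2\}$, $\mathcal L^{2,r,j}:=\{f\in\mathcal L^2:D^jf\in\mathcal L^r\}$. Convention: $0^0:=1$. *)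

theory Defs
  imports "HOL-Analysis.Analysis"
begin

text \<open>
  The dimension is \<open>d = CARD('d)\<close>. Elements of the duals \<open>\<Phi>'\<close> and \<open>\<Psi>'\<close> are functionals that are
  \<open>undefined\<close> off \<open>\<Phi>\<close>, respectively \<open>\<Psi>\<close>, so that HOL equality is equality in the dual.
\<close>

type_synonym 'd fn = "real ^ 'd \<Rightarrow> complex"
type_synonym 'd functional = "'d fn \<Rightarrow> complex"

section \<open>The Schwartz space and its topology\<close>

definition partial :: "'d::finite \<Rightarrow> 'd fn \<Rightarrow> 'd fn" where
  "partial i f = (\<lambda>x. frechet_derivative f (at x) (axis i 1))"

definition partials :: "'d::finite list \<Rightarrow> 'd fn \<Rightarrow> 'd fn" where
  "partials \<beta> = foldr partial \<beta>"

definition monomial :: "'d::finite list \<Rightarrow> real ^ 'd \<Rightarrow> real" where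
  "monomial \<alpha> x = (\<Prod>i\<leftarrow>\<alpha>. x $ i)"

definition schwartz :: "'d::finite fn set" where
  "schwartz = {\<phi>. (\<forall>\<beta> x. partials \<beta> \<phi> differentiable (at x)) \<and>
     (\<forall>\<alpha> \<beta>. bounded (range (\<lambda>x. of_real (monomial \<alpha> x) * partials \<beta> \<phi> x)))}"

definition schwartz_seminorm :: "'d::finite list \<Rightarrow> 'd list \<Rightarrow> 'd fn \<Rightarrow> real" where
  "schwartz_seminorm \<alpha> \<beta> \<phi> = (SUP x. cmod (of_real (monomial \<alpha> x) * partials \<beta> \<phi> x))"

definition schwartz_topology :: "'d::finite fn topology" where
  "schwartz_topology = topology_generated_by
     {{\<eta> \<in> schwartz. schwartz_seminorm \<alpha> \<beta> (\<lambda>x. \<eta> x - \<phi> x) < \<epsilon>} | \<alpha> \<beta> \<phi> \<epsilon>.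
        \<phi> \<in> schwartz \<and> \<epsilon> > 0}"

definition top_dual :: "'d::finite fn set \<Rightarrow> 'd functional set" where
  "top_dual V = {f \<in> extensional V.
     (\<forall>u\<in>V. \<forall>v\<in>V. \<forall>a b. f (\<lambda>x. a * u x + b * v x) = a * f u + b * f v) \<and>
     continuous_map (subtopology schwartz_topology V) euclidean f}"

definition Phi :: "'d::finite fn set" where
  "Phi = {\<phi> \<in> schwartz. \<forall>\<alpha>. (LINT x|lborel. of_real (monomial \<alpha> x) * \<phi> x) = 0}"

definition Psi :: "'d::finite fn set" where
  "Psi = {\<psi> \<in> schwartz. \<forall>\<beta>. partials \<beta> \<psi> 0 = 0}"

section \<open>Fourier transform and the operators \<open>D\<^sup>s\<close>\<close>

definition fourier :: "'d::finite fn \<Rightarrow> 'd fn" where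
  "fourier \<phi> k = of_real ((2 * pi) powr (- real CARD('d) / 2)) *
     (LINT x|lborel. exp (- \<i> * of_real (k \<bullet> x)) * \<phi> x)"

definition fourier_inv :: "'d::finite fn \<Rightarrow> 'd fn" where
  "fourier_inv = inv_into schwartz fourier"

definition fourier_dual :: "'d::finite functional \<Rightarrow> 'd functional" where
  "fourier_dual f = (\<lambda>\<psi>\<in>Psi. f (fourier_inv (\<lambda>k. \<psi> (- k))))"

definition fourier_dual_inv :: "'d::finite functional \<Rightarrow> 'd functional" where
  "fourier_dual_inv = inv_into (top_dual Phi) fourier_dual"

text \<open>
  The value of \<open>powr\<close> at \<open>k = 0\<close> is irrelevant here, because \<open>\<psi> 0 = 0\<close>.
\<close>

definition abs_powr_mult :: "real \<Rightarrow> 'd::finite functional \<Rightarrow> 'd functional" where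
  "abs_powr_mult s g = (\<lambda>\<psi>\<in>Psi. g (\<lambda>k. of_real (norm k powr s) * \<psi> k))"

definition D :: "real \<Rightarrow> 'd::finite functional \<Rightarrow> 'd functional" where
  "D s f = fourier_dual_inv (abs_powr_mult s (fourier_dual f))"

section \<open>The spaces \<open>\<L>\<^sup>p\<close>, \<open>H\<^sup>n\<close> and \<open>\<L>\<^sup>2\<^sup>,\<^sup>r\<^sup>,\<^sup>j\<close> inside \<open>\<Phi>'\<close>\<close>

definition Lp_fun :: "ereal \<Rightarrow> 'd::finite fn set" where
  "Lp_fun p =
     (if p = \<infinity> then {f. continuous_on UNIV f \<and> (f \<longlongrightarrow> 0) at_infinity}
      else {f \<in> borel_measurable lborel.
              integrable lborel (\<lambda>x. cmod (f x) powr real_of_ereal p)})"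

definition Lp_fun_norm :: "ereal \<Rightarrow> 'd::finite fn \<Rightarrow> real" where
  "Lp_fun_norm p f =
     (if p = \<infinity> then (SUP x. cmod (f x))
      else (LINT x|lborel. cmod (f x) powr real_of_ereal p) powr (1 / real_of_ereal p))"

definition functional_of :: "'d::finite fn \<Rightarrow> 'd functional" where
  "functional_of f = (\<lambda>\<phi>\<in>Phi. LINT x|lborel. f x * \<phi> x)"

text \<open>
  Under the identification of functions with functionals, \<open>\<L>\<^sup>p\<close> is a subset of \<open>\<Phi>'\<close>. Two functions
  in \<open>\<L>\<^sup>p\<close> give the same functional iff they agree almost everywhere, so the norm does not depend on
  the representative chosen by \<open>inv_into\<close>. Both notions are meant for \<open>1 \<le> p\<close>.
\<close>

definition Lp :: "ereal \<Rightarrow> 'd::finite functional set" where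
  "Lp p = functional_of ` Lp_fun p"

definition Lp_norm :: "ereal \<Rightarrow> 'd::finite functional \<Rightarrow> real" where
  "Lp_norm p f = Lp_fun_norm p (inv_into (Lp_fun p) functional_of f)"

definition sobolev_H :: "real \<Rightarrow> 'd::finite functional set" where
  "sobolev_H n = {f \<in> Lp 2. D n f \<in> Lp 2}"

definition L2rj :: "ereal \<Rightarrow> real \<Rightarrow> 'd::finite functional set" where
  "L2rj r j = {f \<in> Lp 2. D j f \<in> Lp r}"

text \<open>Real powers of nonnegative reals with \<open>0\<^sup>0 = 1\<close>, whereas \<open>0 powr 0 = 0\<close>.\<close>

definition rpow :: "real \<Rightarrow> real \<Rightarrow> real" where
  "rpow x a = (if a = 0 then 1 else x powr a)"

end

theory Submission
  imports Defs "HOL-Probability.Characteristic_Functions" "HOL-Real_Asymp.Real_Asymp"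
begin

text \<open>
  Everything happens on the Fourier side. A measurable function \<open>G\<close> of at most polynomial size in the mean
  defines the functional \<open>spectral G\<close> on \<open>\<Phi>\<close>, \<open>\<phi> \<mapsto> \<integral> G(k) (\<F>\<phi>)(-k) dk\<close>, and on such functionals \<open>D\<^sup>s\<close>
  is multiplication of \<open>G\<close> by \<open>|k|\<^sup>s\<close> (\<open>D_spectral\<close>). Every \<open>f\<close> in \<open>L\<^sup>2\<close> is of the form \<open>spectral g\<close> with
  \<open>\<parallel>g\<parallel> \<le> \<parallel>f\<parallel>\<close>, and \<open>G\<close> is determined almost everywhere by \<open>spectral G\<close>. Hence a member \<open>f\<close> of \<open>H\<^sup>n\<close> has a
  density \<open>g\<close> with \<open>\<parallel>g\<parallel> \<le> \<parallel>f\<parallel>\<close> and \<open>\<parallel>|k|\<^sup>n g\<parallel> \<le> \<parallel>D\<^sup>n f\<parallel>\<close> (\<open>sobolev_spectral\<close>), and the claim becomes an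
  estimate of the transform of \<open>|k|\<^sup>j g\<close> by the two weighted \<open>L\<^sup>2\<close> norms.

  Let \<open>\<sigma> = \<theta> n - j\<close>. If \<open>\<sigma> < d/2\<close>, then \<open>r = 2d/(d - 2\<sigma>)\<close> is finite. Young's inequality, optimised over a
  scale, bounds \<open>\<parallel>|k|\<^bsup>\<theta>n\<^esup> g\<parallel>\<close> by \<open>\<parallel>g\<parallel>\<^bsup>1-\<theta>\<^esup> \<parallel>|k|\<^sup>n g\<parallel>\<^sup>\<theta>\<close>, and it remains to bound the \<open>L\<^sup>r\<close> norm of the
  transform \<open>F\<close> of \<open>G\<close> by \<open>\<parallel>|k|\<^sup>\<sigma> G\<parallel>\<close>. For that, \<open>{|F| \<ge> t}\<close> is estimated for each \<open>t\<close> separately: the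
  frequencies below a threshold depending on \<open>t\<close> contribute at most \<open>t/2\<close> to \<open>F\<close> everywhere, by
  Cauchy--Schwarz, so the remaining ones contribute at least \<open>t/2\<close> there, and Chebyshev's inequality with
  the \<open>L\<^sup>2\<close> bound of the transform controls the measure of the set. Integrating over \<open>t\<close> and exchanging the
  integrals gives the bound (\<open>fractional_sobolev\<close>).

  If \<open>\<sigma> = d/2\<close>, then \<open>r = \<infinity>\<close> and \<open>\<theta> < 1\<close>, so \<open>n > j + d/2\<close>. Now \<open>|k|\<^sup>j g\<close> is integrable: this is
  Cauchy--Schwarz against the weight \<open>R\<^bsup>2n\<^esup> + |k|\<^bsup>2n\<^esup>\<close>, and the choice of \<open>R\<close> produces the right powers of the
  two norms (\<open>L1_riesz_bound\<close>). The transform of an integrable function is bounded and uniformly continuous;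
  as it also lies in \<open>L\<^sup>2\<close>, it vanishes at infinity.

  Two points need an argument. First, norms of functionals are defined through an arbitrary representing
  function, so this function has to be unique, that is, a function in \<open>L\<^sup>p\<close> or \<open>C\<^sub>0\<close> that annihilates \<open>\<Phi>\<close>
  is zero. Indeed, a Schwartz function can be approximated by elements of \<open>\<Phi>\<close> by cutting out a shrinking
  neighbourhood of the origin in Fourier space, and the error, convolution with a low, wide bump of fixed
  \<open>L\<^sup>1\<close> norm, is not seen by such functions in the limit (\<open>Phi_annihilator_zero\<close>). Second, the transform on
  \<open>L\<^sup>2\<close> enters as a contraction that satisfies the duality formula with Schwartz functions; it is obtained
  from the inequality \<open>\<parallel>\<F>f\<parallel> \<le> \<parallel>f\<parallel>\<close> for integrable \<open>f\<close>, which Gaussian regularisation gives directly.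

  The second inequality of the theorem follows from the first, since
  \<open>a\<^bsup>1-\<theta>\<^esup> b\<^sup>\<theta> \<le> max a b \<le> sqrt (a\<^sup>2 + b\<^sup>2)\<close>.
\<close>

section \<open>Integrals of powers of the norm\<close>

lemma Basis_real_vec: "(Basis :: (real^'d) set) = range (\<lambda>i. axis i 1)"
  by (auto simp: Basis_vec_def)

lemma prod_Basis_real_vec:
  fixes x :: "real^'d" and h :: "real \<Rightarrow> 'a::comm_monoid_mult"
  shows "(\<Prod>b\<in>Basis. h (x \<bullet> b)) = (\<Prod>i\<in>UNIV. h (x $ i))"
proof -
  have "inj (\<lambda>i. axis i (1::real) :: real^'d)" by (auto simp: inj_on_def axis_eq_axis)
  then show ?thesis by (simp add: Basis_real_vec prod.reindex inner_axis)
qed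

text \<open>
  Integrals of radial weights over \<open>\<real>\<^sup>d\<close> are estimated below by products of one-dimensional integrals over
  the coordinates, in place of polar coordinates.
\<close>

lemma nn_integral_prod_coords:
  fixes h :: "real \<Rightarrow> ennreal"
  assumes [measurable]: "h \<in> borel_measurable borel"
  shows "(\<integral>\<^sup>+x. (\<Prod>i\<in>UNIV. h (x $ i)) \<partial>(lborel :: (real^'d) measure)) = (\<integral>\<^sup>+t. h t \<partial>lborel) ^ CARD('d)"
  using nn_integral_lborel_prod[of "\<lambda>_::real^'d. h"]
  by (simp add: prod_Basis_real_vec)

text \<open>
  The affine substitution \<open>x \<mapsto> t + c x\<close> covers translations, reflections (\<open>c = -1\<close>) and dilations.
\<close>

lemma nn_integral_lborel_scale:
  fixes f :: "'a::euclidean_space \<Rightarrow> ennreal"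
  assumes [measurable]: "f \<in> borel_measurable borel" and "c \<noteq> 0"
  shows "(\<integral>\<^sup>+x. f x \<partial>lborel) = \<bar>c\<bar> ^ DIM('a) * (\<integral>\<^sup>+x. f (t + c *\<^sub>R x) \<partial>lborel)"
  by (subst lborel_affine[OF assms(2), of t])
     (simp add: nn_integral_density nn_integral_distr nn_integral_cmult ennreal_power)

lemma integrable_lborel_scale:
  fixes f :: "'a::euclidean_space \<Rightarrow> 'b::{banach, second_countable_topology}"
  assumes "c \<noteq> 0" and f: "integrable lborel f"
  shows "integrable lborel (\<lambda>x. f (t + c *\<^sub>R x))"
proof (rule integrableI_bounded)
  have [measurable]: "f \<in> borel_measurable borel" using f by auto
  show "(\<lambda>x. f (t + c *\<^sub>R x)) \<in> borel_measurable lborel" by simp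
  have "(\<integral>\<^sup>+x. norm (f x) \<partial>lborel) < \<infinity>" using f by (simp add: integrable_iff_bounded)
  then have "ennreal (\<bar>c\<bar> ^ DIM('a)) * (\<integral>\<^sup>+x. norm (f (t + c *\<^sub>R x)) \<partial>lborel) < \<infinity>"
    using nn_integral_lborel_scale[of "\<lambda>x. norm (f x)" c t] assms by (simp add: ennreal_power)
  then show "(\<integral>\<^sup>+x. norm (f (t + c *\<^sub>R x)) \<partial>lborel) < \<infinity>"
    using assms by (auto simp: ennreal_mult_less_top zero_less_power)
qed

lemma integral_lborel_scale:
  fixes f :: "'a::euclidean_space \<Rightarrow> 'b::{banach, second_countable_topology}"
  assumes "c \<noteq> 0" and [measurable]: "f \<in> borel_measurable borel"
  shows "(\<integral>x. f x \<partial>lborel) = \<bar>c\<bar> ^ DIM('a) *\<^sub>R (\<integral>x. f (t + c *\<^sub>R x) \<partial>lborel)"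
  by (subst lborel_affine[OF assms(1), of t])
     (simp add: integral_density integral_distr)

lemma nn_integral_abs_powr_ball:
  fixes a A :: real
  assumes "a < 1" "A \<ge> 0"
  shows "(\<integral>\<^sup>+t. ennreal (\<bar>t\<bar> powr (-a)) * indicator {-A..A} t \<partial>lborel) = ennreal (2 * A powr (1-a) / (1-a))"
proof -
  have pos: "(\<integral>\<^sup>+t. ennreal (\<bar>t\<bar> powr (-a)) * indicator {0..A} t \<partial>lborel) = ennreal (A powr (1-a) / (1-a))"
  proof -
    have "((\<lambda>x. x powr (-a)) has_integral (A powr (1-a) / (1-a))) {0..A}"
      using has_integral_powr_from_0[of "-a" A] assms by (simp add: algebra_simps)
    from nn_integral_has_integral_lebesgue'[OF _ this]
    have "(\<integral>\<^sup>+t. ennreal (t powr (-a)) * indicator {0..A} t \<partial>lborel) = ennreal (A powr (1-a) / (1-a))" by simp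
    also have "(\<integral>\<^sup>+t. ennreal (t powr (-a)) * indicator {0..A} t \<partial>lborel) = (\<integral>\<^sup>+t. ennreal (\<bar>t\<bar> powr (-a)) * indicator {0..A} t \<partial>lborel)"
      by (intro nn_integral_cong) (auto simp: indicator_def)
    finally show ?thesis .
  qed
  have "(\<integral>\<^sup>+t. ennreal (\<bar>t\<bar> powr (-a)) * indicator {-A..0} t \<partial>lborel)
      = (\<integral>\<^sup>+t. ennreal (\<bar>t\<bar> powr (-a)) * indicator {0..A} t \<partial>lborel)"
    by (subst nn_integral_lborel_scale[where c="-1" and t=0])
       (auto simp: indicator_def intro!: nn_integral_cong)
  moreover have "(\<integral>\<^sup>+t. ennreal (\<bar>t\<bar> powr (-a)) * indicator {-A..A} t \<partial>lborel)
     = (\<integral>\<^sup>+t. ennreal (\<bar>t\<bar> powr (-a)) * indicator {-A..0} t + ennreal (\<bar>t\<bar> powr (-a)) * indicator {0..A} t \<partial>lborel)"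
    using assms by (intro nn_integral_cong) (auto simp: indicator_def)
  ultimately show ?thesis using assms pos
    by (simp add: nn_integral_add flip: ennreal_plus)
qed

lemma nn_integral_abs_powr_outside:
  fixes a :: real
  assumes "a > 1"
  shows "(\<integral>\<^sup>+t. ennreal (\<bar>t\<bar> powr (-a)) * indicator {1..} t \<partial>lborel) = ennreal (1 / (a-1))"
proof -
  have "((\<lambda>x. x powr (-a)) has_integral (1 / (a-1))) {1..}"
    using has_integral_powr_to_inf[of "-a" 1] assms minus_divide_right[of 1 "1-a"] by (simp add: algebra_simps)
  from nn_integral_has_integral_lebesgue'[OF _ this]
  have "(\<integral>\<^sup>+t. ennreal (t powr (-a)) * indicator {1..} t \<partial>lborel) = ennreal (1 / (a-1))" by simp
  also have "(\<integral>\<^sup>+t. ennreal (t powr (-a)) * indicator {1..} t \<partial>lborel) = (\<integral>\<^sup>+t. ennreal (\<bar>t\<bar> powr (-a)) * indicator {1..} t \<partial>lborel)"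
    by (intro nn_integral_cong) (auto simp: indicator_def)
  finally show ?thesis .
qed

lemma nn_integral_bracket_powr_1:
  fixes c :: real
  assumes "c > 1/2"
  shows "(\<integral>\<^sup>+t. ennreal ((1 + t\<^sup>2) powr (-c)) \<partial>lborel) < \<infinity>"
proof -
  let ?p = "\<lambda>t::real. ennreal (\<bar>t\<bar> powr (-(2*c)))"
  have sq: "(1 + t\<^sup>2) powr (-c) \<le> \<bar>t\<bar> powr (-(2*c))" if "\<bar>t\<bar> \<ge> 1" for t::real
  proof -
    have "\<bar>t\<bar> powr (-(2*c)) = (t\<^sup>2) powr (-c)"
      using that powr_powr[of "\<bar>t\<bar>" 2 "-c"] by (simp add: powr_numeral)
    then show ?thesis using that assms by (auto intro!: powr_mono2')
  qed
  have one: "(1 + t\<^sup>2) powr (-c) \<le> 1" for t::real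
    using assms powr_mono2'[of "-c" 1 "1+t\<^sup>2"] by simp
  have "(\<integral>\<^sup>+t. ennreal ((1 + t\<^sup>2) powr (-c)) \<partial>lborel)
     \<le> (\<integral>\<^sup>+t. indicator {-1..1} t + (?p t * indicator {1..} t + ?p (-t) * indicator {1..} (-t)) \<partial>lborel)"
  proof (intro nn_integral_mono)
    fix t :: real
    consider "\<bar>t\<bar> \<le> 1" | "t > 1" | "t < -1" by linarith
    then show "ennreal ((1 + t\<^sup>2) powr (-c)) \<le> indicator {-1..1} t + (?p t * indicator {1..} t + ?p (-t) * indicator {1..} (-t))"
    proof cases
      case 1
      then have "ennreal ((1 + t\<^sup>2) powr (-c)) \<le> indicator {-1..1} t" using one[of t] by (auto simp: indicator_def)
      then show ?thesis by (rule order_trans) simp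
    qed (use sq[of t] in auto)
  qed
  also have "\<dots> = 2 + (ennreal (1/(2*c-1)) + (\<integral>\<^sup>+t. ?p (-t) * indicator {1..} (-t) \<partial>lborel))"
    using nn_integral_abs_powr_outside[of "2*c"] assms by (simp add: nn_integral_add)
  also have "(\<integral>\<^sup>+t. ?p (-t) * indicator {1..} (-t) \<partial>lborel) = (\<integral>\<^sup>+t. ?p t * indicator {1..} t \<partial>lborel)"
    by (subst (2) nn_integral_lborel_scale[where c="-1" and t=0]) auto
  also have "\<dots> = ennreal (1/(2*c-1))"
    using nn_integral_abs_powr_outside[of "2*c"] assms by simp
  finally show ?thesis using assms by (auto simp: less_top[symmetric] top_unique)
qed

lemma component_sq_le_norm_sq: "(x $ i)\<^sup>2 \<le> (norm (x::real^'d))\<^sup>2"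
  using component_le_norm_cart[of x i] by (metis abs_ge_zero power2_abs power_mono)

text \<open>
  The weight splits over the coordinates: \<open>1 + |x|\<^sup>2\<close> dominates each \<open>1 + x\<^sub>i\<^sup>2\<close>, so the power \<open>-a\<close> may be
  distributed as \<open>-a/d\<close> to every coordinate, and \<open>a/d > 1/2\<close> makes each factor integrable.
\<close>

lemma nn_integral_bracket_powr:
  fixes a :: real
  assumes "a > real CARD('d::finite) / 2"
  shows "(\<integral>\<^sup>+x. ennreal ((1 + (norm x)\<^sup>2) powr (-a)) \<partial>(lborel :: (real^'d) measure)) < \<infinity>"
proof -
  let ?d = "real CARD('d)"
  have d: "?d > 0" by simp
  have a0: "a > 0" using assms d by linarith
  have c: "a / ?d > 1/2" using assms d by (simp add: field_simps)
  have le: "(1 + (norm x)\<^sup>2) powr (-a) \<le> (\<Prod>i\<in>UNIV. (1 + (x $ i)\<^sup>2) powr (-(a / ?d)))" for x :: "real^'d"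
  proof -
    have "(1 + (norm x)\<^sup>2) powr (-a) = (\<Prod>i\<in>(UNIV::'d set). (1 + (norm x)\<^sup>2) powr (-(a / ?d)))"
      using d by (simp add: powr_power add_nonneg_eq_0_iff)
    also have "\<dots> \<le> (\<Prod>i\<in>UNIV. (1 + (x $ i)\<^sup>2) powr (-(a / ?d)))"
      using a0 d component_sq_le_norm_sq[of x]
      by (intro prod_mono conjI powr_mono2') (auto intro!: add_pos_nonneg)
    finally show ?thesis .
  qed
  have "(\<integral>\<^sup>+x. ennreal ((1 + (norm x)\<^sup>2) powr (-a)) \<partial>(lborel :: (real^'d) measure))
     \<le> (\<integral>\<^sup>+x. (\<Prod>i\<in>UNIV. ennreal ((1 + (x $ i)\<^sup>2) powr (-(a / ?d)))) \<partial>(lborel :: (real^'d) measure))"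
    using le by (intro nn_integral_mono) (simp add: prod_ennreal ennreal_leI)
  also have "\<dots> < \<infinity>"
    using nn_integral_bracket_powr_1[OF c]
    by (subst nn_integral_prod_coords[of "\<lambda>t. ennreal ((1 + t\<^sup>2) powr (-(a / ?d)))"]) (auto simp: power_less_top_ennreal)
  finally show ?thesis .
qed

text \<open>
  As before the singular weight is split over the coordinates, using \<open>|x| \<ge> |x\<^sub>i|\<close>; each factor
  \<open>|x\<^sub>i|\<^bsup>-2\<sigma>/d\<^esup>\<close> is integrable on an interval because \<open>2\<sigma> < d\<close>.
\<close>

lemma nn_integral_norm_powr_ball:
  fixes \<sigma> :: real
  assumes "0 \<le> \<sigma>" "2 * \<sigma> < real CARD('d::finite)"
  obtains C where "C \<ge> 0" "\<And>A. A \<ge> 0 \<Longrightarrow>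
    (\<integral>\<^sup>+x. ennreal (norm x powr (- 2 * \<sigma>)) * indicator {x. norm x \<le> A} x \<partial>(lborel :: (real^'d) measure))
      \<le> ennreal (C * A powr (real CARD('d) - 2 * \<sigma>))"
proof -
  let ?d = "real CARD('d)"
  define a where "a = 2 * \<sigma> / ?d"
  have a: "0 \<le> a" "a < 1" using assms by (auto simp: a_def)
  have ad: "a * ?d = 2 * \<sigma>" by (simp add: a_def)
  define C where "C = (2 / (1-a)) ^ CARD('d)"
  have "(\<integral>\<^sup>+x. ennreal (norm x powr (- 2 * \<sigma>)) * indicator {x. norm x \<le> A} x \<partial>(lborel :: (real^'d) measure))
      \<le> ennreal (C * A powr (?d - 2 * \<sigma>))" if A: "A \<ge> 0" for A
  proof -
    have "negligible (\<Union>i. {x::real^'d. x $ i = 0})"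
      by (auto intro!: negligible_Union simp: negligible_standard_hyperplane_cart)
    then have "AE x in lebesgue. x \<notin> (\<Union>i. {x::real^'d. x $ i = 0})"
      by (intro AE_not_in) (simp add: negligible_iff_null_sets)
    then have "AE x in lebesgue. \<forall>i. (x::real^'d) $ i \<noteq> 0" by eventually_elim auto
    \<comment> \<open>The coordinatewise bound fails on the coordinate hyperplanes, where \<open>0 powr (-a) = 0\<close>.\<close>
    then have ae: "AE x in (lborel::(real^'d) measure). \<forall>i. x $ i \<noteq> 0"
      by (subst (asm) AE_completion_iff) auto
    have le: "ennreal (norm x powr (- 2 * \<sigma>)) * indicator {x. norm x \<le> A} x
       \<le> (\<Prod>i\<in>UNIV. ennreal (\<bar>x $ i\<bar> powr (-a)) * indicator {-A..A} (x $ i))"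
      if nz: "\<forall>i. x $ i \<noteq> 0" for x :: "real^'d"
    proof (cases "norm x \<le> A")
      case True
      have x0: "norm x > 0" using nz by auto
      have "x $ i \<in> {-A..A}" for i
        using component_le_norm_cart[of x i] True by auto
      moreover have "norm x powr (- 2 * \<sigma>) = (\<Prod>i\<in>(UNIV::'d set). norm x powr (-a))"
        using x0 ad by (simp add: powr_power mult.commute[of "real CARD('d)" a])
      moreover have "\<dots> \<le> (\<Prod>i\<in>UNIV. \<bar>x $ i\<bar> powr (-a))"
        using a nz component_le_norm_cart[of x] by (intro prod_mono conjI powr_mono2') auto
      ultimately show ?thesis using True by (simp add: prod_ennreal ennreal_leI)
    qed simp
    have "(\<integral>\<^sup>+x. ennreal (norm x powr (- 2 * \<sigma>)) * indicator {x. norm x \<le> A} x \<partial>(lborel :: (real^'d) measure))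
      \<le> (\<integral>\<^sup>+x. (\<Prod>i\<in>UNIV. ennreal (\<bar>x $ i\<bar> powr (-a)) * indicator {-A..A} (x $ i)) \<partial>(lborel :: (real^'d) measure))"
      by (rule nn_integral_mono_AE, rule eventually_mono[OF ae le])
    also have "\<dots> = ennreal (2 * A powr (1-a) / (1-a)) ^ CARD('d)"
      using a A by (subst nn_integral_prod_coords[of "\<lambda>t. ennreal (\<bar>t\<bar> powr (-a)) * indicator {-A..A} t"])
        (auto simp: nn_integral_abs_powr_ball)
    also have "\<dots> = ennreal (C * A powr (?d - 2 * \<sigma>))"
    proof -
      have "(A powr (1-a)) ^ CARD('d) = A powr (?d - 2 * \<sigma>)"
      proof (cases "A = 0")
        case False
        moreover have "?d * (1 - a) = ?d - 2 * \<sigma>" using ad by (simp add: algebra_simps)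
        ultimately show ?thesis using A by (simp add: powr_power)
      qed (use assms in auto)
      then show ?thesis using a A by (simp add: ennreal_power C_def power_mult_distrib power_divide)
    qed
    finally show ?thesis .
  qed
  moreover have "C \<ge> 0" using a by (simp add: C_def)
  ultimately show ?thesis using that by blast
qed

section \<open>Rapid decay and the Schwartz space\<close>

abbreviation wt :: "real^'d::finite \<Rightarrow> real" where "wt x \<equiv> 1 + (norm x)\<^sup>2"

lemma wt_ge1: "1 \<le> wt x" and wt_pos: "0 < wt x" and wt_nz: "wt x \<noteq> 0" and norm_le_wt: "norm x \<le> wt x"
proof -
  have "0 \<le> (norm x - 1)\<^sup>2" by simp
  then have "2 * norm x \<le> wt x" unfolding power2_diff by simp
  then show "norm x \<le> wt x" using norm_ge_zero[of x] by linarith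
  show "1 \<le> wt x" "0 < wt x" by (simp_all add: add_pos_nonneg)
  show "wt x \<noteq> 0" using \<open>0 < wt x\<close> by linarith
qed

lemma integrable_wt: "integrable lborel (\<lambda>x::real^'d. 1 / wt x ^ CARD('d))"
proof (rule integrableI_nonneg)
  have "(\<integral>\<^sup>+x. ennreal (wt x powr (- real CARD('d))) \<partial>(lborel :: (real^'d) measure)) < \<infinity>"
    by (rule nn_integral_bracket_powr) simp
  moreover have "wt x powr (- real CARD('d)) = 1 / wt x ^ CARD('d)" for x :: "real^'d"
    using wt_pos[of x] by (simp add: powr_minus powr_realpow divide_inverse)
  ultimately show "(\<integral>\<^sup>+x. ennreal (1 / wt x ^ CARD('d)) \<partial>(lborel :: (real^'d) measure)) < \<infinity>" by simp
qed (use wt_pos in auto)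

lemma monomial_simps [simp]: "monomial [] x = 1" "monomial (i # \<alpha>) x = x $ i * monomial \<alpha> x"
  by (simp_all add: monomial_def)

lemma abs_monomial_le: "\<bar>monomial \<alpha> x\<bar> \<le> wt x ^ length \<alpha>"
proof (induction \<alpha>)
  case (Cons i \<alpha>)
  have "\<bar>x $ i\<bar> \<le> wt x" using component_le_norm_cart[of x i] norm_le_wt[of x] by linarith
  with Cons show ?case using wt_pos[of x] by (auto simp: abs_mult intro!: mult_mono)
qed simp

text \<open>
  The seminorms of \<open>\<S>\<close> are indexed by monomials, but estimates are more convenient with powers of the
  positive weight \<open>1 + |x|\<^sup>2\<close>. Expanding the power into a list of monomials translates one into the other.
\<close>

lemma wt_power_eq_monomials:
  obtains As :: "'d::finite list list" where "\<And>x. wt x ^ N = (\<Sum>\<alpha>\<leftarrow>As. monomial \<alpha> x)"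
proof -
  obtain xs :: "'d list" where xs: "set xs = UNIV" "distinct xs"
    using finite_distinct_list[of "UNIV :: 'd set"] by auto
  have "\<exists>As :: 'd list list. \<forall>x. wt x ^ N = (\<Sum>\<alpha>\<leftarrow>As. monomial \<alpha> x)"
  proof (induction N)
    case 0
    show ?case by (intro exI[of _ "[[]]"]) simp
  next
    case (Suc N)
    then obtain As :: "'d list list" where As: "\<And>x. wt x ^ N = (\<Sum>\<alpha>\<leftarrow>As. monomial \<alpha> x)" by blast
    have nrm: "(norm x)\<^sup>2 = (\<Sum>i\<leftarrow>xs. x $ i * x $ i)" for x :: "real^'d"
      using xs by (simp add: sum_list_distinct_conv_sum_set norm_vec_def L2_set_def sum_nonneg power2_eq_square)
    define Bs where "Bs = concat (map (\<lambda>i. map (\<lambda>\<alpha>. i # i # \<alpha>) As) xs)"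
    have "(norm x)\<^sup>2 * (\<Sum>\<alpha>\<leftarrow>As. monomial \<alpha> x) = (\<Sum>\<alpha>\<leftarrow>Bs. monomial \<alpha> x)" for x :: "real^'d"
      unfolding nrm Bs_def
      by (induction xs) (simp_all add: comp_def distrib_right sum_list_const_mult mult.assoc)
    then have "\<forall>x. wt x ^ Suc N = (\<Sum>\<alpha>\<leftarrow>As @ Bs. monomial \<alpha> x)"
      using As by (simp add: distrib_right)
    then show ?case by blast
  qed
  then show ?thesis using that by blast
qed

text \<open>
  Decay faster than every power of the norm: with \<open>wt\<close> in place of monomials, the zeroth derivative part of
  the definition of \<open>\<S>\<close>.
\<close>

definition rapid :: "(real^'d::finite \<Rightarrow> complex) \<Rightarrow> bool" where
  "rapid f \<longleftrightarrow> (\<forall>N. \<exists>C. \<forall>x. wt x ^ N * cmod (f x) \<le> C)"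

lemma rapidI: "(\<And>N. \<exists>C. \<forall>x. wt x ^ N * cmod (f x) \<le> C) \<Longrightarrow> rapid f"
  by (simp add: rapid_def)

lemma rapidE:
  assumes "rapid f"
  obtains C where "C \<ge> 0" "\<And>x. wt x ^ N * cmod (f x) \<le> C"
proof -
  obtain C where C: "\<And>x. wt x ^ N * cmod (f x) \<le> C" using assms by (auto simp: rapid_def)
  have "0 \<le> wt 0 ^ N * cmod (f 0)" by (intro mult_nonneg_nonneg) auto
  then have "0 \<le> C" using C[of 0] by (rule order_trans)
  then show ?thesis using C that by blast
qed

lemma rapid_iff: fixes f :: "real^'d::finite \<Rightarrow> complex" shows "rapid f \<longleftrightarrow> (\<forall>\<alpha>. bounded (range (\<lambda>x. of_real (monomial \<alpha> x) * f x)))"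
proof
  assume f: "rapid f"
  show "\<forall>\<alpha>. bounded (range (\<lambda>x. of_real (monomial \<alpha> x) * f x))"
  proof
    fix \<alpha> :: "'d list"
    obtain C where C: "\<And>x. wt x ^ length \<alpha> * cmod (f x) \<le> C" using rapidE[OF f] by blast
    have "cmod (of_real (monomial \<alpha> x) * f x) \<le> C" for x
      using mult_right_mono[OF abs_monomial_le[of \<alpha> x], of "cmod (f x)"] C[of x] by (simp add: norm_mult)
    then show "bounded (range (\<lambda>x. of_real (monomial \<alpha> x) * f x))" by (auto intro!: boundedI)
  qed
next
  assume b: "\<forall>\<alpha>. bounded (range (\<lambda>x. of_real (monomial \<alpha> x) * f x))"
  have "\<forall>\<alpha>. \<exists>C. \<forall>x. cmod (of_real (monomial \<alpha> x) * f x) \<le> C"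
    using b by (auto simp: bounded_iff)
  then obtain C where C: "\<And>\<alpha> x. cmod (of_real (monomial \<alpha> x) * f x) \<le> C \<alpha>" by metis
  show "rapid f"
  proof (rule rapidI)
    fix N
    obtain As where As: "\<And>x::real^'d. wt x ^ N = (\<Sum>\<alpha>\<leftarrow>As. monomial \<alpha> x)" using wt_power_eq_monomials by blast
    have "wt x ^ N * cmod (f x) \<le> (\<Sum>\<alpha>\<leftarrow>As. C \<alpha>)" for x
    proof -
      have "(\<Sum>\<alpha>\<leftarrow>As. monomial \<alpha> x) * cmod (f x) \<le> (\<Sum>\<alpha>\<leftarrow>As. C \<alpha>)"
      proof (induction As)
        case (Cons \<alpha> As)
        have "monomial \<alpha> x * cmod (f x) \<le> cmod (of_real (monomial \<alpha> x) * f x)"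
          by (simp add: norm_mult mult_right_mono)
        also have "\<dots> \<le> C \<alpha>" by (rule C)
        finally show ?case using Cons by (simp add: distrib_right)
      qed simp
      then show ?thesis by (simp add: As)
    qed
    then show "\<exists>C. \<forall>x. wt x ^ N * cmod (f x) \<le> C" by blast
  qed
qed

lemma rapid_mult_poly:
  assumes "rapid f" "\<And>x. cmod (m x) \<le> C * wt x ^ M"
  shows "rapid (\<lambda>x. m x * f x)"
proof (rule rapidI)
  fix N
  obtain K where K: "K \<ge> 0" "\<And>x. wt x ^ (N + M) * cmod (f x) \<le> K" using rapidE[OF assms(1)] by blast
  have "wt x ^ N * cmod (m x * f x) \<le> \<bar>C\<bar> * K" for x
  proof -
    have "wt x ^ N * cmod (m x * f x) \<le> wt x ^ N * ((\<bar>C\<bar> * wt x ^ M) * cmod (f x))"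
      using order_trans[OF assms(2)[of x] mult_right_mono[OF abs_ge_self[of C], of "wt x ^ M"]] wt_pos[of x]
      unfolding norm_mult by (intro mult_left_mono mult_right_mono) auto
    also have "\<dots> = \<bar>C\<bar> * (wt x ^ (N + M) * cmod (f x))" by (simp add: power_add)
    also have "\<dots> \<le> \<bar>C\<bar> * K" by (intro mult_left_mono K) auto
    finally show ?thesis .
  qed
  then show "\<exists>C. \<forall>x. wt x ^ N * cmod (m x * f x) \<le> C" by blast
qed

lemma rapid_bound:
  assumes "rapid f" "\<And>x. cmod (g x) \<le> C * cmod (f x)"
  shows "rapid g"
proof (rule rapidI)
  fix N
  obtain K where K: "\<And>x. wt x ^ N * cmod (f x) \<le> K" "K \<ge> 0" using rapidE[OF assms(1)] by blast
  have "wt x ^ N * cmod (g x) \<le> \<bar>C\<bar> * K" for x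
  proof -
    have "wt x ^ N * cmod (g x) \<le> wt x ^ N * (\<bar>C\<bar> * cmod (f x))"
      using order_trans[OF assms(2)[of x] mult_right_mono[OF abs_ge_self[of C], of "cmod (f x)"]] wt_pos[of x]
      by (intro mult_left_mono) auto
    also have "\<dots> = \<bar>C\<bar> * (wt x ^ N * cmod (f x))" by simp
    also have "\<dots> \<le> \<bar>C\<bar> * K" by (intro mult_left_mono K) auto
    finally show ?thesis .
  qed
  then show "\<exists>C. \<forall>x. wt x ^ N * cmod (g x) \<le> C" by blast
qed

lemma rapid_add:
  assumes "rapid f" "rapid g"
  shows "rapid (\<lambda>x. f x + g x)"
proof (rule rapidI)
  fix N
  obtain K where K: "\<And>x. wt x ^ N * cmod (f x) \<le> K" using rapidE[OF assms(1)] by blast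
  obtain L where L: "\<And>x. wt x ^ N * cmod (g x) \<le> L" using rapidE[OF assms(2)] by blast
  have "wt x ^ N * cmod (f x + g x) \<le> K + L" for x
  proof -
    have "wt x ^ N * cmod (f x + g x) \<le> wt x ^ N * (cmod (f x) + cmod (g x))"
      using wt_pos[of x] norm_triangle_ineq by (intro mult_left_mono) auto
    then show ?thesis using K[of x] L[of x] by (simp add: distrib_left)
  qed
  then show "\<exists>C. \<forall>x. wt x ^ N * cmod (f x + g x) \<le> C" by blast
qed

lemma rapid_sum_list: "(\<And>g. g \<in> set gs \<Longrightarrow> rapid g) \<Longrightarrow> rapid (\<lambda>x. \<Sum>g\<leftarrow>gs. g x)"
proof (induction gs)
  case Nil
  show ?case by (rule rapidI) auto
next
  case (Cons a gs)
  have "rapid a" using Cons.prems by simp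
  moreover have "rapid (\<lambda>x. \<Sum>g\<leftarrow>gs. g x)" by (rule Cons.IH) (simp add: Cons.prems)
  ultimately have "rapid (\<lambda>x. a x + (\<Sum>g\<leftarrow>gs. g x))" by (rule rapid_add)
  then show ?case by simp
qed

lemma partialI: "(f has_derivative f') (at x) \<Longrightarrow> partial i f x = f' (axis i 1)"
  using frechet_derivative_at[of f f' x] by (simp add: partial_def)

lemma partials_simps [simp]: "partials [] f = f" "partials (i # \<beta>) f = partial i (partials \<beta> f)"
  by (simp_all add: partials_def)

lemma partials_snoc: "partials \<beta> (partial i f) = partials (\<beta> @ [i]) f"
  by (simp add: partials_def)

lemma partials_append: "partials \<gamma> (partials \<beta> f) = partials (\<gamma> @ \<beta>) f"
  by (simp add: partials_def)

lemma schwartz_iff: "\<phi> \<in> schwartz \<longleftrightarrow> (\<forall>\<beta>. (\<forall>x. partials \<beta> \<phi> differentiable (at x)) \<and> rapid (partials \<beta> \<phi>))"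
  by (auto simp: schwartz_def rapid_iff)

lemma schwartz_differentiable: "\<phi> \<in> schwartz \<Longrightarrow> \<phi> differentiable (at x)"
  and schwartz_rapid: "\<phi> \<in> schwartz \<Longrightarrow> rapid \<phi>"
  unfolding schwartz_iff by (auto dest: spec[of _ "[]"])

lemma schwartz_partials: "\<phi> \<in> schwartz \<Longrightarrow> partials \<beta> \<phi> \<in> schwartz"
  unfolding schwartz_iff by (auto simp: partials_append)

lemma schwartz_partial: "\<phi> \<in> schwartz \<Longrightarrow> partial i \<phi> \<in> schwartz"
  using schwartz_partials[of \<phi> "[i]"] by simp

lemma schwartz_has_derivative:
  assumes "\<phi> \<in> schwartz"
  shows "(\<phi> has_derivative (\<lambda>h. \<Sum>i\<in>UNIV. of_real (h $ i) * partial i \<phi> x)) (at x)"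
proof -
  have d: "(\<phi> has_derivative frechet_derivative \<phi> (at x)) (at x)"
    using schwartz_differentiable[OF assms] frechet_derivative_works by blast
  have "frechet_derivative \<phi> (at x) h = (\<Sum>i\<in>UNIV. of_real (h $ i) * partial i \<phi> x)" for h
  proof -
    have lin: "linear (frechet_derivative \<phi> (at x))" using d has_derivative_linear by blast
    have "h = (\<Sum>i\<in>UNIV. (h $ i) *\<^sub>R axis i 1)"
      by (simp add: vec_eq_iff axis_def if_distrib cong: if_cong)
    then have "frechet_derivative \<phi> (at x) h = frechet_derivative \<phi> (at x) (\<Sum>i\<in>UNIV. (h $ i) *\<^sub>R axis i 1)" by simp
    also have "\<dots> = (\<Sum>i\<in>UNIV. (h $ i) *\<^sub>R partial i \<phi> x)"
      using lin by (simp add: linear_sum linear_scale partial_def)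
    finally show ?thesis by (simp add: scaleR_conv_of_real)
  qed
  then show ?thesis using d by presburger
qed

lemma partial_add:
  "f differentiable (at x) \<Longrightarrow> g differentiable (at x) \<Longrightarrow> partial i (\<lambda>x. f x + g x) x = partial i f x + partial i g x"
  unfolding frechet_derivative_works by (drule (1) has_derivative_add, drule partialI) (simp add: partial_def)

lemma partial_mult:
  fixes f g :: "real^'d::finite \<Rightarrow> complex"
  assumes "f differentiable (at x)" "g differentiable (at x)"
  shows "partial i (\<lambda>x. f x * g x) x = f x * partial i g x + partial i f x * g x"
proof -
  have "((\<lambda>x. f x * g x) has_derivative (\<lambda>h. f x * frechet_derivative g (at x) h + frechet_derivative f (at x) h * g x)) (at x)"
    using assms unfolding frechet_derivative_works by (rule has_derivative_mult)
  then show ?thesis by (subst partialI) (auto simp: partial_def)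
qed

lemma sum_list_differentiable:
  "(\<And>g. g \<in> set gs \<Longrightarrow> g differentiable (at x)) \<Longrightarrow> (\<lambda>x. \<Sum>g\<leftarrow>gs. g x :: complex) differentiable (at x)"
  by (induction gs) auto

lemma partial_sum_list:
  assumes "\<And>g. g \<in> set gs \<Longrightarrow> g differentiable (at x)"
  shows "partial i (\<lambda>x. \<Sum>g\<leftarrow>gs. g x) x = (\<Sum>g\<leftarrow>gs. partial i g x)"
  using assms
proof (induction gs)
  case Nil
  show ?case using partialI[of "\<lambda>x. 0"  "\<lambda>x. 0"] by simp
next
  case (Cons g gs)
  then show ?case by (simp add: partial_add sum_list_differentiable)
qed

text \<open>
  The main device for proving that functions are Schwartz. Instead of computing higher derivatives, one
  exhibits a set \<open>A\<close> of functions such that each partial derivative of a member is a finite sum of members;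
  every iterated derivative is then such a sum as well. Properties that are stable under finite
  sums and hold on \<open>A\<close> pass to all derivatives.
\<close>

lemma partials_of_generators:
  assumes diff: "\<And>a x. a \<in> A \<Longrightarrow> a differentiable (at x)"
    and part: "\<And>a i. a \<in> A \<Longrightarrow> \<exists>gs. set gs \<subseteq> A \<and> partial i a = (\<lambda>x. \<Sum>g\<leftarrow>gs. g x)"
    and "a \<in> A"
  shows "\<exists>gs. set gs \<subseteq> A \<and> partials \<beta> a = (\<lambda>x. \<Sum>g\<leftarrow>gs. g x)"
proof (induction \<beta>)
  case Nil
  show ?case using assms(3) by (intro exI[of _ "[a]"]) simp
next
  case (Cons i \<beta>)
  then obtain gs where gs: "set gs \<subseteq> A" "partials \<beta> a = (\<lambda>x. \<Sum>g\<leftarrow>gs. g x)" by blast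
  obtain h where h: "\<And>a. a \<in> A \<Longrightarrow> set (h a) \<subseteq> A \<and> partial i a = (\<lambda>x. \<Sum>g\<leftarrow>h a. g x)"
    using part[of _ i] by metis
  have "partials (i # \<beta>) a = (\<lambda>x. \<Sum>g\<leftarrow>gs. partial i g x)"
    using gs diff partial_sum_list[of gs] by fastforce
  also have "\<dots> = (\<lambda>x. \<Sum>g\<leftarrow>concat (map h gs). g x)"
    using gs(1) h by (intro ext, induction gs) auto
  finally show ?case using gs(1) h by (intro exI[of _ "concat (map h gs)"]) auto
qed

lemma schwartz_generators:
  assumes diff: "\<And>a x. a \<in> A \<Longrightarrow> a differentiable (at x)"
    and rapid: "\<And>a. a \<in> A \<Longrightarrow> rapid a"
    and part: "\<And>a i. a \<in> A \<Longrightarrow> \<exists>gs. set gs \<subseteq> A \<and> partial i a = (\<lambda>x. \<Sum>g\<leftarrow>gs. g x)"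
  shows "A \<subseteq> schwartz"
proof
  fix a assume a: "a \<in> A"
  show "a \<in> schwartz" unfolding schwartz_iff
  proof
    fix \<beta>
    obtain gs where "set gs \<subseteq> A" "partials \<beta> a = (\<lambda>x. \<Sum>g\<leftarrow>gs. g x)"
      using partials_of_generators[OF diff part a] by blast
    then show "(\<forall>x. partials \<beta> a differentiable at x) \<and> rapid (partials \<beta> a)"
      using diff rapid by (auto intro!: sum_list_differentiable rapid_sum_list)
  qed
qed

text \<open>
  The same device for \<open>\<Psi>\<close>: if all generators vanish at the origin, so do all their derivatives.
\<close>

lemma Psi_generators:
  assumes diff: "\<And>a x. a \<in> A \<Longrightarrow> a differentiable (at x)"
    and rapid: "\<And>a. a \<in> A \<Longrightarrow> rapid a"
    and part: "\<And>a i. a \<in> A \<Longrightarrow> \<exists>gs. set gs \<subseteq> A \<and> partial i a = (\<lambda>x. \<Sum>g\<leftarrow>gs. g x)"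
    and zero: "\<And>a. a \<in> A \<Longrightarrow> a 0 = 0"
  shows "A \<subseteq> Psi"
proof
  fix a assume a: "a \<in> A"
  have "partials \<beta> a 0 = 0" for \<beta>
  proof -
    obtain gs where gs: "set gs \<subseteq> A" "partials \<beta> a = (\<lambda>x. \<Sum>g\<leftarrow>gs. g x)"
      using partials_of_generators[OF diff part a] by blast
    have "(\<Sum>g\<leftarrow>gs. g 0) = (\<Sum>g\<leftarrow>gs. 0 :: complex)"
      using gs(1) zero by (intro arg_cong[where f=sum_list] map_cong) auto
    then show ?thesis using gs by simp
  qed
  then show "a \<in> Psi" using schwartz_generators[OF diff rapid part] a by (auto simp: Psi_def)
qed

lemma schwartz_add: "\<phi> \<in> schwartz \<Longrightarrow> \<psi> \<in> schwartz \<Longrightarrow> (\<lambda>x. \<phi> x + \<psi> x) \<in> schwartz"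
proof -
  assume *: "\<phi> \<in> schwartz" "\<psi> \<in> schwartz"
  let ?A = "{\<lambda>x. \<phi> x + \<psi> x |\<phi> \<psi>. \<phi> \<in> schwartz \<and> \<psi> \<in> schwartz} :: 'a fn set"
  have "?A \<subseteq> schwartz"
  proof (rule schwartz_generators)
    fix a i assume "a \<in> ?A"
    then obtain \<phi> \<psi> where a: "a = (\<lambda>x. \<phi> x + \<psi> x)" "\<phi> \<in> schwartz" "\<psi> \<in> schwartz" by blast
    then have "partial i a = (\<lambda>x. partial i \<phi> x + partial i \<psi> x)"
      by (auto simp: partial_add schwartz_differentiable)
    then show "\<exists>gs. set gs \<subseteq> ?A \<and> partial i a = (\<lambda>x. \<Sum>g\<leftarrow>gs. g x)"
      using a schwartz_partial by (intro exI[of _ "[partial i a]"]) auto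
  next
    fix a assume "a \<in> ?A"
    then show "rapid a" using rapid_add schwartz_rapid by blast
  next
    fix a x assume "a \<in> ?A"
    then show "a differentiable (at x)" using schwartz_differentiable by (fastforce intro!: differentiable_add)
  qed
  then show ?thesis using * by blast
qed

text \<open>
  By the Leibniz rule the products \<open>p q\<close> with \<open>p \<in> A\<close> and \<open>q \<in> B\<close> form a set of generators as soon as \<open>A\<close> and
  \<open>B\<close> are closed under partial derivatives.
\<close>

lemma schwartz_mult_of_derivative_closed:
  assumes diff: "\<And>p x. p \<in> A \<Longrightarrow> p differentiable (at x)" "\<And>q x. q \<in> B \<Longrightarrow> q differentiable (at x)"
    and part: "\<And>p i. p \<in> A \<Longrightarrow> partial i p \<in> A" "\<And>q i. q \<in> B \<Longrightarrow> partial i q \<in> B"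
    and rapid: "\<And>p q. p \<in> A \<Longrightarrow> q \<in> B \<Longrightarrow> rapid (\<lambda>x. p x * q x)"
    and "p \<in> A" "q \<in> B"
  shows "(\<lambda>x. p x * q x) \<in> schwartz"
    and "(\<And>p q. p \<in> A \<Longrightarrow> q \<in> B \<Longrightarrow> p 0 * q 0 = 0) \<Longrightarrow> (\<lambda>x. p x * q x) \<in> Psi"
proof -
  let ?C = "{\<lambda>x. p x * q x |p q. p \<in> A \<and> q \<in> B} :: 'a fn set"
  have C: "\<exists>gs. set gs \<subseteq> ?C \<and> partial i c = (\<lambda>x. \<Sum>g\<leftarrow>gs. g x)" if "c \<in> ?C" for c i
  proof -
    from that obtain p q where c: "c = (\<lambda>x. p x * q x)" "p \<in> A" "q \<in> B" by auto
    then have "partial i c = (\<lambda>x. p x * partial i q x + partial i p x * q x)"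
      by (auto simp: partial_mult diff)
    moreover have "(\<lambda>x. p x * partial i q x) \<in> ?C" "(\<lambda>x. partial i p x * q x) \<in> ?C"
      using c part by blast+
    ultimately show ?thesis
      by (intro exI[of _ "[\<lambda>x. p x * partial i q x, \<lambda>x. partial i p x * q x]"]) simp
  qed
  have "?C \<subseteq> schwartz" by (rule schwartz_generators[OF _ _ C]) (use diff rapid in auto)
  then show "(\<lambda>x. p x * q x) \<in> schwartz" using assms(6,7) by blast
  assume z: "\<And>p q. p \<in> A \<Longrightarrow> q \<in> B \<Longrightarrow> p 0 * q 0 = 0"
  have "?C \<subseteq> Psi" by (rule Psi_generators[OF _ _ C]) (use diff rapid z in auto)
  then show "(\<lambda>x. p x * q x) \<in> Psi" using assms(6,7) by blast
qed

lemma Psi_iff: "\<psi> \<in> Psi \<longleftrightarrow> \<psi> \<in> schwartz \<and> (\<forall>\<beta>. partials \<beta> \<psi> 0 = 0)"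
  by (simp add: Psi_def)

lemma Psi_schwartz: "\<psi> \<in> Psi \<Longrightarrow> \<psi> \<in> schwartz" and Psi_zero: "\<psi> \<in> Psi \<Longrightarrow> \<psi> 0 = 0"
  unfolding Psi_iff by (auto dest: spec[of _ "[]"])

lemma Psi_partial:
  assumes "\<psi> \<in> Psi" shows "partial i \<psi> \<in> Psi"
  using assms schwartz_partial[of \<psi> i] unfolding Psi_iff partials_snoc by blast

text \<open>
  Multiplication by a function that grows polynomially together with all its derivatives preserves both
  \<open>\<S>\<close> and \<open>\<Psi>\<close>. The set \<open>A\<close> carries the derivatives.
\<close>

lemma schwartz_mult_slow_growth:
  assumes diff: "\<And>p x. p \<in> A \<Longrightarrow> p differentiable (at x)"
    and part: "\<And>p i. p \<in> A \<Longrightarrow> partial i p \<in> A"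
    and growth: "\<And>p. p \<in> A \<Longrightarrow> \<exists>C N. \<forall>x. cmod (p x) \<le> C * wt x ^ N"
    and "p \<in> A"
  shows "\<phi> \<in> schwartz \<Longrightarrow> (\<lambda>x. p x * \<phi> x) \<in> schwartz"
    and "\<psi> \<in> Psi \<Longrightarrow> (\<lambda>x. p x * \<psi> x) \<in> Psi"
proof -
  have r: "rapid (\<lambda>x. p x * q x)" if "p \<in> A" "q \<in> schwartz" for p q
    using growth[OF that(1)] rapid_mult_poly[OF schwartz_rapid[OF that(2)]] by blast
  show "\<phi> \<in> schwartz \<Longrightarrow> (\<lambda>x. p x * \<phi> x) \<in> schwartz"
    by (rule schwartz_mult_of_derivative_closed(1)[where A=A and B=schwartz, OF diff schwartz_differentiable part schwartz_partial r \<open>p \<in> A\<close>])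
  show "\<psi> \<in> Psi \<Longrightarrow> (\<lambda>x. p x * \<psi> x) \<in> Psi"
    by (rule schwartz_mult_of_derivative_closed(2)[where A=A and B=Psi, OF diff schwartz_differentiable[OF Psi_schwartz] part Psi_partial r[OF _ Psi_schwartz] \<open>p \<in> A\<close>])
       (simp_all add: Psi_zero)
qed

lemma schwartz_mult_affine:
  fixes c d :: complex
  shows "\<phi> \<in> schwartz \<Longrightarrow> (\<lambda>x. (c + d * of_real (x $ i)) * \<phi> x) \<in> schwartz"
    and "\<psi> \<in> Psi \<Longrightarrow> (\<lambda>x. (c + d * of_real (x $ i)) * \<psi> x) \<in> Psi"
proof -
  let ?A = "{\<lambda>x. c + d * of_real (x $ i) |c d. True} :: 'a fn set"
  have der: "((\<lambda>x. c + d * of_real (x $ i)) has_derivative (\<lambda>h. d * of_real (h $ i))) (at x)"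
    for c d :: complex and x :: "real^'a"
    by (auto intro!: derivative_eq_intros bounded_linear_imp_has_derivative bounded_linear_vec_nth)
  have growth: "cmod (c + d * of_real (x $ i)) \<le> (cmod c + cmod d) * wt x ^ 1" for c d and x :: "real^'a"
  proof -
    have "cmod (c + d * of_real (x $ i)) \<le> cmod c + cmod d * \<bar>x $ i\<bar>"
      using norm_triangle_ineq[of c "d * of_real (x $ i)"] by (simp add: norm_mult)
    also have "\<dots> \<le> cmod c * wt x + cmod d * wt x"
      using component_le_norm_cart[of x i] norm_le_wt[of x] wt_ge1[of x] mult_left_mono[of 1 "wt x" "cmod c"]
      by (intro add_mono mult_left_mono) auto
    finally show ?thesis by (simp add: algebra_simps)
  qed
  have part: "partial j (\<lambda>x. c + d * of_real (x $ i)) = (\<lambda>x. d * of_real (axis j 1 $ i) + 0 * of_real (x $ i))" for j c d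
    using partialI[OF der] by fastforce
  have 1: "p differentiable (at x)" if "p \<in> ?A" for p x using that der differentiableI by fastforce
  have 2: "partial j p \<in> ?A" if "p \<in> ?A" for p j using that part by blast
  have 3: "\<exists>C N. \<forall>x. cmod (p x) \<le> C * wt x ^ N" if "p \<in> ?A" for p using that growth by blast
  have 4: "(\<lambda>x. c + d * of_real (x $ i)) \<in> ?A" by blast
  show "\<phi> \<in> schwartz \<Longrightarrow> (\<lambda>x. (c + d * of_real (x $ i)) * \<phi> x) \<in> schwartz"
    using schwartz_mult_slow_growth(1)[where A="?A", OF 1 2 3 4] by blast
  show "\<psi> \<in> Psi \<Longrightarrow> (\<lambda>x. (c + d * of_real (x $ i)) * \<psi> x) \<in> Psi"
    using schwartz_mult_slow_growth(2)[where A="?A", OF 1 2 3 4] by blast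
qed

lemma schwartz_coord: "\<phi> \<in> schwartz \<Longrightarrow> (\<lambda>x. of_real (x $ i) * \<phi> x) \<in> schwartz"
  and Psi_coord: "\<psi> \<in> Psi \<Longrightarrow> (\<lambda>x. of_real (x $ i) * \<psi> x) \<in> Psi"
  and schwartz_cmult: "\<phi> \<in> schwartz \<Longrightarrow> (\<lambda>x. c * \<phi> x) \<in> schwartz"
  and Psi_cmult: "\<psi> \<in> Psi \<Longrightarrow> (\<lambda>x. c * \<psi> x) \<in> Psi"
  using schwartz_mult_affine[of \<phi> 0 1 i] schwartz_mult_affine[of \<phi> c 0 i]
    schwartz_mult_affine(2)[of \<psi> 0 1 i] schwartz_mult_affine(2)[of \<psi> c 0 i] by simp_all

section \<open>Products, characters and Gaussians\<close>

lemma schwartz_mult: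
  assumes "\<phi> \<in> schwartz" "\<psi> \<in> schwartz"
  shows "(\<lambda>x. \<phi> x * \<psi> x) \<in> schwartz"
proof -
  have r: "rapid (\<lambda>x. p x * q x)" if p: "p \<in> schwartz" and q: "q \<in> schwartz" for p q :: "'a fn"
  proof -
    obtain C where "\<And>x. wt x ^ 0 * cmod (p x) \<le> C" using rapidE[OF schwartz_rapid[OF p]] by blast
    then have "cmod (p x) \<le> C * wt x ^ 0" for x by simp
    then show ?thesis by (rule rapid_mult_poly[OF schwartz_rapid[OF q]])
  qed
  show ?thesis
    by (rule schwartz_mult_of_derivative_closed(1)[OF schwartz_differentiable schwartz_differentiable schwartz_partial schwartz_partial r assms])
qed

lemma has_derivative_cexp:
  fixes g :: "'a::real_normed_vector \<Rightarrow> complex"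
  assumes "(g has_derivative g') (at x)"
  shows "((\<lambda>x. exp (g x)) has_derivative (\<lambda>h. exp (g x) * g' h)) (at x)"
  using has_derivative_compose[OF assms, of exp "\<lambda>h. exp (g x) * h"] DERIV_exp[of "g x"]
  by (simp add: has_field_derivative_def)

lemma schwartz_modulate:
  assumes "\<phi> \<in> schwartz"
  shows "(\<lambda>x. exp (\<i> * of_real (a \<bullet> x)) * \<phi> x) \<in> schwartz"
proof -
  let ?A = "{\<lambda>x. c * exp (\<i> * of_real (a \<bullet> x)) |c. True} :: 'a fn set"
  have der: "((\<lambda>x. c * exp (\<i> * of_real (a \<bullet> x))) has_derivative (\<lambda>h. c * (exp (\<i> * of_real (a \<bullet> x)) * (\<i> * of_real (a \<bullet> h))))) (at x)"
    for c :: complex and x :: "real^'a"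
    by (intro has_derivative_mult_right has_derivative_cexp has_derivative_of_real has_derivative_inner_right has_derivative_ident)
  have part: "partial j (\<lambda>x. c * exp (\<i> * of_real (a \<bullet> x))) = (\<lambda>x. (c * \<i> * of_real (a \<bullet> axis j 1)) * exp (\<i> * of_real (a \<bullet> x)))" for j c
    using partialI[OF der] by (fastforce simp: mult_ac)
  have 1: "p differentiable (at x)" if "p \<in> ?A" for p x using that der differentiableI by fastforce
  have 2: "partial j p \<in> ?A" if "p \<in> ?A" for p j using that part by blast
  have 3: "\<exists>C N. \<forall>x. cmod (p x) \<le> C * wt x ^ N" if "p \<in> ?A" for p
  proof -
    obtain c where "p = (\<lambda>x. c * exp (\<i> * of_real (a \<bullet> x)))" using \<open>p \<in> ?A\<close> by blast
    then have "\<forall>x. cmod (p x) \<le> cmod c * wt x ^ 0" by (simp add: norm_mult)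
    then show ?thesis by blast
  qed
  have 4: "(\<lambda>x. 1 * exp (\<i> * of_real (a \<bullet> x))) \<in> ?A" by blast
  show ?thesis using schwartz_mult_slow_growth(1)[where A="?A", OF 1 2 3 4 assms] by simp
qed

lemma partial_reflect:
  assumes "\<phi> \<in> schwartz"
  shows "partial i (\<lambda>x. \<phi> (- x)) = (\<lambda>x. - partial i \<phi> (- x))"
proof
  fix x
  have "((\<lambda>x. \<phi> (- x)) has_derivative (\<lambda>h. frechet_derivative \<phi> (at (- x)) (- h))) (at x)"
    using has_derivative_compose[of uminus uminus x UNIV \<phi> "frechet_derivative \<phi> (at (- x))"]
      schwartz_differentiable[OF assms, of "- x"]
    by (auto simp: frechet_derivative_works intro!: derivative_eq_intros)
  moreover have "linear (frechet_derivative \<phi> (at (- x)))"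
    using schwartz_differentiable[OF assms, of "- x"] frechet_derivative_works has_derivative_linear by blast
  ultimately show "partial i (\<lambda>x. \<phi> (- x)) x = - partial i \<phi> (- x)"
    by (subst partialI) (auto simp: partial_def linear_neg)
qed

lemma
  fixes \<phi> \<psi> :: "'a::finite fn"
  shows schwartz_reflect: "\<phi> \<in> schwartz \<Longrightarrow> (\<lambda>x. \<phi> (- x)) \<in> schwartz"
  and Psi_reflect: "\<psi> \<in> Psi \<Longrightarrow> (\<lambda>x. \<psi> (- x)) \<in> Psi"
proof -
  define R :: "'a fn \<Rightarrow> 'a fn" where "R \<phi> = (\<lambda>x. \<phi> (- x))" for \<phi>
  have diff: "R \<phi> differentiable (at x)" if "\<phi> \<in> schwartz" for \<phi> :: "'a fn" and x
    unfolding R_def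
    by (rule differentiable_compose[where f=\<phi> and g=uminus])
       (rule schwartz_differentiable[OF that], intro derivative_intros)
  have rap: "rapid (R \<phi>)" if \<phi>: "\<phi> \<in> schwartz" for \<phi> :: "'a fn"
  proof (rule rapidI)
    fix N
    obtain C where C: "\<And>x. wt x ^ N * cmod (\<phi> x) \<le> C" using rapidE[OF schwartz_rapid[OF \<phi>]] by blast
    have "wt x ^ N * cmod (R \<phi> x) \<le> C" for x using C[of "- x"] by (simp add: R_def)
    then show "\<exists>C. \<forall>x. wt x ^ N * cmod (R \<phi> x) \<le> C" by blast
  qed
  have part: "partial i (R \<phi>) = R (\<lambda>x. -1 * partial i \<phi> x)" if "\<phi> \<in> schwartz" for \<phi> :: "'a fn" and i
    using partial_reflect[OF that] by (simp add: R_def)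
  have sub: "R ` schwartz \<subseteq> schwartz"
  proof (rule schwartz_generators)
    fix a i assume "a \<in> R ` schwartz"
    then obtain \<phi> where \<phi>: "\<phi> \<in> schwartz" "a = R \<phi>" by blast
    have "partial i a \<in> R ` schwartz"
      unfolding \<phi>(2) part[OF \<phi>(1)] by (intro imageI schwartz_cmult schwartz_partial \<phi>(1))
    then show "\<exists>gs. set gs \<subseteq> R ` schwartz \<and> partial i a = (\<lambda>x. \<Sum>g\<leftarrow>gs. g x)"
      by (intro exI[of _ "[partial i a]"]) simp
  qed (use diff rap in blast)+
  show "\<phi> \<in> schwartz \<Longrightarrow> (\<lambda>x. \<phi> (- x)) \<in> schwartz"
    using subsetD[OF sub imageI, of \<phi>] by (simp only: R_def)
  have sub': "R ` Psi \<subseteq> Psi"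
  proof (rule Psi_generators)
    fix a i assume "a \<in> R ` Psi"
    then obtain \<phi> where \<phi>: "\<phi> \<in> Psi" "a = R \<phi>" by blast
    have "partial i a \<in> R ` Psi"
      unfolding \<phi>(2) part[OF Psi_schwartz[OF \<phi>(1)]] by (intro imageI Psi_cmult Psi_partial \<phi>(1))
    then show "\<exists>gs. set gs \<subseteq> R ` Psi \<and> partial i a = (\<lambda>x. \<Sum>g\<leftarrow>gs. g x)"
      by (intro exI[of _ "[partial i a]"]) simp
  next
    fix a assume "a \<in> R ` Psi"
    then show "a 0 = 0" using Psi_zero by (auto simp: R_def)
  qed (use diff[OF Psi_schwartz] rap[OF Psi_schwartz] in blast)+
  show "\<psi> \<in> Psi \<Longrightarrow> (\<lambda>x. \<psi> (- x)) \<in> Psi"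
    using subsetD[OF sub' imageI, of \<psi>] by (simp only: R_def)
qed

text \<open>
  Polynomial functions, generated so that induction handles the two facts about them that are used:
  polynomial growth, and closure under partial derivatives.
\<close>

inductive_set polyfun :: "(real^'d::finite \<Rightarrow> real) set" where
  "(\<lambda>_. c) \<in> polyfun"
| "p \<in> polyfun \<Longrightarrow> q \<in> polyfun \<Longrightarrow> (\<lambda>x. p x + q x) \<in> polyfun"
| "p \<in> polyfun \<Longrightarrow> (\<lambda>x. x $ i * p x) \<in> polyfun"

lemma polyfun_growth:
  assumes "p \<in> polyfun" shows "\<exists>C N. 0 \<le> C \<and> (\<forall>x. \<bar>p x\<bar> \<le> C * wt x ^ N)"
  using assms
proof induction
  case (1 c)
  show ?case by (intro exI[of _ "\<bar>c\<bar>"] conjI exI[of _ 0] allI) simp_all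
next
  case (2 p q)
  from 2(3) obtain C N where C: "0 \<le> C" "\<And>x. \<bar>p x\<bar> \<le> C * wt x ^ N" by metis
  from 2(4) obtain D M where D: "0 \<le> D" "\<And>x. \<bar>q x\<bar> \<le> D * wt x ^ M" by metis
  have "\<bar>p x + q x\<bar> \<le> (C + D) * wt x ^ (N + M)" for x
  proof -
    have "C * wt x ^ N \<le> C * wt x ^ (N + M)" "D * wt x ^ M \<le> D * wt x ^ (N + M)"
      using C(1) D(1) wt_ge1[of x] by (intro mult_left_mono power_increasing; simp)+
    then show ?thesis using C(2)[of x] D(2)[of x] unfolding distrib_right by linarith
  qed
  then show ?case using C(1) D(1) by (intro exI[of _ "C + D"] exI[of _ "N + M"] conjI allI) simp_all
next
  case (3 p i)
  from 3(2) obtain C N where C: "0 \<le> C" "\<And>x. \<bar>p x\<bar> \<le> C * wt x ^ N" by metis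
  have "\<bar>x $ i * p x\<bar> \<le> C * wt x ^ Suc N" for x
  proof -
    have "\<bar>x $ i\<bar> * \<bar>p x\<bar> \<le> wt x * (C * wt x ^ N)"
      using component_le_norm_cart[of x i] norm_le_wt[of x] wt_pos[of x]
      by (intro mult_mono C(2)) auto
    then show ?thesis by (simp only: abs_mult power_Suc mult.left_commute)
  qed
  then show ?case using C(1) by (intro exI[of _ C] exI[of _ "Suc N"] conjI allI)
qed

lemma polyfun_derivative:
  assumes "p \<in> polyfun"
  shows "\<exists>p'. (\<forall>x. (p has_derivative (p' x)) (at x)) \<and> (\<forall>i. (\<lambda>x. p' x (axis i 1)) \<in> polyfun)"
  using assms
proof induction
  case (1 c)
  show ?case by (intro exI[of _ "\<lambda>_ _. 0"]) (auto intro: polyfun.intros)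
next
  case (2 p q)
  then obtain p' q' where *: "\<And>x. (p has_derivative (p' x)) (at x)" "\<And>i. (\<lambda>x. p' x (axis i 1)) \<in> polyfun"
    "\<And>x. (q has_derivative (q' x)) (at x)" "\<And>i. (\<lambda>x. q' x (axis i 1)) \<in> polyfun" by blast
  show ?case
  proof (intro exI[of _ "\<lambda>x h. p' x h + q' x h"] conjI allI)
    show "((\<lambda>x. p x + q x) has_derivative (\<lambda>h. p' x h + q' x h)) (at x)" for x
      by (intro has_derivative_add *)
    show "(\<lambda>x. p' x (axis i 1) + q' x (axis i 1)) \<in> polyfun" for i by (intro polyfun.intros(2) *)
  qed
next
  case (3 p i)
  then obtain p' where *: "\<And>x. (p has_derivative (p' x)) (at x)" "\<And>i. (\<lambda>x. p' x (axis i 1)) \<in> polyfun" by blast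
  have "(\<lambda>x. x $ i * p' x (axis j 1) + (axis j 1 :: real^'a) $ i * p x) \<in> polyfun" for j
  proof (cases "i = j")
    case True
    have "(\<lambda>x. x $ i * p' x (axis j 1) + p x) \<in> polyfun"
      by (intro polyfun.intros(2) polyfun.intros(3) * 3(1))
    with True show ?thesis by simp
  next
    case False
    then have "(axis j 1 :: real^'a) $ i = 0" by (simp add: axis_def)
    moreover have "(\<lambda>x. x $ i * p' x (axis j 1)) \<in> polyfun" by (intro polyfun.intros(3) *)
    ultimately show ?thesis by simp
  qed
  moreover have "((\<lambda>x. x $ i * p x) has_derivative (\<lambda>h. x $ i * p' x h + h $ i * p x)) (at x)" for x
    by (intro has_derivative_mult * bounded_linear_imp_has_derivative bounded_linear_vec_nth)
  ultimately show ?case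
    by (intro exI[of _ "\<lambda>x h. x $ i * p' x h + h $ i * p x"] conjI allI)
qed

lemma exp_bound_power:
  assumes "s > 0"
  shows "\<exists>C. \<forall>t\<ge>0. (1 + t) ^ N * exp (- (s * t)) \<le> (C::real)"
proof -
  have "((\<lambda>t. (1 + t) ^ N * exp (- (s * t))) \<longlongrightarrow> 0) at_top" using assms by real_asymp
  then have "eventually (\<lambda>t. (1 + t) ^ N * exp (- (s * t)) < 1) at_top"
    by (rule order_tendstoD) simp
  then obtain T where T: "\<And>t. t \<ge> T \<Longrightarrow> (1 + t) ^ N * exp (- (s * t)) < 1" by (auto simp: eventually_at_top_linorder)
  have "(1 + t) ^ N * exp (- (s * t)) \<le> (1 + \<bar>T\<bar>) ^ N + 1" if "t \<ge> 0" for t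
  proof (cases "t \<ge> T")
    case True
    then show ?thesis using T[of t] by (smt (verit) zero_le_power abs_ge_zero)
  next
    case False
    then have "(1 + t) ^ N * exp (- (s * t)) \<le> (1 + \<bar>T\<bar>) ^ N * 1"
      using that assms by (intro mult_mono power_mono) auto
    then show ?thesis by simp
  qed
  then show ?thesis by blast
qed

text \<open>
  The generators are polynomial multiples of the Gaussian.
\<close>

lemma schwartz_gaussian:
  assumes "s > 0"
  shows "(\<lambda>x::real^'d::finite. of_real (exp (- s * (norm x)\<^sup>2))) \<in> schwartz"
proof -
  let ?g = "\<lambda>x::real^'d. exp (- s * (norm x)\<^sup>2)"
  let ?A = "{\<lambda>x. of_real (p x * ?g x) |p. p \<in> polyfun} :: 'd fn set"
  have dg: "(?g has_derivative (\<lambda>h. ?g x * (- s * (2 * (x \<bullet> h))))) (at x)" for x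
    unfolding power2_norm_eq_inner by (auto intro!: derivative_eq_intros simp: inner_commute)
  have *: "\<exists>q\<in>?A. partial i a = q" and diff: "a differentiable (at x)" if "a \<in> ?A" for a i x
  proof -
    from that obtain p where p: "p \<in> polyfun" "a = (\<lambda>x. of_real (p x * ?g x))" by auto
    obtain p' where p': "\<And>x. (p has_derivative (p' x)) (at x)" "\<And>i. (\<lambda>x. p' x (axis i 1)) \<in> polyfun"
      using polyfun_derivative[OF p(1)] by blast
    have d: "(a has_derivative (\<lambda>h. of_real (p x * (?g x * (- s * (2 * (x \<bullet> h)))) + p' x h * ?g x))) (at x)" for x
      unfolding p(2) by (intro p' has_derivative_of_real has_derivative_mult dg)
    then show "a differentiable (at x)" using differentiableI by blast
    have "(\<lambda>x. - 2 * s * (x $ i * p x)) \<in> polyfun"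
    proof -
      have "(\<lambda>x. c * q x) \<in> polyfun" if "q \<in> polyfun" for c q
        using that
      proof induction
        case (2 p q)
        then show ?case using polyfun.intros(2)[OF 2(3,4)] by (simp add: distrib_left)
      next
        case (3 p i)
        then show ?case using polyfun.intros(3)[OF 3(2), of i] by (simp add: mult_ac)
      next
        case (1 d)
        show ?case by (rule polyfun.intros(1))
      qed
      then show ?thesis using polyfun.intros(3)[OF p(1)] by blast
    qed
    define q where "q = (\<lambda>x. p' x (axis i 1) + - 2 * s * (x $ i * p x))"
    have "q \<in> polyfun"
      unfolding q_def by (rule polyfun.intros(2)[OF p'(2)[of i] \<open>(\<lambda>x. - 2 * s * (x $ i * p x)) \<in> polyfun\<close>])
    then have "(\<lambda>x. of_real (q x * ?g x)) \<in> ?A" by blast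
    moreover have "partial i a = (\<lambda>x. of_real (q x * ?g x))"
      using partialI[OF d] by (auto simp: q_def inner_axis algebra_simps)
    ultimately show "\<exists>q\<in>?A. partial i a = q" by blast
  qed
  have "?A \<subseteq> schwartz"
  proof (rule schwartz_generators)
    fix a i assume "a \<in> ?A"
    from *[OF this, of i] show "\<exists>gs. set gs \<subseteq> ?A \<and> partial i a = (\<lambda>x. \<Sum>g\<leftarrow>gs. g x)"
      by (intro exI[of _ "[partial i a]"]) auto
  next
    fix a assume "a \<in> ?A"
    then obtain p where p: "p \<in> polyfun" "a = (\<lambda>x. of_real (p x * ?g x))" by auto
    obtain C M where C: "C \<ge> 0" "\<And>x. \<bar>p x\<bar> \<le> C * wt x ^ M" using polyfun_growth[OF p(1)] by metis
    have "rapid (\<lambda>x. of_real (?g x) :: complex)"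
    proof (rule rapidI)
      fix N
      obtain K where "\<And>t. t \<ge> 0 \<Longrightarrow> (1 + t) ^ N * exp (- (s * t)) \<le> K" using exp_bound_power[OF assms] by blast
      then show "\<exists>C. \<forall>x. wt x ^ N * cmod (of_real (?g x)) \<le> C" by (intro exI[of _ K]) auto
    qed
    from rapid_mult_poly[OF this, of "\<lambda>x. of_real (p x)" C M] show "rapid a" using C by (simp add: p(2))
  qed (use diff in blast)
  moreover have "(\<lambda>x. of_real ((\<lambda>_. 1) x * ?g x)) \<in> ?A"
    by (rule CollectI, rule exI[of _ "\<lambda>_. 1"]) (simp add: polyfun.intros(1))
  ultimately have "(\<lambda>x. of_real ((\<lambda>_. 1) x * ?g x)) \<in> schwartz" by (rule subsetD)
  then show ?thesis by (simp only: mult_1_left)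
qed

section \<open>The Fourier transform of Schwartz functions\<close>

lemma schwartz_continuous_on: "\<phi> \<in> schwartz \<Longrightarrow> continuous_on S \<phi>"
  by (meson continuous_at_imp_continuous_on differentiable_imp_continuous_within schwartz_differentiable)

lemma schwartz_measurable: "\<phi> \<in> schwartz \<Longrightarrow> \<phi> \<in> borel_measurable borel"
  by (intro borel_measurable_continuous_onI schwartz_continuous_on)

lemma rapid_integrable:
  fixes f :: "real^'d::finite \<Rightarrow> complex"
  assumes "rapid f" "f \<in> borel_measurable borel"
  shows "integrable lborel f"
proof -
  obtain C where C: "\<And>x. wt x ^ CARD('d) * cmod (f x) \<le> C" using rapidE[OF assms(1)] by blast
  show ?thesis
  proof (rule Bochner_Integration.integrable_bound)
    show "integrable lborel (\<lambda>x::real^'d. C * (1 / wt x ^ CARD('d)))"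
      by (intro integrable_mult_right integrable_wt)
    show "f \<in> borel_measurable lborel" using assms by simp
    have "cmod (f x) \<le> C * (1 / wt x ^ CARD('d))" for x
      using C[of x] wt_pos[of x] by (simp add: field_simps)
    then show "AE x in lborel. norm (f x) \<le> norm (C * (1 / wt x ^ CARD('d)))"
      by (intro AE_I2) (smt (verit) real_norm_def)
  qed
qed

lemma schwartz_integrable: "\<phi> \<in> schwartz \<Longrightarrow> integrable lborel \<phi>"
  by (intro rapid_integrable schwartz_rapid schwartz_measurable)

lemma cmod_exp_minus_ii [simp]: "cmod (exp (- \<i> * of_real t)) = 1" "cmod (exp (- (\<i> * of_real t))) = 1"
  by (simp_all add: norm_exp_eq_Re)

lemma measurable_character [measurable]:
  "(\<lambda>x. exp (- \<i> * of_real (k \<bullet> x))) \<in> borel_measurable (borel :: (real^'d::finite) measure)"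
  by (intro borel_measurable_continuous_onI continuous_intros)

lemma integrable_bounded_mult:
  fixes f g :: "'a \<Rightarrow> complex"
  assumes "integrable M f" "g \<in> borel_measurable M" "\<And>x. cmod (g x) \<le> C"
  shows "integrable M (\<lambda>x. g x * f x)"
proof (rule Bochner_Integration.integrable_bound)
  show "integrable M (\<lambda>x. C * norm (f x))" using assms(1) by auto
  show "(\<lambda>x. g x * f x) \<in> borel_measurable M" using assms(1,2) by auto
  have "norm (g x * f x) \<le> norm (C * norm (f x))" for x
  proof -
    have "norm (g x * f x) \<le> C * norm (f x)" unfolding norm_mult by (intro mult_right_mono assms) auto
    also have "\<dots> \<le> norm (C * norm (f x))" by simp
    finally show ?thesis .
  qed
  then show "AE x in M. norm (g x * f x) \<le> norm (C * norm (f x))" by simp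
qed

lemma integrable_character:
  fixes f :: "real^'d::finite \<Rightarrow> complex"
  assumes "integrable lborel f"
  shows "integrable lborel (\<lambda>x. exp (- \<i> * of_real (k \<bullet> x)) * f x)"
  by (rule integrable_bounded_mult[OF assms, of _ 1]) (use measurable_character in auto)

text \<open>
  The normalising constant of \<open>\<F>\<close>.
\<close>

abbreviation fconst :: "'d::finite itself \<Rightarrow> real" where
  "fconst _ \<equiv> (2 * pi) powr (- real CARD('d) / 2)"

lemma fourier_add:
  assumes "integrable lborel f" "integrable lborel g"
  shows "fourier (\<lambda>x. f x + g x) k = fourier f k + fourier g k"
  using integrable_character[OF assms(1), of k] integrable_character[OF assms(2), of k]
  by (simp add: fourier_def distrib_left)

lemma fourier_diff:
  assumes "integrable lborel f" "integrable lborel g"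
  shows "fourier (\<lambda>x. f x - g x) k = fourier f k - fourier g k"
  using integrable_character[OF assms(1), of k] integrable_character[OF assms(2), of k]
  by (simp add: fourier_def right_diff_distrib)

lemma fourier_cmult: "fourier (\<lambda>x. c * f x) k = c * fourier f k"
proof -
  have "(\<lambda>x. exp (- \<i> * of_real (k \<bullet> x)) * (c * f x)) = (\<lambda>x. c * (exp (- \<i> * of_real (k \<bullet> x)) * f x))"
    by (simp add: fun_eq_iff mult_ac)
  then show ?thesis unfolding fourier_def by (simp only: integral_mult_right_zero) (simp add: mult_ac)
qed

lemma fourier_zero: "fourier (\<lambda>_. 0) k = 0"
  by (simp add: fourier_def)

lemma norm_fourier_le:
  fixes f :: "real^'d::finite \<Rightarrow> complex"
  assumes "integrable lborel f"
  shows "cmod (fourier f k) \<le> fconst TYPE('d) * (\<integral>x. cmod (f x) \<partial>lborel)"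
proof -
  have "cmod (\<integral>x. exp (- \<i> * of_real (k \<bullet> x)) * f x \<partial>lborel) \<le> (\<integral>x. cmod (f x) \<partial>lborel)"
    using integral_norm_bound[of lborel "\<lambda>x. exp (- \<i> * of_real (k \<bullet> x)) * f x"] by (simp add: norm_mult)
  then show ?thesis by (simp add: fourier_def norm_mult mult_left_mono)
qed

text \<open>
  A quadratic error bound that is valid for all increments, not only small ones, gives differentiability
  without any epsilon management; it suits the transform because \<open>|e\<^bsup>iu\<^esup> - 1 - iu| \<le> u\<^sup>2/2\<close> globally.
\<close>

lemma has_derivative_quadratic:
  fixes f :: "'a::real_normed_vector \<Rightarrow> 'b::real_normed_vector"
  assumes "bounded_linear L" "\<And>h. norm (f (x + h) - f x - L h) \<le> C * (norm h)\<^sup>2"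
  shows "(f has_derivative L) (at x)"
  unfolding has_derivative_at
proof (intro conjI assms(1))
  show "(\<lambda>h. norm (f (x + h) - f x - L h) / norm h) \<midarrow>0\<rightarrow> 0"
  proof (rule Lim_null_comparison)
    show "((\<lambda>h::'a. C * norm h) \<longlongrightarrow> 0) (at 0)" by (auto intro!: tendsto_eq_intros)
    show "\<forall>\<^sub>F h in at 0. norm (norm (f (x + h) - f x - L h) / norm h) \<le> C * norm h"
      unfolding eventually_at_filter
    proof (intro always_eventually allI impI)
      fix h :: 'a assume "h \<noteq> 0"
      then show "norm (norm (f (x + h) - f x - L h) / norm h) \<le> C * norm h"
        using assms(2)[of h] by (simp add: divide_le_eq power2_eq_square mult_ac)
    qed
  qed
qed

lemma fourier_has_derivative:
  fixes f :: "real^'d::finite \<Rightarrow> complex"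
  assumes f: "integrable lborel f" and f2: "integrable lborel (\<lambda>x. (norm x)\<^sup>2 * cmod (f x))"
    and f1: "\<And>i. integrable lborel (\<lambda>x. of_real (x $ i) * f x)"
  shows "(fourier f has_derivative
     (\<lambda>h. \<Sum>i\<in>UNIV. of_real (h $ i) * fourier (\<lambda>x. - \<i> * (of_real (x $ i) * f x)) k)) (at k)"
proof (rule has_derivative_quadratic)
  let ?e = "\<lambda>k x. exp (- \<i> * of_real (k \<bullet> x)) :: complex"
  let ?c = "fconst TYPE('d)"
  let ?L = "\<lambda>h. \<Sum>i\<in>UNIV. of_real (h $ i) * fourier (\<lambda>x. - \<i> * (of_real (x $ i) * f x)) k"
  show "bounded_linear ?L"
    by (intro bounded_linear_sum bounded_linear_mult_const bounded_linear_compose[OF bounded_linear_of_real] bounded_linear_vec_nth)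
  fix h :: "real^'d"
  have Lh: "?L h = of_real ?c * (\<integral>x. ?e k x * (- \<i> * of_real (h \<bullet> x) * f x) \<partial>lborel)"
  proof -
    have int: "integrable lborel (\<lambda>x. ?e k x * (- \<i> * of_real (h $ i) * (of_real (x $ i) * f x)))" for i
      using f1[of i] by (intro integrable_character integrable_mult_right)
    have "?e k x * (- \<i> * of_real (h \<bullet> x) * f x) = (\<Sum>i\<in>UNIV. ?e k x * (- \<i> * of_real (h $ i) * (of_real (x $ i) * f x)))" for x
      by (simp add: inner_vec_def sum_distrib_left sum_distrib_right mult_ac)
    then have "(\<integral>x. ?e k x * (- \<i> * of_real (h \<bullet> x) * f x) \<partial>lborel)
        = (\<Sum>i\<in>UNIV. \<integral>x. ?e k x * (- \<i> * of_real (h $ i) * (of_real (x $ i) * f x)) \<partial>lborel)"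
      using int by (simp only:) (rule Bochner_Integration.integral_sum)
    also have "\<dots> = (\<Sum>i\<in>UNIV. of_real (h $ i) * (\<integral>x. ?e k x * (- \<i> * (of_real (x $ i) * f x)) \<partial>lborel))"
    proof (rule sum.cong[OF refl])
      fix i
      have "?e k x * (- \<i> * of_real (h $ i) * (of_real (x $ i) * f x)) = of_real (h $ i) * (?e k x * (- \<i> * (of_real (x $ i) * f x)))" for x
        by (simp add: mult_ac)
      then show "(\<integral>x. ?e k x * (- \<i> * of_real (h $ i) * (of_real (x $ i) * f x)) \<partial>lborel) = of_real (h $ i) * (\<integral>x. ?e k x * (- \<i> * (of_real (x $ i) * f x)) \<partial>lborel)"
        by (simp only: integral_mult_right_zero)
    qed
    finally show ?thesis by (simp add: fourier_def sum_distrib_left mult_ac)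
  qed
  have intL: "integrable lborel (\<lambda>x. ?e k x * (- \<i> * of_real (h \<bullet> x) * f x))"
  proof -
    have eq: "- \<i> * of_real (h \<bullet> x) * f x = (\<Sum>i\<in>UNIV. (- \<i> * of_real (h $ i)) * (of_real (x $ i) * f x))" for x
      by (simp add: inner_vec_def sum_distrib_left sum_distrib_right mult_ac)
    have "integrable lborel (\<lambda>x. - \<i> * of_real (h \<bullet> x) * f x)"
      unfolding eq by (intro Bochner_Integration.integrable_sum integrable_mult_right f1)
    then show ?thesis by (rule integrable_character)
  qed
  let ?R = "\<lambda>x. ?e (k + h) x * f x - ?e k x * f x - ?e k x * (- \<i> * of_real (h \<bullet> x) * f x)"
  have eq: "fourier f (k + h) - fourier f k - ?L h = of_real ?c * (\<integral>x. ?R x \<partial>lborel)"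
    using integrable_character[OF f] intL unfolding Lh
    by (simp add: fourier_def right_diff_distrib distrib_left)
  have le: "cmod (?R x) \<le> (norm h)\<^sup>2 * ((norm x)\<^sup>2 * cmod (f x))" for x
  proof -
    have "?R x = ?e k x * f x * (exp (\<i> * of_real (- (h \<bullet> x))) - (\<Sum>m\<le>1. (\<i> * of_real (- (h \<bullet> x))) ^ m / fact m))"
      by (simp add: inner_add_left exp_add[symmetric] algebra_simps exp_diff exp_minus field_simps)
    then have "cmod (?R x) = cmod (f x) * cmod (exp (\<i> * of_real (- (h \<bullet> x))) - (\<Sum>m\<le>1. (\<i> * of_real (- (h \<bullet> x))) ^ m / fact m))"
      by (simp only: norm_mult cmod_exp_minus_ii mult_1_left)
    also have "\<dots> \<le> cmod (f x) * (\<bar>- (h \<bullet> x)\<bar> ^ Suc 1 / fact (Suc 1))"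
      by (intro mult_left_mono iexp_approx1) auto
    also have "\<dots> \<le> cmod (f x) * ((norm h)\<^sup>2 * (norm x)\<^sup>2)"
    proof (intro mult_left_mono)
      have "(h \<bullet> x)\<^sup>2 \<le> (norm h)\<^sup>2 * (norm x)\<^sup>2"
        using Cauchy_Schwarz_ineq[of h x] by (simp add: power2_norm_eq_inner)
      then show "\<bar>- (h \<bullet> x)\<bar> ^ Suc 1 / fact (Suc 1) \<le> (norm h)\<^sup>2 * (norm x)\<^sup>2"
        using zero_le_power2[of "h \<bullet> x"] by (simp add: power2_eq_square[symmetric] abs_mult_self_eq, linarith)
    qed simp
    finally show ?thesis by (simp add: mult_ac)
  qed
  have "cmod (\<integral>x. ?R x \<partial>lborel) \<le> (\<integral>x. (norm h)\<^sup>2 * ((norm x)\<^sup>2 * cmod (f x)) \<partial>lborel)"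
    using f2 le integrable_character[OF f] intL
    by (intro Bochner_Integration.integral_norm_bound_integral) auto
  also have "\<dots> = (norm h)\<^sup>2 * (\<integral>x. (norm x)\<^sup>2 * cmod (f x) \<partial>lborel)" by simp
  finally have "?c * cmod (\<integral>x. ?R x \<partial>lborel) \<le> ?c * ((norm h)\<^sup>2 * (\<integral>x. (norm x)\<^sup>2 * cmod (f x) \<partial>lborel))"
    by (intro mult_left_mono) auto
  then show "cmod (fourier f (k + h) - fourier f k - ?L h) \<le> (?c * (\<integral>x. (norm x)\<^sup>2 * cmod (f x) \<partial>lborel)) * (norm h)\<^sup>2"
    unfolding eq norm_mult by (simp add: mult_ac)
qed

lemma schwartz_norm_sq_integrable:
  assumes "\<phi> \<in> schwartz"
  shows "integrable lborel (\<lambda>x. (norm x)\<^sup>2 * cmod (\<phi> x))"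
proof -
  have "integrable lborel (\<lambda>x. of_real ((norm x)\<^sup>2) * \<phi> x)"
  proof (rule rapid_integrable)
    show "rapid (\<lambda>x. of_real ((norm x)\<^sup>2) * \<phi> x)"
      by (rule rapid_mult_poly[OF schwartz_rapid[OF assms], of _ 1 1]) (simp add: norm_power)
    show "(\<lambda>x. of_real ((norm x)\<^sup>2) * \<phi> x) \<in> borel_measurable borel"
      using schwartz_measurable[OF assms] by simp
  qed
  from integrable_norm[OF this] show ?thesis by (simp add: norm_mult norm_power)
qed

lemma fourier_schwartz_derivative:
  assumes "\<phi> \<in> schwartz"
  shows "(fourier \<phi> has_derivative
     (\<lambda>h. \<Sum>i\<in>UNIV. of_real (h $ i) * fourier (\<lambda>x. - \<i> * (of_real (x $ i) * \<phi> x)) k)) (at k)"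
  by (intro fourier_has_derivative schwartz_integrable schwartz_norm_sq_integrable schwartz_coord assms)

lemma partial_fourier:
  assumes "\<phi> \<in> schwartz"
  shows "partial i (fourier \<phi>) = fourier (\<lambda>x. - \<i> * (of_real (x $ i) * \<phi> x))"
proof
  fix k
  have "(\<Sum>j\<in>UNIV. of_real ((axis i 1 :: real^'a) $ j) * fourier (\<lambda>x. - \<i> * (of_real (x $ j) * \<phi> x)) k)
      = (\<Sum>j\<in>UNIV. if j = i then fourier (\<lambda>x. - \<i> * (of_real (x $ j) * \<phi> x)) k else 0)"
    by (intro sum.cong) (auto simp: axis_def)
  then show "partial i (fourier \<phi>) k = fourier (\<lambda>x. - \<i> * (of_real (x $ i) * \<phi> x)) k"
    using partialI[OF fourier_schwartz_derivative[OF assms, of k], of i] by (simp add: sum.delta)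
qed

lemma wt_shift: "norm h \<le> 1 \<Longrightarrow> wt x \<le> 3 * wt (x + h)"
proof -
  assume h: "norm h \<le> 1"
  have "norm x \<le> norm (x + h) + norm h" using norm_triangle_ineq4[of "x + h" h] by simp
  then have "(norm x)\<^sup>2 \<le> (norm (x + h) + norm h)\<^sup>2" by (intro power_mono) auto
  also have "\<dots> \<le> 2 * (norm (x + h))\<^sup>2 + 2 * (norm h)\<^sup>2"
    using sum_squares_bound[of "norm (x + h)" "norm h"] by (simp add: power2_sum)
  finally have "(norm x)\<^sup>2 \<le> 2 * (norm (x + h))\<^sup>2 + 2 * (norm h)\<^sup>2" .
  moreover have "(norm h)\<^sup>2 \<le> 1" using h by (simp add: power_le_one)
  ultimately show ?thesis using zero_le_power2[of "norm (x + h)"] unfolding distrib_left by linarith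
qed

text \<open>
  The transform of the difference quotient \<open>(\<phi>(x + \<epsilon> e\<^sub>i) - \<phi>(x))/\<epsilon>\<close> is exactly \<open>(e\<^bsup>i \<epsilon> k\<^sub>i\<^esup> - 1)/\<epsilon>\<close> times that of
  \<open>\<phi>\<close>, by translation invariance. Dominated convergence then replaces integration by parts.
\<close>

lemma fourier_partial:
  fixes \<phi> :: "'d::finite fn"
  assumes "\<phi> \<in> schwartz"
  shows "fourier (partial i \<phi>) k = \<i> * of_real (k $ i) * fourier \<phi> k"
proof -
  let ?e = "axis i 1 :: real^'d"
  let ?E = "\<lambda>x. exp (- \<i> * of_real (k \<bullet> x)) :: complex"
  define \<epsilon> where "\<epsilon> n = inverse (real (Suc n))" for n
  have \<epsilon>: "0 < \<epsilon> n" "\<epsilon> n \<le> 1" for n by (auto simp: \<epsilon>_def inverse_le_1_iff)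
  have \<epsilon>0: "\<epsilon> \<longlonglongrightarrow> 0" unfolding \<epsilon>_def by (rule LIMSEQ_inverse_real_of_nat)
  have \<epsilon>at: "filterlim \<epsilon> (at 0) sequentially"
    using \<epsilon>0 \<epsilon>(1) by (auto simp: filterlim_at intro!: always_eventually less_imp_neq[symmetric] dest: less_imp_neq)
  define Q where "Q n x = (\<phi> (x + \<epsilon> n *\<^sub>R ?e) - \<phi> x) / of_real (\<epsilon> n)" for n x
  have line: "((\<lambda>t. \<phi> (x + t *\<^sub>R ?e)) has_derivative (\<lambda>s. of_real s * partial i \<phi> (x + t *\<^sub>R ?e))) (at t)" for x t
  proof -
    let ?f' = "frechet_derivative \<phi> (at (x + t *\<^sub>R ?e))"
    have d: "(\<phi> has_derivative ?f') (at (x + t *\<^sub>R ?e))"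
      using schwartz_differentiable[OF assms] frechet_derivative_works by blast
    have "((\<lambda>t. \<phi> (x + t *\<^sub>R ?e)) has_derivative (\<lambda>s. ?f' (s *\<^sub>R ?e))) (at t)"
      by (rule has_derivative_compose[of "\<lambda>t. x + t *\<^sub>R ?e" "\<lambda>s. s *\<^sub>R ?e" t UNIV \<phi> ?f', OF _ d])
         (auto intro!: derivative_eq_intros)
    moreover have "?f' (s *\<^sub>R ?e) = of_real s * partial i \<phi> (x + t *\<^sub>R ?e)" for s
      unfolding partial_def by (subst linear_scale[OF has_derivative_linear[OF d]]) (simp only: scaleR_conv_of_real)
    ultimately show ?thesis by simp
  qed
  obtain C where C: "C \<ge> 0" "\<And>x. wt x ^ CARD('d) * cmod (partial i \<phi> x) \<le> C"
    using rapidE[OF schwartz_rapid[OF schwartz_partial[OF assms]]] by blast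
  have Qb: "cmod (Q n x) \<le> 3 ^ CARD('d) * C * (1 / wt x ^ CARD('d))" for n x
  proof -
    \<comment> \<open>The mean value theorem turns the decay of the derivative into a domination of the quotients that is
      uniform in \<open>n\<close>; the shift by less than one costs a factor 3 in the weight.\<close>
    obtain t where t: "t \<in> {0<..<\<epsilon> n}" and
      le: "norm (\<phi> (x + \<epsilon> n *\<^sub>R ?e) - \<phi> (x + 0 *\<^sub>R ?e)) \<le> norm (of_real (\<epsilon> n - 0) * partial i \<phi> (x + t *\<^sub>R ?e))"
      using mvt_general[OF \<epsilon>(1)[of n], of "\<lambda>t. \<phi> (x + t *\<^sub>R ?e)" "\<lambda>t s. of_real s * partial i \<phi> (x + t *\<^sub>R ?e)"]
        line has_derivative_continuous_on[OF has_derivative_at_withinI[OF line]] by blast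
    have "cmod (Q n x) \<le> cmod (partial i \<phi> (x + t *\<^sub>R ?e))"
      using le \<epsilon>(1)[of n] by (simp add: Q_def norm_divide norm_mult divide_le_eq mult.commute)
    moreover have "wt x ^ CARD('d) * cmod (partial i \<phi> (x + t *\<^sub>R ?e)) \<le> 3 ^ CARD('d) * C"
    proof -
      have "norm (t *\<^sub>R ?e) \<le> 1" using t \<epsilon>(2)[of n] by (simp add: norm_axis_1)
      then have "wt x ^ CARD('d) \<le> (3 * wt (x + t *\<^sub>R ?e)) ^ CARD('d)"
        using wt_pos[of x] by (intro power_mono wt_shift) auto
      then have "wt x ^ CARD('d) * cmod (partial i \<phi> (x + t *\<^sub>R ?e)) \<le> (3 * wt (x + t *\<^sub>R ?e)) ^ CARD('d) * cmod (partial i \<phi> (x + t *\<^sub>R ?e))"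
        by (rule mult_right_mono) simp
      also have "\<dots> = 3 ^ CARD('d) * (wt (x + t *\<^sub>R ?e) ^ CARD('d) * cmod (partial i \<phi> (x + t *\<^sub>R ?e)))"
        by (simp only: power_mult_distrib mult.assoc)
      also have "\<dots> \<le> 3 ^ CARD('d) * C" by (intro mult_left_mono C) auto
      finally show ?thesis .
    qed
    ultimately have "wt x ^ CARD('d) * cmod (Q n x) \<le> 3 ^ CARD('d) * C"
      using wt_pos[of x] by (smt (verit) mult_left_mono zero_le_power)
    then show ?thesis using wt_pos[of x] by (simp add: field_simps)
  qed
  have meas: "\<phi> \<in> borel_measurable borel" "partial i \<phi> \<in> borel_measurable borel"
    using assms schwartz_measurable schwartz_partial by blast+
  have Qlim: "(\<lambda>n. Q n x) \<longlonglongrightarrow> partial i \<phi> x" for x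
  proof -
    have "((\<lambda>h. norm (\<phi> (x + h *\<^sub>R ?e) - \<phi> x - of_real h * partial i \<phi> x) / norm h) \<longlongrightarrow> 0) (at 0)"
      using line[of x 0] unfolding has_derivative_at by (simp del: scaleR_conv_of_real)
    from filterlim_compose[OF this \<epsilon>at]
    have "(\<lambda>n. norm (\<phi> (x + \<epsilon> n *\<^sub>R ?e) - \<phi> x - of_real (\<epsilon> n) * partial i \<phi> x) / norm (\<epsilon> n)) \<longlonglongrightarrow> 0" .
    moreover have "norm (\<phi> (x + \<epsilon> n *\<^sub>R ?e) - \<phi> x - of_real (\<epsilon> n) * partial i \<phi> x) / norm (\<epsilon> n) = norm (Q n x - partial i \<phi> x)" for n
    proof -
      have "Q n x - partial i \<phi> x = (\<phi> (x + \<epsilon> n *\<^sub>R ?e) - \<phi> x - of_real (\<epsilon> n) * partial i \<phi> x) / of_real (\<epsilon> n)"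
        using \<epsilon>(1)[of n] by (simp add: Q_def diff_divide_distrib)
      then show ?thesis using \<epsilon>(1)[of n] by (simp add: norm_divide)
    qed
    ultimately have "(\<lambda>n. Q n x - partial i \<phi> x) \<longlonglongrightarrow> 0" by (simp add: tendsto_norm_zero_iff)
    then show ?thesis by (rule LIM_zero_cancel)
  qed
  have lim1: "(\<lambda>n. \<integral>x. ?E x * Q n x \<partial>lborel) \<longlonglongrightarrow> (\<integral>x. ?E x * partial i \<phi> x \<partial>lborel)"
  proof (rule integral_dominated_convergence)
    show "integrable lborel (\<lambda>x::real^'d. 3 ^ CARD('d) * C * (1 / wt x ^ CARD('d)))"
      by (intro integrable_mult_right integrable_wt)
    show "(\<lambda>x. ?E x * partial i \<phi> x) \<in> borel_measurable lborel" using meas measurable_character[of k] by simp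
    show "(\<lambda>x. ?E x * Q n x) \<in> borel_measurable lborel" for n
      using meas measurable_character[of k] unfolding Q_def by simp
    show "AE x in lborel. (\<lambda>n. ?E x * Q n x) \<longlonglongrightarrow> ?E x * partial i \<phi> x"
      by (intro AE_I2 tendsto_mult_left Qlim)
    show "AE x in lborel. norm (?E x * Q n x) \<le> 3 ^ CARD('d) * C * (1 / wt x ^ CARD('d))" for n
      using Qb by (simp add: norm_mult)
  qed
  have QF: "(\<integral>x. ?E x * Q n x \<partial>lborel) = (exp (\<i> * of_real (k $ i) * of_real (\<epsilon> n)) - 1) / of_real (\<epsilon> n) * (\<integral>x. ?E x * \<phi> x \<partial>lborel)" for n
  proof -
    let ?t = "\<epsilon> n *\<^sub>R ?e"
    have int: "integrable lborel (\<lambda>x. ?E x * \<phi> x)" by (intro integrable_character schwartz_integrable assms)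
    have shift: "integrable lborel (\<lambda>x. ?E x * \<phi> (x + ?t))"
      using integrable_lborel_scale[of 1 \<phi> ?t] schwartz_integrable[OF assms]
      by (intro integrable_character) (simp add: add.commute)
    have "(\<integral>x. ?E x * \<phi> x \<partial>lborel) = (\<integral>x. ?E (?t + x) * \<phi> (?t + x) \<partial>lborel)"
      using integral_lborel_scale[of 1 "\<lambda>x. ?E x * \<phi> x" ?t] meas measurable_character[of k] by simp
    also have "\<dots> = (\<integral>x. exp (- (\<i> * of_real (k $ i) * of_real (\<epsilon> n))) * (?E x * \<phi> (x + ?t)) \<partial>lborel)"
      by (intro Bochner_Integration.integral_cong refl)
         (simp add: inner_add_right inner_axis exp_add[symmetric] algebra_simps)
    also have "\<dots> = exp (- (\<i> * of_real (k $ i) * of_real (\<epsilon> n))) * (\<integral>x. ?E x * \<phi> (x + ?t) \<partial>lborel)"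
      by (rule integral_mult_right_zero)
    finally have sh: "(\<integral>x. ?E x * \<phi> (x + ?t) \<partial>lborel) = exp (\<i> * of_real (k $ i) * of_real (\<epsilon> n)) * (\<integral>x. ?E x * \<phi> x \<partial>lborel)"
      by (simp add: exp_minus field_simps)
    have "(\<integral>x. ?E x * Q n x \<partial>lborel) = (\<integral>x. (?E x * \<phi> (x + ?t) - ?E x * \<phi> x) / of_real (\<epsilon> n) \<partial>lborel)"
      by (intro Bochner_Integration.integral_cong refl) (simp add: Q_def algebra_simps diff_divide_distrib)
    also have "\<dots> = (\<integral>x. ?E x * \<phi> (x + ?t) - ?E x * \<phi> x \<partial>lborel) / of_real (\<epsilon> n)" by simp
    also have "\<dots> = ((\<integral>x. ?E x * \<phi> (x + ?t) \<partial>lborel) - (\<integral>x. ?E x * \<phi> x \<partial>lborel)) / of_real (\<epsilon> n)"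
      using int shift by (simp only: Bochner_Integration.integral_diff)
    finally show ?thesis unfolding sh by (simp add: algebra_simps)
  qed
  have lim2: "(\<lambda>n. (exp (\<i> * of_real (k $ i) * of_real (\<epsilon> n)) - 1) / of_real (\<epsilon> n)) \<longlonglongrightarrow> \<i> * of_real (k $ i)"
  proof -
    have "((\<lambda>z. exp (\<i> * of_real (k $ i) * z)) has_field_derivative (\<i> * of_real (k $ i))) (at (0::complex))"
      by (auto intro!: derivative_eq_intros)
    then have "((\<lambda>z. (exp (\<i> * of_real (k $ i) * z) - 1) / z) \<longlongrightarrow> \<i> * of_real (k $ i)) (at (0::complex))"
      by (simp add: has_field_derivative_iff)
    moreover have "filterlim (\<lambda>n. of_real (\<epsilon> n) :: complex) (at 0) sequentially"
      using tendsto_of_real[OF \<epsilon>0, where ?'a=complex] less_imp_neq[OF \<epsilon>(1)]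
      by (auto simp: filterlim_at intro!: always_eventually)
    ultimately show ?thesis by (rule filterlim_compose)
  qed
  have "(\<lambda>n. \<integral>x. ?E x * Q n x \<partial>lborel) \<longlonglongrightarrow> \<i> * of_real (k $ i) * (\<integral>x. ?E x * \<phi> x \<partial>lborel)"
    unfolding QF by (intro tendsto_mult_right lim2)
  with lim1 have "(\<integral>x. ?E x * partial i \<phi> x \<partial>lborel) = \<i> * of_real (k $ i) * (\<integral>x. ?E x * \<phi> x \<partial>lborel)"
    using LIMSEQ_unique by blast
  then show ?thesis by (simp add: fourier_def mult_ac)
qed

lemma monomial_fourier:
  assumes "\<phi> \<in> schwartz"
  shows "of_real (monomial \<alpha> k) * fourier \<phi> k = (- \<i>) ^ length \<alpha> * fourier (partials \<alpha> \<phi>) k"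
proof (induction \<alpha>)
  case (Cons i \<alpha>)
  have "fourier (partials (i # \<alpha>) \<phi>) k = \<i> * of_real (k $ i) * fourier (partials \<alpha> \<phi>) k"
    using fourier_partial[OF schwartz_partials[OF assms]] by simp
  then have "of_real (k $ i) * fourier (partials \<alpha> \<phi>) k = - \<i> * fourier (partials (i # \<alpha>) \<phi>) k"
    by (simp add: mult.assoc[symmetric])
  then have *: "(- \<i>) ^ length \<alpha> * (of_real (k $ i) * fourier (partials \<alpha> \<phi>) k) = (- \<i>) ^ length \<alpha> * (- \<i> * fourier (partials (i # \<alpha>) \<phi>) k)"
    by simp
  have "of_real (monomial (i # \<alpha>) k) * fourier \<phi> k = of_real (k $ i) * (of_real (monomial \<alpha> k) * fourier \<phi> k)"
    by simp
  also have "\<dots> = (- \<i>) ^ length \<alpha> * (of_real (k $ i) * fourier (partials \<alpha> \<phi>) k)"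
    unfolding Cons by (simp only: mult.left_commute)
  finally show ?case unfolding * by simp
qed simp

lemma schwartz_monomial: "\<phi> \<in> schwartz \<Longrightarrow> (\<lambda>x. of_real (monomial \<alpha> x) * \<phi> x) \<in> schwartz"
  by (induction \<alpha>) (auto simp: mult.assoc intro: schwartz_coord)

text \<open>
  The generators are the transforms of Schwartz functions. Their derivatives are again of this form, and
  decay follows because multiplication by a monomial corresponds to differentiation.
\<close>

lemma fourier_schwartz:
  assumes "\<phi> \<in> schwartz" shows "fourier \<phi> \<in> schwartz"
proof -
  have "fourier ` schwartz \<subseteq> (schwartz :: 'a fn set)"
  proof (rule schwartz_generators)
    fix a :: "'a fn" and x assume "a \<in> fourier ` schwartz"
    then show "a differentiable (at x)" using fourier_schwartz_derivative differentiableI by blast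
  next
    fix a :: "'a fn" assume "a \<in> fourier ` schwartz"
    then obtain \<phi> where \<phi>: "\<phi> \<in> schwartz" "a = fourier \<phi>" by blast
    show "rapid a" unfolding rapid_iff
    proof
      fix \<alpha>
      have "cmod (of_real (monomial \<alpha> k) * a k) \<le> fconst TYPE('a) * (\<integral>x. cmod (partials \<alpha> \<phi> x) \<partial>lborel)" for k
        using norm_fourier_le[OF schwartz_integrable[OF schwartz_partials[OF \<phi>(1), of \<alpha>]], of k]
        by (simp only: \<phi>(2) monomial_fourier[OF \<phi>(1)] norm_mult norm_power) simp
      then show "bounded (range (\<lambda>x. of_real (monomial \<alpha> x) * a x))" by (auto intro!: boundedI)
    qed
  next
    fix a :: "'a fn" and i assume "a \<in> fourier ` schwartz"
    then obtain \<phi> where \<phi>: "\<phi> \<in> schwartz" "a = fourier \<phi>" by blast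
    have "(\<lambda>x. - \<i> * (of_real (x $ i) * \<phi> x)) \<in> schwartz"
      by (intro schwartz_cmult schwartz_coord \<phi>)
    then have "partial i a \<in> fourier ` schwartz" using partial_fourier[OF \<phi>(1)] \<phi>(2) by simp
    then show "\<exists>gs. set gs \<subseteq> fourier ` schwartz \<and> partial i a = (\<lambda>x. \<Sum>g\<leftarrow>gs. g x)"
      by (intro exI[of _ "[partial i a]"]) simp
  qed
  then show ?thesis using assms by blast
qed

lemma partials_fourier:
  assumes "\<phi> \<in> schwartz"
  shows "partials \<beta> (fourier \<phi>) = fourier (\<lambda>x. (- \<i>) ^ length \<beta> * (of_real (monomial \<beta> x) * \<phi> x))"
proof (induction \<beta>)
  case (Cons i \<beta>)
  have "(\<lambda>x. (- \<i>) ^ length \<beta> * (of_real (monomial \<beta> x) * \<phi> x)) \<in> schwartz"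
    by (intro schwartz_cmult schwartz_monomial assms)
  from partial_fourier[OF this, of i] Cons show ?case by (simp add: mult_ac)
qed simp

section \<open>Gaussian regularisation and Fourier inversion\<close>

definition gauss :: "real^'d::finite \<Rightarrow> real" where "gauss x = exp (- (norm x)\<^sup>2 / 2)"

lemma gauss_pos: "0 < gauss x" and gauss_nonneg: "0 \<le> gauss x" and gauss_le_1: "gauss x \<le> 1" and gauss_minus: "gauss (- x) = gauss x"
  by (simp_all add: gauss_def)

lemma gauss_measurable [measurable]: "gauss \<in> borel_measurable borel"
  unfolding gauss_def by measurable

lemma isCont_gauss: "isCont gauss x"
  unfolding gauss_def by (intro continuous_intros) simp

lemma schwartz_gauss: "(\<lambda>x. of_real (gauss x)) \<in> schwartz"
  using schwartz_gaussian[of "1/2"] by (simp add: gauss_def)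

lemma nn_integral_gauss: "(\<integral>\<^sup>+x. ennreal (gauss x) \<partial>(lborel :: (real^'d::finite) measure)) = ennreal ((2 * pi) powr (real CARD('d) / 2))"
proof -
  have one: "(\<integral>\<^sup>+t. ennreal (exp (- t\<^sup>2 / 2)) \<partial>lborel) = ennreal (sqrt (2 * pi))"
  proof -
    have "(\<integral>\<^sup>+t. ennreal (std_normal_density t) \<partial>lborel) = ennreal 1"
      using integral_normal_density[of 1 0] integrable_normal_density[of 1 0]
      by (subst nn_integral_eq_integral) auto
    then have "ennreal (sqrt (2 * pi)) * (\<integral>\<^sup>+t. ennreal (std_normal_density t) \<partial>lborel) = ennreal (sqrt (2 * pi))" by simp
    also have "ennreal (sqrt (2 * pi)) * (\<integral>\<^sup>+t. ennreal (std_normal_density t) \<partial>lborel)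
        = (\<integral>\<^sup>+t. ennreal (sqrt (2 * pi) * std_normal_density t) \<partial>lborel)"
      by (subst nn_integral_cmult[symmetric]) (auto simp: ennreal_mult')
    also have "(\<lambda>t. sqrt (2 * pi) * std_normal_density t) = (\<lambda>t. exp (- t\<^sup>2 / 2))"
      by (auto simp: std_normal_density_def)
    finally show ?thesis .
  qed
  have "ennreal (gauss x) = (\<Prod>i\<in>UNIV. ennreal (exp (- (x $ i)\<^sup>2 / 2)))" for x :: "real^'d"
  proof -
    have "(norm x)\<^sup>2 = (\<Sum>i\<in>UNIV. (x $ i)\<^sup>2)" by (simp add: norm_vec_def L2_set_def sum_nonneg)
    then have "gauss x = (\<Prod>i\<in>UNIV. exp (- (x $ i)\<^sup>2 / 2))"
      by (simp add: gauss_def exp_sum[symmetric] sum_negf sum_divide_distrib)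
    then show ?thesis by (simp add: prod_ennreal)
  qed
  then have "(\<integral>\<^sup>+x. ennreal (gauss x) \<partial>(lborel :: (real^'d::finite) measure)) = ennreal (sqrt (2 * pi)) ^ CARD('d)"
    using nn_integral_prod_coords[of "\<lambda>t. ennreal (exp (- t\<^sup>2 / 2))", where 'd='d] one by simp
  also have "\<dots> = ennreal ((2 * pi) powr (real CARD('d) / 2))"
  proof -
    have "sqrt (2 * pi) ^ CARD('d) = ((2 * pi) powr (1/2)) powr real CARD('d)"
      by (simp add: powr_half_sqrt powr_realpow)
    also have "\<dots> = (2 * pi) powr (real CARD('d) / 2)" unfolding powr_powr by simp
    finally show ?thesis by (simp add: ennreal_power)
  qed
  finally show ?thesis .
qed

lemma integrable_gauss: "integrable lborel (gauss :: real^'d::finite \<Rightarrow> real)"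
  using nn_integral_gauss[where 'd='d] by (intro integrableI_nonneg) (auto simp: gauss_nonneg)

lemma integral_gauss: "(\<integral>x. gauss x \<partial>(lborel :: (real^'d::finite) measure)) = (2 * pi) powr (real CARD('d) / 2)"
  by (subst integral_eq_nn_integral) (auto simp: gauss_nonneg nn_integral_gauss)

lemma fconst_pos: "0 < fconst TYPE('d::finite)"
  and fconst_mult_gauss: "fconst TYPE('d) * (2 * pi) powr (real CARD('d) / 2) = 1"
  by (simp_all add: powr_add[symmetric])

lemma partial_gauss: "partial i (\<lambda>x. of_real (gauss x)) = (\<lambda>x. - (of_real (x $ i) * of_real (gauss x)))"
proof
  fix x :: "real^'a"
  have "(gauss has_derivative (\<lambda>h. gauss x * (- (x \<bullet> h)))) (at x)"
    unfolding gauss_def power2_norm_eq_inner by (auto intro!: derivative_eq_intros simp: inner_commute)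
  then have "((\<lambda>x. of_real (gauss x) :: complex) has_derivative (\<lambda>h. of_real (gauss x * (- (x \<bullet> h))))) (at x)"
    by (rule has_derivative_of_real)
  from partialI[OF this, of i] show "partial i (\<lambda>x. of_real (gauss x)) x = - (of_real (x $ i) * of_real (gauss x))"
    by (simp add: inner_axis mult.commute)
qed

text \<open>
  The transform of the Gaussian satisfies \<open>\<partial>\<^sub>i u = - k\<^sub>i u\<close>, as the Gaussian does, since the two rules that exchange
  multiplication and differentiation turn this system into itself. So \<open>u exp (|k|\<^sup>2/2)\<close> is constant, and its value at
  the origin is the Gaussian integral.
\<close>

lemma fourier_gauss: "fourier (\<lambda>x::real^'d::finite. of_real (gauss x)) = (\<lambda>k. of_real (gauss k))"
proof -
  let ?g = "\<lambda>x::real^'d. of_real (gauss x) :: complex"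
  have p: "partial i (fourier ?g) = (\<lambda>k. - of_real (k $ i) * fourier ?g k)" for i
  proof
    fix k
    have "(\<lambda>x. - \<i> * (of_real (x $ i) * ?g x)) = (\<lambda>x. \<i> * partial i ?g x)"
      by (simp add: partial_gauss)
    then have "partial i (fourier ?g) k = \<i> * fourier (partial i ?g) k"
      by (simp only: partial_fourier[OF schwartz_gauss] fourier_cmult)
    also have "\<dots> = \<i> * (\<i> * of_real (k $ i) * fourier ?g k)"
      by (simp only: fourier_partial[OF schwartz_gauss])
    also have "\<dots> = - of_real (k $ i) * fourier ?g k" by (simp add: mult.assoc[symmetric])
    finally show "partial i (fourier ?g) k = - of_real (k $ i) * fourier ?g k" .
  qed
  have d: "(fourier ?g has_derivative (\<lambda>h. - of_real (k \<bullet> h) * fourier ?g k)) (at k)" for k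
    using schwartz_has_derivative[OF fourier_schwartz[OF schwartz_gauss], of k]
    by (simp add: p inner_vec_def sum_distrib_right sum_distrib_left sum_negf mult_ac)
  let ?q = "\<lambda>k::real^'d. of_real (exp ((k \<bullet> k) / 2)) :: complex"
  have "((\<lambda>k. exp ((k \<bullet> k) / 2)) has_derivative (\<lambda>h. exp ((k \<bullet> k) / 2) * (k \<bullet> h))) (at k)" for k :: "real^'d"
    by (auto intro!: derivative_eq_intros simp: inner_commute)
  then have dq: "(?q has_derivative (\<lambda>h. of_real (exp ((k \<bullet> k) / 2) * (k \<bullet> h)))) (at k)" for k
    by (intro has_derivative_of_real)
  have "((\<lambda>k. ?q k * fourier ?g k) has_derivative (\<lambda>h. 0)) (at k within UNIV)" for k
    using has_derivative_mult[OF dq[of k] d[of k]] by (simp add: algebra_simps)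
  then have "\<exists>c. \<forall>k\<in>UNIV. ?q k * fourier ?g k = c"
    by (intro has_derivative_zero_constant) auto
  then obtain c where c: "\<And>k. ?q k * fourier ?g k = c" by blast
  have "fourier ?g 0 = of_real (fconst TYPE('d)) * of_real ((2 * pi) powr (real CARD('d) / 2))"
    by (simp add: fourier_def integral_gauss)
  also have "\<dots> = 1" by (simp only: of_real_mult[symmetric] fconst_mult_gauss of_real_1)
  finally have "c = 1" using c[of 0] by simp
  have "fourier ?g k = of_real (gauss k)" for k
  proof -
    have "fourier ?g k = of_real (gauss k) * (?q k * fourier ?g k)"
      by (simp add: gauss_def power2_norm_eq_inner mult.assoc[symmetric] flip: of_real_mult exp_add)
    then show ?thesis using c[of k] \<open>c = 1\<close> by simp
  qed
  then show ?thesis by blast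
qed

lemma integrable_pair_bounded:
  fixes f g :: "real^'d::finite \<Rightarrow> complex"
  assumes f: "integrable lborel f" and g: "integrable lborel g"
    and m[measurable]: "case_prod m \<in> borel_measurable (borel \<Otimes>\<^sub>M borel)" and C: "\<And>x y. cmod (m x y) \<le> C"
  shows "integrable (lborel \<Otimes>\<^sub>M lborel) (\<lambda>(x, y). m x y * (f x * g y))"
proof (rule integrableI_bounded)
  have [measurable]: "f \<in> borel_measurable borel" "g \<in> borel_measurable borel"
    using f g by auto
  have [measurable]: "case_prod m \<in> borel_measurable (lborel \<Otimes>\<^sub>M lborel)"
    using m by (subst measurable_cong_sets[OF sets_pair_measure_cong[OF sets_lborel sets_lborel] refl])
  show meas: "(\<lambda>(x, y). m x y * (f x * g y)) \<in> borel_measurable (lborel \<Otimes>\<^sub>M lborel)" by measurable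
  have C0: "0 \<le> C" using C[of 0 0] norm_ge_zero order_trans by blast
  have "(\<integral>\<^sup>+z. ennreal (norm (case z of (x, y) \<Rightarrow> m x y * (f x * g y))) \<partial>(lborel \<Otimes>\<^sub>M lborel))
     \<le> (\<integral>\<^sup>+z. ennreal C * (ennreal (norm (f (fst z))) * ennreal (norm (g (snd z)))) \<partial>(lborel \<Otimes>\<^sub>M lborel))"
  proof (rule nn_integral_mono, clarsimp)
    fix x y
    have "cmod (m x y * (f x * g y)) \<le> C * (cmod (f x) * cmod (g y))"
      unfolding norm_mult by (intro mult_right_mono C) auto
    then show "ennreal (cmod (m x y * (f x * g y))) \<le> ennreal C * (ennreal (cmod (f x)) * ennreal (cmod (g y)))"
      using C0 by (simp add: ennreal_mult[symmetric])
  qed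
  also have "\<dots> = (\<integral>\<^sup>+x. \<integral>\<^sup>+y. ennreal C * (ennreal (norm (f x)) * ennreal (norm (g y))) \<partial>lborel \<partial>lborel)"
    by (subst lborel.nn_integral_fst[symmetric]) auto
  also have "\<dots> = ennreal C * ((\<integral>\<^sup>+x. ennreal (norm (f x)) \<partial>lborel) * (\<integral>\<^sup>+y. ennreal (norm (g y)) \<partial>lborel))"
    by (simp add: nn_integral_cmult nn_integral_multc)
  also have "\<dots> < \<infinity>" using f g by (auto simp: integrable_iff_bounded ennreal_mult_less_top)
  finally show "(\<integral>\<^sup>+z. ennreal (norm (case z of (x, y) \<Rightarrow> m x y * (f x * g y))) \<partial>(lborel \<Otimes>\<^sub>M lborel)) < \<infinity>" .
qed

lemma fubini_bounded:
  fixes f g :: "real^'d::finite \<Rightarrow> complex"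
  assumes f: "integrable lborel f" and g: "integrable lborel g"
    and m: "case_prod m \<in> borel_measurable (borel \<Otimes>\<^sub>M borel)" and C: "\<And>x y. cmod (m x y) \<le> C"
  shows "(\<integral>x. \<integral>y. m x y * (f x * g y) \<partial>lborel \<partial>lborel) = (\<integral>y. \<integral>x. m x y * (f x * g y) \<partial>lborel \<partial>lborel)"
  using lborel_pair.integral_fst[of "\<lambda>x y. m x y * (f x * g y)"] lborel_pair.integral_snd[of "\<lambda>x y. m x y * (f x * g y)"]
    integrable_pair_bounded[OF assms] by simp

lemma measurable_character_pair:
  "(\<lambda>(x::real^'d::finite, y). exp (- \<i> * of_real (x \<bullet> y))) \<in> borel_measurable (borel \<Otimes>\<^sub>M borel)"
  unfolding case_prod_unfold borel_prod by (intro borel_measurable_continuous_onI continuous_intros)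

lemma fourier_continuous:
  assumes f: "integrable lborel f"
  shows "continuous_on UNIV (fourier f)"
proof (rule continuous_at_imp_continuous_on, rule ballI)
  fix k
  have [measurable]: "f \<in> borel_measurable borel" using f by auto
  have "((\<lambda>k. \<integral>x. exp (- \<i> * of_real (k \<bullet> x)) * f x \<partial>lborel) \<longlongrightarrow> (\<integral>x. exp (- \<i> * of_real (k \<bullet> x)) * f x \<partial>lborel)) (at k)"
    unfolding tendsto_at_iff_sequentially comp_def
  proof (intro allI impI)
    fix X assume X: "X \<longlonglongrightarrow> k"
    show "(\<lambda>n. \<integral>x. exp (- \<i> * of_real (X n \<bullet> x)) * f x \<partial>lborel) \<longlonglongrightarrow> (\<integral>x. exp (- \<i> * of_real (k \<bullet> x)) * f x \<partial>lborel)"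
    proof (rule integral_dominated_convergence)
      show "integrable lborel (\<lambda>x. cmod (f x))" using f by simp
      show "AE x in lborel. (\<lambda>n. exp (- \<i> * of_real (X n \<bullet> x)) * f x) \<longlonglongrightarrow> exp (- \<i> * of_real (k \<bullet> x)) * f x"
        by (intro AE_I2 tendsto_intros X)
      show "(\<lambda>x. exp (- \<i> * of_real (k \<bullet> x)) * f x) \<in> borel_measurable lborel"
        using measurable_character[of k] by simp
      show "(\<lambda>x. exp (- \<i> * of_real (X n \<bullet> x)) * f x) \<in> borel_measurable lborel" for n
        using measurable_character[of "X n"] by simp
    qed (simp add: norm_mult)
  qed
  then show "isCont (fourier f) k"
    unfolding isCont_def fourier_def by (intro tendsto_mult_left)
qed

lemma fourier_measurable: "integrable lborel f \<Longrightarrow> fourier f \<in> borel_measurable borel"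
  by (intro borel_measurable_continuous_onI fourier_continuous)

lemma integrable_fourier_mult:
  fixes f g :: "real^'d::finite \<Rightarrow> complex"
  assumes "integrable lborel f" "integrable lborel g"
  shows "integrable lborel (\<lambda>k. fourier f k * g k)"
  by (rule integrable_bounded_mult[OF assms(2)]) (use fourier_measurable norm_fourier_le assms in auto)

lemma multiplication_formula:
  fixes f g :: "real^'d::finite \<Rightarrow> complex"
  assumes f: "integrable lborel f" and g: "integrable lborel g"
  shows "(\<integral>k. fourier f k * g k \<partial>lborel) = (\<integral>x. f x * fourier g x \<partial>lborel)"
proof -
  let ?m = "\<lambda>x y::real^'d. exp (- \<i> * of_real (x \<bullet> y)) :: complex"
  let ?c = "of_real (fconst TYPE('d)) :: complex"
  have "(\<integral>k. \<integral>x. ?m k x * (g k * f x) \<partial>lborel \<partial>lborel) = (\<integral>x. \<integral>k. ?m k x * (g k * f x) \<partial>lborel \<partial>lborel)"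
    by (rule fubini_bounded[OF g f measurable_character_pair, of 1]) simp
  moreover have "(\<integral>x. ?m k x * (g k * f x) \<partial>lborel) = (\<integral>x. ?m k x * f x \<partial>lborel) * g k" for k
  proof -
    have "?m k x * (g k * f x) = (?m k x * f x) * g k" for x by (simp only: mult_ac)
    then show ?thesis by (simp only: integral_mult_left_zero)
  qed
  moreover have "(\<integral>k. ?m k x * (g k * f x) \<partial>lborel) = f x * (\<integral>k. ?m x k * g k \<partial>lborel)" for x
  proof -
    have "?m k x * (g k * f x) = f x * (?m x k * g k)" for k by (simp only: mult_ac inner_commute)
    then show ?thesis by (simp only: integral_mult_right_zero)
  qed
  ultimately have "(\<integral>k. (\<integral>x. ?m k x * f x \<partial>lborel) * g k \<partial>lborel) = (\<integral>x. f x * (\<integral>k. ?m x k * g k \<partial>lborel) \<partial>lborel)"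
    by (simp only:)
  then have "?c * (\<integral>k. (\<integral>x. ?m k x * f x \<partial>lborel) * g k \<partial>lborel) = ?c * (\<integral>x. f x * (\<integral>k. ?m x k * g k \<partial>lborel) \<partial>lborel)"
    by (rule arg_cong)
  moreover have "fourier f k * g k = ?c * ((\<integral>x. ?m k x * f x \<partial>lborel) * g k)" for k
    by (simp only: fourier_def mult.assoc)
  moreover have "f x * fourier g x = ?c * (f x * (\<integral>k. ?m x k * g k \<partial>lborel))" for x
    by (simp only: fourier_def mult.left_commute)
  ultimately show ?thesis by (simp only: integral_mult_right_zero)
qed

text \<open>
  Up to the factor \<open>(2\<pi>)\<^bsup>d/2\<^esup>\<close>, the mean of \<open>h\<close> over a Gaussian centred at \<open>y\<close> with standard deviation \<open>\<epsilon>\<close>, that is,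
  the heat flow at time \<open>\<epsilon>\<^sup>2/2\<close>. The dilation is put into the argument of \<open>h\<close> so that limits \<open>\<epsilon> \<rightarrow> 0\<close> have a
  fixed dominating function.
\<close>

definition heat :: "real \<Rightarrow> (real^'d::finite \<Rightarrow> complex) \<Rightarrow> real^'d \<Rightarrow> complex" where
  "heat \<epsilon> h y = (\<integral>z. h (y + \<epsilon> *\<^sub>R z) * of_real (gauss z) \<partial>lborel)"

lemma integrable_gauss_scaled:
  assumes "\<epsilon> > 0"
  shows "integrable lborel (\<lambda>k::real^'d::finite. of_real (gauss (\<epsilon> *\<^sub>R k)) :: complex)"
  using integrable_lborel_scale[of \<epsilon> gauss 0] integrable_gauss assms by (intro integrable_of_real) simp

text \<open>
  Damping the inversion integral by a Gaussian makes it absolutely convergent for every integrable \<open>f\<close>, and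
  the multiplication formula evaluates it as a Gaussian mean of \<open>f\<close>. Inversion, the \<open>L\<^sup>2\<close> bound and injectivity
  all follow from this identity as the damping disappears.
\<close>

lemma heat_eq:
  fixes f :: "real^'d::finite \<Rightarrow> complex"
  assumes f: "integrable lborel f" and \<epsilon>: "\<epsilon> > 0"
  shows "(\<integral>k. exp (- \<i> * of_real (y \<bullet> k)) * (fourier f (- k) * of_real (gauss (\<epsilon> *\<^sub>R k))) \<partial>lborel) = heat \<epsilon> f y"
proof -
  let ?G = "\<lambda>k. exp (\<i> * of_real (y \<bullet> k)) * of_real (gauss (\<epsilon> *\<^sub>R k)) :: complex"
  have fm[measurable]: "f \<in> borel_measurable borel" using f by auto
  have em: "(\<lambda>k. exp (\<i> * of_real (a \<bullet> k))) \<in> borel_measurable (borel :: (real^'d) measure)" for a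
    by (intro borel_measurable_continuous_onI continuous_intros)
  have G: "integrable lborel ?G"
    by (rule integrable_bounded_mult[OF integrable_gauss_scaled[OF \<epsilon>], of _ 1]) (use em in auto)
  have [measurable]: "?G \<in> borel_measurable borel" using G by auto
  have [measurable]: "fourier f \<in> borel_measurable borel" by (rule fourier_measurable[OF f])
  have "(\<integral>k. exp (- \<i> * of_real (y \<bullet> k)) * (fourier f (- k) * of_real (gauss (\<epsilon> *\<^sub>R k))) \<partial>lborel)
      = (\<integral>k. fourier f k * ?G k \<partial>lborel)"
    by (subst integral_lborel_scale[of "-1" "\<lambda>k. fourier f k * ?G k" 0]) (auto simp: gauss_minus mult_ac)
  also have "\<dots> = (\<integral>x. f x * fourier ?G x \<partial>lborel)" by (rule multiplication_formula[OF f G])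
  also have "\<dots> = \<bar>\<epsilon>\<bar> ^ DIM(real^'d) *\<^sub>R (\<integral>z. f (y + \<epsilon> *\<^sub>R z) * fourier ?G (y + \<epsilon> *\<^sub>R z) \<partial>lborel)"
    using fourier_measurable[OF G] \<epsilon> by (intro integral_lborel_scale) auto
  also have "\<dots> = (\<integral>z. f (y + \<epsilon> *\<^sub>R z) * (\<bar>\<epsilon>\<bar> ^ DIM(real^'d) *\<^sub>R fourier ?G (y + \<epsilon> *\<^sub>R z)) \<partial>lborel)"
    by (simp only: integral_scaleR_right[symmetric] mult_scaleR_right)
  also have "\<dots> = heat \<epsilon> f y"
    unfolding heat_def
  proof (rule Bochner_Integration.integral_cong[OF refl])
    fix z :: "real^'d"
    let ?H = "\<lambda>k. exp (- \<i> * of_real (z \<bullet> k)) * of_real (gauss k) :: complex"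
    have [measurable]: "?H \<in> borel_measurable borel" using measurable_character[of z] by simp
    have "fourier ?G (y + \<epsilon> *\<^sub>R z) = of_real (fconst TYPE('d)) * (\<integral>k. ?H (\<epsilon> *\<^sub>R k) \<partial>lborel)"
    proof -
      have "exp (- \<i> * of_real ((y + \<epsilon> *\<^sub>R z) \<bullet> k)) * exp (\<i> * of_real (y \<bullet> k)) = exp (- \<i> * of_real (z \<bullet> (\<epsilon> *\<^sub>R k)))" for k
        unfolding mult_exp_exp by (rule arg_cong[where f=exp]) (simp add: inner_add_left distrib_left)
      then have "exp (- \<i> * of_real ((y + \<epsilon> *\<^sub>R z) \<bullet> k)) * ?G k = ?H (\<epsilon> *\<^sub>R k)" for k
        by (simp only: mult.assoc[symmetric])
      then show ?thesis unfolding fourier_def by (simp only:)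
    qed
    then have "\<bar>\<epsilon>\<bar> ^ DIM(real^'d) *\<^sub>R fourier ?G (y + \<epsilon> *\<^sub>R z) = of_real (fconst TYPE('d)) * (\<bar>\<epsilon>\<bar> ^ DIM(real^'d) *\<^sub>R (\<integral>k. ?H (0 + \<epsilon> *\<^sub>R k) \<partial>lborel))"
      by simp
    also have "\<dots> = of_real (fconst TYPE('d)) * (\<integral>k. ?H k \<partial>lborel)"
      using \<epsilon> by (subst integral_lborel_scale[of \<epsilon> ?H 0]) auto
    also have "\<dots> = fourier (\<lambda>k. of_real (gauss k)) z" by (simp add: fourier_def)
    also have "\<dots> = of_real (gauss z)" by (simp add: fourier_gauss)
    finally show "f (y + \<epsilon> *\<^sub>R z) * (\<bar>\<epsilon>\<bar> ^ DIM(real^'d) *\<^sub>R fourier ?G (y + \<epsilon> *\<^sub>R z)) = f (y + \<epsilon> *\<^sub>R z) * of_real (gauss z)" by simp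
  qed
  finally show ?thesis .
qed

lemma fourier_heat:
  assumes "integrable lborel f" "\<epsilon> > 0"
  shows "fourier (\<lambda>k. fourier f (- k) * of_real (gauss (\<epsilon> *\<^sub>R k))) (y::real^'d::finite) = of_real (fconst TYPE('d)) * heat \<epsilon> f y"
  by (simp only: fourier_def[of "\<lambda>k. fourier f (- k) * of_real (gauss (\<epsilon> *\<^sub>R k))"] heat_eq[OF assms])

lemma heat_limit:
  fixes h :: "real^'d::finite \<Rightarrow> complex"
  assumes hm[measurable]: "h \<in> borel_measurable borel" and B: "\<And>x. cmod (h x) \<le> B" and c: "isCont h y"
    and X: "X \<longlonglongrightarrow> 0"
  shows "(\<lambda>n. heat (X n) h y) \<longlonglongrightarrow> of_real ((2 * pi) powr (real CARD('d) / 2)) * h y"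
proof -
  have "(\<lambda>n. heat (X n) h y) \<longlonglongrightarrow> (\<integral>z. h y * of_real (gauss (z :: real^'d)) \<partial>lborel)"
    unfolding heat_def
  proof (rule integral_dominated_convergence)
    show "integrable lborel (\<lambda>z::real^'d. B * gauss z)" by (intro integrable_mult_right integrable_gauss)
    show "AE z in lborel. (\<lambda>n. h (y + X n *\<^sub>R z) * of_real (gauss z)) \<longlonglongrightarrow> h y * of_real (gauss z)"
    proof (intro AE_I2 tendsto_mult_right)
      fix z
      have "(\<lambda>n. y + X n *\<^sub>R z) \<longlonglongrightarrow> y + 0 *\<^sub>R z" by (intro tendsto_intros X)
      then have "(\<lambda>n. y + X n *\<^sub>R z) \<longlonglongrightarrow> y" by simp
      then show "(\<lambda>n. h (y + X n *\<^sub>R z)) \<longlonglongrightarrow> h y" by (rule isCont_tendsto_compose[OF c])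
    qed
    show "AE z in lborel. norm (h (y + X n *\<^sub>R z) * of_real (gauss z)) \<le> B * gauss z" for n
      using B by (auto simp: norm_mult gauss_nonneg intro!: mult_right_mono)
  qed auto
  then show ?thesis by (simp add: integral_gauss mult.commute)
qed

lemma norm_heat_le:
  fixes h :: "real^'d::finite \<Rightarrow> complex"
  assumes hm[measurable]: "h \<in> borel_measurable borel" and B: "\<And>x. cmod (h x) \<le> B"
  shows "cmod (heat \<epsilon> h y) \<le> B * (2 * pi) powr (real CARD('d) / 2)"
proof -
  have i: "integrable lborel (\<lambda>z. h (y + \<epsilon> *\<^sub>R z) * of_real (gauss z))"
    by (rule integrable_bounded_mult[OF integrable_of_real[OF integrable_gauss] _ B]) simp
  have "cmod (heat \<epsilon> h y) \<le> (\<integral>z. B * gauss z \<partial>(lborel :: (real^'d) measure))"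
    unfolding heat_def using i B
    by (intro Bochner_Integration.integral_norm_bound_integral integrable_mult_right integrable_gauss)
       (auto simp: norm_mult gauss_nonneg intro!: mult_right_mono)
  then show ?thesis by (simp add: integral_gauss)
qed

lemma fourier_inversion:
  fixes f :: "real^'d::finite \<Rightarrow> complex"
  assumes f: "integrable lborel f" and ff: "integrable lborel (fourier f)" and B: "\<And>x. cmod (f x) \<le> B" and c: "isCont f (- y)"
  shows "fourier (fourier f) y = f (- y)"
proof -
  define X where "X n = inverse (real (Suc n))" for n
  have X: "X \<longlonglongrightarrow> 0" unfolding X_def by (rule LIMSEQ_inverse_real_of_nat)
  have X0: "X n > 0" for n by (simp add: X_def)
  have [measurable]: "f \<in> borel_measurable borel" using f by auto
  have fm[measurable]: "fourier f \<in> borel_measurable borel" by (rule fourier_measurable[OF f])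
  let ?e = "\<lambda>k. exp (- \<i> * of_real ((- y) \<bullet> k)) :: complex"
  have ffm: "integrable lborel (\<lambda>k. fourier f (- k))"
    using integrable_lborel_scale[of "-1" "fourier f" 0] ff by simp
  have em: "?e \<in> borel_measurable borel" by (rule measurable_character)
  have "(\<lambda>n. \<integral>k. ?e k * (fourier f (- k) * of_real (gauss (X n *\<^sub>R k))) \<partial>lborel) \<longlonglongrightarrow> (\<integral>k. ?e k * (fourier f (- k) * 1) \<partial>lborel)"
  proof (rule integral_dominated_convergence)
    show "integrable lborel (\<lambda>k. cmod (fourier f (- k)))" using ffm by simp
    show "AE k in lborel. (\<lambda>n. ?e k * (fourier f (- k) * of_real (gauss (X n *\<^sub>R k)))) \<longlonglongrightarrow> ?e k * (fourier f (- k) * 1)"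
    proof (intro AE_I2 tendsto_mult_left)
      fix k :: "real^'d"
      have "(\<lambda>n. X n *\<^sub>R k) \<longlonglongrightarrow> 0 *\<^sub>R k" by (intro tendsto_intros X)
      then have "(\<lambda>n. gauss (X n *\<^sub>R k)) \<longlonglongrightarrow> gauss (0 *\<^sub>R k)" by (rule isCont_tendsto_compose[OF isCont_gauss])
      then have "(\<lambda>n. of_real (gauss (X n *\<^sub>R k)) :: complex) \<longlonglongrightarrow> of_real (gauss (0 *\<^sub>R k))" by (rule tendsto_of_real)
      then show "(\<lambda>n. of_real (gauss (X n *\<^sub>R k)) :: complex) \<longlonglongrightarrow> 1" by (simp add: gauss_def)
    qed
    show "AE k in lborel. norm (?e k * (fourier f (- k) * of_real (gauss (X n *\<^sub>R k)))) \<le> cmod (fourier f (- k))" for n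
    proof (rule AE_I2)
      fix k :: "real^'d"
      have "norm (?e k * (fourier f (- k) * of_real (gauss (X n *\<^sub>R k)))) = cmod (fourier f (- k)) * gauss (X n *\<^sub>R k)"
        by (simp add: norm_mult gauss_nonneg)
      then show "norm (?e k * (fourier f (- k) * of_real (gauss (X n *\<^sub>R k)))) \<le> cmod (fourier f (- k))"
        using gauss_le_1[of "X n *\<^sub>R k"] by (simp add: mult_left_le)
    qed
  qed (use em in auto)
  moreover have "(\<lambda>n. \<integral>k. ?e k * (fourier f (- k) * of_real (gauss (X n *\<^sub>R k))) \<partial>lborel) \<longlonglongrightarrow> of_real ((2 * pi) powr (real CARD('d) / 2)) * f (- y)"
    unfolding heat_eq[OF f X0] by (rule heat_limit[OF _ B c X]) simp
  ultimately have "(\<integral>k. ?e k * (fourier f (- k) * 1) \<partial>lborel) = of_real ((2 * pi) powr (real CARD('d) / 2)) * f (- y)"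
    by (rule LIMSEQ_unique)
  moreover have "(\<integral>k. ?e k * (fourier f (- k) * 1) \<partial>lborel) = (\<integral>k. exp (- \<i> * of_real (y \<bullet> k)) * fourier f k \<partial>lborel)"
    using measurable_character[of y]
    by (subst (2) integral_lborel_scale[of "-1" _ 0]) auto
  ultimately have "fourier (fourier f) y = of_real (fconst TYPE('d)) * (of_real ((2 * pi) powr (real CARD('d) / 2)) * f (- y))"
    by (simp only: fourier_def[of "fourier f"])
  also have "\<dots> = of_real (fconst TYPE('d) * (2 * pi) powr (real CARD('d) / 2)) * f (- y)"
    by (simp only: of_real_mult mult.assoc)
  finally show ?thesis by (simp only: fconst_mult_gauss of_real_1 mult_1_left)
qed

lemma schwartz_inversion:
  assumes "\<phi> \<in> schwartz"
  shows "fourier (fourier \<phi>) = (\<lambda>x. \<phi> (- x))"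
proof
  fix x
  obtain C where C: "\<And>x. wt x ^ 0 * cmod (\<phi> x) \<le> C" using rapidE[OF schwartz_rapid[OF assms]] by blast
  show "fourier (fourier \<phi>) x = \<phi> (- x)"
  proof (rule fourier_inversion)
    show "cmod (\<phi> x) \<le> C" for x using C[of x] by simp
    show "isCont \<phi> (- x)" using differentiable_imp_continuous_within[OF schwartz_differentiable[OF assms]] by blast
  qed (intro schwartz_integrable fourier_schwartz assms)+
qed

text \<open>
  A regularised polarised Plancherel identity.
\<close>

lemma multiplication_heat:
  fixes f h :: "real^'d::finite \<Rightarrow> complex"
  assumes f: "integrable lborel f" and h: "integrable lborel h" and \<epsilon>: "\<epsilon> > 0"
  shows "(\<integral>k. fourier f k * (fourier h (- k) * of_real (gauss (\<epsilon> *\<^sub>R k))) \<partial>lborel)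
    = of_real (fconst TYPE('d)) * (\<integral>x. f x * heat \<epsilon> h x \<partial>lborel)"
    and "integrable lborel (\<lambda>k. fourier h (- k) * of_real (gauss (\<epsilon> *\<^sub>R k)) :: complex)"
proof -
  have [measurable]: "fourier h \<in> borel_measurable borel" by (rule fourier_measurable[OF h])
  show i: "integrable lborel (\<lambda>k. fourier h (- k) * of_real (gauss (\<epsilon> *\<^sub>R k)))"
    by (rule integrable_bounded_mult[OF integrable_gauss_scaled[OF \<epsilon>]]) (use norm_fourier_le[OF h] in auto)
  show "(\<integral>k. fourier f k * (fourier h (- k) * of_real (gauss (\<epsilon> *\<^sub>R k))) \<partial>lborel)
    = of_real (fconst TYPE('d)) * (\<integral>x. f x * heat \<epsilon> h x \<partial>lborel)"
    unfolding multiplication_formula[OF f i] fourier_heat[OF h \<epsilon>]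
    by (simp only: integral_mult_right_zero[symmetric] mult.left_commute)
qed

section \<open>The \<open>L\<^sup>2\<close> bound and injectivity on integrable functions\<close>

definition L2sq :: "(real^'d::finite \<Rightarrow> complex) \<Rightarrow> ennreal" where
  "L2sq f = (\<integral>\<^sup>+x. ennreal ((cmod (f x))\<^sup>2) \<partial>lborel)"

lemma norm_integral_le_nn_integral:
  fixes f :: "'a \<Rightarrow> 'b::{banach, second_countable_topology}"
  shows "ennreal (norm (integral\<^sup>L M f)) \<le> (\<integral>\<^sup>+x. ennreal (norm (f x)) \<partial>M)"
proof (cases "integrable M f")
  case True
  then show ?thesis by (rule integral_norm_bound_ennreal)
qed (simp add: not_integrable_integral_eq)

lemma fourier_cnj: "fourier (\<lambda>x. cnj (f x)) (- k) = cnj (fourier f k)"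
proof -
  have "exp (- \<i> * of_real (- k \<bullet> x)) * cnj (f x) = cnj (exp (- \<i> * of_real (k \<bullet> x)) * f x)" for x
    by (simp add: exp_cnj)
  then have I: "(\<integral>x. exp (- \<i> * of_real (- k \<bullet> x)) * cnj (f x) \<partial>lborel) = cnj (\<integral>x. exp (- \<i> * of_real (k \<bullet> x)) * f x \<partial>lborel)"
    by (simp only: Bochner_Integration.integral_cnj)
  show ?thesis unfolding fourier_def complex_cnj_mult complex_cnj_complex_of_real I ..
qed

lemma heat_measurable:
  fixes h :: "real^'d::finite \<Rightarrow> complex"
  assumes h: "integrable lborel h" and \<epsilon>: "\<epsilon> > 0"
  shows "heat \<epsilon> h \<in> borel_measurable borel"
proof -
  define c where "c = complex_of_real (fconst TYPE('d))"
  have c: "c \<noteq> 0" using fconst_pos[where 'd='d] unfolding c_def by simp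
  have eq: "fourier (\<lambda>k. fourier h (- k) * of_real (gauss (\<epsilon> *\<^sub>R k))) = (\<lambda>y. c * heat \<epsilon> h y)"
    unfolding c_def by (rule ext, rule fourier_heat[OF h \<epsilon>])
  have "(\<lambda>y. c * heat \<epsilon> h y) \<in> borel_measurable borel"
    using fourier_measurable[OF multiplication_heat(2)[OF h h \<epsilon>]] unfolding eq .
  then have "(\<lambda>y. inverse c * (c * heat \<epsilon> h y)) \<in> borel_measurable borel"
    by (rule borel_measurable_times[OF borel_measurable_const])
  moreover have "inverse c * (c * heat \<epsilon> h y) = heat \<epsilon> h y" for y
    unfolding mult.assoc[symmetric] left_inverse[OF c] by (rule mult_1_left)
  ultimately show ?thesis by (simp only:)
qed

text \<open>
  Pointwise \<open>|f(x) f(x + \<epsilon>z)| \<le> (|f(x)|\<^sup>2 + |f(x + \<epsilon>z)|\<^sup>2)/2\<close>, and both terms have the same integral over \<open>x\<close> by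
  translation invariance.
\<close>

lemma nn_integral_gauss_correlation_le:
  fixes f :: "real^'d::finite \<Rightarrow> complex"
  assumes fm[measurable]: "f \<in> borel_measurable borel"
  shows "(\<integral>\<^sup>+x. \<integral>\<^sup>+z. ennreal (cmod (f x) * (cmod (f (x + \<epsilon> *\<^sub>R z)) * gauss z)) \<partial>lborel \<partial>lborel)
     \<le> L2sq f * ennreal ((2 * pi) powr (real CARD('d) / 2))"
proof -
  have tr: "(\<integral>\<^sup>+x. ennreal ((cmod (f (x + a)))\<^sup>2) \<partial>lborel) = L2sq f" for a
    using nn_integral_lborel_scale[of "\<lambda>x. ennreal ((cmod (f x))\<^sup>2)" 1 a] by (simp add: L2sq_def add.commute)
  have le: "ennreal (cmod (f x) * (cmod (f (x + \<epsilon> *\<^sub>R z)) * gauss z))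
     \<le> ennreal (gauss z / 2) * (ennreal ((cmod (f x))\<^sup>2) + ennreal ((cmod (f (x + \<epsilon> *\<^sub>R z)))\<^sup>2))" for x z
  proof -
    have "2 * (cmod (f x) * cmod (f (x + \<epsilon> *\<^sub>R z))) \<le> (cmod (f x))\<^sup>2 + (cmod (f (x + \<epsilon> *\<^sub>R z)))\<^sup>2"
      using sum_squares_bound[of "cmod (f x)" "cmod (f (x + \<epsilon> *\<^sub>R z))"] by (simp add: mult.assoc)
    then have "(gauss z / 2) * (2 * (cmod (f x) * cmod (f (x + \<epsilon> *\<^sub>R z)))) \<le> (gauss z / 2) * ((cmod (f x))\<^sup>2 + (cmod (f (x + \<epsilon> *\<^sub>R z)))\<^sup>2)"
      by (rule mult_left_mono) (simp add: gauss_nonneg)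
    then have "cmod (f x) * (cmod (f (x + \<epsilon> *\<^sub>R z)) * gauss z) \<le> (gauss z / 2) * ((cmod (f x))\<^sup>2 + (cmod (f (x + \<epsilon> *\<^sub>R z)))\<^sup>2)"
      by (simp add: mult_ac)
    then show ?thesis by (simp add: ennreal_mult[symmetric] gauss_nonneg ennreal_leI flip: ennreal_plus)
  qed
  have "(\<integral>\<^sup>+x. \<integral>\<^sup>+z. ennreal (cmod (f x) * (cmod (f (x + \<epsilon> *\<^sub>R z)) * gauss z)) \<partial>lborel \<partial>lborel)
     \<le> (\<integral>\<^sup>+x. \<integral>\<^sup>+z. ennreal (gauss z / 2) * (ennreal ((cmod (f x))\<^sup>2) + ennreal ((cmod (f (x + \<epsilon> *\<^sub>R z)))\<^sup>2)) \<partial>lborel \<partial>lborel)"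
    by (intro nn_integral_mono le)
  also have "\<dots> = (\<integral>\<^sup>+z. \<integral>\<^sup>+x. ennreal (gauss z / 2) * (ennreal ((cmod (f x))\<^sup>2) + ennreal ((cmod (f (x + \<epsilon> *\<^sub>R z)))\<^sup>2)) \<partial>lborel \<partial>lborel)"
    by (rule lborel_pair.Fubini'[symmetric]) measurable
  also have "\<dots> = (\<integral>\<^sup>+z. ennreal (gauss z / 2) * (L2sq f + L2sq f) \<partial>(lborel :: (real^'d) measure))"
  proof (rule nn_integral_cong)
    fix z :: "real^'d"
    show "(\<integral>\<^sup>+x. ennreal (gauss z / 2) * (ennreal ((cmod (f x))\<^sup>2) + ennreal ((cmod (f (x + \<epsilon> *\<^sub>R z)))\<^sup>2)) \<partial>lborel) = ennreal (gauss z / 2) * (L2sq f + L2sq f)"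
      by (subst nn_integral_cmult, measurable) (subst nn_integral_add, auto simp: tr L2sq_def)
  qed
  also have "\<dots> = (\<integral>\<^sup>+z. ennreal (gauss z) * L2sq f \<partial>(lborel :: (real^'d) measure))"
  proof (rule nn_integral_cong)
    fix z :: "real^'d"
    have "ennreal (gauss z / 2) * (L2sq f + L2sq f) = (ennreal (gauss z / 2) + ennreal (gauss z / 2)) * L2sq f"
      by (simp add: distrib_left distrib_right)
    also have "ennreal (gauss z / 2) + ennreal (gauss z / 2) = ennreal (gauss z)"
      using gauss_nonneg[of z] by (simp flip: ennreal_plus)
    finally show "ennreal (gauss z / 2) * (L2sq f + L2sq f) = ennreal (gauss z) * L2sq f" .
  qed
  also have "\<dots> = L2sq f * ennreal ((2 * pi) powr (real CARD('d) / 2))"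
    by (subst nn_integral_multc) (simp_all add: nn_integral_gauss mult.commute)
  finally show ?thesis .
qed

text \<open>
  Take \<open>h\<close> to be the conjugate of \<open>f\<close> in \<open>multiplication_heat\<close>: the left side is the integral of \<open>|\<F>f|\<^sup>2\<close> against
  a Gaussian that increases to 1, and the right side is at most \<open>\<parallel>f\<parallel>\<^sup>2\<close> since the Gaussian mean is an average
  of translates. Fatou's lemma removes the damping.
\<close>

lemma fourier_L2_contraction:
  fixes f :: "real^'d::finite \<Rightarrow> complex"
  assumes f: "integrable lborel f"
  shows "L2sq (fourier f) \<le> L2sq f"
proof -
  have fm[measurable]: "f \<in> borel_measurable borel" using f by auto
  have Fm[measurable]: "fourier f \<in> borel_measurable borel" by (rule fourier_measurable[OF f])
  define h where "h x = cnj (f x)" for x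
  have h: "integrable lborel h" unfolding h_def using f by simp
  then have hm[measurable]: "h \<in> borel_measurable borel" by auto
  have hk: "fourier h (- k) = cnj (fourier f k)" for k unfolding h_def by (rule fourier_cnj)
  have reg: "(\<integral>\<^sup>+k. ennreal ((cmod (fourier f k))\<^sup>2 * gauss (\<epsilon> *\<^sub>R k)) \<partial>lborel) \<le> L2sq f" if \<epsilon>: "\<epsilon> > 0" for \<epsilon>
  proof -
    let ?g = "\<lambda>k. fourier f k * (fourier h (- k) * of_real (gauss (\<epsilon> *\<^sub>R k)))"
    have g: "?g k = of_real ((cmod (fourier f k))\<^sup>2 * gauss (\<epsilon> *\<^sub>R k))" for k
      by (simp add: hk complex_norm_square mult.assoc[symmetric] del: of_real_power)
    have "integrable lborel ?g"
      by (rule integrable_fourier_mult[OF f multiplication_heat(2)[OF f h \<epsilon>]])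
    then have "integrable lborel (\<lambda>k. complex_of_real ((cmod (fourier f k))\<^sup>2 * gauss (\<epsilon> *\<^sub>R k)))" by (simp only: g)
    then have i: "integrable lborel (\<lambda>k. (cmod (fourier f k))\<^sup>2 * gauss (\<epsilon> *\<^sub>R k))"
      by (simp only: complex_of_real_integrable_eq)
    have "(\<integral>\<^sup>+k. ennreal ((cmod (fourier f k))\<^sup>2 * gauss (\<epsilon> *\<^sub>R k)) \<partial>lborel) = ennreal (\<integral>k. (cmod (fourier f k))\<^sup>2 * gauss (\<epsilon> *\<^sub>R k) \<partial>lborel)"
      by (rule nn_integral_eq_integral[OF i]) (simp add: gauss_nonneg)
    also have "(\<integral>k. (cmod (fourier f k))\<^sup>2 * gauss (\<epsilon> *\<^sub>R k) \<partial>lborel) = cmod (of_real (\<integral>k. (cmod (fourier f k))\<^sup>2 * gauss (\<epsilon> *\<^sub>R k) \<partial>lborel))"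
      by (simp add: integral_nonneg_AE gauss_nonneg)
    also have "of_real (\<integral>k. (cmod (fourier f k))\<^sup>2 * gauss (\<epsilon> *\<^sub>R k) \<partial>lborel) = (\<integral>k. ?g k \<partial>lborel)"
      by (simp only: g integral_complex_of_real)
    also have "\<dots> = of_real (fconst TYPE('d)) * (\<integral>x. f x * heat \<epsilon> h x \<partial>lborel)"
      by (rule multiplication_heat(1)[OF f h \<epsilon>])
    also have "ennreal (cmod \<dots>) = ennreal (fconst TYPE('d)) * ennreal (cmod (\<integral>x. f x * heat \<epsilon> h x \<partial>lborel))"
      by (simp add: norm_mult ennreal_mult')
    also have "\<dots> \<le> ennreal (fconst TYPE('d)) * (\<integral>\<^sup>+x. ennreal (cmod (f x * heat \<epsilon> h x)) \<partial>lborel)"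
      by (intro mult_left_mono norm_integral_le_nn_integral) simp
    also have "\<dots> \<le> ennreal (fconst TYPE('d)) * (\<integral>\<^sup>+x. \<integral>\<^sup>+z. ennreal (cmod (f x) * (cmod (f (x + \<epsilon> *\<^sub>R z)) * gauss z)) \<partial>lborel \<partial>lborel)"
    proof (intro mult_left_mono nn_integral_mono)
      fix x
      have "ennreal (cmod (heat \<epsilon> h x)) \<le> (\<integral>\<^sup>+z. ennreal (cmod (h (x + \<epsilon> *\<^sub>R z) * of_real (gauss z))) \<partial>lborel)"
        unfolding heat_def by (rule norm_integral_le_nn_integral)
      then have "ennreal (cmod (f x)) * ennreal (cmod (heat \<epsilon> h x)) \<le> ennreal (cmod (f x)) * (\<integral>\<^sup>+z. ennreal (cmod (h (x + \<epsilon> *\<^sub>R z) * of_real (gauss z))) \<partial>lborel)"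
        by (rule mult_left_mono) simp
      also have "\<dots> = (\<integral>\<^sup>+z. ennreal (cmod (f x)) * ennreal (cmod (h (x + \<epsilon> *\<^sub>R z) * of_real (gauss z))) \<partial>lborel)"
        by (rule nn_integral_cmult[symmetric]) measurable
      finally show "ennreal (cmod (f x * heat \<epsilon> h x)) \<le> (\<integral>\<^sup>+z. ennreal (cmod (f x) * (cmod (f (x + \<epsilon> *\<^sub>R z)) * gauss z)) \<partial>lborel)"
        by (simp add: norm_mult ennreal_mult h_def gauss_nonneg)
    qed simp
    also have "\<dots> \<le> ennreal (fconst TYPE('d)) * (L2sq f * ennreal ((2 * pi) powr (real CARD('d) / 2)))"
      by (intro mult_left_mono nn_integral_gauss_correlation_le fm) simp
    also have "\<dots> = L2sq f * ennreal (fconst TYPE('d) * (2 * pi) powr (real CARD('d) / 2))"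
      by (simp only: ennreal_mult[OF powr_ge_zero powr_ge_zero] mult_ac)
    also have "\<dots> = L2sq f" by (simp only: fconst_mult_gauss) simp
    finally show ?thesis .
  qed
  define X where "X n = inverse (real (Suc n))" for n
  have X: "X \<longlonglongrightarrow> 0" unfolding X_def by (rule LIMSEQ_inverse_real_of_nat)
  have X0: "X n > 0" for n by (simp add: X_def)
  have lim: "(\<lambda>n. ennreal ((cmod (fourier f k))\<^sup>2 * gauss (X n *\<^sub>R k))) \<longlonglongrightarrow> ennreal ((cmod (fourier f k))\<^sup>2)" for k
  proof (intro tendsto_ennrealI)
    have "(\<lambda>n. X n *\<^sub>R k) \<longlonglongrightarrow> 0 *\<^sub>R k" by (intro tendsto_intros X)
    then have "(\<lambda>n. gauss (X n *\<^sub>R k)) \<longlonglongrightarrow> gauss (0 *\<^sub>R k)" by (rule isCont_tendsto_compose[OF isCont_gauss])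
    then have "(\<lambda>n. (cmod (fourier f k))\<^sup>2 * gauss (X n *\<^sub>R k)) \<longlonglongrightarrow> (cmod (fourier f k))\<^sup>2 * gauss (0 *\<^sub>R k)" by (rule tendsto_mult_left)
    then show "(\<lambda>n. (cmod (fourier f k))\<^sup>2 * gauss (X n *\<^sub>R k)) \<longlonglongrightarrow> (cmod (fourier f k))\<^sup>2" by (simp add: gauss_def)
  qed
  have "L2sq (fourier f) = (\<integral>\<^sup>+k. liminf (\<lambda>n. ennreal ((cmod (fourier f k))\<^sup>2 * gauss (X n *\<^sub>R k))) \<partial>lborel)"
    unfolding L2sq_def
  proof (rule nn_integral_cong)
    fix k
    show "ennreal ((cmod (fourier f k))\<^sup>2) = liminf (\<lambda>n. ennreal ((cmod (fourier f k))\<^sup>2 * gauss (X n *\<^sub>R k)))"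
      using lim_imp_Liminf[OF _ lim[of k]] by simp
  qed
  also have "\<dots> \<le> liminf (\<lambda>n. \<integral>\<^sup>+k. ennreal ((cmod (fourier f k))\<^sup>2 * gauss (X n *\<^sub>R k)) \<partial>lborel)"
    by (intro nn_integral_liminf) simp
  also have "\<dots> \<le> L2sq f"
    using reg[OF X0] Liminf_mono[of "\<lambda>n. \<integral>\<^sup>+k. ennreal ((cmod (fourier f k))\<^sup>2 * gauss (X n *\<^sub>R k)) \<partial>lborel" "\<lambda>_. L2sq f" sequentially]
    by (simp add: Liminf_const)
  finally show ?thesis .
qed

text \<open>
  Boxes form an intersection-stable generator of the Borel sets, so vanishing of the integrals extends to
  all Borel sets. The function is signed, hence the induction over the generated sigma algebra instead of
  uniqueness of measures.
\<close>

lemma AE_zero_if_box_integrals_zero: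
  fixes f :: "'a::euclidean_space \<Rightarrow> real"
  assumes f: "integrable lborel f"
    and box: "\<And>a b. (\<integral>x. indicator (box a b) x *\<^sub>R f x \<partial>lborel) = 0"
  shows "AE x in lborel. f x = 0"
proof -
  let ?G = "range (\<lambda>(a, b). box a b) :: 'a set set"
  have fm[measurable]: "f \<in> borel_measurable borel" using f by auto
  have sets: "sets borel = sigma_sets UNIV ?G" by (simp add: borel_eq_box)
  have total: "integral\<^sup>L lborel f = 0"
  proof -
    have "(\<lambda>n. \<integral>x. indicator (box (- (real n *\<^sub>R One)) (real n *\<^sub>R One)) x *\<^sub>R f x \<partial>lborel) \<longlonglongrightarrow> (\<integral>x. f x \<partial>lborel)"
    proof (rule integral_dominated_convergence)
      show "integrable lborel (\<lambda>x. norm (f x))" using f by simp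
      show "AE x in lborel. (\<lambda>n. indicator (box (- (real n *\<^sub>R One)) (real n *\<^sub>R One)) x *\<^sub>R f x) \<longlonglongrightarrow> f x"
      proof (rule AE_I2)
        fix x :: 'a
        have "x \<in> (\<Union>n. box (- (real n *\<^sub>R One)) (real n *\<^sub>R One))" unfolding UN_box_eq_UNIV by simp
        then obtain N where N: "x \<in> box (- (real N *\<^sub>R One)) (real N *\<^sub>R One)" by blast
        have "x \<in> box (- (real n *\<^sub>R One)) (real n *\<^sub>R One)" if "n \<ge> N" for n
        proof -
          have "real N \<le> real n" using that by simp
          with N show ?thesis by (fastforce simp: box_def)
        qed
        then have "eventually (\<lambda>n. indicator (box (- (real n *\<^sub>R One)) (real n *\<^sub>R One)) x *\<^sub>R f x = f x) sequentially"
          by (auto simp: eventually_sequentially intro!: exI[of _ N])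
        then show "(\<lambda>n. indicator (box (- (real n *\<^sub>R One)) (real n *\<^sub>R One)) x *\<^sub>R f x) \<longlonglongrightarrow> f x"
          by (rule tendsto_eventually)
      qed
      show "AE x in lborel. norm (indicator (box (- (real n *\<^sub>R One)) (real n *\<^sub>R One)) x *\<^sub>R f x) \<le> norm (f x)" for n
        by (auto simp: indicator_def)
    qed auto
    then show ?thesis using box by (simp add: LIMSEQ_const_iff)
  qed
  have ind: "integrable lborel (\<lambda>x. indicator A x *\<^sub>R f x)" if "A \<in> sets borel" for A
    using integrable_mult_indicator[OF _ f, of A] that by simp
  have stable: "Int_stable ?G" by (auto simp: Int_stable_def box_Int_box)
  have subset_Pow_UNIV: "?G \<subseteq> Pow UNIV" by simp
  have zero: "(\<integral>x. indicator A x *\<^sub>R f x \<partial>lborel) = 0" if "A \<in> sigma_sets UNIV ?G" for A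
    using stable subset_Pow_UNIV that
  proof (induction rule: sigma_sets_induct_disjoint)
    case (basic A)
    then show ?case using box by auto
  next
    case empty
    show ?case by simp
  next
    case (compl A)
    then have A: "A \<in> sets borel" using sets by simp
    have "(\<integral>x. indicator (UNIV - A) x *\<^sub>R f x \<partial>lborel) = (\<integral>x. f x - indicator A x *\<^sub>R f x \<partial>lborel)"
      by (intro Bochner_Integration.integral_cong) (auto simp: indicator_def)
    also have "\<dots> = 0" using compl total ind[OF A] f by simp
    finally show ?case .
  next
    case (union A)
    then have A: "A i \<in> sets borel" for i using sets by auto
    have "(LINT x:(\<Union>i. A i)|lborel. f x) = (\<Sum>i. (LINT x:(A i)|lborel. f x))"
      using A union(1) ind[of "\<Union>i. A i"]
      by (intro lebesgue_integral_countable_add) (auto simp: disjoint_family_on_def set_integrable_def)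
    then show ?case using union by (simp add: set_lebesgue_integral_def)
  qed
  show ?thesis
  proof (rule density_unique_real[OF f])
    show "integrable lborel (\<lambda>_::'a. 0 :: real)" by simp
    fix A :: "'a set" assume "A \<in> sets lborel"
    then have "(LINT x:A|lborel. f x) = 0"
      using zero[of A] sets by (simp add: set_lebesgue_integral_def)
    then show "(LINT x:A|lborel. f x) = (LINT x:A|lborel. 0)" by (simp add: set_lebesgue_integral_def)
  qed
qed

text \<open>
  If \<open>\<F>f = 0\<close>, then \<open>f\<close> is orthogonal to all Gaussian means of indicators of boxes. These are bounded and
  converge to the indicators off the boundary, which is a null set.
\<close>

lemma fourier_injective_L1:
  fixes f :: "real^'d::finite \<Rightarrow> complex"
  assumes f: "integrable lborel f" and zero: "\<And>k. fourier f k = 0"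
  shows "AE x in lborel. f x = 0"
proof -
  have fm[measurable]: "f \<in> borel_measurable borel" using f by auto
  define X where "X n = inverse (real (Suc n))" for n
  have X: "X \<longlonglongrightarrow> 0" unfolding X_def by (rule LIMSEQ_inverse_real_of_nat)
  have X0: "X n > 0" for n by (simp add: X_def)
  have box: "(\<integral>x. f x * of_real (indicator (box a b) x) \<partial>lborel) = 0" for a b
  proof -
    define h where "h x = (of_real (indicator (box a b) x) :: complex)" for x
    have hm[measurable]: "h \<in> borel_measurable borel" unfolding h_def by simp
    have hB: "cmod (h x) \<le> 1" for x by (simp add: h_def indicator_def)
    have hi: "integrable lborel h" unfolding h_def
      by (intro integrable_of_real integrable_real_indicator emeasure_lborel_box_finite) simp
    have "fconst TYPE('d) \<noteq> 0" using fconst_pos[where 'd='d] by linarith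
    then have "(\<integral>x. f x * heat (X n) h x \<partial>lborel) = 0" for n
      using multiplication_heat(1)[OF f hi X0[of n]] by (simp add: zero)
    moreover have "(\<lambda>n. \<integral>x. f x * heat (X n) h x \<partial>lborel) \<longlonglongrightarrow> (\<integral>x. f x * (of_real ((2 * pi) powr (real CARD('d) / 2)) * h x) \<partial>lborel)"
    proof (rule integral_dominated_convergence)
      show "integrable lborel (\<lambda>x. cmod (f x) * (1 * (2 * pi) powr (real CARD('d) / 2)))" using f by simp
      show "(\<lambda>x. f x * heat (X n) h x) \<in> borel_measurable lborel" for n
        using heat_measurable[OF hi X0] by simp
      show "AE x in lborel. (\<lambda>n. f x * heat (X n) h x) \<longlonglongrightarrow> f x * (of_real ((2 * pi) powr (real CARD('d) / 2)) * h x)"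
      proof -
        have "AE x in lborel. x \<notin> cbox a b - box a b"
          by (rule AE_not_in[OF null_sets_cbox_Diff_box])
        then show ?thesis
        proof eventually_elim
          case (elim x)
          then have "x \<notin> frontier (box a b)" by (simp add: frontier_box split: if_splits)
          then have "isCont (indicator (box a b) :: _ \<Rightarrow> real) x" by (simp add: isCont_indicator)
          then have "isCont h x" unfolding h_def by (intro continuous_intros)
          then show ?case by (intro tendsto_mult_left heat_limit[OF hm hB _ X])
        qed
      qed
      show "AE x in lborel. norm (f x * heat (X n) h x) \<le> cmod (f x) * (1 * (2 * pi) powr (real CARD('d) / 2))" for n
        unfolding norm_mult by (intro AE_I2 mult_left_mono norm_heat_le hm hB) auto
    qed simp
    ultimately have "(\<integral>x. f x * (of_real ((2 * pi) powr (real CARD('d) / 2)) * h x) \<partial>lborel) = 0"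
      by (simp add: LIMSEQ_const_iff)
    moreover have "f x * (of_real ((2 * pi) powr (real CARD('d) / 2)) * h x) = of_real ((2 * pi) powr (real CARD('d) / 2)) * (f x * h x)" for x
      by (simp only: mult.left_commute)
    ultimately have "of_real ((2 * pi) powr (real CARD('d) / 2)) * (\<integral>x. f x * h x \<partial>lborel) = 0"
      by (simp only: integral_mult_right_zero)
    then show ?thesis by (simp add: h_def)
  qed
  have int: "integrable lborel (\<lambda>x. f x * of_real (indicator (box a b) x))" for a b
    using integrable_bounded_mult[OF f, of "\<lambda>x. of_real (indicator (box a b) x)" 1] by (simp add: mult.commute indicator_def)
  have "AE x in lborel. Re (f x) = 0"
  proof (rule AE_zero_if_box_integrals_zero)
    show "integrable lborel (\<lambda>x. Re (f x))" using f by simp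
    show "(\<integral>x. indicator (box a b) x *\<^sub>R Re (f x) \<partial>lborel) = 0" for a b
      using integral_Re[OF int[of a b]] box[of a b] by (simp add: mult.commute)
  qed
  moreover have "AE x in lborel. Im (f x) = 0"
  proof (rule AE_zero_if_box_integrals_zero)
    show "integrable lborel (\<lambda>x. Im (f x))" using f by simp
    show "(\<integral>x. indicator (box a b) x *\<^sub>R Im (f x) \<partial>lborel) = 0" for a b
      using integral_Im[OF int[of a b]] box[of a b] by (simp add: mult.commute)
  qed
  ultimately show ?thesis by eventually_elim (simp add: complex_eq_iff)
qed

section \<open>Functions vanishing to infinite order at the origin\<close>

text \<open>
  Induction on the order: each partial derivative of \<open>\<psi>\<close> is again in \<open>\<Psi>\<close>, hence \<open>O(|k|\<^sup>N)\<close>, and the mean value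
  theorem on the segment from the origin, where \<open>\<psi>\<close> vanishes, gains one power.
\<close>

lemma Psi_flat:
  assumes "\<psi> \<in> Psi"
  shows "\<exists>C\<ge>0. \<forall>k. cmod (\<psi> k) \<le> C * norm k ^ N"
  using assms
proof (induction N arbitrary: \<psi>)
  case 0
  obtain C where "C \<ge> 0" "\<And>x. wt x ^ 0 * cmod (\<psi> x) \<le> C" using rapidE[OF schwartz_rapid[OF Psi_schwartz[OF 0]]] by blast
  then show ?case by auto
next
  case (Suc N)
  have "\<forall>i. \<exists>C. 0 \<le> C \<and> (\<forall>k. cmod (partial i \<psi> k) \<le> C * norm k ^ N)"
  proof
    fix i
    show "\<exists>C. 0 \<le> C \<and> (\<forall>k. cmod (partial i \<psi> k) \<le> C * norm k ^ N)"
      using Suc.IH[OF Psi_partial[OF Suc.prems, of i]] .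
  qed
  from choice[OF this] obtain C where "\<forall>i. 0 \<le> C i \<and> (\<forall>k. cmod (partial i \<psi> k) \<le> C i * norm k ^ N)" ..
  then have C: "\<And>i. 0 \<le> C i" "\<And>i k. cmod (partial i \<psi> k) \<le> C i * norm k ^ N" by simp_all
  have "cmod (\<psi> k) \<le> (\<Sum>i\<in>UNIV. C i) * norm k ^ Suc N" for k
  proof -
    let ?f' = "\<lambda>t s. \<Sum>i\<in>UNIV. of_real ((s *\<^sub>R k) $ i) * partial i \<psi> (t *\<^sub>R k)"
    have line: "((\<lambda>t. \<psi> (t *\<^sub>R k)) has_derivative ?f' t) (at t)" for t
      by (rule has_derivative_compose[of "\<lambda>t. t *\<^sub>R k" "\<lambda>s. s *\<^sub>R k" t UNIV \<psi>, OF _ schwartz_has_derivative[OF Psi_schwartz[OF Suc.prems]]])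
         (auto intro!: derivative_eq_intros)
    have "\<exists>t\<in>{0<..<1}. norm (\<psi> (1 *\<^sub>R k) - \<psi> (0 *\<^sub>R k)) \<le> norm (?f' t (1 - 0))"
    proof (rule mvt_general)
      show "continuous_on {0..1} (\<lambda>t. \<psi> (t *\<^sub>R k))"
        by (rule has_derivative_continuous_on[OF has_derivative_at_withinI[OF line]])
    qed (use line in auto)
    then obtain t where t: "t \<in> {0<..<1}" and le: "norm (\<psi> (1 *\<^sub>R k) - \<psi> (0 *\<^sub>R k)) \<le> norm (?f' t (1 - 0))"
      by (rule bexE)
    have "cmod (\<psi> k) \<le> norm (\<Sum>i\<in>UNIV. of_real (k $ i) * partial i \<psi> (t *\<^sub>R k))"
      using le Psi_zero[OF Suc.prems] by simp
    also have "\<dots> \<le> (\<Sum>i\<in>UNIV. norm k * (C i * norm k ^ N))"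
    proof (intro sum_norm_le)
      fix i
      have "norm (t *\<^sub>R k) \<le> norm k" using t by (simp add: mult_left_le_one_le)
      then have "cmod (partial i \<psi> (t *\<^sub>R k)) \<le> C i * norm k ^ N"
        using order_trans[OF C(2) mult_left_mono[OF power_mono C(1)]] by simp
      then show "norm (of_real (k $ i) * partial i \<psi> (t *\<^sub>R k)) \<le> norm k * (C i * norm k ^ N)"
        unfolding norm_mult using component_le_norm_cart[of k i] by (intro mult_mono) auto
    qed
    also have "\<dots> = (\<Sum>i\<in>UNIV. C i) * norm k ^ Suc N"
      unfolding sum_distrib_right by (intro sum.cong) (auto simp: mult_ac)
    finally show ?thesis .
  qed
  moreover have "0 \<le> (\<Sum>i\<in>UNIV. C i)" using C(1) by (simp add: sum_nonneg)
  ultimately show ?case by blast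
qed

lemma Psi_powr_bound:
  assumes \<psi>: "\<psi> \<in> Psi"
  shows "\<exists>C\<ge>0. \<forall>k. norm k powr s * cmod (\<psi> k) \<le> C"
proof (cases "s \<ge> 0")
  case True
  define N where "N = nat \<lceil>s\<rceil>"
  obtain C where C: "C \<ge> 0" "\<And>x. wt x ^ N * cmod (\<psi> x) \<le> C" using rapidE[OF schwartz_rapid[OF Psi_schwartz[OF \<psi>]]] by blast
  have "norm k powr s * cmod (\<psi> k) \<le> C" for k
  proof -
    have "norm k powr s \<le> wt k powr s" using norm_le_wt[of k] True by (intro powr_mono2) auto
    also have "\<dots> \<le> wt k powr real N" using wt_ge1[of k] unfolding N_def by (intro powr_mono of_nat_ceiling)
    also have "\<dots> = wt k ^ N" using wt_pos[of k] by (rule powr_realpow)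
    finally show ?thesis using C(2)[of k] by (meson order_trans mult_right_mono norm_ge_zero)
  qed
  then show ?thesis using C(1) by blast
next
  case False
  define N where "N = nat \<lceil>- s\<rceil>"
  have N: "0 \<le> s + real N" unfolding N_def by linarith
  obtain C where C: "C \<ge> 0" "\<And>k. cmod (\<psi> k) \<le> C * norm k ^ N" using Psi_flat[OF \<psi>] by blast
  obtain D where D: "D \<ge> 0" "\<And>k. cmod (\<psi> k) \<le> D * norm k ^ 0" using Psi_flat[OF \<psi>] by blast
  have "norm k powr s * cmod (\<psi> k) \<le> C + D" for k
  proof (cases "norm k \<le> 1")
    case True
    show ?thesis
    proof (cases "k = 0")
      case False
      have "norm k powr s * cmod (\<psi> k) \<le> norm k powr s * (C * norm k ^ N)"
        by (intro mult_left_mono C) auto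
      also have "\<dots> = C * norm k powr (s + real N)"
        using False by (simp add: powr_add powr_realpow)
      also have "\<dots> \<le> C * 1"
        using N True C(1) powr_mono2[of "s + real N" "norm k" 1] by (intro mult_left_mono) auto
      finally show ?thesis using D by simp
    qed (use C D in simp)
  next
    case k: False
    then have "norm k powr s \<le> 1" using False powr_mono[of s 0 "norm k"] by (cases "k = 0") auto
    then have "norm k powr s * cmod (\<psi> k) \<le> 1 * cmod (\<psi> k)" by (intro mult_right_mono) auto
    then show ?thesis using D(2)[of k] C(1) by simp
  qed
  then show ?thesis using C(1) D(1) by (intro exI[of _ "C + D"]) simp
qed

lemma wt_power_le: "wt k ^ N \<le> 2 ^ N * (1 + norm k ^ (2 * N))"
proof (cases "norm k \<le> 1")
  case True
  then have "wt k \<le> 2" by (simp add: power_le_one)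
  then have "wt k ^ N \<le> 2 ^ N" using wt_pos[of k] by (intro power_mono) auto
  also have "\<dots> \<le> 2 ^ N * (1 + norm k ^ (2 * N))" by (simp add: mult_le_cancel_left1)
  finally show ?thesis .
next
  case False
  then have "wt k \<le> 2 * (norm k)\<^sup>2" by (simp add: one_le_power)
  then have "wt k ^ N \<le> (2 * (norm k)\<^sup>2) ^ N" using wt_pos[of k] by (intro power_mono) auto
  also have "\<dots> = 2 ^ N * norm k ^ (2 * N)" by (simp add: power_mult_distrib power_mult)
  also have "\<dots> \<le> 2 ^ N * (1 + norm k ^ (2 * N))" by (intro mult_left_mono) auto
  finally show ?thesis .
qed

lemma has_derivative_of_real_derivative:
  "(f has_real_derivative c) (at x) \<Longrightarrow> (f has_derivative (\<lambda>r. r * c)) (at x)"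
  by (simp add: has_field_derivative_def mult_commute_abs)

lemma has_derivative_norm_powr:
  fixes k :: "real^'d::finite"
  assumes "k \<noteq> 0"
  shows "((\<lambda>k. norm k powr s) has_derivative (\<lambda>h. s * norm k powr (s - 2) * (k \<bullet> h))) (at k)"
proof -
  have k: "k \<bullet> k > 0" using assms by simp
  have d: "((\<lambda>k. (k \<bullet> k) powr (s / 2)) has_derivative (\<lambda>h. s * norm k powr (s - 2) * (k \<bullet> h))) (at k)"
  proof -
    have "((\<lambda>k. k \<bullet> k) has_derivative (\<lambda>h. 2 * (k \<bullet> h))) (at k)"
      by (auto intro!: derivative_eq_intros simp: inner_commute)
    moreover have "((\<lambda>t. t powr (s / 2)) has_derivative (\<lambda>r. r * (s / 2 * (k \<bullet> k) powr (s / 2 - 1)))) (at (k \<bullet> k))"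
      by (rule has_derivative_of_real_derivative[OF has_real_derivative_powr[OF k]])
    ultimately have "((\<lambda>k. (k \<bullet> k) powr (s / 2)) has_derivative (\<lambda>h. 2 * (k \<bullet> h) * (s / 2 * (k \<bullet> k) powr (s / 2 - 1)))) (at k)"
      by (rule has_derivative_compose)
    moreover have "(k \<bullet> k) powr (s / 2 - 1) = norm k powr (s - 2)"
    proof -
      have "(k \<bullet> k) powr (s / 2 - 1) = (norm k powr 2) powr (s / 2 - 1)"
        using assms by (simp add: power2_norm_eq_inner)
      also have "\<dots> = norm k powr (s - 2)" unfolding powr_powr by (simp add: right_diff_distrib)
      finally show ?thesis .
    qed
    ultimately show ?thesis by (simp add: mult_ac)
  qed
  have "(k' \<bullet> k') powr (s / 2) = norm k' powr s" for k' :: "real^'d"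
  proof (cases "k' = 0")
    case False
    then have "(k' \<bullet> k') powr (s / 2) = (norm k' powr 2) powr (s / 2)" by (simp add: power2_norm_eq_inner)
    also have "\<dots> = norm k' powr s" unfolding powr_powr by simp
    finally show ?thesis .
  qed simp
  with d show ?thesis by simp
qed

lemma has_derivative_zero_of_quadratic:
  fixes f :: "'a::real_normed_vector \<Rightarrow> 'b::real_normed_vector"
  assumes "\<And>k. norm (f k) \<le> C * (norm k)\<^sup>2"
  shows "(f has_derivative (\<lambda>h. 0)) (at 0)"
proof (rule has_derivative_quadratic)
  have "f 0 = 0" using assms[of 0] by simp
  then show "norm (f (0 + h) - f 0 - 0) \<le> C * (norm h)\<^sup>2" for h using assms[of h] by simp
qed simp

text \<open>
  The functions \<open>|k|\<^sup>s \<psi>\<close> with \<open>\<psi> \<in> \<Psi>\<close> and \<open>s\<close> an arbitrary real number are generators: the derivative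
  \<open>|k|\<^bsup>s-2\<^esup> (s k\<^sub>i \<psi>) + |k|\<^sup>s \<partial>\<^sub>i \<psi>\<close> lowers the exponent, which is harmless since the flatness of \<open>\<psi>\<close> absorbs
  any negative power. At the origin every such function is \<open>O(|k|\<^sup>2)\<close>, so its derivative there is zero.
\<close>

lemma abs_powr_Psi:
  fixes \<psi> :: "'d::finite fn"
  assumes "\<psi> \<in> Psi"
  shows "(\<lambda>k. of_real (norm k powr s) * \<psi> k) \<in> Psi"
proof -
  define M :: "real \<Rightarrow> 'd fn \<Rightarrow> 'd fn" where "M s \<psi> = (\<lambda>k. of_real (norm k powr s) * \<psi> k)" for s \<psi>
  have bound: "\<exists>C\<ge>0. \<forall>k. cmod (M s \<psi> k) \<le> C" if "\<psi> \<in> Psi" for s \<psi>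
    using Psi_powr_bound[OF that, of s] by (simp add: M_def norm_mult)
  have der0: "(M s \<psi> has_derivative (\<lambda>h. 0)) (at 0)" if \<psi>: "\<psi> \<in> Psi" for s \<psi>
  proof -
    obtain C where C: "\<And>k. cmod (M (s - 2) \<psi> k) \<le> C" using bound[OF \<psi>] by blast
    have "norm (M s \<psi> k) \<le> C * (norm k)\<^sup>2" for k
    proof (cases "k = 0")
      case False
      then have "norm k powr s = norm k powr (s - 2) * (norm k)\<^sup>2"
        using powr_add[of "norm k" "s - 2" 2] by (simp add: powr_numeral)
      then have "norm (M s \<psi> k) = norm (M (s - 2) \<psi> k) * (norm k)\<^sup>2"
        by (simp add: M_def norm_mult norm_power)
      also have "\<dots> \<le> C * (norm k)\<^sup>2" by (intro mult_right_mono C) auto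
      finally show ?thesis .
    qed (simp add: M_def)
    then show ?thesis by (rule has_derivative_zero_of_quadratic)
  qed
  have der: "(M s \<psi> has_derivative (\<lambda>h. of_real (norm k powr s) * frechet_derivative \<psi> (at k) h
       + of_real (s * norm k powr (s - 2) * (k \<bullet> h)) * \<psi> k)) (at k)" if \<psi>: "\<psi> \<in> Psi" and k: "k \<noteq> 0" for s \<psi> k
    unfolding M_def
    using schwartz_differentiable[OF Psi_schwartz[OF \<psi>]] frechet_derivative_works
    by (intro has_derivative_mult has_derivative_of_real has_derivative_norm_powr k) blast
  let ?A = "{M s \<psi> |s \<psi>. \<psi> \<in> Psi}"
  have "?A \<subseteq> Psi"
  proof (rule Psi_generators)
    fix a x assume "a \<in> ?A"
    then obtain s \<psi> where a: "a = M s \<psi>" "\<psi> \<in> Psi" by blast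
    show "a differentiable (at x)"
      unfolding a(1) using der0[OF a(2)] der[OF a(2)] differentiableI by (cases "x = 0") blast+
    show "a 0 = 0" by (simp add: a(1) M_def)
  next
    fix a assume "a \<in> ?A"
    then obtain s \<psi> where a: "a = M s \<psi>" "\<psi> \<in> Psi" by blast
    show "rapid a"
    proof (rule rapidI)
      fix N
      obtain C where C: "\<And>k. cmod (M s \<psi> k) \<le> C" using bound[OF a(2)] by blast
      obtain D where D: "\<And>k. cmod (M (s + 2 * real N) \<psi> k) \<le> D" using bound[OF a(2)] by blast
      have "wt k ^ N * cmod (a k) \<le> 2 ^ N * (C + D)" for k
      proof -
        have eq: "norm k ^ (2 * N) * cmod (M s \<psi> k) = cmod (M (s + 2 * real N) \<psi> k)"
        proof (cases "k = 0")
          case False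
          then have "norm k powr (s + 2 * real N) = norm k powr s * norm k ^ (2 * N)"
            using powr_realpow[of "norm k" "2 * N"] by (simp add: powr_add)
          then show ?thesis by (simp add: M_def norm_mult norm_power)
        qed (simp add: M_def)
        have "wt k ^ N * cmod (a k) \<le> (2 ^ N * (1 + norm k ^ (2 * N))) * cmod (M s \<psi> k)"
          unfolding a(1) by (intro mult_right_mono wt_power_le) auto
        also have "\<dots> = 2 ^ N * (cmod (M s \<psi> k) + cmod (M (s + 2 * real N) \<psi> k))"
          unfolding eq[symmetric] by (simp add: algebra_simps)
        also have "\<dots> \<le> 2 ^ N * (C + D)" by (intro mult_left_mono add_mono C D) auto
        finally show ?thesis .
      qed
      then show "\<exists>C. \<forall>x. wt x ^ N * cmod (a x) \<le> C" by blast
    qed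
  next
    fix a i assume "a \<in> ?A"
    then obtain s \<psi> where a: "a = M s \<psi>" "\<psi> \<in> Psi" by blast
    let ?b = "M (s - 2) (\<lambda>k. of_real s * (of_real (k $ i) * \<psi> k))" and ?c = "M s (partial i \<psi>)"
    have b: "(\<lambda>k. of_real s * (of_real (k $ i) * \<psi> k)) \<in> Psi" by (intro Psi_cmult Psi_coord a(2))
    have c: "partial i \<psi> \<in> Psi" by (rule Psi_partial[OF a(2)])
    have "partial i a k = ?b k + ?c k" for k
    proof (cases "k = 0")
      case True
      then show ?thesis using partialI[OF der0[OF a(2), of s], of i] a(1) by (simp add: M_def)
    next
      case False
      show ?thesis using partialI[OF der[OF a(2) False, of s], of i] unfolding a(1)
        by (simp add: M_def inner_axis partial_def)
    qed
    then have "partial i a = (\<lambda>x. \<Sum>g\<leftarrow>[?b, ?c]. g x)" by auto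
    moreover have "set [?b, ?c] \<subseteq> ?A" using b c by auto
    ultimately show "\<exists>gs. set gs \<subseteq> ?A \<and> partial i a = (\<lambda>x. \<Sum>g\<leftarrow>gs. g x)" by blast
  qed
  moreover have "M s \<psi> \<in> ?A" using assms by blast
  ultimately have "M s \<psi> \<in> Psi" by (rule subsetD)
  then show ?thesis by (simp only: M_def)
qed

text \<open>
  A cutoff that removes the origin: it is positive off the origin, vanishes to infinite order at it, and
  tends to 1 at infinity. Among such functions this one has three convenient features. With \<open>t = |k|\<^sup>2\<close>, the
  derivative of \<open>-e\<^bsup>-bt\<^esup>/(bt)\<close> involves only \<open>e\<^bsup>-bt\<^esup>\<close> and powers of \<open>1/t\<close>, so that derivatives stay in a simple
  family; \<open>1 - flat b\<close> decays like a Gaussian and is thus Schwartz; and changing \<open>b\<close> amounts to a dilation.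
\<close>

definition flat :: "real \<Rightarrow> real^'d::finite \<Rightarrow> real" where
  "flat b k = (if k = 0 then 0 else exp (- (exp (- b * (k \<bullet> k)) / (b * (k \<bullet> k)))))"

lemma flat_bounds: "b > 0 \<Longrightarrow> 0 \<le> flat b k" "b > 0 \<Longrightarrow> flat b k \<le> 1" "b > 0 \<Longrightarrow> k \<noteq> 0 \<Longrightarrow> 0 < flat b k"
  by (auto simp: flat_def)

text \<open>
  For \<open>t = |k|\<^sup>2 < 1\<close> the cutoff is at most \<open>e\<^bsup>-c/t\<^esup>\<close> with \<open>c = e\<^bsup>-b\<^esup>/b\<close>, and \<open>(c/t)\<^sup>m/m! \<le> e\<^bsup>c/t\<^esup>\<close>.
\<close>

lemma flat_le_power:
  assumes b: "b > 0"
  shows "\<exists>C\<ge>0. \<forall>k::real^'d::finite. flat b k \<le> C * (k \<bullet> k) ^ m"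
proof -
  define c where "c = exp (- b) / b"
  have c: "c > 0" using b by (simp add: c_def)
  have "flat b k \<le> (1 + fact m / c ^ m) * (k \<bullet> k) ^ m" for k :: "real^'d"
  proof (cases "k = 0")
    case True
    then show ?thesis using c by (simp add: flat_def)
  next
    case False
    define t where "t = k \<bullet> k"
    have t: "t > 0" using False by (simp add: t_def)
    show ?thesis
    proof (cases "t \<ge> 1")
      case True
      have "flat b k \<le> 1" by (rule flat_bounds(2)[OF b])
      also have "\<dots> \<le> (1 + fact m / c ^ m) * 1" using c by simp
      also have "\<dots> \<le> (1 + fact m / c ^ m) * t ^ m" using True c by (intro mult_left_mono one_le_power) auto
      finally show ?thesis by (simp add: t_def)
    next
      case small: False
      have "exp (- b) \<le> exp (- b * t)" using small b by (simp add: mult_left_le)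
      then have "c / t \<le> exp (- b * t) / (b * t)" using t b by (simp add: c_def divide_right_mono)
      then have "flat b k \<le> exp (- (c / t))" using False by (simp add: flat_def t_def[symmetric])
      also have "\<dots> \<le> fact m / c ^ m * t ^ m"
      proof -
        have "(c / t) ^ m / fact m \<le> exp (c / t)"
        proof -
          have "(c / t) ^ m / fact m = (\<Sum>n\<in>{m}. (c / t) ^ n /\<^sub>R fact n)" by (simp add: divide_inverse mult.commute)
          also have "\<dots> \<le> (\<Sum>n. (c / t) ^ n /\<^sub>R fact n)"
            using c t by (intro sum_le_suminf summable_exp_generic) auto
          finally show ?thesis by (simp add: exp_def)
        qed
        then have "exp (- (c / t)) \<le> inverse ((c / t) ^ m / fact m)"
          using c t unfolding exp_minus by (intro le_imp_inverse_le) auto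
        also have "\<dots> = fact m / c ^ m * t ^ m" using c t by (simp add: power_divide field_simps)
        finally show ?thesis .
      qed
      also have "\<dots> \<le> (1 + fact m / c ^ m) * t ^ m" using t by (intro mult_right_mono) auto
      finally show ?thesis by (simp add: t_def)
    qed
  qed
  moreover have "0 \<le> 1 + fact m / c ^ m" using c by simp
  ultimately show ?thesis by blast
qed

lemma flat_inverse_power_bound:
  assumes b: "b > 0"
  shows "\<exists>C\<ge>0. \<forall>k::real^'d::finite. inverse (k \<bullet> k) ^ m * flat b k \<le> C * (k \<bullet> k) ^ j"
proof -
  obtain C where C: "C \<ge> 0" "\<And>k::real^'d. flat b k \<le> C * (k \<bullet> k) ^ (m + j)" using flat_le_power[OF b] by blast
  have "inverse (k \<bullet> k) ^ m * flat b k \<le> C * (k \<bullet> k) ^ j" for k :: "real^'d"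
  proof (cases "k = 0")
    case True
    then show ?thesis using C(1) by (simp add: flat_def)
  next
    case False
    have "inverse (k \<bullet> k) ^ m * flat b k \<le> inverse (k \<bullet> k) ^ m * (C * (k \<bullet> k) ^ (m + j))"
      by (intro mult_left_mono C) auto
    also have "\<dots> = C * (k \<bullet> k) ^ j * (inverse (k \<bullet> k) * (k \<bullet> k)) ^ m" by (simp only: power_add power_mult_distrib mult_ac)
    also have "\<dots> = C * (k \<bullet> k) ^ j" using False by simp
    finally show ?thesis .
  qed
  then show ?thesis using C(1) by blast
qed

lemma flat_derivative:
  fixes k :: "real^'d::finite"
  assumes b: "b > 0"
  shows "((\<lambda>k. inverse (k \<bullet> k) ^ m * flat b k) has_derivative
    (\<lambda>h. 2 * (k \<bullet> h) * ((- real m * inverse (k \<bullet> k) ^ Suc m + exp (- b * (k \<bullet> k)) * inverse (k \<bullet> k) ^ Suc m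
       + exp (- b * (k \<bullet> k)) / b * inverse (k \<bullet> k) ^ Suc (Suc m)) * flat b k))) (at k)"
proof (cases "k = 0")
  case True
  obtain C where C: "\<And>k::real^'d. inverse (k \<bullet> k) ^ m * flat b k \<le> C * (k \<bullet> k) ^ 1"
    using flat_inverse_power_bound[OF b] by blast
  have "((\<lambda>k::real^'d. inverse (k \<bullet> k) ^ m * flat b k) has_derivative (\<lambda>h. 0)) (at 0)"
  proof (rule has_derivative_zero_of_quadratic)
    show "norm (inverse (k \<bullet> k) ^ m * flat b k) \<le> C * (norm k)\<^sup>2" for k :: "real^'d"
      using C[of k] flat_bounds(1)[OF b, of k] by (simp add: power2_norm_eq_inner)
  qed
  then show ?thesis using True by simp
next
  case False
  define e where "e t = inverse t ^ m * exp (- (exp (- b * t) / (b * t)))" for t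
  have t: "k \<bullet> k > 0" using False by simp
  have De: "(e has_real_derivative (- real m * inverse t ^ Suc m + exp (- b * t) * inverse t ^ Suc m
       + exp (- b * t) / b * inverse t ^ Suc (Suc m)) * exp (- (exp (- b * t) / (b * t)))) (at t)" if t: "t > 0" for t
  proof -
    have 1: "((\<lambda>t. exp (- (exp (- b * t) / (b * t)))) has_real_derivative
      exp (- (exp (- b * t) / (b * t))) * (exp (- b * t) * inverse t + exp (- b * t) / b * inverse t ^ 2)) (at t)"
      using t b by (auto intro!: derivative_eq_intros simp: field_simps power2_eq_square)
    have 2: "((\<lambda>t. inverse t ^ m) has_real_derivative - real m * inverse t ^ Suc m) (at t)"
    proof (cases m)
      case (Suc n)
      have "((\<lambda>t. inverse t ^ m) has_real_derivative real m * (- (inverse t ^ Suc (Suc 0)) * inverse t ^ (m - Suc 0))) (at t)"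
        using t by (intro DERIV_power DERIV_inverse) simp
      then show ?thesis by (rule DERIV_cong) (simp add: Suc algebra_simps)
    qed simp
    have "(e has_real_derivative inverse t ^ m * (exp (- (exp (- b * t) / (b * t))) * (exp (- b * t) * inverse t + exp (- b * t) / b * inverse t ^ 2))
       + (- real m * inverse t ^ Suc m) * exp (- (exp (- b * t) / (b * t)))) (at t)"
      unfolding e_def using DERIV_mult'[OF 2 1] by simp
    then show ?thesis by (rule DERIV_cong) (simp add: algebra_simps power2_eq_square)
  qed
  have e: "(e has_derivative (\<lambda>r. r * ((- real m * inverse (k \<bullet> k) ^ Suc m + exp (- b * (k \<bullet> k)) * inverse (k \<bullet> k) ^ Suc m
       + exp (- b * (k \<bullet> k)) / b * inverse (k \<bullet> k) ^ Suc (Suc m)) * flat b k))) (at (k \<bullet> k))"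
    using has_derivative_of_real_derivative[OF De[OF t]] False by (simp only: flat_def if_False)
  have i: "((\<lambda>k. k \<bullet> k) has_derivative (\<lambda>h. 2 * (k \<bullet> h))) (at k)"
    by (auto intro!: derivative_eq_intros simp: inner_commute)
  show ?thesis
  proof (rule has_derivative_transform_within_open[OF has_derivative_compose[OF i e]])
    show "open (- {0 :: real^'d})" "k \<in> - {0}" using False by auto
    show "e (x \<bullet> x) = inverse (x \<bullet> x) ^ m * flat b x" if "x \<in> - {0}" for x :: "real^'d"
      using that by (simp add: e_def flat_def)
  qed
qed

text \<open>
  The negative powers of \<open>|k|\<^sup>2\<close> are included because they appear on differentiating the cutoff; only with
  them do the functions \<open>q |k|\<^bsup>-2m\<^esup> flat\<close>, with \<open>q\<close> Schwartz, form a set of generators for \<open>\<Psi>\<close>.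
\<close>

lemma schwartz_mult_flat:
  fixes q :: "'d::finite fn"
  assumes b: "b > 0" and q: "q \<in> schwartz"
  shows "(\<lambda>k. q k * of_real (inverse (k \<bullet> k) ^ m * flat b k)) \<in> Psi"
proof -
  define P :: "'d fn \<Rightarrow> nat \<Rightarrow> 'd fn" where "P q m = (\<lambda>k. q k * of_real (inverse (k \<bullet> k) ^ m * flat b k))" for q m
  let ?A = "{P q m |q m. q \<in> schwartz}"
  have E: "(\<lambda>k::real^'d. of_real (exp (- b * (norm k)\<^sup>2))) \<in> schwartz" by (rule schwartz_gaussian[OF b])
  have dR: "((\<lambda>k::real^'d. of_real (inverse (k \<bullet> k) ^ m * flat b k) :: complex) has_derivative
    (\<lambda>h. of_real (2 * (k \<bullet> h) * ((- real m * inverse (k \<bullet> k) ^ Suc m + exp (- b * (k \<bullet> k)) * inverse (k \<bullet> k) ^ Suc m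
       + exp (- b * (k \<bullet> k)) / b * inverse (k \<bullet> k) ^ Suc (Suc m)) * flat b k)))) (at k)" for k m
    by (rule has_derivative_of_real[OF flat_derivative[OF b]])
  have "?A \<subseteq> Psi"
  proof (rule Psi_generators)
    fix a x assume "a \<in> ?A"
    then obtain q m where a: "a = P q m" "q \<in> schwartz" by blast
    show "a differentiable (at x)" unfolding a(1) P_def
      by (rule differentiable_mult[OF schwartz_differentiable[OF a(2)] differentiableI[OF dR]])
    show "a 0 = 0" by (simp add: a(1) P_def flat_def)
  next
    fix a assume "a \<in> ?A"
    then obtain q m where a: "a = P q m" "q \<in> schwartz" by blast
    obtain C where C: "\<And>k::real^'d. inverse (k \<bullet> k) ^ m * flat b k \<le> C * (k \<bullet> k) ^ 0"
      using flat_inverse_power_bound[OF b] by blast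
    show "rapid a"
    proof (rule rapid_bound[OF schwartz_rapid[OF a(2)]])
      fix k :: "real^'d"
      have "\<bar>inverse (k \<bullet> k) ^ m * flat b k\<bar> \<le> C" using C[of k] flat_bounds(1)[OF b, of k] by simp
      then have "cmod (q k) * \<bar>inverse (k \<bullet> k) ^ m * flat b k\<bar> \<le> cmod (q k) * C" by (rule mult_left_mono) simp
      then show "cmod (a k) \<le> C * cmod (q k)" unfolding a(1) P_def norm_mult norm_of_real by (simp add: mult.commute)
    qed
  next
    fix a i assume "a \<in> ?A"
    then obtain q m where a: "a = P q m" "q \<in> schwartz" by blast
    let ?E = "\<lambda>k::real^'d. of_real (exp (- b * (norm k)\<^sup>2)) :: complex"
    let ?q1 = "\<lambda>k. of_real (- 2 * real m) * (of_real (k $ i) * q k)"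
      and ?q2 = "\<lambda>k. 2 * (of_real (k $ i) * (?E k * q k))" and ?q3 = "\<lambda>k. of_real (2 / b) * (of_real (k $ i) * (?E k * q k))"
    let ?gs = "[P (partial i q) m, P ?q1 (Suc m), P ?q2 (Suc m), P ?q3 (Suc (Suc m))]"
    have "?q1 \<in> schwartz" "?q2 \<in> schwartz" "?q3 \<in> schwartz" "partial i q \<in> schwartz"
      by (intro schwartz_cmult schwartz_coord schwartz_mult schwartz_partial E a(2))+
    then have "set ?gs \<subseteq> ?A" by auto
    moreover have "partial i a = (\<lambda>x. \<Sum>g\<leftarrow>?gs. g x)"
    proof
      fix k
      have "partial i a k = q k * partial i (\<lambda>k. of_real (inverse (k \<bullet> k) ^ m * flat b k)) k + partial i q k * of_real (inverse (k \<bullet> k) ^ m * flat b k)"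
        unfolding a(1) P_def by (rule partial_mult[OF schwartz_differentiable[OF a(2)] differentiableI[OF dR]])
      also have "partial i (\<lambda>k. of_real (inverse (k \<bullet> k) ^ m * flat b k) :: complex) k
         = of_real (2 * (k $ i) * ((- real m * inverse (k \<bullet> k) ^ Suc m + exp (- b * (k \<bullet> k)) * inverse (k \<bullet> k) ^ Suc m
       + exp (- b * (k \<bullet> k)) / b * inverse (k \<bullet> k) ^ Suc (Suc m)) * flat b k))"
        using partialI[OF dR, of i] by (simp add: inner_axis)
      finally show "partial i a k = (\<Sum>g\<leftarrow>?gs. g k)"
        unfolding P_def power2_norm_eq_inner by (simp add: algebra_simps)
    qed
    ultimately show "\<exists>gs. set gs \<subseteq> ?A \<and> partial i a = (\<lambda>x. \<Sum>g\<leftarrow>gs. g x)" by blast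
  qed
  moreover have "P q m \<in> ?A" using q by blast
  ultimately have "P q m \<in> Psi" by (rule subsetD)
  then show ?thesis by (simp only: P_def)
qed

lemma schwartz_mult_flat0:
  assumes "b > 0" "q \<in> schwartz"
  shows "(\<lambda>k. q k * of_real (flat b k)) \<in> Psi"
  using schwartz_mult_flat[OF assms, of 0] by simp

text \<open>
  The function itself is bounded by a multiple of a Gaussian, from \<open>1 - e\<^bsup>-u\<^esup> \<le> u\<close> away from the origin, and its
  partial derivatives are of the form treated in \<open>schwartz_mult_flat\<close>.
\<close>

lemma one_minus_flat_schwartz:
  assumes b: "b > 0"
  shows "(\<lambda>k::real^'d::finite. of_real (1 - flat b k)) \<in> schwartz"
proof -
  let ?\<chi> = "\<lambda>k::real^'d. of_real (1 - flat b k) :: complex"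
  let ?E = "\<lambda>k::real^'d. of_real (exp (- b * (norm k)\<^sup>2)) :: complex"
  have E: "?E \<in> schwartz" by (rule schwartz_gaussian[OF b])
  have d: "(?\<chi> has_derivative (\<lambda>h. - of_real (2 * (k \<bullet> h) * ((exp (- b * (k \<bullet> k)) * inverse (k \<bullet> k)
       + exp (- b * (k \<bullet> k)) / b * inverse (k \<bullet> k) ^ 2) * flat b k)))) (at k)" for k
  proof -
    have "(flat b has_derivative (\<lambda>h. 2 * (k \<bullet> h) * ((exp (- b * (k \<bullet> k)) * inverse (k \<bullet> k)
       + exp (- b * (k \<bullet> k)) / b * inverse (k \<bullet> k) ^ 2) * flat b k))) (at k)"
      using flat_derivative[OF b, of 0 k] by (simp add: power2_eq_square)
    then have "(?\<chi> has_derivative (\<lambda>h. of_real (0 - 2 * (k \<bullet> h) * ((exp (- b * (k \<bullet> k)) * inverse (k \<bullet> k)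
       + exp (- b * (k \<bullet> k)) / b * inverse (k \<bullet> k) ^ 2) * flat b k)))) (at k)"
      by (intro has_derivative_of_real has_derivative_diff has_derivative_const)
    then show ?thesis by (simp only: diff_0 of_real_minus)
  qed
  have part: "partial i ?\<chi> \<in> schwartz" for i
  proof -
    let ?q = "\<lambda>k. of_real (k $ i) * ?E k"
    have q: "?q \<in> schwartz" by (intro schwartz_coord E)
    let ?u = "\<lambda>k. (- 2) * (?q k * of_real (inverse (k \<bullet> k) ^ 1 * flat b k))"
      and ?v = "\<lambda>k. of_real (- 2 / b) * (?q k * of_real (inverse (k \<bullet> k) ^ 2 * flat b k))"
    have "(\<lambda>k. ?u k + ?v k) \<in> schwartz"
      by (intro schwartz_add schwartz_cmult Psi_schwartz schwartz_mult_flat[OF b q])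
    moreover have "partial i ?\<chi> = (\<lambda>k. ?u k + ?v k)"
      using partialI[OF d, of i] unfolding power2_norm_eq_inner by (auto simp: inner_axis algebra_simps)
    ultimately show ?thesis by (simp only:)
  qed
  have "insert ?\<chi> schwartz \<subseteq> schwartz"
  proof (rule schwartz_generators)
    fix a x assume "a \<in> insert ?\<chi> schwartz"
    then show "a differentiable (at x)" using differentiableI[OF d] schwartz_differentiable by blast
  next
    fix a assume a: "a \<in> insert ?\<chi> schwartz"
    have "rapid ?\<chi>"
    proof (rule rapid_bound[OF schwartz_rapid[OF E]])
      fix k :: "real^'d"
      define t where "t = k \<bullet> k"
      have t: "t \<ge> 0" by (simp add: t_def)
      have "1 - flat b k \<le> (exp b + 1 / b) * exp (- b * t)"
      proof (cases "t \<ge> 1")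
        case True
        then have "k \<noteq> 0" by (auto simp: t_def)
        then have "1 - flat b k \<le> exp (- b * t) / (b * t)"
          using exp_ge_add_one_self[of "- (exp (- b * t) / (b * t))"] by (simp add: flat_def t_def)
        also have "\<dots> \<le> exp (- b * t) / (b * 1)" using True b by (intro divide_left_mono mult_left_mono) auto
        also have "\<dots> \<le> (exp b + 1 / b) * exp (- b * t)" by (simp add: distrib_right)
        finally show ?thesis .
      next
        case False
        have "1 - flat b k \<le> 1" using flat_bounds(1)[OF b, of k] by simp
        also have "1 \<le> exp b * exp (- b * t)" using False b by (simp add: mult_exp_exp)
        also have "\<dots> \<le> (exp b + 1 / b) * exp (- b * t)" using b by (simp add: distrib_right)
        finally show ?thesis .
      qed
      moreover have "cmod (?\<chi> k) = 1 - flat b k" using flat_bounds(2)[OF b, of k] by (simp add: norm_of_real del: of_real_diff)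
      ultimately show "cmod (?\<chi> k) \<le> (exp b + 1 / b) * cmod (?E k)"
        by (simp add: t_def power2_norm_eq_inner del: of_real_diff)
    qed
    then show "rapid a" using a schwartz_rapid by blast
  next
    fix a i assume "a \<in> insert ?\<chi> schwartz"
    then have "partial i a \<in> schwartz" using part schwartz_partial by blast
    then show "\<exists>gs. set gs \<subseteq> insert ?\<chi> schwartz \<and> partial i a = (\<lambda>x. \<Sum>g\<leftarrow>gs. g x)"
      by (intro exI[of _ "[partial i a]"]) simp
  qed
  then show ?thesis by blast
qed

lemma fourier_at_0: "fourier f 0 = of_real (fconst TYPE('d)) * (\<integral>x. f x \<partial>(lborel :: (real^'d::finite) measure))"
  by (simp add: fourier_def)

text \<open>
  Moments of \<open>\<F>\<psi>\<close> are, by the two exchange rules and inversion, multiples of derivatives of \<open>\<psi>\<close> at the origin.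
\<close>

lemma fourier_Psi_in_Phi:
  fixes \<psi> :: "'d::finite fn"
  assumes "\<psi> \<in> Psi" shows "fourier \<psi> \<in> Phi"
proof -
  have S: "\<psi> \<in> schwartz" by (rule Psi_schwartz[OF assms])
  have "(LINT x|lborel. of_real (monomial \<alpha> x) * fourier \<psi> x) = 0" for \<alpha>
  proof -
    have "of_real (fconst TYPE('d)) * (LINT x|lborel. fourier (partials \<alpha> \<psi>) x) = fourier (fourier (partials \<alpha> \<psi>)) 0"
      by (simp only: fourier_at_0)
    also have "\<dots> = 0" using assms by (simp add: schwartz_inversion[OF schwartz_partials[OF S]] Psi_iff)
    finally have "(LINT x|lborel. fourier (partials \<alpha> \<psi>) x) = 0"
      using fconst_pos[where 'd='d] by simp
    then show ?thesis by (simp add: monomial_fourier[OF S])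
  qed
  then show ?thesis using fourier_schwartz[OF S] by (simp add: Phi_def)
qed

lemma Phi_schwartz: "\<phi> \<in> Phi \<Longrightarrow> \<phi> \<in> schwartz"
  by (simp add: Phi_def)

lemma fourier_Phi_in_Psi:
  fixes \<phi> :: "'d::finite fn"
  assumes "\<phi> \<in> Phi" shows "fourier \<phi> \<in> Psi"
proof -
  have S: "\<phi> \<in> schwartz" by (rule Phi_schwartz[OF assms])
  have "partials \<beta> (fourier \<phi>) 0 = 0" for \<beta>
    using assms by (simp add: partials_fourier[OF S] fourier_at_0 Phi_def)
  then show ?thesis using fourier_schwartz[OF S] by (simp add: Psi_iff)
qed

section \<open>Functionals with a spectral density\<close>

lemma seminorm_upper:
  assumes "\<phi> \<in> schwartz"
  shows "cmod (of_real (monomial \<alpha> x) * partials \<beta> \<phi> x) \<le> schwartz_seminorm \<alpha> \<beta> \<phi>"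
  unfolding schwartz_seminorm_def
proof (rule cSUP_upper)
  have "bounded (range (\<lambda>x. of_real (monomial \<alpha> x) * partials \<beta> \<phi> x))"
    using assms by (simp add: schwartz_def)
  then obtain B where "\<And>x. cmod (of_real (monomial \<alpha> x) * partials \<beta> \<phi> x) \<le> B"
    unfolding bounded_iff by auto
  then show "bdd_above (range (\<lambda>x. cmod (of_real (monomial \<alpha> x) * partials \<beta> \<phi> x)))"
    by (intro bdd_aboveI2)
qed simp

lemma partials_zero: "partials \<beta> (\<lambda>_. 0) = (\<lambda>_. 0)"
proof (induction \<beta>)
  case (Cons i \<beta>)
  have "partial i (\<lambda>_. 0) = (\<lambda>_. 0)"
    using partialI[OF has_derivative_const[of 0]] by auto
  with Cons show ?case by simp
qed simp

lemma seminorm_zero: "schwartz_seminorm \<alpha> \<beta> (\<lambda>_. 0) = 0"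
  by (simp add: schwartz_seminorm_def partials_zero)

abbreviation seminorm_sum :: "('d::finite list \<times> 'd list) list \<Rightarrow> 'd fn \<Rightarrow> real" where
  "seminorm_sum Ss \<phi> \<equiv> \<Sum>p\<leftarrow>Ss. schwartz_seminorm (fst p) (snd p) \<phi>"

text \<open>
  The topology of \<open>\<S>\<close> is given by a subbasis, so finitely many seminorms are handled by induction on the list.
  The empty list is the statement that \<open>\<S>\<close> is the whole space.
\<close>

lemma openin_seminorm_ball:
  fixes \<phi> :: "'d::finite fn"
  assumes \<phi>: "\<phi> \<in> schwartz" and \<delta>: "\<delta> > 0"
  shows "openin schwartz_topology {\<eta> \<in> schwartz. \<forall>p\<in>set Ss. schwartz_seminorm (fst p) (snd p) (\<lambda>x. \<eta> x - \<phi> x) < \<delta>}"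
proof (induction Ss)
  case Nil
  let ?S = "{{\<eta> \<in> schwartz. schwartz_seminorm \<alpha> \<beta> (\<lambda>x. \<eta> x - \<phi> x) < \<epsilon>} | \<alpha> \<beta> (\<phi>::'d fn) \<epsilon>. \<phi> \<in> schwartz \<and> \<epsilon> > 0}"
  have "\<Union> ?S = schwartz"
  proof (intro equalityI subsetI)
    fix \<eta> :: "'d fn" assume \<eta>: "\<eta> \<in> schwartz"
    then have "\<eta> \<in> {\<eta>' \<in> schwartz. schwartz_seminorm [] [] (\<lambda>x. \<eta>' x - \<eta> x) < 1}"
      by (simp add: seminorm_zero)
    moreover have "{\<eta>' \<in> schwartz. schwartz_seminorm [] [] (\<lambda>x. \<eta>' x - \<eta> x) < 1} \<in> ?S"
      by (intro CollectI exI[of _ "[]"] exI[of _ \<eta>] exI[of _ "1::real"]) (use \<eta> in simp)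
    ultimately show "\<eta> \<in> \<Union> ?S" by (rule UnionI[rotated])
  qed auto
  then have "topspace schwartz_topology = (schwartz :: 'd fn set)"
    unfolding schwartz_topology_def topology_generated_by_topspace .
  then have "openin schwartz_topology (schwartz :: 'd fn set)"
    using openin_topspace[of "schwartz_topology :: 'd fn topology"] by (simp only:)
  then show ?case by simp
next
  case (Cons p Ss)
  have "openin schwartz_topology {\<eta> \<in> schwartz. schwartz_seminorm (fst p) (snd p) (\<lambda>x. \<eta> x - \<phi> x) < \<delta>}"
    unfolding schwartz_topology_def by (rule topology_generated_by_Basis) (use \<phi> \<delta> in blast)
  from openin_Int[OF this Cons.IH] show ?case
    by (rule back_subst[where P="openin schwartz_topology"]) auto
qed

text \<open>
  A linear functional dominated by finitely many seminorms is continuous: on the seminorm ball of radius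
  \<open>\<delta>\<close> around \<open>u\<close> it varies by at most \<open>C\<delta>\<close> times the number of seminorms.
\<close>

lemma top_dualI:
  fixes T :: "'d::finite functional"
  assumes ext: "T \<in> extensional V" and V: "V \<subseteq> schwartz"
    and sub: "\<And>u v a b. u \<in> V \<Longrightarrow> v \<in> V \<Longrightarrow> (\<lambda>x. a * u x + b * v x) \<in> V"
    and lin: "\<And>u v a b. u \<in> V \<Longrightarrow> v \<in> V \<Longrightarrow> T (\<lambda>x. a * u x + b * v x) = a * T u + b * T v"
    and C: "C \<ge> 0" and bound: "\<And>u. u \<in> V \<Longrightarrow> cmod (T u) \<le> C * seminorm_sum Ss u"
  shows "T \<in> top_dual V"
proof -
  have "continuous_map (subtopology schwartz_topology V) euclidean T"
    unfolding continuous_map_def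
  proof (intro conjI allI impI)
    show "T \<in> topspace (subtopology schwartz_topology V) \<rightarrow> topspace euclidean" by simp
    fix U :: "complex set" assume "openin euclidean U"
    then have U: "open U" by simp
    show "openin (subtopology schwartz_topology V) {x \<in> topspace (subtopology schwartz_topology V). T x \<in> U}"
    proof (subst openin_subopen, intro ballI)
      fix u assume u: "u \<in> {x \<in> topspace (subtopology schwartz_topology V). T x \<in> U}"
      then have uV: "u \<in> V" and uU: "T u \<in> U" by (simp_all add: topspace_subtopology)
      have uS: "u \<in> schwartz" using uV V by blast
      obtain e where e: "e > 0" "ball (T u) e \<subseteq> U" using U uU open_contains_ball by blast
      define \<delta> where "\<delta> = e / (C * real (length Ss) + 1)"
      have den: "C * real (length Ss) + 1 > 0" using C by (simp add: add_nonneg_pos)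
      have \<delta>: "\<delta> > 0" using e(1) den by (simp add: \<delta>_def)
      let ?W = "{\<eta> \<in> schwartz. \<forall>p\<in>set Ss. schwartz_seminorm (fst p) (snd p) (\<lambda>x. \<eta> x - u x) < \<delta>}"
      have W: "openin schwartz_topology ?W" by (rule openin_seminorm_ball[OF uS \<delta>])
      have uW: "u \<in> ?W" using uS \<delta> by (simp add: seminorm_zero)
      have "T \<eta> \<in> U" if \<eta>: "\<eta> \<in> ?W" "\<eta> \<in> V" for \<eta>
      proof -
        have eq: "(\<lambda>x. 1 * \<eta> x + (- 1) * u x) = (\<lambda>x. \<eta> x - u x)" by simp
        have "T (\<lambda>x. \<eta> x - u x) = T \<eta> - T u"
          using lin[OF \<eta>(2) uV, of 1 "- 1"] unfolding eq by simp
        moreover have "(\<lambda>x. \<eta> x - u x) \<in> V" using sub[OF \<eta>(2) uV, of 1 "- 1"] unfolding eq .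
        ultimately have "cmod (T \<eta> - T u) \<le> C * seminorm_sum Ss (\<lambda>x. \<eta> x - u x)"
          using bound by metis
        also have "seminorm_sum Ss (\<lambda>x. \<eta> x - u x) \<le> (\<Sum>p\<leftarrow>Ss. \<delta>)"
          using \<eta>(1) by (intro sum_list_mono) (auto intro: less_imp_le)
        then have "C * seminorm_sum Ss (\<lambda>x. \<eta> x - u x) \<le> C * (\<Sum>p\<leftarrow>Ss. \<delta>)" by (rule mult_left_mono) (rule C)
        also have "\<dots> = C * real (length Ss) * \<delta>" by (simp add: sum_list_triv)
        also have "\<dots> < (C * real (length Ss) + 1) * \<delta>" using \<delta> by (simp add: distrib_right)
        also have "\<dots> = e" using den by (simp add: \<delta>_def)
        finally have "T \<eta> \<in> ball (T u) e" by (simp add: dist_norm norm_minus_commute)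
        then show ?thesis using e(2) by blast
      qed
      moreover have "openin (subtopology schwartz_topology V) (?W \<inter> V)"
        using W openin_subtopology by blast
      moreover have "?W \<inter> V \<subseteq> topspace (subtopology schwartz_topology V)"
        using openin_subset[OF W] by (auto simp: topspace_subtopology)
      ultimately show "\<exists>W. openin (subtopology schwartz_topology V) W \<and> u \<in> W \<and> W \<subseteq> {x \<in> topspace (subtopology schwartz_topology V). T x \<in> U}"
        using uW uV by (intro exI[of _ "?W \<inter> V"]) auto
    qed
  qed
  then show ?thesis using ext lin by (simp add: top_dual_def)
qed

lemma wt_partials_le:
  fixes N :: nat
  obtains As :: "'d::finite list list" where
    "\<And>\<phi> \<beta> x. \<phi> \<in> schwartz \<Longrightarrow> wt x ^ N * cmod (partials \<beta> \<phi> x) \<le> (\<Sum>\<alpha>\<leftarrow>As. schwartz_seminorm \<alpha> \<beta> \<phi>)"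
proof -
  obtain As where As: "\<And>x::real^'d. wt x ^ N = (\<Sum>\<alpha>\<leftarrow>As. monomial \<alpha> x)" using wt_power_eq_monomials by blast
  show ?thesis
  proof (rule that[of As])
    fix \<phi> :: "'d fn" and \<beta> x assume \<phi>: "\<phi> \<in> schwartz"
    have "(\<Sum>\<alpha>\<leftarrow>Bs. monomial \<alpha> x) * cmod (partials \<beta> \<phi> x) \<le> (\<Sum>\<alpha>\<leftarrow>Bs. schwartz_seminorm \<alpha> \<beta> \<phi>)" for Bs
    proof (induction Bs)
      case (Cons \<alpha> Bs)
      have "monomial \<alpha> x * cmod (partials \<beta> \<phi> x) \<le> cmod (of_real (monomial \<alpha> x) * partials \<beta> \<phi> x)"
        by (simp add: norm_mult mult_right_mono)
      also have "\<dots> \<le> schwartz_seminorm \<alpha> \<beta> \<phi>" by (rule seminorm_upper[OF \<phi>])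
      finally show ?case using Cons by (simp add: distrib_right)
    qed simp
    then show "wt x ^ N * cmod (partials \<beta> \<phi> x) \<le> (\<Sum>\<alpha>\<leftarrow>As. schwartz_seminorm \<alpha> \<beta> \<phi>)" by (simp add: As)
  qed
qed

text \<open>
  Quantitative continuity of \<open>\<F>\<close> on \<open>\<S>\<close>: a power of \<open>1 + |k|\<^sup>2\<close> turns into derivatives of \<open>\<phi>\<close>, whose \<open>L\<^sup>1\<close> norms
  are seminorms times the integral of \<open>(1 + |x|\<^sup>2)\<^bsup>-d\<^esup>\<close>.
\<close>

lemma fourier_seminorm_bound:
  fixes M :: nat
  shows "\<exists>C Ss. 0 \<le> C \<and> (\<forall>\<phi>\<in>schwartz. \<forall>k::real^'d::finite. wt k ^ M * cmod (fourier \<phi> k) \<le> C * seminorm_sum Ss \<phi>)"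
proof -
  obtain As where As: "\<And>\<phi> \<beta> x. \<phi> \<in> schwartz \<Longrightarrow> wt x ^ CARD('d) * cmod (partials \<beta> \<phi> x) \<le> (\<Sum>\<alpha>\<leftarrow>As. schwartz_seminorm (\<alpha>::'d list) \<beta> \<phi>)"
    using wt_partials_le[where N="CARD('d)"] by blast
  obtain Bs where Bs: "\<And>x::real^'d. wt x ^ M = (\<Sum>\<alpha>\<leftarrow>Bs. monomial \<alpha> x)" using wt_power_eq_monomials by blast
  define K where "K = (\<integral>x. 1 / wt x ^ CARD('d) \<partial>(lborel :: (real^'d) measure))"
  have K: "K \<ge> 0" unfolding K_def using wt_pos by (intro integral_nonneg_AE AE_I2) (simp add: less_imp_le)
  define C where "C = fconst TYPE('d) * K"
  have C: "C \<ge> 0" using K by (simp add: C_def)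
  define Ss where "Ss = concat (map (\<lambda>\<beta>. map (\<lambda>\<alpha>. (\<alpha>, \<beta>)) As) Bs)"
  have "wt k ^ M * cmod (fourier \<phi> k) \<le> C * seminorm_sum Ss \<phi>" if \<phi>: "\<phi> \<in> schwartz" for \<phi> :: "'d fn" and k
  proof -
    have one: "cmod (fourier (partials \<beta> \<phi>) k) \<le> C * (\<Sum>\<alpha>\<leftarrow>As. schwartz_seminorm \<alpha> \<beta> \<phi>)" for \<beta>
    proof -
      let ?s = "\<Sum>\<alpha>\<leftarrow>As. schwartz_seminorm \<alpha> \<beta> \<phi>"
      have i: "integrable lborel (partials \<beta> \<phi>)" by (rule schwartz_integrable[OF schwartz_partials[OF \<phi>]])
      have "(\<integral>x. cmod (partials \<beta> \<phi> x) \<partial>lborel) \<le> (\<integral>x. ?s * (1 / wt x ^ CARD('d)) \<partial>(lborel :: (real^'d) measure))"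
      proof (rule integral_mono)
        show "integrable lborel (\<lambda>x. cmod (partials \<beta> \<phi> x))" using i by simp
        show "integrable lborel (\<lambda>x::real^'d. ?s * (1 / wt x ^ CARD('d)))" by (intro integrable_mult_right integrable_wt)
        show "cmod (partials \<beta> \<phi> x) \<le> ?s * (1 / wt x ^ CARD('d))" for x
          using As[OF \<phi>, of x \<beta>] wt_pos[of x] by (simp add: field_simps)
      qed
      also have "\<dots> = ?s * K" unfolding K_def by (rule integral_mult_right_zero)
      finally have "fconst TYPE('d) * (\<integral>x. cmod (partials \<beta> \<phi> x) \<partial>lborel) \<le> fconst TYPE('d) * (?s * K)"
        by (rule mult_left_mono) simp
      also have "\<dots> = C * ?s" by (simp add: C_def)
      finally show ?thesis using norm_fourier_le[OF i, of k] by linarith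
    qed
    have "(\<Sum>\<beta>\<leftarrow>Xs. monomial \<beta> k) * cmod (fourier \<phi> k) \<le> C * seminorm_sum (concat (map (\<lambda>\<beta>. map (\<lambda>\<alpha>. (\<alpha>, \<beta>)) As) Xs)) \<phi>" for Xs
    proof (induction Xs)
      case (Cons \<beta> Xs)
      have "monomial \<beta> k * cmod (fourier \<phi> k) \<le> cmod (of_real (monomial \<beta> k) * fourier \<phi> k)"
        by (simp add: norm_mult mult_right_mono)
      also have "\<dots> = cmod (fourier (partials \<beta> \<phi>) k)"
        unfolding monomial_fourier[OF \<phi>] by (simp add: norm_mult norm_power)
      also have "\<dots> \<le> C * (\<Sum>\<alpha>\<leftarrow>As. schwartz_seminorm \<alpha> \<beta> \<phi>)" by (rule one)
      finally show ?case using Cons by (simp add: distrib_right distrib_left comp_def)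
    qed simp
    then show ?thesis by (simp only: Bs Ss_def)
  qed
  then show ?thesis using C by blast
qed

text \<open>
  Functions that define tempered distributions by integration.
\<close>

definition tempered :: "'d::finite fn \<Rightarrow> bool" where
  "tempered G \<longleftrightarrow> G \<in> borel_measurable borel \<and> (\<exists>M. integrable lborel (\<lambda>k. cmod (G k) / wt k ^ M))"

lemma tempered_integrable:
  assumes "tempered G" "\<phi> \<in> schwartz"
  shows "integrable lborel (\<lambda>k. G k * \<phi> k)"
proof -
  obtain M where M: "integrable lborel (\<lambda>k. cmod (G k) / wt k ^ M)" and [measurable]: "G \<in> borel_measurable borel"
    using assms(1) by (auto simp: tempered_def)
  have [measurable]: "\<phi> \<in> borel_measurable borel" by (rule schwartz_measurable[OF assms(2)])
  obtain C where C: "C \<ge> 0" "\<And>x. wt x ^ M * cmod (\<phi> x) \<le> C" using rapidE[OF schwartz_rapid[OF assms(2)]] by blast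
  show ?thesis
  proof (rule Bochner_Integration.integrable_bound)
    show "integrable lborel (\<lambda>k. C * (cmod (G k) / wt k ^ M))" using M by (rule integrable_mult_right)
    have "cmod (G k * \<phi> k) \<le> C * (cmod (G k) / wt k ^ M)" for k
    proof -
      have "cmod (G k) * cmod (\<phi> k) = (wt k ^ M * cmod (\<phi> k)) * (cmod (G k) / wt k ^ M)"
        using wt_nz[of k] by simp
      also have "\<dots> \<le> C * (cmod (G k) / wt k ^ M)" using wt_pos[of k] by (intro mult_right_mono C) simp
      finally show ?thesis by (simp only: norm_mult)
    qed
    then show "AE k in lborel. norm (G k * \<phi> k) \<le> norm (C * (cmod (G k) / wt k ^ M))"
      by (intro AE_I2) (smt (verit) real_norm_def)
  qed simp
qed

lemma tempered_abs_powr: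
  assumes "tempered G" "s \<ge> 0"
  shows "tempered (\<lambda>k. of_real (norm k powr s) * G k)"
proof -
  obtain M where M: "integrable lborel (\<lambda>k. cmod (G k) / wt k ^ M)" and [measurable]: "G \<in> borel_measurable borel"
    using assms(1) by (auto simp: tempered_def)
  define N where "N = nat \<lceil>s\<rceil>"
  have le: "norm k powr s \<le> wt k ^ N" for k :: "real^'a"
  proof -
    have "norm k powr s \<le> wt k powr s" using norm_le_wt[of k] assms(2) by (intro powr_mono2) auto
    also have "\<dots> \<le> wt k powr real N" using wt_ge1[of k] unfolding N_def by (intro powr_mono of_nat_ceiling)
    also have "\<dots> = wt k ^ N" using wt_pos[of k] by (rule powr_realpow)
    finally show ?thesis .
  qed
  have "integrable lborel (\<lambda>k. cmod (of_real (norm k powr s) * G k) / wt k ^ (M + N))"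
  proof (rule Bochner_Integration.integrable_bound[OF M])
    have "cmod (of_real (norm k powr s) * G k) / wt k ^ (M + N) \<le> cmod (G k) / wt k ^ M" for k
    proof -
      have "cmod (of_real (norm k powr s) * G k) / wt k ^ (M + N) \<le> (wt k ^ N * cmod (G k)) / wt k ^ (M + N)"
        using le[of k] wt_pos[of k] by (intro divide_right_mono) (auto simp: norm_mult intro!: mult_right_mono)
      also have "\<dots> = cmod (G k) / wt k ^ M" using wt_nz[of k] by (simp add: power_add)
      finally show ?thesis .
    qed
    then show "AE k in lborel. norm (cmod (of_real (norm k powr s) * G k) / wt k ^ (M + N)) \<le> norm (cmod (G k) / wt k ^ M)"
      using wt_pos by (intro AE_I2) (simp add: less_imp_le)
  qed simp
  then show ?thesis unfolding tempered_def by (intro conjI exI[of _ "M + N"]) measurable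
qed

lemma tempered_diff:
  assumes "tempered G" "tempered H"
  shows "tempered (\<lambda>k. G k - H k)"
proof -
  obtain M where M: "integrable lborel (\<lambda>k. cmod (G k) / wt k ^ M)" and [measurable]: "G \<in> borel_measurable borel"
    using assms(1) by (auto simp: tempered_def)
  obtain N where N: "integrable lborel (\<lambda>k. cmod (H k) / wt k ^ N)" and [measurable]: "H \<in> borel_measurable borel"
    using assms(2) by (auto simp: tempered_def)
  have "integrable lborel (\<lambda>k. cmod (G k - H k) / wt k ^ (M + N))"
  proof (rule Bochner_Integration.integrable_bound[OF Bochner_Integration.integrable_add[OF M N]])
    have "cmod (G k - H k) / wt k ^ (M + N) \<le> cmod (G k) / wt k ^ M + cmod (H k) / wt k ^ N" for k
    proof -
      have "cmod (G k - H k) / wt k ^ (M + N) \<le> (cmod (G k) + cmod (H k)) / wt k ^ (M + N)"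
        using wt_pos[of k] norm_triangle_ineq4 by (intro divide_right_mono) auto
      also have "\<dots> \<le> cmod (G k) / wt k ^ M + cmod (H k) / wt k ^ N"
        unfolding add_divide_distrib using wt_ge1[of k] wt_pos[of k]
        by (intro add_mono divide_left_mono power_increasing mult_pos_pos zero_less_power) auto
      finally show ?thesis .
    qed
    then show "AE k in lborel. norm (cmod (G k - H k) / wt k ^ (M + N)) \<le> norm (cmod (G k) / wt k ^ M + cmod (H k) / wt k ^ N)"
      using wt_pos by (intro AE_I2) (simp add: less_imp_le)
  qed simp
  then show ?thesis unfolding tempered_def by (intro conjI exI[of _ "M + N"]) measurable
qed

lemma tempered_L2:
  fixes G :: "'d::finite fn"
  assumes [measurable]: "G \<in> borel_measurable borel" and L2: "L2sq G < \<infinity>"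
  shows "tempered G"
proof -
  have i: "integrable lborel (\<lambda>k. (cmod (G k))\<^sup>2)"
    by (rule integrableI_nonneg) (use L2 in \<open>auto simp: L2sq_def\<close>)
  have "integrable lborel (\<lambda>k::real^'d. cmod (G k) / wt k ^ CARD('d))"
  proof (rule Bochner_Integration.integrable_bound[OF Bochner_Integration.integrable_add[OF i integrable_wt]])
    have "cmod (G k) / wt k ^ CARD('d) \<le> (cmod (G k))\<^sup>2 + 1 / wt k ^ CARD('d)" for k
    proof -
      let ?w = "1 / wt k ^ CARD('d)"
      have w: "0 \<le> ?w" "?w \<le> 1" using wt_ge1[of k] wt_pos[of k] by (simp_all add: one_le_power)
      have "2 * cmod (G k) * ?w \<le> (cmod (G k))\<^sup>2 + ?w\<^sup>2" by (rule sum_squares_bound)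
      moreover have "?w\<^sup>2 \<le> ?w" unfolding power2_eq_square[of ?w] by (rule mult_left_le[OF w(2,1)])
      moreover have "0 \<le> cmod (G k) * ?w" using w by (intro mult_nonneg_nonneg) auto
      moreover have "cmod (G k) / wt k ^ CARD('d) = cmod (G k) * ?w" by simp
      ultimately show ?thesis by linarith
    qed
    then show "AE k in lborel. norm (cmod (G k) / wt k ^ CARD('d)) \<le> norm ((cmod (G k))\<^sup>2 + 1 / wt k ^ CARD('d))"
      using wt_pos by (intro AE_I2) (simp add: less_imp_le)
  qed simp
  then show ?thesis unfolding tempered_def by (intro conjI exI[of _ "CARD('d)"]) measurable
qed

text \<open>
  The functional whose Fourier transform is \<open>G\<close>, written without the inverse transform: formally it pairs \<open>\<phi>\<close>
  with the function \<open>\<F>\<^bsup>-1\<^esup> G\<close>. The reflection of the argument makes the operator \<open>fourier_dual\<close> send it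
  to integration against \<open>G\<close>.
\<close>

definition spectral :: "'d::finite fn \<Rightarrow> 'd functional" where
  "spectral G = (\<lambda>\<phi>\<in>Phi. LINT k|lborel. G k * fourier \<phi> (- k))"

lemma Phi_lincomb:
  assumes u: "u \<in> Phi" and v: "v \<in> Phi"
  shows "(\<lambda>x. a * u x + b * v x) \<in> Phi"
proof -
  have S: "u \<in> schwartz" "v \<in> schwartz" using u v by (simp_all add: Phi_def)
  have "(LINT x|lborel. of_real (monomial \<alpha> x) * (a * u x + b * v x)) = 0" for \<alpha>
  proof -
    have i: "integrable lborel (\<lambda>x. of_real (monomial \<alpha> x) * u x)" "integrable lborel (\<lambda>x. of_real (monomial \<alpha> x) * v x)"
      by (rule schwartz_integrable[OF schwartz_monomial[OF S(1)]], rule schwartz_integrable[OF schwartz_monomial[OF S(2)]])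
    have "of_real (monomial \<alpha> x) * (a * u x + b * v x) = a * (of_real (monomial \<alpha> x) * u x) + b * (of_real (monomial \<alpha> x) * v x)" for x
      by (simp add: algebra_simps)
    then have "(LINT x|lborel. of_real (monomial \<alpha> x) * (a * u x + b * v x))
       = a * (LINT x|lborel. of_real (monomial \<alpha> x) * u x) + b * (LINT x|lborel. of_real (monomial \<alpha> x) * v x)"
      using i by simp
    also have "\<dots> = 0" using u v by (simp add: Phi_def)
    finally show ?thesis .
  qed
  moreover have "(\<lambda>x. a * u x + b * v x) \<in> schwartz" by (intro schwartz_add schwartz_cmult S)
  ultimately show ?thesis by (simp add: Phi_def)
qed

lemma spectral_in_top_dual:
  fixes G :: "'d::finite fn"
  assumes G: "tempered G"
  shows "spectral G \<in> top_dual Phi"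
proof -
  obtain M where M: "integrable lborel (\<lambda>k. cmod (G k) / wt k ^ M)" and [measurable]: "G \<in> borel_measurable borel"
    using G by (auto simp: tempered_def)
  obtain C Ss where C: "0 \<le> C" "\<And>\<phi> k. \<phi> \<in> schwartz \<Longrightarrow> wt (k::real^'d) ^ M * cmod (fourier \<phi> k) \<le> C * seminorm_sum Ss \<phi>"
    using fourier_seminorm_bound[of M, where 'd='d] by blast
  define I where "I = (\<integral>k. cmod (G k) / wt k ^ M \<partial>lborel)"
  have I: "I \<ge> 0" unfolding I_def using wt_pos by (intro integral_nonneg_AE AE_I2) (simp add: less_imp_le)
  have R: "(\<lambda>k. fourier u (- k)) \<in> schwartz" if "u \<in> schwartz" for u :: "'d fn"
    by (intro schwartz_reflect fourier_schwartz that)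
  show ?thesis
  proof (rule top_dualI)
    show "spectral G \<in> extensional Phi" by (simp add: spectral_def)
    show "Phi \<subseteq> (schwartz :: 'd fn set)" by (auto simp: Phi_def)
    show "(\<lambda>x. a * u x + b * v x) \<in> Phi" if "u \<in> Phi" "v \<in> Phi" for u v :: "'d fn" and a b
      by (rule Phi_lincomb[OF that])
    show "spectral G (\<lambda>x. a * u x + b * v x) = a * spectral G u + b * spectral G v" if uv: "u \<in> Phi" "v \<in> Phi" for u v a b
    proof -
      have S: "u \<in> schwartz" "v \<in> schwartz" using uv by (simp_all add: Phi_def)
      have "fourier (\<lambda>x. a * u x + b * v x) (- k) = a * fourier u (- k) + b * fourier v (- k)" for k
        using S by (subst fourier_add) (auto simp: fourier_cmult schwartz_integrable)
      then have "G k * fourier (\<lambda>x. a * u x + b * v x) (- k) = a * (G k * fourier u (- k)) + b * (G k * fourier v (- k))" for k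
        by (simp add: algebra_simps)
      moreover have "integrable lborel (\<lambda>k. G k * fourier u (- k))" "integrable lborel (\<lambda>k. G k * fourier v (- k))"
        by (rule tempered_integrable[OF G R[OF S(1)]], rule tempered_integrable[OF G R[OF S(2)]])
      ultimately have "(LINT k|lborel. G k * fourier (\<lambda>x. a * u x + b * v x) (- k))
         = a * (LINT k|lborel. G k * fourier u (- k)) + b * (LINT k|lborel. G k * fourier v (- k))"
        by simp
      then show ?thesis using uv by (simp add: spectral_def Phi_lincomb)
    qed
    show "0 \<le> I * C" using I C by simp
    show "cmod (spectral G u) \<le> I * C * seminorm_sum Ss u" if u: "u \<in> Phi" for u
    proof -
      have S: "u \<in> schwartz" using u by (simp add: Phi_def)
      let ?s = "C * seminorm_sum Ss u"
      have "cmod (LINT k|lborel. G k * fourier u (- k)) \<le> (\<integral>k. ?s * (cmod (G k) / wt k ^ M) \<partial>lborel)"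
      proof (rule Bochner_Integration.integral_norm_bound_integral)
        show "integrable lborel (\<lambda>k. G k * fourier u (- k))" by (rule tempered_integrable[OF G R[OF S]])
        show "integrable lborel (\<lambda>k. ?s * (cmod (G k) / wt k ^ M))" using M by (rule integrable_mult_right)
        fix k
        have "cmod (G k) * cmod (fourier u (- k)) = (wt (- k) ^ M * cmod (fourier u (- k))) * (cmod (G k) / wt k ^ M)"
          using wt_nz[of k] by simp
        also have "\<dots> \<le> ?s * (cmod (G k) / wt k ^ M)" using wt_pos[of k] by (intro mult_right_mono C S) simp
        finally show "norm (G k * fourier u (- k)) \<le> ?s * (cmod (G k) / wt k ^ M)" by (simp only: norm_mult)
      qed
      also have "\<dots> = ?s * I" unfolding I_def by (rule integral_mult_right_zero)
      finally show ?thesis using u by (simp add: spectral_def mult_ac)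
    qed
  qed
qed

lemma fourier_reflect: "fourier (\<lambda>x. f (- x)) k = fourier (f :: 'd::finite fn) (- k)" if "f \<in> borel_measurable borel"
proof -
  note [measurable] = that
  have "(\<integral>x. exp (- \<i> * of_real (k \<bullet> x)) * f (- x) \<partial>lborel) = (\<integral>x. exp (- \<i> * of_real (- k \<bullet> x)) * f x \<partial>lborel)"
    using measurable_character[of k]
    by (subst integral_lborel_scale[of "-1" "\<lambda>x. exp (- \<i> * of_real (k \<bullet> x)) * f (- x)" 0]) auto
  then show ?thesis by (simp only: fourier_def)
qed

lemma fourier_inv_reflect:
  assumes "\<psi> \<in> schwartz"
  shows "fourier_inv (\<lambda>k. \<psi> (- k)) = fourier \<psi>"
proof -
  have inj: "inj_on fourier (schwartz :: 'a fn set)"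
  proof (rule inj_onI)
    fix u v :: "'a fn" assume uv: "u \<in> schwartz" "v \<in> schwartz" and eq: "fourier u = fourier v"
    have "(\<lambda>x. u (- x)) = (\<lambda>x. v (- x))" unfolding schwartz_inversion[OF uv(1), symmetric] schwartz_inversion[OF uv(2), symmetric] eq ..
    then have "u (- (- x)) = v (- (- x))" for x by (rule fun_cong)
    then show "u = v" by auto
  qed
  show ?thesis
    unfolding fourier_inv_def schwartz_inversion[OF assms, symmetric]
    by (rule inv_into_f_f[OF inj fourier_schwartz[OF assms]])
qed

lemma fourier_dual_eq: "fourier_dual f = (\<lambda>\<psi>\<in>Psi. f (fourier \<psi>))"
  unfolding fourier_dual_def by (rule restrict_ext) (simp add: fourier_inv_reflect Psi_schwartz)

lemma fourier_reflect_fourier: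
  assumes "\<phi> \<in> schwartz"
  shows "fourier (\<lambda>k. fourier \<phi> (- k)) = \<phi>"
  using fourier_reflect[OF schwartz_measurable[OF fourier_schwartz[OF assms]]] schwartz_inversion[OF assms]
  by (auto simp: fun_eq_iff)

text \<open>
  Since \<open>fourier_dual_inv\<close> is a Hilbert choice of preimage, computing it requires injectivity, and that holds
  because every \<open>\<phi> \<in> \<Phi>\<close> is the transform of a \<open>\<psi> \<in> \<Psi>\<close>.
\<close>

lemma inj_on_fourier_dual: "inj_on fourier_dual (top_dual Phi)"
proof (rule inj_onI)
  fix S T :: "'a functional" assume S: "S \<in> top_dual Phi" and T: "T \<in> top_dual Phi" and eq: "fourier_dual S = fourier_dual T"
  show "S = T"
  proof (rule extensionalityI[where A=Phi])
    show "S \<in> extensional Phi" "T \<in> extensional Phi" using S T by (simp_all add: top_dual_def)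
    fix \<phi> :: "'a fn" assume \<phi>: "\<phi> \<in> Phi"
    let ?\<psi> = "\<lambda>k. fourier \<phi> (- k)"
    have \<psi>: "?\<psi> \<in> Psi" by (rule Psi_reflect[OF fourier_Phi_in_Psi[OF \<phi>]])
    have "fourier_dual S ?\<psi> = fourier_dual T ?\<psi>" by (simp only: eq)
    then show "S \<phi> = T \<phi>" using \<psi> by (simp add: fourier_dual_eq fourier_reflect_fourier[OF Phi_schwartz[OF \<phi>]])
  qed
qed

lemma fourier_dual_spectral: "fourier_dual (spectral G) = (\<lambda>\<psi>\<in>Psi. LINT k|lborel. G k * \<psi> k)"
  unfolding fourier_dual_eq spectral_def
  by (rule restrict_ext) (simp add: fourier_Psi_in_Phi schwartz_inversion Psi_schwartz)

text \<open>
  On the Fourier side both operations are explicit, so \<open>D\<^sup>s\<close> acts by multiplication of the density.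
\<close>

lemma D_spectral:
  assumes "tempered G" "s \<ge> 0"
  shows "D s (spectral G) = spectral (\<lambda>k. of_real (norm k powr s) * G k)"
proof -
  have "abs_powr_mult s (fourier_dual (spectral G)) = fourier_dual (spectral (\<lambda>k. of_real (norm k powr s) * G k))"
    unfolding fourier_dual_spectral abs_powr_mult_def
    by (rule restrict_ext) (simp add: abs_powr_Psi mult.assoc mult.left_commute)
  then show ?thesis
    unfolding D_def fourier_dual_inv_def
    by (simp only: inv_into_f_f[OF inj_on_fourier_dual spectral_in_top_dual[OF tempered_abs_powr[OF assms]]])
qed

lemma gauss_flat_mult_Psi:
  "(\<lambda>k. exp (- \<i> * of_real (a \<bullet> k)) * of_real (gauss k * flat 1 k)) \<in> Psi"
proof -
  have "(\<lambda>k. exp (\<i> * of_real ((- a) \<bullet> k)) * of_real (gauss k)) \<in> schwartz"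
    by (rule schwartz_modulate[OF schwartz_gauss])
  from schwartz_mult_flat0[OF _ this, of 1] show ?thesis by (simp add: mult.assoc)
qed

text \<open>
  The difference \<open>U\<close> of the densities annihilates \<open>\<Psi>\<close>, in particular all characters times a Gaussian times
  \<open>flat\<close>. So the integrable function \<open>U gauss flat\<close> has zero transform, and the factor is positive off the
  origin.
\<close>

lemma spectral_injective:
  fixes G H :: "'d::finite fn"
  assumes "tempered G" "tempered H" "spectral G = spectral H"
  shows "AE k in lborel. G k = H k"
proof -
  define U where "U k = G k - H k" for k
  have U: "tempered U" unfolding U_def by (rule tempered_diff[OF assms(1,2)])
  have zero: "(LINT k|lborel. U k * \<psi> k) = 0" if \<psi>: "\<psi> \<in> Psi" for \<psi>
  proof -
    have "(LINT k|lborel. G k * \<psi> k) = (LINT k|lborel. H k * \<psi> k)"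
      using fun_cong[OF fourier_dual_spectral[of G], of \<psi>] fun_cong[OF fourier_dual_spectral[of H], of \<psi>] assms(3) \<psi> by simp
    then show ?thesis
      using tempered_integrable[OF assms(1) Psi_schwartz[OF \<psi>]] tempered_integrable[OF assms(2) Psi_schwartz[OF \<psi>]]
      by (simp add: U_def left_diff_distrib)
  qed
  let ?v = "\<lambda>k. U k * of_real (gauss k * flat 1 k)"
  have "(\<lambda>k. exp (- \<i> * of_real (0 \<bullet> k)) * of_real (gauss k * flat 1 k)) \<in> (schwartz :: 'd fn set)"
    by (rule Psi_schwartz[OF gauss_flat_mult_Psi])
  then have g: "(\<lambda>k. of_real (gauss k * flat 1 k)) \<in> (schwartz :: 'd fn set)" by simp
  have "AE k in lborel. ?v k = 0"
  proof (rule fourier_injective_L1)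
    show "integrable lborel ?v" by (rule tempered_integrable[OF U g])
    fix a
    have "(\<integral>k. exp (- \<i> * of_real (a \<bullet> k)) * ?v k \<partial>lborel) = (LINT k|lborel. U k * (exp (- \<i> * of_real (a \<bullet> k)) * of_real (gauss k * flat 1 k)))"
      by (simp only: mult.left_commute)
    also have "\<dots> = 0" by (rule zero[OF gauss_flat_mult_Psi])
    finally show "fourier ?v a = 0" by (simp add: fourier_def)
  qed
  moreover have "AE k in (lborel :: (real^'d) measure). k \<noteq> 0" by (rule AE_lborel_singleton)
  ultimately show ?thesis
  proof eventually_elim
    case (elim k)
    have "gauss k * flat 1 k > 0" using flat_bounds(3)[of 1 k] gauss_pos[of k] elim(2) by simp
    then have "U k = 0" using elim(1) by auto
    then show ?case by (simp add: U_def)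
  qed
qed

section \<open>Functions annihilating \<open>\<Phi>\<close>\<close>

text \<open>
  A class that contains \<open>L\<^sup>p\<close> for \<open>1 \<le> p < \<infinity>\<close> as well as \<open>C\<^sub>0\<close>, so that uniqueness of representatives is
  proved once for all of them. Nonzero constants, which do annihilate \<open>\<Phi>\<close>, are excluded because \<open>\<delta>\<close> is arbitrarily
  small.
\<close>

definition nearly_integrable :: "'d::finite fn \<Rightarrow> bool" where
  "nearly_integrable u \<longleftrightarrow> u \<in> borel_measurable borel \<and>
     (\<forall>\<delta>>0. \<exists>v::real^'d \<Rightarrow> real. integrable lborel v \<and> (\<forall>x. 0 \<le> v x) \<and> (\<forall>x. cmod (u x) \<le> \<delta> + v x))"

lemma nearly_integrableE:
  fixes u :: "'d::finite fn"
  assumes "nearly_integrable u" "\<delta> > 0"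
  obtains v :: "real^'d \<Rightarrow> real" where "integrable lborel v" "\<And>x. 0 \<le> v x" "\<And>x. cmod (u x) \<le> \<delta> + v x"
  using assms unfolding nearly_integrable_def by blast

lemma nearly_integrable_measurable: "nearly_integrable u \<Longrightarrow> u \<in> borel_measurable borel"
  by (simp add: nearly_integrable_def)

lemma nearly_integrable_diff:
  fixes u w :: "'d::finite fn"
  assumes u: "nearly_integrable u" and w: "nearly_integrable w"
  shows "nearly_integrable (\<lambda>x. u x - w x)"
  unfolding nearly_integrable_def
proof (intro conjI allI impI)
  show "(\<lambda>x. u x - w x) \<in> borel_measurable borel"
    using nearly_integrable_measurable[OF u] nearly_integrable_measurable[OF w] by simp
  fix \<delta> :: real assume "\<delta> > 0"
  then have \<delta>: "\<delta> / 2 > 0" by simp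
  obtain v1 :: "real^'d \<Rightarrow> real" where v1: "integrable lborel v1" "\<And>x. 0 \<le> v1 x" "\<And>x. cmod (u x) \<le> \<delta> / 2 + v1 x"
    using nearly_integrableE[OF u \<delta>] by blast
  obtain v2 :: "real^'d \<Rightarrow> real" where v2: "integrable lborel v2" "\<And>x. 0 \<le> v2 x" "\<And>x. cmod (w x) \<le> \<delta> / 2 + v2 x"
    using nearly_integrableE[OF w \<delta>] by blast
  have "cmod (u x - w x) \<le> \<delta> + (v1 x + v2 x)" for x
    using norm_triangle_ineq4[of "u x" "w x"] v1(3)[of x] v2(3)[of x] by linarith
  then show "\<exists>v::real^'d \<Rightarrow> real. integrable lborel v \<and> (\<forall>x. 0 \<le> v x) \<and> (\<forall>x. cmod (u x - w x) \<le> \<delta> + v x)"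
    using v1 v2 by (intro exI[of _ "\<lambda>x. v1 x + v2 x"]) simp
qed

lemma nearly_integrable_mult:
  fixes u \<phi> :: "'d::finite fn"
  assumes u: "nearly_integrable u" and \<phi>: "\<phi> \<in> schwartz"
  shows "integrable lborel (\<lambda>x. u x * \<phi> x)"
proof -
  obtain v :: "real^'d \<Rightarrow> real" where v: "integrable lborel v" "\<And>x. 0 \<le> v x" "\<And>x. cmod (u x) \<le> 1 + v x"
    using nearly_integrableE[OF u zero_less_one] by blast
  obtain C where C: "C \<ge> 0" "\<And>x. wt x ^ 0 * cmod (\<phi> x) \<le> C" using rapidE[OF schwartz_rapid[OF \<phi>]] by blast
  have [measurable]: "u \<in> borel_measurable borel" "\<phi> \<in> borel_measurable borel"
    using nearly_integrable_measurable[OF u] schwartz_measurable[OF \<phi>] by simp_all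
  show ?thesis
  proof (rule Bochner_Integration.integrable_bound)
    show "integrable lborel (\<lambda>x. cmod (\<phi> x) + C * v x)"
      using schwartz_integrable[OF \<phi>] v(1) by simp
    have "cmod (u x * \<phi> x) \<le> cmod (\<phi> x) + C * v x" for x
    proof -
      have "cmod (u x * \<phi> x) \<le> (1 + v x) * cmod (\<phi> x)"
        unfolding norm_mult by (intro mult_right_mono v) simp
      also have "\<dots> = cmod (\<phi> x) + v x * cmod (\<phi> x)" by (simp add: distrib_right)
      also have "v x * cmod (\<phi> x) \<le> v x * C" using C(2)[of x] v(2)[of x] by (intro mult_left_mono) auto
      finally show ?thesis by (simp add: mult.commute)
    qed
    then show "AE x in lborel. norm (u x * \<phi> x) \<le> norm (cmod (\<phi> x) + C * v x)"
      by (intro AE_I2) (smt (verit) real_norm_def)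
  qed simp
qed

lemma fourier_scale:
  fixes f :: "'d::finite fn"
  assumes "s > 0" and [measurable]: "f \<in> borel_measurable borel"
  shows "fourier (\<lambda>k. f (s *\<^sub>R k)) x = of_real (1 / s ^ CARD('d)) * fourier f (inverse s *\<^sub>R x)"
proof -
  let ?g = "\<lambda>k. exp (- \<i> * of_real ((inverse s *\<^sub>R x) \<bullet> k)) * f k"
  have [measurable]: "?g \<in> borel_measurable borel"
    using measurable_character[of "inverse s *\<^sub>R x"] by simp
  have "(\<integral>k. ?g k \<partial>lborel) = s ^ CARD('d) *\<^sub>R (\<integral>k. ?g (0 + s *\<^sub>R k) \<partial>lborel)"
    using integral_lborel_scale[of s ?g 0] assms(1) by simp
  also have "(\<integral>k. ?g (0 + s *\<^sub>R k) \<partial>lborel) = (\<integral>k. exp (- \<i> * of_real (x \<bullet> k)) * f (s *\<^sub>R k) \<partial>lborel)"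
  proof -
    have "(inverse s *\<^sub>R x) \<bullet> (0 + s *\<^sub>R k) = x \<bullet> k" for k using assms(1) by simp
    then show ?thesis by (simp only: add_0)
  qed
  finally have "(\<integral>k. exp (- \<i> * of_real (x \<bullet> k)) * f (s *\<^sub>R k) \<partial>lborel) = of_real (1 / s ^ CARD('d)) * (\<integral>k. ?g k \<partial>lborel)"
    using assms(1) by (simp add: scaleR_conv_of_real)
  then show ?thesis by (simp only: fourier_def mult.left_commute)
qed

lemma flat_scale: "flat (s\<^sup>2) k = flat 1 (s *\<^sub>R k)" if "s > 0"
  using that by (simp add: flat_def power2_eq_square mult.assoc mult.left_commute)

text \<open>
  The multiplier \<open>\<eta>\<close> acts as convolution with \<open>\<F>\<eta>\<close>. The bounded part \<open>\<delta>\<close> of \<open>u\<close> meets the \<open>L\<^sup>1\<close> norm of this kernel,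
  the integrable part \<open>v\<close> meets its supremum \<open>B\<close>.
\<close>

lemma fourier_mult_bound:
  fixes u p \<eta> :: "'d::finite fn"
  assumes u[measurable]: "u \<in> borel_measurable borel" and p: "integrable lborel p" and \<eta>: "integrable lborel \<eta>"
    and v: "integrable lborel v" "\<And>x. 0 \<le> v x" "\<And>x. cmod (u x) \<le> \<delta> + v x" and \<delta>: "\<delta> \<ge> 0"
    and K: "integrable lborel (fourier \<eta>)" "\<And>x. cmod (fourier \<eta> x) \<le> B"
  shows "cmod (\<integral>x. u x * fourier (\<lambda>k. fourier p k * \<eta> k) x \<partial>lborel)
     \<le> fconst TYPE('d) * (\<integral>y. cmod (p y) \<partial>lborel) * (\<delta> * (\<integral>x. cmod (fourier \<eta> x) \<partial>lborel) + B * (\<integral>x. v x \<partial>lborel))"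
proof -
  let ?c = "fconst TYPE('d)"
  define L where "L = (\<integral>x. cmod (fourier \<eta> x) \<partial>lborel)"
  define P where "P = (\<integral>y. cmod (p y) \<partial>lborel)"
  define V where "V = (\<integral>x. v x \<partial>lborel)"
  have nn: "0 \<le> L" "0 \<le> P" "0 \<le> V" using v(2) by (simp_all add: L_def P_def V_def integral_nonneg_AE)
  have B: "0 \<le> B" using K(2)[of 0] norm_ge_zero order_trans by blast
  have [measurable]: "p \<in> borel_measurable borel" "\<eta> \<in> borel_measurable borel" "v \<in> borel_measurable borel"
    "fourier \<eta> \<in> borel_measurable borel"
    using p \<eta> v(1) fourier_measurable[OF \<eta>] by auto
  have rep: "fourier (\<lambda>k. fourier p k * \<eta> k) x = of_real ?c * (\<integral>y. p y * fourier \<eta> (x + y) \<partial>lborel)" for x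
  proof -
    let ?e = "\<lambda>k. exp (- \<i> * of_real (x \<bullet> k)) * \<eta> k"
    have e: "integrable lborel ?e" by (rule integrable_character[OF \<eta>])
    have "fourier ?e y = fourier \<eta> (x + y)" for y
    proof -
      have "exp (- \<i> * of_real (y \<bullet> k)) * ?e k = exp (- \<i> * of_real ((x + y) \<bullet> k)) * \<eta> k" for k
      proof -
        have "exp (- \<i> * of_real (y \<bullet> k)) * exp (- \<i> * of_real (x \<bullet> k)) = exp (- \<i> * of_real ((x + y) \<bullet> k))"
          unfolding mult_exp_exp by (rule arg_cong[where f=exp]) (simp add: inner_add_left distrib_left)
        then show ?thesis by (simp only: mult.assoc[symmetric])
      qed
      then show ?thesis by (simp only: fourier_def)
    qed
    moreover have "(\<integral>k. fourier p k * ?e k \<partial>lborel) = (\<integral>y. p y * fourier ?e y \<partial>lborel)"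
      by (rule multiplication_formula[OF p e])
    ultimately show ?thesis
      by (simp only: fourier_def[of "\<lambda>k. fourier p k * \<eta> k"] mult.left_commute)
  qed
  have inner: "(\<integral>\<^sup>+x. ennreal (cmod (u x)) * ennreal (cmod (fourier \<eta> (x + y))) \<partial>lborel) \<le> ennreal (\<delta> * L + B * V)" for y
  proof -
    have "(\<integral>\<^sup>+x. ennreal (cmod (u x)) * ennreal (cmod (fourier \<eta> (x + y))) \<partial>lborel)
       \<le> (\<integral>\<^sup>+x. ennreal \<delta> * ennreal (cmod (fourier \<eta> (y + 1 *\<^sub>R x))) + ennreal B * ennreal (v x) \<partial>lborel)"
    proof (rule nn_integral_mono)
      fix x
      have "cmod (u x) * cmod (fourier \<eta> (x + y)) \<le> (\<delta> + v x) * cmod (fourier \<eta> (x + y))"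
        by (intro mult_right_mono v) simp
      also have "\<dots> \<le> \<delta> * cmod (fourier \<eta> (x + y)) + B * v x"
        using mult_left_mono[OF K(2)[of "x + y"] v(2)[of x]] by (simp add: distrib_right mult.commute)
      finally show "ennreal (cmod (u x)) * ennreal (cmod (fourier \<eta> (x + y))) \<le> ennreal \<delta> * ennreal (cmod (fourier \<eta> (y + 1 *\<^sub>R x))) + ennreal B * ennreal (v x)"
        using \<delta> B v(2)[of x] by (simp add: ennreal_mult[symmetric] add.commute ennreal_leI flip: ennreal_plus)
    qed
    also have "\<dots> = ennreal \<delta> * (\<integral>\<^sup>+x. ennreal (cmod (fourier \<eta> (y + 1 *\<^sub>R x))) \<partial>lborel) + ennreal B * (\<integral>\<^sup>+x. ennreal (v x) \<partial>lborel)"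
      by (simp add: nn_integral_add nn_integral_cmult)
    also have "(\<integral>\<^sup>+x. ennreal (cmod (fourier \<eta> (y + 1 *\<^sub>R x))) \<partial>lborel) = (\<integral>\<^sup>+x. ennreal (cmod (fourier \<eta> x)) \<partial>lborel)"
      using nn_integral_lborel_scale[of "\<lambda>x. ennreal (cmod (fourier \<eta> x))" 1 y] by simp
    also have "\<dots> = ennreal L" unfolding L_def using K(1) by (intro nn_integral_eq_integral) auto
    also have "(\<integral>\<^sup>+x. ennreal (v x) \<partial>lborel) = ennreal V" unfolding V_def using v by (intro nn_integral_eq_integral) auto
    also have "ennreal \<delta> * ennreal L + ennreal B * ennreal V = ennreal (\<delta> * L + B * V)"
      using \<delta> B nn by (simp add: ennreal_mult)
    finally show ?thesis .
  qed
  have "ennreal (cmod (\<integral>x. u x * fourier (\<lambda>k. fourier p k * \<eta> k) x \<partial>lborel))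
     \<le> (\<integral>\<^sup>+x. ennreal (cmod (u x * fourier (\<lambda>k. fourier p k * \<eta> k) x)) \<partial>lborel)"
    by (rule norm_integral_le_nn_integral)
  also have "\<dots> \<le> (\<integral>\<^sup>+x. ennreal ?c * (\<integral>\<^sup>+y. ennreal (cmod (u x)) * (ennreal (cmod (p y)) * ennreal (cmod (fourier \<eta> (x + y)))) \<partial>lborel) \<partial>lborel)"
  proof (rule nn_integral_mono)
    fix x
    have "ennreal (cmod (\<integral>y. p y * fourier \<eta> (x + y) \<partial>lborel)) \<le> (\<integral>\<^sup>+y. ennreal (cmod (p y * fourier \<eta> (x + y))) \<partial>lborel)"
      by (rule norm_integral_le_nn_integral)
    then have "ennreal (cmod (u x)) * (ennreal ?c * ennreal (cmod (\<integral>y. p y * fourier \<eta> (x + y) \<partial>lborel)))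
       \<le> ennreal (cmod (u x)) * (ennreal ?c * (\<integral>\<^sup>+y. ennreal (cmod (p y * fourier \<eta> (x + y))) \<partial>lborel))"
      by (intro mult_left_mono) auto
    also have "\<dots> = ennreal ?c * (\<integral>\<^sup>+y. ennreal (cmod (u x)) * (ennreal (cmod (p y)) * ennreal (cmod (fourier \<eta> (x + y)))) \<partial>lborel)"
      by (subst nn_integral_cmult) (auto simp: norm_mult ennreal_mult mult_ac)
    finally show "ennreal (cmod (u x * fourier (\<lambda>k. fourier p k * \<eta> k) x)) \<le> ennreal ?c * (\<integral>\<^sup>+y. ennreal (cmod (u x)) * (ennreal (cmod (p y)) * ennreal (cmod (fourier \<eta> (x + y)))) \<partial>lborel)"
      by (simp add: rep norm_mult ennreal_mult)
  qed
  also have "\<dots> = ennreal ?c * (\<integral>\<^sup>+x. \<integral>\<^sup>+y. ennreal (cmod (u x)) * (ennreal (cmod (p y)) * ennreal (cmod (fourier \<eta> (x + y)))) \<partial>lborel \<partial>lborel)"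
    by (rule nn_integral_cmult) measurable
  also have "(\<integral>\<^sup>+x. \<integral>\<^sup>+y. ennreal (cmod (u x)) * (ennreal (cmod (p y)) * ennreal (cmod (fourier \<eta> (x + y)))) \<partial>lborel \<partial>lborel)
      = (\<integral>\<^sup>+y. \<integral>\<^sup>+x. ennreal (cmod (u x)) * (ennreal (cmod (p y)) * ennreal (cmod (fourier \<eta> (x + y)))) \<partial>lborel \<partial>lborel)"
    by (rule lborel_pair.Fubini'[symmetric]) measurable
  also have "\<dots> = (\<integral>\<^sup>+y. ennreal (cmod (p y)) * (\<integral>\<^sup>+x. ennreal (cmod (u x)) * ennreal (cmod (fourier \<eta> (x + y))) \<partial>lborel) \<partial>lborel)"
    by (intro nn_integral_cong) (subst nn_integral_cmult[symmetric], auto simp: mult_ac)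
  also have "\<dots> \<le> (\<integral>\<^sup>+y. ennreal (cmod (p y)) * ennreal (\<delta> * L + B * V) \<partial>lborel)"
    by (intro nn_integral_mono mult_left_mono inner) simp
  also have "\<dots> = (\<integral>\<^sup>+y. ennreal (cmod (p y)) \<partial>lborel) * ennreal (\<delta> * L + B * V)"
    by (rule nn_integral_multc) measurable
  also have "(\<integral>\<^sup>+y. ennreal (cmod (p y)) \<partial>lborel) = ennreal P"
    unfolding P_def using p by (intro nn_integral_eq_integral) auto
  also have "ennreal ?c * (ennreal P * ennreal (\<delta> * L + B * V)) = ennreal (?c * P * (\<delta> * L + B * V))"
    using nn B \<delta> by (simp add: ennreal_mult mult.assoc)
  finally have "ennreal (cmod (\<integral>x. u x * fourier (\<lambda>k. fourier p k * \<eta> k) x \<partial>lborel)) \<le> ennreal (?c * P * (\<delta> * L + B * V))"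
    by (simp add: mult_left_mono)
  then show ?thesis unfolding L_def P_def V_def
    using nn B \<delta> by (subst (asm) ennreal_le_iff) (auto simp: L_def P_def V_def)
qed

text \<open>
  Let \<open>p\<close> be Schwartz and remove a neighbourhood of the origin of size \<open>1/s\<close> from \<open>\<F>p\<close> by the cutoff
  \<open>flat (s\<^sup>2)\<close>. What is left has its transform in \<open>\<Phi>\<close>, so it does not see \<open>u\<close>. The removed part is convolution of
  \<open>p\<close> with a dilated kernel whose \<open>L\<^sup>1\<close> norm does not depend on \<open>s\<close> and whose supremum is \<open>O(s\<^bsup>-d\<^esup>)\<close>; by
  \<open>fourier_mult_bound\<close> it contributes \<open>O(\<delta>)\<close> for large \<open>s\<close>. Hence \<open>u\<close> annihilates all Schwartz functions,
  among them all characters times a Gaussian.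
\<close>

lemma Phi_annihilator_zero:
  fixes u :: "'d::finite fn"
  assumes u: "nearly_integrable u" and zero: "\<And>\<phi>. \<phi> \<in> Phi \<Longrightarrow> (LINT x|lborel. u x * \<phi> x) = 0"
  shows "AE x in lborel. u x = 0"
proof -
  define \<eta> :: "'d fn" where "\<eta> k = of_real (1 - flat 1 k)" for k
  have \<eta>: "\<eta> \<in> schwartz" unfolding \<eta>_def by (rule one_minus_flat_schwartz) simp
  define L where "L = (\<integral>x. cmod (fourier \<eta> x) \<partial>lborel)"
  have L: "L \<ge> 0" unfolding L_def by (simp add: integral_nonneg_AE)
  obtain B where B: "B \<ge> 0" "\<And>x. wt x ^ 0 * cmod (fourier \<eta> x) \<le> B"
    using rapidE[OF schwartz_rapid[OF fourier_schwartz[OF \<eta>]]] by blast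
  have um: "u \<in> borel_measurable borel" by (rule nearly_integrable_measurable[OF u])
  have test: "(\<integral>x. u x * p (- x) \<partial>lborel) = 0" if p: "p \<in> schwartz" for p :: "'d fn"
  proof -
    define I where "I = (\<integral>x. u x * p (- x) \<partial>lborel)"
    define P where "P = (\<integral>y. cmod (p y) \<partial>lborel)"
    let ?c = "fconst TYPE('d)"
    have P: "P \<ge> 0" unfolding P_def by (simp add: integral_nonneg_AE)
    have bound: "cmod I \<le> ?c * P * (\<delta> * L + (B / s ^ CARD('d)) * (\<integral>x. v x \<partial>lborel))"
      if s: "s > 0" and \<delta>: "\<delta> > 0" and v: "integrable lborel v" "\<And>x. 0 \<le> v x" "\<And>x. cmod (u x) \<le> \<delta> + v x"
      for s \<delta> :: real and v :: "real^'d \<Rightarrow> real"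
    proof -
      define \<eta>s :: "'d fn" where "\<eta>s k = of_real (1 - flat (s\<^sup>2) k)" for k
      have s2: "s\<^sup>2 > 0" using s by simp
      have \<eta>s: "\<eta>s \<in> schwartz" unfolding \<eta>s_def by (rule one_minus_flat_schwartz[OF s2])
      have \<eta>s': "\<eta>s = (\<lambda>k. \<eta> (s *\<^sub>R k))" by (rule ext) (simp add: \<eta>s_def \<eta>_def flat_scale[OF s])
      have F: "fourier \<eta>s x = of_real (1 / s ^ CARD('d)) * fourier \<eta> (inverse s *\<^sub>R x)" for x
        unfolding \<eta>s' by (rule fourier_scale[OF s schwartz_measurable[OF \<eta>]])
      have Fi: "integrable lborel (fourier \<eta>s)" by (intro schwartz_integrable fourier_schwartz \<eta>s)
      have Fb: "cmod (fourier \<eta>s x) \<le> B / s ^ CARD('d)" for x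
        using B(2)[of "inverse s *\<^sub>R x"] s by (simp add: F norm_mult norm_divide norm_power divide_right_mono)
      have FL: "(\<integral>x. cmod (fourier \<eta>s x) \<partial>lborel) = L"
      proof -
        have m: "(\<lambda>x. cmod (fourier \<eta>s x)) \<in> borel_measurable borel"
          using schwartz_measurable[OF fourier_schwartz[OF \<eta>s]] by simp
        have "(\<integral>x. cmod (fourier \<eta>s x) \<partial>lborel) = s ^ CARD('d) *\<^sub>R (\<integral>x. cmod (fourier \<eta>s (0 + s *\<^sub>R x)) \<partial>lborel)"
          using integral_lborel_scale[OF _ m, of s 0] s by simp
        also have "\<dots> = L" using s by (simp add: F L_def norm_mult norm_divide norm_power)
        finally show ?thesis .
      qed
      have q: "fourier p \<in> schwartz" by (rule fourier_schwartz[OF p])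
      have split: "fourier (\<lambda>k. fourier p k * of_real (flat (s\<^sup>2) k)) x = p (- x) - fourier (\<lambda>k. fourier p k * \<eta>s k) x" for x
      proof -
        have "fourier p k * of_real (flat (s\<^sup>2) k) = fourier p k - fourier p k * \<eta>s k" for k
          by (simp add: \<eta>s_def algebra_simps)
        then show ?thesis
          using fourier_diff[OF schwartz_integrable[OF q] schwartz_integrable[OF schwartz_mult[OF q \<eta>s]], of x] schwartz_inversion[OF p]
          by simp
      qed
      have "(LINT x|lborel. u x * fourier (\<lambda>k. fourier p k * of_real (flat (s\<^sup>2) k)) x) = 0"
        by (intro zero fourier_Psi_in_Phi schwartz_mult_flat0[OF s2 q])
      then have "I = (\<integral>x. u x * fourier (\<lambda>k. fourier p k * \<eta>s k) x \<partial>lborel)"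
        using nearly_integrable_mult[OF u schwartz_reflect[OF p]] nearly_integrable_mult[OF u fourier_schwartz[OF schwartz_mult[OF q \<eta>s]]]
        by (simp add: split right_diff_distrib I_def)
      then show ?thesis
        using fourier_mult_bound[OF um schwartz_integrable[OF p] schwartz_integrable[OF \<eta>s] v less_imp_le[OF \<delta>] Fi Fb]
        by (simp only: FL P_def)
    qed
    have "cmod I \<le> 0 + e" if e: "e > 0" for e
    proof -
      define \<delta> where "\<delta> = e / (?c * P * (L + 1) + 1)"
      have den: "?c * P * (L + 1) + 1 > 0" using P L by (simp add: add_nonneg_pos)
      have \<delta>: "\<delta> > 0" using e den by (simp add: \<delta>_def)
      obtain v :: "real^'d \<Rightarrow> real" where v: "integrable lborel v" "\<And>x. 0 \<le> v x" "\<And>x. cmod (u x) \<le> \<delta> + v x"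
        using nearly_integrableE[OF u \<delta>] by blast
      define V where "V = (\<integral>x. v x \<partial>lborel)"
      have V: "V \<ge> 0" unfolding V_def using v(2) by (simp add: integral_nonneg_AE)
      \<comment> \<open>First \<open>\<delta>\<close>, then the splitting of \<open>u\<close>, which fixes \<open>V\<close>, and only then the dilation \<open>s\<close>.\<close>
      define s where "s = max 1 (B * V / \<delta>)"
      have s: "s \<ge> 1" "B * V / \<delta> \<le> s" by (simp_all add: s_def)
      have "s \<le> s ^ CARD('d)" using s(1) by (simp add: self_le_power)
      then have "B * V \<le> \<delta> * s ^ CARD('d)" using s(2) \<delta> by (simp add: divide_le_eq mult.commute) (meson mult_left_mono order_trans less_imp_le)
      then have small: "B / s ^ CARD('d) * V \<le> \<delta>" using s(1) by (simp add: divide_le_eq)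
      have "cmod I \<le> ?c * P * (\<delta> * L + (B / s ^ CARD('d)) * V)"
        unfolding V_def by (rule bound[OF _ \<delta> v]) (use s in simp)
      also have "\<dots> \<le> ?c * P * (\<delta> * L + \<delta>)" using small P by (intro mult_left_mono add_left_mono) auto
      also have "\<dots> = (?c * P * (L + 1)) * \<delta>" by (simp add: algebra_simps)
      also have "\<dots> \<le> (?c * P * (L + 1) + 1) * \<delta>" using \<delta> by (simp add: distrib_right)
      also have "\<dots> = e" using den by (simp add: \<delta>_def)
      finally show ?thesis by simp
    qed
    then have "cmod I \<le> 0" by (rule field_le_epsilon)
    then show ?thesis by (simp add: I_def)
  qed
  have "AE x in lborel. u x * of_real (gauss x) = 0"
  proof (rule fourier_injective_L1)
    show "integrable lborel (\<lambda>x. u x * of_real (gauss x))" by (rule nearly_integrable_mult[OF u schwartz_gauss])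
    fix a
    have "(\<integral>x. u x * (exp (\<i> * of_real (a \<bullet> (- x))) * of_real (gauss (- x))) \<partial>lborel) = 0"
      by (rule test[OF schwartz_modulate[OF schwartz_gauss]])
    then show "fourier (\<lambda>x. u x * of_real (gauss x)) a = 0"
      by (simp add: fourier_def gauss_minus mult.left_commute)
  qed
  then show ?thesis
  proof eventually_elim
    case (elim x)
    then show ?case using gauss_pos[of x] by simp
  qed
qed

lemma functional_of_injective:
  fixes f g :: "'d::finite fn"
  assumes f: "nearly_integrable f" and g: "nearly_integrable g" and eq: "functional_of f = functional_of g"
  shows "AE x in lborel. f x = g x"
proof -
  have "AE x in lborel. f x - g x = 0"
  proof (rule Phi_annihilator_zero[OF nearly_integrable_diff[OF f g]])
    fix \<phi> :: "'d fn" assume \<phi>: "\<phi> \<in> Phi"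
    have "(LINT x|lborel. f x * \<phi> x) = (LINT x|lborel. g x * \<phi> x)"
      using fun_cong[OF eq, of \<phi>] \<phi> by (simp add: functional_of_def)
    then show "(LINT x|lborel. (f x - g x) * \<phi> x) = 0"
      using nearly_integrable_mult[OF f Phi_schwartz[OF \<phi>]] nearly_integrable_mult[OF g Phi_schwartz[OF \<phi>]]
      by (simp add: left_diff_distrib)
  qed
  then show ?thesis by simp
qed

text \<open>
  In \<open>C\<^sub>0\<close> the integrable part is supported in a large ball. In \<open>L\<^sup>p\<close> the function \<open>\<delta>\<^bsup>1-p\<^esup> |f|\<^sup>p\<close> is integrable and
  dominates \<open>|f|\<close> wherever \<open>|f| > \<delta>\<close>.
\<close>

lemma Lp_fun_nearly_integrable:
  fixes f :: "'d::finite fn"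
  assumes f: "f \<in> Lp_fun r" and r: "1 \<le> r"
  shows "nearly_integrable f"
proof (cases "r = \<infinity>")
  case True
  then have c: "continuous_on UNIV f" and lim: "(f \<longlongrightarrow> 0) at_infinity" using f by (simp_all add: Lp_fun_def)
  show ?thesis unfolding nearly_integrable_def
  proof (intro conjI allI impI)
    show "f \<in> borel_measurable borel" using c by (rule borel_measurable_continuous_onI)
    fix \<delta> :: real assume \<delta>: "\<delta> > 0"
    then obtain R where R: "\<And>x. R \<le> norm x \<Longrightarrow> cmod (f x) < \<delta>"
      using lim unfolding Lim_at_infinity by (auto simp: dist_norm)
    have "compact (f ` cball 0 R)"
      by (intro compact_continuous_image continuous_on_subset[OF c]) auto
    then have "bounded (f ` cball 0 R)" by (rule compact_imp_bounded)
    then obtain M where "\<forall>y\<in>f ` cball 0 R. cmod y \<le> M" unfolding bounded_iff by blast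
    then have M: "\<And>x. x \<in> cball 0 R \<Longrightarrow> cmod (f x) \<le> M" by blast
    define v :: "real^'d \<Rightarrow> real" where "v x = \<bar>M\<bar> * indicator (cball 0 R) x" for x
    have "integrable lborel v" unfolding v_def
      by (intro integrable_mult_right integrable_real_indicator emeasure_lborel_cball_finite) simp
    moreover have "cmod (f x) \<le> \<delta> + v x" for x
    proof (cases "x \<in> cball 0 R")
      case True
      then show ?thesis using M[OF True] \<delta> by (simp add: v_def)
    next
      case False
      then show ?thesis using R[of x] by (simp add: v_def)
    qed
    moreover have "0 \<le> v x" for x by (simp add: v_def)
    ultimately show "\<exists>v::real^'d \<Rightarrow> real. integrable lborel v \<and> (\<forall>x. 0 \<le> v x) \<and> (\<forall>x. cmod (f x) \<le> \<delta> + v x)" by blast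
  qed
next
  case False
  define R where "R = real_of_ereal r"
  have R: "R \<ge> 1" using r False by (cases r) (auto simp: R_def)
  have m: "f \<in> borel_measurable borel" and i: "integrable lborel (\<lambda>x. cmod (f x) powr R)"
    using f False by (auto simp: Lp_fun_def R_def)
  show ?thesis unfolding nearly_integrable_def
  proof (intro conjI allI impI)
    show "f \<in> borel_measurable borel" by (rule m)
    fix \<delta> :: real assume \<delta>: "\<delta> > 0"
    define v where "v x = \<delta> powr (1 - R) * cmod (f x) powr R" for x
    have "integrable lborel v" unfolding v_def by (intro integrable_mult_right i)
    moreover have "0 \<le> v x" for x by (simp add: v_def)
    moreover have "cmod (f x) \<le> \<delta> + v x" for x
    proof (cases "cmod (f x) \<le> \<delta>")
      case True
      then show ?thesis by (simp add: v_def add_increasing2)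
    next
      case False
      then have p: "cmod (f x) > 0" using \<delta> by linarith
      have "cmod (f x) = cmod (f x) powr (1 - R) * cmod (f x) powr R"
        using p by (simp flip: powr_add)
      also have "\<dots> \<le> v x" unfolding v_def using False \<delta> R
        by (intro mult_right_mono powr_mono2') auto
      finally show ?thesis using \<delta> by simp
    qed
    ultimately show "\<exists>v::real^'d \<Rightarrow> real. integrable lborel v \<and> (\<forall>x. 0 \<le> v x) \<and> (\<forall>x. cmod (f x) \<le> \<delta> + v x)" by blast
  qed
qed

text \<open>
  The representative chosen in the definition of \<open>Lp_norm\<close> agrees almost everywhere with \<open>f\<close>, hence has the same
  norm; two continuous functions that agree almost everywhere are equal.
\<close>

lemma Lp_norm_functional_of:
  fixes f :: "'d::finite fn"
  assumes f: "f \<in> Lp_fun r" and r: "1 \<le> r"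
  shows "Lp_norm r (functional_of f) = Lp_fun_norm r f"
proof -
  define g where "g = inv_into (Lp_fun r) functional_of (functional_of f)"
  have g: "g \<in> Lp_fun r" and eq: "functional_of g = functional_of f"
    unfolding g_def using inv_into_into[OF imageI[OF f], of functional_of] f_inv_into_f[OF imageI[OF f], of functional_of] by simp_all
  have ae: "AE x in lborel. g x = f x"
    by (rule functional_of_injective[OF Lp_fun_nearly_integrable[OF g r] Lp_fun_nearly_integrable[OF f r] eq])
  have "Lp_fun_norm r g = Lp_fun_norm r f"
  proof (cases "r = \<infinity>")
    case True
    then have c: "continuous_on UNIV f" "continuous_on UNIV g" using f g by (simp_all add: Lp_fun_def)
    have "closed {x. g x = f x}" by (rule closed_Collect_eq[OF c(2,1)])
    moreover have "AE x in lebesgue. x \<in> {x. g x = f x}" using AE_completion[OF ae] by simp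
    ultimately have "x \<in> {x. g x = f x}" for x by (rule mem_closed_if_AE_lebesgue)
    then have "g = f" by auto
    then show ?thesis by simp
  next
    case False
    then have [measurable]: "f \<in> borel_measurable borel" "g \<in> borel_measurable borel" using f g by (auto simp: Lp_fun_def)
    have "(LINT x|lborel. cmod (g x) powr real_of_ereal r) = (LINT x|lborel. cmod (f x) powr real_of_ereal r)"
      by (rule integral_cong_AE) (use ae in auto)
    then show ?thesis using False by (simp add: Lp_fun_norm_def)
  qed
  then show ?thesis by (simp add: Lp_norm_def g_def)
qed

section \<open>The Fourier transform on \<open>L\<^sup>2\<close>\<close>

definition cut :: "real \<Rightarrow> 'd::finite fn \<Rightarrow> 'd fn" where
  "cut A G k = (if norm k \<le> A then G k else 0)"

lemma cut_measurable [measurable]: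
  fixes G :: "'d::finite fn"
  assumes [measurable]: "G \<in> borel_measurable borel"
  shows "cut A G \<in> borel_measurable borel"
proof -
  have "cut A G = (\<lambda>k. indicator (cball 0 A) k *\<^sub>R G k)" by (auto simp: cut_def fun_eq_iff)
  moreover have "(\<lambda>k. indicator (cball 0 A) k *\<^sub>R G k) \<in> borel_measurable borel"
    by (intro borel_measurable_scaleR borel_measurable_indicator assms) simp
  ultimately show ?thesis by (simp only:)
qed

lemma cut_integrable:
  fixes G :: "'d::finite fn"
  assumes [measurable]: "G \<in> borel_measurable borel" and L2: "L2sq G < \<infinity>"
  shows "integrable lborel (cut A G)"
proof -
  have i: "integrable lborel (\<lambda>k. (cmod (G k))\<^sup>2)"
    by (rule integrableI_nonneg) (use L2 in \<open>auto simp: L2sq_def\<close>)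
  have j: "integrable lborel (\<lambda>k::real^'d. indicator (cball 0 A) k :: real)"
    by (intro integrable_real_indicator emeasure_lborel_cball_finite) simp
  show ?thesis
  proof (rule Bochner_Integration.integrable_bound[OF Bochner_Integration.integrable_add[OF i j]])
    have "cmod (cut A G k) \<le> (cmod (G k))\<^sup>2 + indicator (cball 0 A) k" for k
    proof (cases "norm k \<le> A")
      case True
      have "2 * cmod (G k) * 1 \<le> (cmod (G k))\<^sup>2 + 1\<^sup>2" by (rule sum_squares_bound)
      then have "cmod (G k) \<le> (cmod (G k))\<^sup>2 + 1" using norm_ge_zero[of "G k"] unfolding power_one mult_1_right by linarith
      then show ?thesis using True by (simp add: cut_def)
    qed (simp add: cut_def)
    then show "AE k in lborel. norm (cut A G k) \<le> norm ((cmod (G k))\<^sup>2 + indicator (cball 0 A) k)"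
      by (intro AE_I2) (smt (verit) real_norm_def)
  qed simp
qed

lemma L2sq_mono: "(\<And>k. cmod (f k) \<le> cmod (g k)) \<Longrightarrow> L2sq f \<le> L2sq g"
  unfolding L2sq_def by (intro nn_integral_mono ennreal_leI power_mono) auto

lemma tail_tendsto_zero:
  fixes G :: "'d::finite fn"
  assumes [measurable]: "G \<in> borel_measurable borel" and L2: "L2sq G < \<infinity>"
  shows "(\<lambda>n. L2sq (\<lambda>k. G k - cut (real n) G k)) \<longlonglongrightarrow> 0"
proof -
  have "(\<lambda>n. \<integral>\<^sup>+k. ennreal ((cmod (G k - cut (real n) G k))\<^sup>2) \<partial>lborel) \<longlonglongrightarrow> (\<integral>\<^sup>+k. 0 \<partial>(lborel :: (real^'d) measure))"
  proof (rule nn_integral_dominated_convergence[where w="\<lambda>k. ennreal ((cmod (G k))\<^sup>2)"])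
    show "AE k in lborel. (\<lambda>n. ennreal ((cmod (G k - cut (real n) G k))\<^sup>2)) \<longlonglongrightarrow> 0"
    proof (rule AE_I2)
      fix k :: "real^'d"
      have "eventually (\<lambda>n. norm k \<le> real n) sequentially"
        using eventually_ge_at_top[of "nat \<lceil>norm k\<rceil>"] by eventually_elim linarith
      then have "eventually (\<lambda>n. ennreal ((cmod (G k - cut (real n) G k))\<^sup>2) = 0) sequentially"
        by eventually_elim (simp add: cut_def)
      then show "(\<lambda>n. ennreal ((cmod (G k - cut (real n) G k))\<^sup>2)) \<longlonglongrightarrow> 0" by (rule tendsto_eventually)
    qed
    show "AE k in lborel. ennreal ((cmod (G k - cut (real n) G k))\<^sup>2) \<le> ennreal ((cmod (G k))\<^sup>2)" for n
      by (auto simp: cut_def)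
    show "(\<integral>\<^sup>+k. ennreal ((cmod (G k))\<^sup>2) \<partial>lborel) < \<infinity>" using L2 by (simp add: L2sq_def)
  qed auto
  then show ?thesis by (simp add: L2sq_def)
qed

text \<open>
  The summand bounds the increments by a geometric sequence with ratio \<open>sqrt (1/2)\<close>.
\<close>

lemma convergent_of_geometric_sum:
  fixes f :: "nat \<Rightarrow> complex"
  assumes "(\<Sum>m. ennreal (2 ^ m * (cmod (f (Suc m) - f m))\<^sup>2)) < \<infinity>"
  shows "convergent f"
proof -
  define K where "K = enn2real (\<Sum>m. ennreal (2 ^ m * (cmod (f (Suc m) - f m))\<^sup>2))"
  have K: "0 \<le> K" unfolding K_def by (rule enn2real_nonneg)
  have KS: "ennreal K = (\<Sum>m. ennreal (2 ^ m * (cmod (f (Suc m) - f m))\<^sup>2))"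
    unfolding K_def using assms unfolding infinity_ennreal_def by (rule ennreal_enn2real)
  have le: "cmod (f (Suc m) - f m) \<le> sqrt K * sqrt (1/2) ^ m" for m
  proof -
    have "ennreal (2 ^ m * (cmod (f (Suc m) - f m))\<^sup>2) = (\<Sum>n\<in>{m}. ennreal (2 ^ n * (cmod (f (Suc n) - f n))\<^sup>2))" by simp
    also have "\<dots> \<le> ennreal K" unfolding KS by (rule sum_le_suminf) (auto intro: summableI)
    finally have "2 ^ m * (cmod (f (Suc m) - f m))\<^sup>2 \<le> K" using K by (simp only: ennreal_le_iff)
    then have "(cmod (f (Suc m) - f m))\<^sup>2 \<le> K * (1/2) ^ m" by (simp add: power_one_over field_simps)
    then have "sqrt ((cmod (f (Suc m) - f m))\<^sup>2) \<le> sqrt (K * (1/2) ^ m)" by (rule real_sqrt_le_mono)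
    then show ?thesis by (simp add: real_sqrt_mult real_sqrt_power)
  qed
  have "summable (\<lambda>m. sqrt K * sqrt (1/2) ^ m)"
    by (intro summable_mult summable_geometric) (simp add: real_sqrt_lt_1_iff)
  then have "summable (\<lambda>m. f (Suc m) - f m)"
    by (rule summable_comparison_test') (use le in simp)
  then have "(\<lambda>n. \<Sum>m<n. f (Suc m) - f m) \<longlonglongrightarrow> (\<Sum>m. f (Suc m) - f m)" by (rule summable_LIMSEQ)
  then have "(\<lambda>n. f n - f 0) \<longlonglongrightarrow> (\<Sum>m. f (Suc m) - f m)" by (simp add: sum_lessThan_telescope)
  then have "(\<lambda>n. (f n - f 0) + f 0) \<longlonglongrightarrow> (\<Sum>m. f (Suc m) - f m) + f 0" by (intro tendsto_add tendsto_const)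
  then show ?thesis by (auto simp: convergent_def)
qed

text \<open>
  The truncations of \<open>G\<close> to balls are integrable and form a Cauchy sequence in \<open>L\<^sup>2\<close>; so do their transforms, by
  the \<open>L\<^sup>2\<close> bound. The limit is constructed by hand as the pointwise limit of a rapidly converging subsequence,
  and Fatou's lemma carries the tail estimate over to it.
\<close>

lemma L2_fourier_exists:
  fixes G :: "'d::finite fn"
  assumes Gm[measurable]: "G \<in> borel_measurable borel" and L2: "L2sq G < \<infinity>"
  obtains F :: "'d fn" where "F \<in> borel_measurable borel"
    "\<And>A. L2sq (\<lambda>x. F x - fourier (cut A G) x) \<le> L2sq (\<lambda>k. G k - cut A G k)"
proof -
  define \<tau> where "\<tau> A = L2sq (\<lambda>k. G k - cut A G k)" for A
  have tail: "(\<lambda>n. \<tau> (real n)) \<longlonglongrightarrow> 0" unfolding \<tau>_def by (rule tail_tendsto_zero[OF Gm L2])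
  have int: "integrable lborel (cut A G)" for A by (rule cut_integrable[OF Gm L2])
  have [measurable]: "fourier (cut A G) \<in> borel_measurable borel" for A by (rule fourier_measurable[OF int])
  have contr: "L2sq (\<lambda>x. fourier (cut A G) x - fourier (cut B G) x) \<le> L2sq (\<lambda>k. cut A G k - cut B G k)" for A B
    using fourier_L2_contraction[of "\<lambda>k. cut A G k - cut B G k"] int
    by (simp add: fourier_diff[symmetric])
  have "\<exists>n\<ge>m. \<tau> (real n) \<le> ennreal ((1/4) ^ m)" for m
  proof -
    have "eventually (\<lambda>n. \<tau> (real n) < ennreal ((1/4) ^ m)) sequentially"
      by (rule order_tendstoD(2)[OF tail]) simp
    then have "eventually (\<lambda>n. n \<ge> m \<and> \<tau> (real n) < ennreal ((1/4) ^ m)) sequentially"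
      using eventually_ge_at_top[of m] by eventually_elim simp
    then obtain n where "n \<ge> m" "\<tau> (real n) < ennreal ((1/4) ^ m)"
      using eventually_happens'[OF sequentially_bot] by blast
    then show ?thesis by (intro exI[of _ n]) (simp add: less_imp_le)
  qed
  then obtain N where N: "\<And>m. m \<le> N m" "\<And>m. \<tau> (real (N m)) \<le> ennreal ((1/4) ^ m)" by metis
  \<comment> \<open>The squared tails decay like \<open>4\<^bsup>-m\<^esup>\<close> along \<open>N\<close>, which leaves room for the weights \<open>2\<^sup>m\<close> that force almost
    everywhere convergence.\<close>
  define f where "f m = fourier (cut (real (N m)) G)" for m
  have fm[measurable]: "f m \<in> borel_measurable borel" for m unfolding f_def by measurable
  have step: "L2sq (\<lambda>x. f (Suc m) x - f m x) \<le> ennreal (2 * (1/4) ^ m)" for m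
  proof -
    have "L2sq (\<lambda>x. f (Suc m) x - f m x) \<le> L2sq (\<lambda>k. cut (real (N (Suc m))) G k - cut (real (N m)) G k)"
      unfolding f_def by (rule contr)
    also have "\<dots> \<le> \<tau> (real (N m)) + \<tau> (real (N (Suc m)))"
      unfolding \<tau>_def L2sq_def by (subst nn_integral_add[symmetric], measurable, intro nn_integral_mono) (auto simp: cut_def)
    also have "\<dots> \<le> ennreal ((1/4) ^ m) + ennreal ((1/4) ^ Suc m)" by (intro add_mono N)
    also have "\<dots> = ennreal ((1/4) ^ m + (1/4) ^ Suc m)" by (subst ennreal_plus) auto
    also have "\<dots> \<le> ennreal (2 * (1/4) ^ m)" by (intro ennreal_leI) simp
    finally show ?thesis .
  qed
  have "(\<integral>\<^sup>+x. (\<Sum>m. ennreal (2 ^ m * (cmod (f (Suc m) x - f m x))\<^sup>2)) \<partial>lborel)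
      = (\<Sum>m. \<integral>\<^sup>+x. ennreal (2 ^ m * (cmod (f (Suc m) x - f m x))\<^sup>2) \<partial>lborel)"
    by (rule nn_integral_suminf) measurable
  also have "\<dots> = (\<Sum>m. ennreal (2 ^ m) * L2sq (\<lambda>x. f (Suc m) x - f m x))"
    unfolding L2sq_def by (intro suminf_cong) (subst nn_integral_cmult[symmetric], measurable, simp add: ennreal_mult')
  also have "\<dots> \<le> (\<Sum>m. ennreal (2 * (1/2) ^ m))"
  proof (rule suminf_le)
    fix m
    have "ennreal (2 ^ m) * L2sq (\<lambda>x. f (Suc m) x - f m x) \<le> ennreal (2 ^ m) * ennreal (2 * (1/4) ^ m)"
      by (intro mult_left_mono step) simp
    also have "\<dots> = ennreal (2 ^ m * (2 * (1/4) ^ m))" by (simp add: ennreal_mult')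
    also have "2 ^ m * (2 * (1/4) ^ m) = 2 * (1/2 :: real) ^ m" by (simp flip: power_mult_distrib)
    finally show "ennreal (2 ^ m) * L2sq (\<lambda>x. f (Suc m) x - f m x) \<le> ennreal (2 * (1/2) ^ m)" .
  qed auto
  also have "\<dots> = ennreal (\<Sum>m. 2 * (1/2) ^ m)"
    by (intro suminf_ennreal2 summable_mult summable_geometric) auto
  also have "\<dots> < \<infinity>" by simp
  finally have "(\<integral>\<^sup>+x. (\<Sum>m. ennreal (2 ^ m * (cmod (f (Suc m) x - f m x))\<^sup>2)) \<partial>lborel) \<noteq> \<infinity>" by simp
  then have "AE x in lborel. (\<Sum>m. ennreal (2 ^ m * (cmod (f (Suc m) x - f m x))\<^sup>2)) \<noteq> \<infinity>"
    by (intro nn_integral_PInf_AE) measurable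
  then have conv: "AE x in lborel. convergent (\<lambda>m. f m x)"
    by eventually_elim (rule convergent_of_geometric_sum, simp add: less_top)
  define F where "F x = lim (\<lambda>m. f m x)" for x
  have Fm: "F \<in> borel_measurable borel" unfolding F_def by (rule borel_measurable_lim_metric) measurable
  note Fm[measurable]
  have lim: "AE x in lborel. (\<lambda>m. f m x) \<longlonglongrightarrow> F x"
    using conv by eventually_elim (simp add: F_def convergent_LIMSEQ_iff)
  have "L2sq (\<lambda>x. F x - fourier (cut A G) x) \<le> \<tau> A" for A
  proof -
    have "L2sq (\<lambda>x. F x - fourier (cut A G) x) = (\<integral>\<^sup>+x. liminf (\<lambda>m. ennreal ((cmod (f m x - fourier (cut A G) x))\<^sup>2)) \<partial>lborel)"
      unfolding L2sq_def
    proof (rule nn_integral_cong_AE, use lim in eventually_elim)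
      case (elim x)
      have "(\<lambda>m. ennreal ((cmod (f m x - fourier (cut A G) x))\<^sup>2)) \<longlonglongrightarrow> ennreal ((cmod (F x - fourier (cut A G) x))\<^sup>2)"
        by (intro tendsto_ennrealI tendsto_power tendsto_norm tendsto_diff elim tendsto_const)
      from lim_imp_Liminf[OF _ this] show ?case by simp
    qed
    also have "\<dots> \<le> liminf (\<lambda>m. \<integral>\<^sup>+x. ennreal ((cmod (f m x - fourier (cut A G) x))\<^sup>2) \<partial>lborel)"
      by (rule nn_integral_liminf) measurable
    also have "\<dots> \<le> liminf (\<lambda>m. \<tau> A)"
    proof (rule Liminf_mono)
      have "eventually (\<lambda>m. A \<le> real m) sequentially"
        using eventually_ge_at_top[of "nat \<lceil>A\<rceil>"] by eventually_elim linarith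
      then show "\<forall>\<^sub>F m in sequentially. (\<integral>\<^sup>+x. ennreal ((cmod (f m x - fourier (cut A G) x))\<^sup>2) \<partial>lborel) \<le> \<tau> A"
      proof eventually_elim
        case (elim m)
        then have A: "A \<le> real (N m)" using N(1)[of m] by linarith
        have "(\<integral>\<^sup>+x. ennreal ((cmod (f m x - fourier (cut A G) x))\<^sup>2) \<partial>lborel) \<le> L2sq (\<lambda>k. cut (real (N m)) G k - cut A G k)"
          using contr[of "real (N m)" A] by (simp add: f_def L2sq_def)
        also have "\<dots> \<le> \<tau> A" unfolding \<tau>_def by (rule L2sq_mono) (use A in \<open>auto simp: cut_def\<close>)
        finally show ?case .
      qed
    qed
    also have "\<dots> = \<tau> A" by (simp add: Liminf_const)
    finally show ?thesis .
  qed
  then show ?thesis using that[OF Fm] unfolding \<tau>_def by blast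
qed

text \<open>
  \<open>F\<close> is the \<open>L\<^sup>2\<close> Fourier transform of \<open>G\<close>. The form of the approximation clause serves two purposes: it gives the
  norm bound and the duality formula, and it is exactly the estimate of the high frequencies that the proof
  of \<open>fractional_sobolev\<close> relies on.
\<close>

definition L2_fourier_pair :: "'d::finite fn \<Rightarrow> 'd fn \<Rightarrow> bool" where
  "L2_fourier_pair G F \<longleftrightarrow> G \<in> borel_measurable borel \<and> L2sq G < \<infinity> \<and> F \<in> borel_measurable borel \<and>
    (\<forall>A. L2sq (\<lambda>x. F x - fourier (cut A G) x) \<le> L2sq (\<lambda>k. G k - cut A G k))"

lemma L2_fourier_norm:
  assumes "L2_fourier_pair G F" shows "L2sq F \<le> L2sq G"
proof -
  \<comment> \<open>A negative radius truncates to zero, so the approximation clause becomes the norm bound.\<close>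
  have "cut (-1) G = (\<lambda>_. 0)" using norm_ge_zero by (auto simp: cut_def fun_eq_iff) (smt (verit) norm_ge_zero)
  then show ?thesis using assms by (auto simp: L2_fourier_pair_def fourier_zero dest!: spec[of _ "-1"])
qed

lemma norm_integral_mult_le:
  fixes u \<phi> :: "'d::finite fn"
  assumes [measurable]: "u \<in> borel_measurable borel" "\<phi> \<in> borel_measurable borel"
  shows "ennreal ((cmod (\<integral>x. u x * \<phi> x \<partial>lborel))\<^sup>2) \<le> L2sq u * L2sq \<phi>"
proof -
  have "ennreal (cmod (\<integral>x. u x * \<phi> x \<partial>lborel)) \<le> (\<integral>\<^sup>+x. ennreal (cmod (u x)) * ennreal (cmod (\<phi> x)) \<partial>lborel)"
    using norm_integral_le_nn_integral[of lborel "\<lambda>x. u x * \<phi> x"] by (simp add: norm_mult ennreal_mult)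
  then have "(ennreal (cmod (\<integral>x. u x * \<phi> x \<partial>lborel)))\<^sup>2 \<le> (\<integral>\<^sup>+x. ennreal (cmod (u x)) * ennreal (cmod (\<phi> x)) \<partial>lborel)\<^sup>2"
    by (rule power_mono) simp
  also have "\<dots> \<le> (\<integral>\<^sup>+x. ennreal (cmod (u x)) ^ 2 \<partial>lborel) * (\<integral>\<^sup>+x. ennreal (cmod (\<phi> x)) ^ 2 \<partial>lborel)"
    by (rule Cauchy_Schwarz_nn_integral) auto
  finally show ?thesis by (simp add: L2sq_def ennreal_power)
qed

lemma schwartz_L2:
  assumes "\<phi> \<in> schwartz" shows "L2sq \<phi> < \<infinity>"
proof -
  obtain C where C: "C \<ge> 0" "\<And>x. wt x ^ 0 * cmod (\<phi> x) \<le> C" using rapidE[OF schwartz_rapid[OF assms]] by blast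
  have "L2sq \<phi> \<le> (\<integral>\<^sup>+x. ennreal C * ennreal (cmod (\<phi> x)) \<partial>lborel)"
    unfolding L2sq_def
  proof (rule nn_integral_mono)
    fix x
    have "(cmod (\<phi> x))\<^sup>2 \<le> C * cmod (\<phi> x)" unfolding power2_eq_square using C(2)[of x] by (intro mult_right_mono) auto
    then show "ennreal ((cmod (\<phi> x))\<^sup>2) \<le> ennreal C * ennreal (cmod (\<phi> x))"
      using C(1) by (simp add: ennreal_mult[symmetric] ennreal_leI)
  qed
  also have "\<dots> = ennreal C * (\<integral>\<^sup>+x. ennreal (cmod (\<phi> x)) \<partial>lborel)"
    using schwartz_measurable[OF assms] by (intro nn_integral_cmult) simp
  also have "\<dots> < \<infinity>" using schwartz_integrable[OF assms] by (simp add: integrable_iff_bounded ennreal_mult_less_top)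
  finally show ?thesis .
qed

lemma tendsto_zero_of_sq_le:
  fixes a :: "nat \<Rightarrow> complex"
  assumes "\<And>n. ennreal ((cmod (a n))\<^sup>2) \<le> \<tau> n * K" "\<tau> \<longlonglongrightarrow> (0::ennreal)" "K < \<infinity>"
  shows "a \<longlonglongrightarrow> 0"
proof -
  have "(\<lambda>n. \<tau> n * K) \<longlonglongrightarrow> 0 * K"
    using assms(2,3) by (intro tendsto_mult_ennreal tendsto_const) auto
  then have "(\<lambda>n. \<tau> n * K) \<longlonglongrightarrow> 0" by simp
  then have "(\<lambda>n. ennreal ((cmod (a n))\<^sup>2)) \<longlonglongrightarrow> 0"
    using assms(1) by (intro tendsto_sandwich[of "\<lambda>_. 0" "\<lambda>n. ennreal ((cmod (a n))\<^sup>2)" sequentially "\<lambda>n. \<tau> n * K" 0] always_eventually) auto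
  then have "(\<lambda>n. (cmod (a n))\<^sup>2) \<longlonglongrightarrow> 0" by (simp add: ennreal_tendsto_0_iff)
  then have "(\<lambda>n. sqrt ((cmod (a n))\<^sup>2)) \<longlonglongrightarrow> sqrt 0" by (rule tendsto_real_sqrt)
  then show ?thesis by (simp add: tendsto_norm_zero_iff)
qed

text \<open>
  The multiplication formula for truncations of \<open>G\<close>, followed by a limit in \<open>L\<^sup>2\<close> on both sides.
\<close>

lemma L2_fourier_duality:
  fixes G F :: "'d::finite fn"
  assumes GF: "L2_fourier_pair G F" and \<phi>: "\<phi> \<in> schwartz"
  shows "(\<integral>x. F x * \<phi> x \<partial>lborel) = (\<integral>k. G k * fourier \<phi> k \<partial>lborel)"
proof -
  have Gm[measurable]: "G \<in> borel_measurable borel" and GL: "L2sq G < \<infinity>" and Fm[measurable]: "F \<in> borel_measurable borel"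
    and GF': "\<And>A. L2sq (\<lambda>x. F x - fourier (cut A G) x) \<le> L2sq (\<lambda>k. G k - cut A G k)"
    using GF by (auto simp: L2_fourier_pair_def)
  have FL: "L2sq F < \<infinity>" using L2_fourier_norm[OF GF] GL by simp
  have int: "integrable lborel (cut A G)" for A by (rule cut_integrable[OF Gm GL])
  have [measurable]: "fourier (cut A G) \<in> borel_measurable borel" for A by (rule fourier_measurable[OF int])
  have q: "fourier \<phi> \<in> schwartz" by (rule fourier_schwartz[OF \<phi>])
  have [measurable]: "\<phi> \<in> borel_measurable borel" "fourier \<phi> \<in> borel_measurable borel"
    using schwartz_measurable \<phi> q by blast+
  have tail: "(\<lambda>n. L2sq (\<lambda>k. G k - cut (real n) G k)) \<longlonglongrightarrow> 0" by (rule tail_tendsto_zero[OF Gm GL])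
  define a where "a n = (\<integral>x. (F x - fourier (cut (real n) G) x) * \<phi> x \<partial>lborel)" for n
  define b where "b n = (\<integral>k. (G k - cut (real n) G k) * fourier \<phi> k \<partial>lborel)" for n
  have "a \<longlonglongrightarrow> 0"
  proof (rule tendsto_zero_of_sq_le[OF _ tail schwartz_L2[OF \<phi>]])
    fix n
    have "ennreal ((cmod (a n))\<^sup>2) \<le> L2sq (\<lambda>x. F x - fourier (cut (real n) G) x) * L2sq \<phi>"
      unfolding a_def by (rule norm_integral_mult_le) measurable
    also have "\<dots> \<le> L2sq (\<lambda>k. G k - cut (real n) G k) * L2sq \<phi>" by (intro mult_right_mono GF') simp
    finally show "ennreal ((cmod (a n))\<^sup>2) \<le> L2sq (\<lambda>k. G k - cut (real n) G k) * L2sq \<phi>" .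
  qed
  moreover have "b \<longlonglongrightarrow> 0"
  proof (rule tendsto_zero_of_sq_le[OF _ tail schwartz_L2[OF q]])
    show "ennreal ((cmod (b n))\<^sup>2) \<le> L2sq (\<lambda>k. G k - cut (real n) G k) * L2sq (fourier \<phi>)" for n
      unfolding b_def by (rule norm_integral_mult_le) measurable
  qed
  ultimately have "(\<lambda>n. a n - b n) \<longlonglongrightarrow> 0 - 0" by (rule tendsto_diff)
  moreover have "a n - b n = (\<integral>x. F x * \<phi> x \<partial>lborel) - (\<integral>k. G k * fourier \<phi> k \<partial>lborel)" for n
  proof -
    have i: "integrable lborel (\<lambda>x. F x * \<phi> x)" "integrable lborel (\<lambda>k. G k * fourier \<phi> k)"
      by (rule tempered_integrable[OF tempered_L2[OF Fm FL] \<phi>], rule tempered_integrable[OF tempered_L2[OF Gm GL] q])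
    have j: "integrable lborel (\<lambda>x. fourier (cut (real n) G) x * \<phi> x)"
      by (rule integrable_fourier_mult[OF int schwartz_integrable[OF \<phi>]])
    have k: "integrable lborel (\<lambda>k. cut (real n) G k * fourier \<phi> k)"
      using integrable_fourier_mult[OF schwartz_integrable[OF \<phi>] int[of "real n"]] by (simp add: mult.commute)
    show ?thesis
      using i j k multiplication_formula[OF int schwartz_integrable[OF \<phi>], of "real n"]
      by (simp add: a_def b_def left_diff_distrib)
  qed
  ultimately show ?thesis by (simp add: LIMSEQ_const_iff)
qed

lemma L2_fourier_pairE:
  fixes G :: "'d::finite fn"
  assumes "G \<in> borel_measurable borel" "L2sq G < \<infinity>"
  obtains F where "L2_fourier_pair G F"
proof -
  obtain F :: "'d fn" where F: "F \<in> borel_measurable borel" "\<And>A. L2sq (\<lambda>x. F x - fourier (cut A G) x) \<le> L2sq (\<lambda>k. G k - cut A G k)"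
    using L2_fourier_exists[OF assms] by blast
  then have "L2_fourier_pair G F" unfolding L2_fourier_pair_def using assms by simp
  then show ?thesis by (rule that)
qed

lemma L2sq_reflect:
  fixes G :: "'d::finite fn"
  assumes [measurable]: "G \<in> borel_measurable borel"
  shows "L2sq (\<lambda>k. G (- k)) = L2sq G"
  unfolding L2sq_def by (subst nn_integral_lborel_scale[of "\<lambda>k. ennreal ((cmod (G (- k)))\<^sup>2)" "-1" 0]) auto

text \<open>
  This is how a density is turned back into a function, up to the reflection in \<open>spectral\<close>;
  \<open>functional_of_L2_spectral\<close> goes in the opposite direction.
\<close>

lemma functional_of_L2_pair:
  fixes G F :: "'d::finite fn"
  assumes GF: "L2_fourier_pair (\<lambda>k. G (- k)) F"
  shows "functional_of F = spectral G"
  unfolding functional_of_def spectral_def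
proof (rule restrict_ext)
  fix \<phi> :: "'d fn" assume "\<phi> \<in> Phi"
  then have \<phi>: "\<phi> \<in> schwartz" by (rule Phi_schwartz)
  have [measurable]: "(\<lambda>k. G (- k)) \<in> borel_measurable borel" using GF by (simp add: L2_fourier_pair_def)
  have [measurable]: "fourier \<phi> \<in> borel_measurable borel" by (rule schwartz_measurable[OF fourier_schwartz[OF \<phi>]])
  have "(\<integral>x. F x * \<phi> x \<partial>lborel) = (\<integral>k. G (- k) * fourier \<phi> k \<partial>lborel)" by (rule L2_fourier_duality[OF GF \<phi>])
  also have "\<dots> = (\<integral>k. G k * fourier \<phi> (- k) \<partial>lborel)"
    by (subst integral_lborel_scale[of "-1" "\<lambda>k. G (- k) * fourier \<phi> k" 0]) auto
  finally show "(\<integral>x. F x * \<phi> x \<partial>lborel) = (\<integral>k. G k * fourier \<phi> (- k) \<partial>lborel)" .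
qed

lemma functional_of_L2_spectral:
  fixes f :: "'d::finite fn"
  assumes fm[measurable]: "f \<in> borel_measurable borel" and fL: "L2sq f < \<infinity>"
  obtains g :: "'d fn" where "g \<in> borel_measurable borel" "L2sq g \<le> L2sq f" "functional_of f = spectral g"
proof -
  obtain g where g: "L2_fourier_pair f g" using L2_fourier_pairE[OF fm fL] by blast
  have "functional_of f = spectral g"
    unfolding functional_of_def spectral_def
  proof (rule restrict_ext)
    fix \<phi> :: "'d fn" assume "\<phi> \<in> Phi"
    then have \<phi>: "\<phi> \<in> schwartz" by (rule Phi_schwartz)
    have "(\<integral>k. g k * fourier \<phi> (- k) \<partial>lborel) = (\<integral>x. f x * fourier (\<lambda>k. fourier \<phi> (- k)) x \<partial>lborel)"
      by (rule L2_fourier_duality[OF g schwartz_reflect[OF fourier_schwartz[OF \<phi>]]])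
    then show "(\<integral>x. f x * \<phi> x \<partial>lborel) = (\<integral>k. g k * fourier \<phi> (- k) \<partial>lborel)"
      by (simp add: fourier_reflect_fourier[OF \<phi>])
  qed
  then show ?thesis using that g L2_fourier_norm[OF g] by (auto simp: L2_fourier_pair_def)
qed

section \<open>Interpolation and the fractional Sobolev inequality\<close>

text \<open>
  Multiplication by \<open>|k|\<^sup>s\<close>, the action of \<open>D\<^sup>s\<close> on densities. As \<open>0 powr 0 = 0\<close>, \<open>riesz 0\<close> is the identity only
  off the origin, which is why some identities below hold almost everywhere.
\<close>

abbreviation riesz :: "real \<Rightarrow> 'd::finite fn \<Rightarrow> 'd fn" where
  "riesz s g \<equiv> \<lambda>k. of_real (norm k powr s) * g k"

lemma riesz_measurable [measurable]:
  fixes g :: "'d::finite fn"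
  assumes [measurable]: "g \<in> borel_measurable borel"
  shows "riesz s g \<in> borel_measurable borel"
  by measurable

lemma riesz_riesz: "riesz s (riesz t g) = riesz (s + t) g"
  by (simp add: powr_add mult.assoc fun_eq_iff)

lemma powr_squared: "(x powr s)\<^sup>2 = x powr (2 * s)" for x s :: real
  by (simp only: power2_eq_square mult_2 powr_add)

lemma L2sq_riesz: "L2sq (riesz s g) = (\<integral>\<^sup>+k. ennreal (norm k powr (2 * s) * (cmod (g k))\<^sup>2) \<partial>lborel)"
proof -
  have "(cmod (riesz s g k))\<^sup>2 = norm k powr (2 * s) * (cmod (g k))\<^sup>2" for k
  proof -
    have "(cmod (riesz s g k))\<^sup>2 = (norm k powr s)\<^sup>2 * (cmod (g k))\<^sup>2"
      by (simp only: norm_mult norm_of_real power_mult_distrib power2_abs)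
    also have "(norm k powr s)\<^sup>2 = norm k powr (2 * s)"
      by (rule powr_squared)
    finally show ?thesis .
  qed
  then show ?thesis by (simp add: L2sq_def)
qed

lemma L2sq_cong_AE: "AE k in lborel. f k = g k \<Longrightarrow> L2sq f = L2sq g"
  unfolding L2sq_def by (rule nn_integral_cong_AE) auto

lemma AE_zero_of_L2sq:
  fixes g :: "'d::finite fn"
  assumes [measurable]: "g \<in> borel_measurable borel" and "L2sq g = 0"
  shows "AE k in lborel. g k = 0"
proof -
  have "AE k in lborel. ennreal ((cmod (g k))\<^sup>2) = 0"
    using assms(2) unfolding L2sq_def by (subst (asm) nn_integral_0_iff_AE) auto
  then show ?thesis by eventually_elim simp
qed

lemma AE_zero_of_L2sq_riesz:
  fixes g :: "'d::finite fn"
  assumes m[measurable]: "g \<in> borel_measurable borel" and "L2sq (riesz s g) = 0"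
  shows "AE k in lborel. g k = 0"
proof -
  have "AE k in lborel. riesz s g k = 0" by (rule AE_zero_of_L2sq[OF riesz_measurable[OF m] assms(2)])
  moreover have "AE k in (lborel :: (real^'d) measure). k \<noteq> 0" by (rule AE_lborel_singleton)
  ultimately show ?thesis by eventually_elim auto
qed

text \<open>
  Young's inequality gives \<open>|k|\<^bsup>2\<theta>n\<^esup> \<le> \<mu>\<^bsup>\<theta>-1\<^esup> ((1 - \<theta>) \<mu> + \<theta> |k|\<^bsup>2n\<^esup>)\<close> for each \<open>\<mu> > 0\<close>. Integrating against \<open>|g|\<^sup>2\<close> and
  choosing \<open>\<mu> = b\<^sup>2/a\<^sup>2\<close>, for which the two terms balance, gives the product of powers. The degenerate cases are
  separated because \<open>\<mu>\<close> needs positive bounds.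
\<close>

lemma L2sq_riesz_interpolation:
  fixes g :: "'d::finite fn"
  assumes gm[measurable]: "g \<in> borel_measurable borel"
    and A: "L2sq g \<le> ennreal (a\<^sup>2)" and B: "L2sq (riesz n g) \<le> ennreal (b\<^sup>2)"
    and ab: "0 \<le> a" "0 \<le> b" and \<theta>: "0 \<le> \<theta>" "\<theta> \<le> 1"
  shows "L2sq (riesz (\<theta> * n) g) \<le> ennreal ((rpow a (1 - \<theta>) * rpow b \<theta>)\<^sup>2)"
proof -
  consider "\<theta> = 0" | "\<theta> = 1" | "0 < \<theta>" "\<theta> < 1" using \<theta> by linarith
  then show ?thesis
  proof cases
    case 1
    have "L2sq (riesz (\<theta> * n) g) \<le> L2sq g"
      by (rule L2sq_mono) (auto simp: 1 norm_mult)
    then show ?thesis using A ab 1 by (simp add: rpow_def)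
  next
    case 2
    then show ?thesis using B ab by (simp add: rpow_def)
  next
    case 3
    show ?thesis
    proof (cases "a = 0 \<or> b = 0")
      case True
      then have "AE k in lborel. g k = 0"
        using AE_zero_of_L2sq[OF gm] AE_zero_of_L2sq_riesz[OF gm, of n] A B by auto
      then have "L2sq (riesz (\<theta> * n) g) = L2sq (\<lambda>_::real^'d. 0)" by (intro L2sq_cong_AE) auto
      then show ?thesis by (simp add: L2sq_def)
    next
      case False
      then have a: "a > 0" and b: "b > 0" using ab by auto
      define \<mu> where "\<mu> = b\<^sup>2 / a\<^sup>2"
      have \<mu>: "\<mu> > 0" using a b by (simp add: \<mu>_def)
      let ?c1 = "\<mu> powr (\<theta> - 1) * ((1 - \<theta>) * \<mu>)" and ?c2 = "\<mu> powr (\<theta> - 1) * \<theta>"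
      have c: "?c1 \<ge> 0" "?c2 \<ge> 0" using \<mu> 3 by auto
      have pt: "norm k powr (2 * (\<theta> * n)) \<le> ?c1 + ?c2 * norm k powr (2 * n)" for k :: "real^'d"
      proof (cases "k = 0")
        case False
        define x where "x = norm k powr (2 * n)"
        have x: "x > 0" using False by (simp add: x_def)
        have "x powr \<theta> * \<mu> powr (1 - \<theta>) \<le> \<theta> * x + (1 - \<theta>) * \<mu>"
          using Youngs_inequality_0[of \<theta> "1 - \<theta>" x \<mu>] x \<mu> 3 by simp
        then have le: "\<mu> powr (\<theta> - 1) * (x powr \<theta> * \<mu> powr (1 - \<theta>)) \<le> \<mu> powr (\<theta> - 1) * (\<theta> * x + (1 - \<theta>) * \<mu>)"
          by (rule mult_left_mono) simp
        have eq1: "\<mu> powr (\<theta> - 1) * (x powr \<theta> * \<mu> powr (1 - \<theta>)) = x powr \<theta>"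
        proof -
          have "\<mu> powr (\<theta> - 1) * \<mu> powr (1 - \<theta>) = 1" using \<mu> by (simp flip: powr_add)
          then show ?thesis by (simp only: mult.left_commute mult_1_right)
        qed
        have eq2: "x powr \<theta> = norm k powr (2 * (\<theta> * n))"
          unfolding x_def powr_powr by (simp add: mult_ac)
        have eq3: "\<mu> powr (\<theta> - 1) * (\<theta> * x + (1 - \<theta>) * \<mu>) = ?c1 + ?c2 * x"
          by (simp only: distrib_left mult.assoc add.commute)
        have "x powr \<theta> \<le> ?c1 + ?c2 * x" using le unfolding eq1 eq3 .
        then show ?thesis unfolding eq2 unfolding x_def .
      qed (use c in simp)
      have "L2sq (riesz (\<theta> * n) g) \<le> (\<integral>\<^sup>+k. ennreal ?c1 * ennreal ((cmod (g k))\<^sup>2) + ennreal ?c2 * ennreal (norm k powr (2 * n) * (cmod (g k))\<^sup>2) \<partial>lborel)"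
        unfolding L2sq_riesz
      proof (rule nn_integral_mono)
        fix k :: "real^'d"
        have "norm k powr (2 * (\<theta> * n)) * (cmod (g k))\<^sup>2 \<le> (?c1 + ?c2 * norm k powr (2 * n)) * (cmod (g k))\<^sup>2"
          by (intro mult_right_mono pt) simp
        also have "\<dots> = ?c1 * (cmod (g k))\<^sup>2 + ?c2 * (norm k powr (2 * n) * (cmod (g k))\<^sup>2)"
          by (simp only: distrib_right mult.assoc)
        finally show "ennreal (norm k powr (2 * (\<theta> * n)) * (cmod (g k))\<^sup>2) \<le> ennreal ?c1 * ennreal ((cmod (g k))\<^sup>2) + ennreal ?c2 * ennreal (norm k powr (2 * n) * (cmod (g k))\<^sup>2)"
          using c by (simp only: ennreal_mult[symmetric] ennreal_plus[symmetric] zero_le_power2 mult_nonneg_nonneg powr_ge_zero ennreal_leI)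
      qed
      also have "\<dots> = ennreal ?c1 * L2sq g + ennreal ?c2 * L2sq (riesz n g)"
        unfolding L2sq_riesz unfolding L2sq_def by (subst nn_integral_add) (simp_all add: nn_integral_cmult)
      also have "\<dots> \<le> ennreal ?c1 * ennreal (a\<^sup>2) + ennreal ?c2 * ennreal (b\<^sup>2)"
        by (intro add_mono mult_left_mono A B) auto
      also have "\<dots> = ennreal (?c1 * a\<^sup>2 + ?c2 * b\<^sup>2)"
        using c by (simp only: ennreal_mult[symmetric] ennreal_plus[symmetric] zero_le_power2 mult_nonneg_nonneg)
      also have "?c1 * a\<^sup>2 + ?c2 * b\<^sup>2 = (rpow a (1 - \<theta>) * rpow b \<theta>)\<^sup>2"
      proof -
        have \<mu>a: "\<mu> * a\<^sup>2 = b\<^sup>2" using a by (simp add: \<mu>_def)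
        have "?c1 * a\<^sup>2 + ?c2 * b\<^sup>2 = \<mu> powr (\<theta> - 1) * ((1 - \<theta>) * (\<mu> * a\<^sup>2) + \<theta> * b\<^sup>2)"
          by (simp only: distrib_left mult.assoc)
        also have "\<dots> = \<mu> powr (\<theta> - 1) * b\<^sup>2" unfolding \<mu>a by (simp add: left_diff_distrib)
        also have "\<dots> = (a powr (1 - \<theta>) * b powr \<theta>)\<^sup>2"
        proof -
          have \<mu>2: "\<mu> = (b / a) powr 2" using a b by (simp add: \<mu>_def power_divide)
          have "((b / a) powr 2) powr (\<theta> - 1) = ((b / a) powr (\<theta> - 1))\<^sup>2"
            unfolding powr_powr powr_squared by (simp only: mult.commute)
          moreover have "(b / a) powr (\<theta> - 1) * b = a powr (1 - \<theta>) * b powr \<theta>"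
          proof -
            have "(b / a) powr (\<theta> - 1) = b powr (\<theta> - 1) * a powr (1 - \<theta>)"
              using a b powr_minus_divide[of a "\<theta> - 1"] by (simp add: powr_divide)
            moreover have "b powr (\<theta> - 1) * b = b powr \<theta>"
              using b powr_add[of b "\<theta> - 1" 1] by simp
            ultimately show ?thesis by (simp add: mult_ac)
          qed
          ultimately show ?thesis unfolding \<mu>2 by (metis power_mult_distrib)
        qed
        finally show ?thesis using 3 by (simp add: rpow_def)
      qed
      finally show ?thesis .
    qed
  qed
qed

lemma nn_integral_powr_Icc:
  fixes q a :: real
  assumes "q > 0" "a \<ge> 0"
  shows "(\<integral>\<^sup>+t. ennreal (t powr (q - 1)) * indicator {0..a} t \<partial>lborel) = ennreal (a powr q / q)"
proof -
  have "((\<lambda>x. x powr (q - 1)) has_integral (a powr q / q)) {0..a}"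
    using has_integral_powr_from_0[of "q - 1" a] assms by simp
  from nn_integral_has_integral_lebesgue'[OF _ this] show ?thesis by simp
qed

text \<open>
  The transform of the truncation is at most the \<open>L\<^sup>1\<close> norm of the truncation. Write \<open>|G| = |k|\<^bsup>-\<sigma>\<^esup> |k|\<^sup>\<sigma> |G|\<close> and apply
  Cauchy--Schwarz on the ball, where \<open>|k|\<^bsup>-2\<sigma>\<^esup>\<close> is integrable.
\<close>

lemma low_frequency_bound:
  fixes \<sigma> :: real
  assumes \<sigma>: "0 < \<sigma>" "2 * \<sigma> < real CARD('d::finite)"
  obtains K where "K > 0" "\<And>(G :: 'd fn) w A x. G \<in> borel_measurable borel \<Longrightarrow> L2sq G < \<infinity> \<Longrightarrow> L2sq (riesz \<sigma> G) \<le> ennreal (w\<^sup>2) \<Longrightarrow> 0 \<le> w \<Longrightarrow> 0 \<le> A \<Longrightarrow>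
      cmod (fourier (cut A G) x) \<le> K * w * A powr ((real CARD('d) - 2 * \<sigma>) / 2)"
proof -
  let ?d = "real CARD('d)"
  obtain C where C: "C \<ge> 0" "\<And>A. A \<ge> 0 \<Longrightarrow>
    (\<integral>\<^sup>+x. ennreal (norm x powr (- 2 * \<sigma>)) * indicator {x. norm x \<le> A} x \<partial>(lborel :: (real^'d) measure)) \<le> ennreal (C * A powr (?d - 2 * \<sigma>))"
    using nn_integral_norm_powr_ball[of \<sigma>, where 'd='d] \<sigma> by auto
  \<comment> \<open>\<open>C + 1\<close> instead of \<open>C\<close> makes \<open>K\<close> positive, so that later one can divide by it.\<close>
  define K where "K = fconst TYPE('d) * sqrt (C + 1)"
  have "cmod (fourier (cut A G) x) \<le> K * w * A powr ((?d - 2 * \<sigma>) / 2)"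
    if Gm[measurable]: "G \<in> borel_measurable borel" and GL: "L2sq G < \<infinity>" and W: "L2sq (riesz \<sigma> G) \<le> ennreal (w\<^sup>2)" and w: "0 \<le> w" and A: "0 \<le> A"
    for G :: "'d fn" and w A x
  proof -
    have int: "integrable lborel (cut A G)" by (rule cut_integrable[OF Gm GL])
    define J where "J = (\<integral>k. cmod (cut A G k) \<partial>lborel)"
    have J: "J \<ge> 0" unfolding J_def by (simp add: integral_nonneg_AE)
    have nz: "AE k in (lborel :: (real^'d) measure). k \<noteq> 0" by (rule AE_lborel_singleton)
    let ?u = "\<lambda>k::real^'d. ennreal (norm k powr (- \<sigma>)) * indicator {x. norm x \<le> A} k" and ?v = "\<lambda>k. ennreal (cmod (riesz \<sigma> G k))"
    have sm: "{x::real^'d. norm x \<le> A} \<in> sets borel" by simp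
    have um[measurable]: "?u \<in> borel_measurable borel"
      by (intro borel_measurable_times_ennreal borel_measurable_indicator sm) measurable
    have "ennreal J = (\<integral>\<^sup>+k. ennreal (cmod (cut A G k)) \<partial>lborel)"
      unfolding J_def using int by (intro nn_integral_eq_integral[symmetric]) auto
    also have "\<dots> = (\<integral>\<^sup>+k. ?u k * ?v k \<partial>lborel)"
    proof (rule nn_integral_cong_AE, use nz in eventually_elim)
      case (elim k)
      have "norm k powr (- \<sigma>) * norm k powr \<sigma> = 1" using elim by (simp flip: powr_add)
      then have "norm k powr (- \<sigma>) * cmod (riesz \<sigma> G k) = cmod (G k)" by (simp add: norm_mult mult.assoc[symmetric])
      then have "ennreal (norm k powr (- \<sigma>)) * ?v k = ennreal (cmod (G k))" by (simp flip: ennreal_mult)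
      then show ?case by (simp add: cut_def indicator_def)
    qed
    finally have "(ennreal J)\<^sup>2 = (\<integral>\<^sup>+k. ?u k * ?v k \<partial>lborel)\<^sup>2" by simp
    also have "\<dots> \<le> (\<integral>\<^sup>+k. ?u k ^ 2 \<partial>lborel) * (\<integral>\<^sup>+k. ?v k ^ 2 \<partial>lborel)"
      by (rule Cauchy_Schwarz_nn_integral) measurable
    also have "(\<integral>\<^sup>+k. ?v k ^ 2 \<partial>lborel) = L2sq (riesz \<sigma> G)" by (simp only: L2sq_def ennreal_power[OF norm_ge_zero])
    also have "(\<integral>\<^sup>+k. ?u k ^ 2 \<partial>lborel) = (\<integral>\<^sup>+x. ennreal (norm x powr (- 2 * \<sigma>)) * indicator {x. norm x \<le> A} x \<partial>(lborel :: (real^'d) measure))"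
    proof (rule nn_integral_cong)
      fix k :: "real^'d"
      have "(norm k powr (- \<sigma>))\<^sup>2 = norm k powr (- 2 * \<sigma>)" unfolding powr_squared by simp
      then have "(ennreal (norm k powr (- \<sigma>)))\<^sup>2 = ennreal (norm k powr (- 2 * \<sigma>))" by (simp add: ennreal_power)
      then show "?u k ^ 2 = ennreal (norm k powr (- 2 * \<sigma>)) * indicator {x. norm x \<le> A} k"
        by (simp add: indicator_def power_mult_distrib)
    qed
    also have "\<dots> * L2sq (riesz \<sigma> G) \<le> ennreal (C * A powr (?d - 2 * \<sigma>)) * ennreal (w\<^sup>2)"
      by (intro mult_mono C A W) auto
    also have "\<dots> = ennreal (C * A powr (?d - 2 * \<sigma>) * w\<^sup>2)" using C(1) by (simp add: ennreal_mult)
    finally have "J\<^sup>2 \<le> C * A powr (?d - 2 * \<sigma>) * w\<^sup>2"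
      using J C(1) by (simp add: ennreal_power)
    also have "\<dots> \<le> (C + 1) * A powr (?d - 2 * \<sigma>) * w\<^sup>2" by (intro mult_right_mono) auto
    also have "A powr (?d - 2 * \<sigma>) = (A powr ((?d - 2 * \<sigma>) / 2))\<^sup>2"
      unfolding powr_squared by (rule arg_cong[where f="\<lambda>u. A powr u"]) (simp add: field_simps)
    also have "(C + 1) * (A powr ((?d - 2 * \<sigma>) / 2))\<^sup>2 * w\<^sup>2 = (sqrt (C + 1) * w * A powr ((?d - 2 * \<sigma>) / 2))\<^sup>2"
      using C(1) by (simp add: power_mult_distrib mult_ac)
    finally have "J \<le> sqrt (C + 1) * w * A powr ((?d - 2 * \<sigma>) / 2)"
      by (rule power2_le_imp_le) (use C(1) w in simp)
    then have "fconst TYPE('d) * J \<le> fconst TYPE('d) * (sqrt (C + 1) * w * A powr ((?d - 2 * \<sigma>) / 2))"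
      by (rule mult_left_mono) simp
    with norm_fourier_le[OF int, of x] have "cmod (fourier (cut A G) x) \<le> fconst TYPE('d) * (sqrt (C + 1) * w * A powr ((?d - 2 * \<sigma>) / 2))"
      unfolding J_def by (rule order_trans)
    then show ?thesis by (simp only: K_def mult.assoc)
  qed
  moreover have "K > 0" using C(1) fconst_pos[where 'd='d] by (simp add: K_def)
  ultimately show ?thesis using that by blast
qed

text \<open>
  Where \<open>|F| \<ge> t\<close> and the low frequencies contribute at most \<open>t/2\<close>, the high frequencies contribute at least \<open>t/2\<close>;
  Chebyshev's inequality and the \<open>L\<^sup>2\<close> bound for the high frequencies do the rest.
\<close>

lemma distribution_function_bound:
  fixes G F :: "'d::finite fn"
  assumes GF: "L2_fourier_pair G F" and t: "t > 0" and low: "\<And>x. cmod (fourier (cut A G) x) \<le> t / 2"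
  shows "emeasure lborel {x. t \<le> cmod (F x)} \<le> ennreal (4 / t\<^sup>2) * L2sq (\<lambda>k. G k - cut A G k)"
proof -
  have Gm[measurable]: "G \<in> borel_measurable borel" and GL: "L2sq G < \<infinity>" and Fm[measurable]: "F \<in> borel_measurable borel"
    and GF': "L2sq (\<lambda>x. F x - fourier (cut A G) x) \<le> L2sq (\<lambda>k. G k - cut A G k)"
    using GF by (auto simp: L2_fourier_pair_def)
  have [measurable]: "fourier (cut A G) \<in> borel_measurable borel" by (rule fourier_measurable[OF cut_integrable[OF Gm GL]])
  let ?u = "\<lambda>x. ennreal ((cmod (F x - fourier (cut A G) x))\<^sup>2)"
  have "{x. t \<le> cmod (F x)} \<subseteq> {x\<in>UNIV. 1 \<le> ennreal (4 / t\<^sup>2) * ?u x}"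
  proof
    fix x assume "x \<in> {x. t \<le> cmod (F x)}"
    then have "t / 2 \<le> cmod (F x - fourier (cut A G) x)"
      using low[of x] norm_triangle_ineq2[of "F x" "fourier (cut A G) x"] by simp
    then have "(t / 2)\<^sup>2 \<le> (cmod (F x - fourier (cut A G) x))\<^sup>2" using t by (intro power_mono) auto
    then have "1 \<le> 4 / t\<^sup>2 * (cmod (F x - fourier (cut A G) x))\<^sup>2" using t by (simp add: power_divide field_simps)
    then show "x \<in> {x\<in>UNIV. 1 \<le> ennreal (4 / t\<^sup>2) * ?u x}"
      by (simp add: ennreal_mult[symmetric] flip: ennreal_1)
  qed
  then have "emeasure lborel {x. t \<le> cmod (F x)} \<le> emeasure lborel {x\<in>UNIV. 1 \<le> ennreal (4 / t\<^sup>2) * ?u x}"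
    by (rule emeasure_mono) measurable
  also have "\<dots> \<le> ennreal (4 / t\<^sup>2) * (\<integral>\<^sup>+x. ?u x * indicator UNIV x \<partial>lborel)"
    by (rule nn_integral_Markov_inequality) auto
  also have "\<dots> = ennreal (4 / t\<^sup>2) * L2sq (\<lambda>x. F x - fourier (cut A G) x)" by (simp add: L2sq_def)
  also have "\<dots> \<le> ennreal (4 / t\<^sup>2) * L2sq (\<lambda>k. G k - cut A G k)" by (intro mult_left_mono GF') simp
  finally show ?thesis .
qed

text \<open>
  In the layer cake formula \<open>\<integral> |F|\<^sup>p = \<integral> p t\<^bsup>p-1\<^esup> |{|F| \<ge> t}| dt\<close> the truncation radius is chosen for each level \<open>t\<close> so
  that \<open>low_frequency_bound\<close> equals \<open>t/2\<close>. The level sets are then bounded by \<open>4 t\<^bsup>-2\<^esup>\<close> times the integral of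
  \<open>|G|\<^sup>2\<close> over \<open>t \<le> L |k|\<^bsup>d/p\<^esup>\<close>. After exchanging the integrals the inner one is \<open>\<integral> t\<^bsup>p-3\<^esup> dt\<close> over \<open>[0, L |k|\<^bsup>d/p\<^esup>]\<close>,
  which converges as \<open>p > 2\<close> and is proportional to \<open>|k|\<^bsup>2\<sigma>\<^esup>\<close> because \<open>(p - 2) d/p = 2\<sigma>\<close>. Homogeneity in \<open>w\<close> comes
  out since \<open>L\<close> is proportional to \<open>w\<close>.
\<close>

lemma fractional_sobolev:
  fixes \<sigma> p :: real
  assumes \<sigma>: "0 < \<sigma>" "2 * \<sigma> < real CARD('d::finite)" and p: "p = 2 * real CARD('d) / (real CARD('d) - 2 * \<sigma>)"
  obtains C where "C \<ge> 0" "\<And>(G :: 'd fn) F w. L2_fourier_pair G F \<Longrightarrow> L2sq (riesz \<sigma> G) \<le> ennreal (w\<^sup>2) \<Longrightarrow> 0 \<le> w \<Longrightarrow>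
      (\<integral>\<^sup>+x. ennreal (cmod (F x) powr p) \<partial>lborel) \<le> ennreal (C * w powr p)"
proof -
  let ?d = "real CARD('d)"
  have d\<sigma>: "?d - 2 * \<sigma> > 0" using \<sigma> by simp
  have p2: "p > 2" using d\<sigma> \<sigma> by (simp add: p less_divide_eq)
  have dp: "?d / p = (?d - 2 * \<sigma>) / 2" using d\<sigma> by (simp add: p)
  have dpp: "?d / p * (p - 2) = 2 * \<sigma>"
  proof -
    have "?d / p * (p - 2) = ?d - ?d / p * 2" using p2 by (simp add: right_diff_distrib)
    also have "\<dots> = ?d - (?d - 2 * \<sigma>) / 2 * 2" unfolding dp ..
    also have "\<dots> = 2 * \<sigma>" by (simp add: field_simps)
    finally show ?thesis .
  qed
  obtain K where K: "K > 0" "\<And>(G :: 'd fn) w A x. G \<in> borel_measurable borel \<Longrightarrow> L2sq G < \<infinity> \<Longrightarrow> L2sq (riesz \<sigma> G) \<le> ennreal (w\<^sup>2) \<Longrightarrow> 0 \<le> w \<Longrightarrow> 0 \<le> A \<Longrightarrow>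
      cmod (fourier (cut A G) x) \<le> K * w * A powr ((?d - 2 * \<sigma>) / 2)"
    by (rule low_frequency_bound[OF \<sigma>], rule that)
  define C where "C = 4 * p / (p - 2) * (2 * K) powr (p - 2)"
  have C: "C \<ge> 0" using p2 K(1) by (simp add: C_def)
  have "(\<integral>\<^sup>+x. ennreal (cmod (F x) powr p) \<partial>lborel) \<le> ennreal (C * w powr p)"
    if GF: "L2_fourier_pair G F" and W: "L2sq (riesz \<sigma> G) \<le> ennreal (w\<^sup>2)" and w0: "0 \<le> w" for G F :: "'d fn" and w
  proof (cases "w = 0")
    have Gm[measurable]: "G \<in> borel_measurable borel" and GL: "L2sq G < \<infinity>" and Fm[measurable]: "F \<in> borel_measurable borel"
      using GF by (auto simp: L2_fourier_pair_def)
    case True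
    then have "AE k in lborel. G k = 0" using W by (intro AE_zero_of_L2sq_riesz[OF Gm, of \<sigma>]) simp
    then have "L2sq G = L2sq (\<lambda>_::real^'d. 0)" by (rule L2sq_cong_AE)
    then have "L2sq F = 0" using L2_fourier_norm[OF GF] by (simp add: L2sq_def)
    then have "AE x in lborel. F x = 0" by (rule AE_zero_of_L2sq[OF Fm])
    then have "(\<integral>\<^sup>+x. ennreal (cmod (F x) powr p) \<partial>lborel) = (\<integral>\<^sup>+x. 0 \<partial>(lborel :: (real^'d) measure))"
      by (intro nn_integral_cong_AE) auto
    then show ?thesis by simp
  next
    have Gm[measurable]: "G \<in> borel_measurable borel" and GL: "L2sq G < \<infinity>" and Fm[measurable]: "F \<in> borel_measurable borel"
      using GF by (auto simp: L2_fourier_pair_def)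
    case False
    then have w: "w > 0" using w0 by simp
    define L where "L = 2 * K * w"
    have L: "L > 0" using K(1) w by (simp add: L_def)
    \<comment> \<open>Solves \<open>K w A\<^bsup>d/p\<^esup> = t/2\<close> for the radius \<open>A\<close>.\<close>
    define cutoff where "cutoff t = (t / L) powr (p / ?d)" for t
    have cutoff: "K * w * cutoff t powr ((?d - 2 * \<sigma>) / 2) = t / 2" if "t > 0" for t
    proof -
      have "cutoff t powr ((?d - 2 * \<sigma>) / 2) = (t / L) powr (p / ?d * (?d / p))" unfolding cutoff_def powr_powr dp ..
      also have "\<dots> = t / L" using p2 that L by simp
      finally show ?thesis using K(1) w by (simp add: L_def)
    qed
    let ?s = "\<lambda>t (k::real^'d). t \<le> L * norm k powr (?d / p)"
    have high: "L2sq (\<lambda>k. G k - cut (cutoff t) G k) \<le> (\<integral>\<^sup>+k. ennreal ((cmod (G k))\<^sup>2) * (if ?s t k then 1 else 0) \<partial>lborel)" if t: "t > 0" for t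
      unfolding L2sq_def
    proof (rule nn_integral_mono)
      fix k :: "real^'d"
      show "ennreal ((cmod (G k - cut (cutoff t) G k))\<^sup>2) \<le> ennreal ((cmod (G k))\<^sup>2) * (if ?s t k then 1 else 0)"
      proof (cases "norm k \<le> cutoff t")
        case False
        have "cutoff t powr (?d / p) \<le> norm k powr (?d / p)"
          using False p2 by (intro powr_mono2) (auto simp: cutoff_def)
        moreover have "cutoff t powr (?d / p) = t / L"
          using p2 t L by (simp add: cutoff_def powr_powr)
        ultimately have "?s t k" using L by (simp add: divide_le_eq mult.commute)
        then show ?thesis using False by (simp add: cut_def)
      qed (simp add: cut_def)
    qed
    have level: "ennreal (p * t powr (p - 1)) * emeasure lborel {x. t \<le> cmod (F x)}
       \<le> (\<integral>\<^sup>+k. ennreal (4 * p * (cmod (G k))\<^sup>2) * (ennreal (t powr (p - 2 - 1)) * indicator {0..L * norm k powr (?d / p)} t) \<partial>lborel)"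
      if t: "t > 0" for t
    proof -
      have "emeasure lborel {x. t \<le> cmod (F x)} \<le> ennreal (4 / t\<^sup>2) * L2sq (\<lambda>k. G k - cut (cutoff t) G k)"
      proof (rule distribution_function_bound[OF GF t])
        have "cutoff t \<ge> 0" by (simp add: cutoff_def)
        from K(2)[OF Gm GL W w0 this] show "cmod (fourier (cut (cutoff t) G) x) \<le> t / 2" for x
          unfolding cutoff[OF t] .
      qed
      also have "\<dots> \<le> ennreal (4 / t\<^sup>2) * (\<integral>\<^sup>+k. ennreal ((cmod (G k))\<^sup>2) * (if ?s t k then 1 else 0) \<partial>lborel)"
        by (intro mult_left_mono high t) simp
      finally have "ennreal (p * t powr (p - 1)) * emeasure lborel {x. t \<le> cmod (F x)}
         \<le> ennreal (p * t powr (p - 1)) * (ennreal (4 / t\<^sup>2) * (\<integral>\<^sup>+k. ennreal ((cmod (G k))\<^sup>2) * (if ?s t k then 1 else 0) \<partial>lborel))"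
        by (rule mult_left_mono) simp
      also have "\<dots> = (\<integral>\<^sup>+k. ennreal (p * t powr (p - 1)) * (ennreal (4 / t\<^sup>2) * (ennreal ((cmod (G k))\<^sup>2) * (if ?s t k then 1 else 0))) \<partial>lborel)"
      proof -
        have Qm: "(\<lambda>k. ennreal ((cmod (G k))\<^sup>2) * (if ?s t k then 1 else 0)) \<in> borel_measurable lborel" by measurable
        show ?thesis
          by (simp only: nn_integral_cmult[OF Qm] nn_integral_cmult[OF borel_measurable_times_ennreal[OF borel_measurable_const Qm]])
      qed
      also have "\<dots> = (\<integral>\<^sup>+k. ennreal (4 * p * (cmod (G k))\<^sup>2) * (ennreal (t powr (p - 2 - 1)) * indicator {0..L * norm k powr (?d / p)} t) \<partial>lborel)"
      proof (rule nn_integral_cong)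
        fix k :: "real^'d"
        have "t powr (p - 1) = t powr (p - 2 - 1) * t\<^sup>2"
          using t powr_add[of t "p - 2 - 1" 2] by (simp add: powr_numeral)
        then have "p * t powr (p - 1) * (4 / t\<^sup>2) = 4 * p * t powr (p - 2 - 1)" using t by simp
        then have "ennreal (p * t powr (p - 1)) * ennreal (4 / t\<^sup>2) = ennreal (4 * p) * ennreal (t powr (p - 2 - 1))"
          using p2 by (simp flip: ennreal_mult)
        then have "ennreal (p * t powr (p - 1)) * (ennreal (4 / t\<^sup>2) * (ennreal ((cmod (G k))\<^sup>2) * (if ?s t k then 1 else 0)))
          = ennreal (4 * p) * ennreal (t powr (p - 2 - 1)) * (ennreal ((cmod (G k))\<^sup>2) * (if ?s t k then 1 else 0))"
          by (simp only: mult.assoc[symmetric])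
        also have "\<dots> = ennreal (4 * p * (cmod (G k))\<^sup>2) * (ennreal (t powr (p - 2 - 1)) * (if ?s t k then 1 else 0))"
          using p2 by (simp add: ennreal_mult mult_ac)
        finally show "ennreal (p * t powr (p - 1)) * (ennreal (4 / t\<^sup>2) * (ennreal ((cmod (G k))\<^sup>2) * (if ?s t k then 1 else 0)))
          = ennreal (4 * p * (cmod (G k))\<^sup>2) * (ennreal (t powr (p - 2 - 1)) * indicator {0..L * norm k powr (?d / p)} t)"
          using t by (simp add: indicator_def)
      qed
      finally show ?thesis .
    qed
    have "(\<integral>\<^sup>+x. ennreal (cmod (F x) powr p) \<partial>lborel)
       = (\<integral>\<^sup>+x. \<integral>\<^sup>+t. ennreal (p * t powr (p - 1)) * (if 0 < t \<and> t \<le> cmod (F x) then 1 else 0) \<partial>lborel \<partial>lborel)"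
    proof (rule nn_integral_cong)
      fix x
      have "(\<integral>\<^sup>+t. ennreal (p * t powr (p - 1)) * (if 0 < t \<and> t \<le> cmod (F x) then 1 else 0) \<partial>lborel)
          = (\<integral>\<^sup>+t. ennreal p * (ennreal (t powr (p - 1)) * indicator {0..cmod (F x)} t) \<partial>lborel)"
        using p2 by (intro nn_integral_cong) (auto simp: indicator_def ennreal_mult')
      also have "\<dots> = ennreal p * ennreal (cmod (F x) powr p / p)"
        using p2 by (subst nn_integral_cmult) (auto simp: nn_integral_powr_Icc)
      also have "\<dots> = ennreal (cmod (F x) powr p)" using p2 by (simp flip: ennreal_mult)
      finally show "ennreal (cmod (F x) powr p) = (\<integral>\<^sup>+t. ennreal (p * t powr (p - 1)) * (if 0 < t \<and> t \<le> cmod (F x) then 1 else 0) \<partial>lborel)" ..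
    qed
    also have "\<dots> = (\<integral>\<^sup>+t. \<integral>\<^sup>+x. ennreal (p * t powr (p - 1)) * (if 0 < t \<and> t \<le> cmod (F x) then 1 else 0) \<partial>lborel \<partial>lborel)"
      by (rule lborel_pair.Fubini'[symmetric]) measurable
    also have "\<dots> \<le> (\<integral>\<^sup>+t. \<integral>\<^sup>+k. ennreal (4 * p * (cmod (G k))\<^sup>2) * (ennreal (t powr (p - 2 - 1)) * indicator {0..L * norm k powr (?d / p)} t) \<partial>lborel \<partial>lborel)"
    proof (rule nn_integral_mono)
      fix t :: real
      show "(\<integral>\<^sup>+x. ennreal (p * t powr (p - 1)) * (if 0 < t \<and> t \<le> cmod (F x) then 1 else 0) \<partial>lborel)
        \<le> (\<integral>\<^sup>+k. ennreal (4 * p * (cmod (G k))\<^sup>2) * (ennreal (t powr (p - 2 - 1)) * indicator {0..L * norm k powr (?d / p)} t) \<partial>lborel)"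
      proof (cases "t > 0")
        case True
        have "(\<integral>\<^sup>+x. ennreal (p * t powr (p - 1)) * (if 0 < t \<and> t \<le> cmod (F x) then 1 else 0) \<partial>lborel)
           = (\<integral>\<^sup>+x. ennreal (p * t powr (p - 1)) * indicator {x. t \<le> cmod (F x)} x \<partial>lborel)"
          using True by (intro nn_integral_cong) (auto simp: indicator_def)
        also have "\<dots> = ennreal (p * t powr (p - 1)) * emeasure lborel {x. t \<le> cmod (F x)}"
          by (intro nn_integral_cmult_indicator) measurable
        finally show ?thesis using level[OF True] by simp
      qed simp
    qed
    also have "\<dots> = (\<integral>\<^sup>+k. \<integral>\<^sup>+t. ennreal (4 * p * (cmod (G k))\<^sup>2) * (ennreal (t powr (p - 2 - 1)) * indicator {0..L * norm k powr (?d / p)} t) \<partial>lborel \<partial>lborel)"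
      unfolding indicator_def atLeastAtMost_iff by (rule lborel_pair.Fubini') measurable
    also have "\<dots> = (\<integral>\<^sup>+k. ennreal (4 * p / (p - 2) * L powr (p - 2)) * ennreal (norm k powr (2 * \<sigma>) * (cmod (G k))\<^sup>2) \<partial>lborel)"
    proof (rule nn_integral_cong)
      fix k :: "real^'d"
      have "(\<integral>\<^sup>+t. ennreal (4 * p * (cmod (G k))\<^sup>2) * (ennreal (t powr (p - 2 - 1)) * indicator {0..L * norm k powr (?d / p)} t) \<partial>lborel)
        = ennreal (4 * p * (cmod (G k))\<^sup>2) * ennreal ((L * norm k powr (?d / p)) powr (p - 2) / (p - 2))"
      proof -
        have I: "(\<integral>\<^sup>+t. ennreal (t powr (p - 2 - 1)) * indicator {0..L * norm k powr (?d / p)} t \<partial>lborel)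
          = ennreal ((L * norm k powr (?d / p)) powr (p - 2) / (p - 2))"
          by (rule nn_integral_powr_Icc) (use p2 L in auto)
        have m: "(\<lambda>t. ennreal (t powr (p - 2 - 1)) * indicator {0..L * norm k powr (?d / p)} t) \<in> borel_measurable lborel"
          by measurable
        show ?thesis by (simp only: nn_integral_cmult[OF m] I)
      qed
      also have "\<dots> = ennreal (4 * p * (cmod (G k))\<^sup>2 * ((L * norm k powr (?d / p)) powr (p - 2) / (p - 2)))"
        using p2 by (intro ennreal_mult[symmetric]) auto
      also have "(L * norm k powr (?d / p)) powr (p - 2) = L powr (p - 2) * norm k powr (2 * \<sigma>)"
        using L dpp by (simp add: powr_mult powr_powr)
      also have "4 * p * (cmod (G k))\<^sup>2 * (L powr (p - 2) * norm k powr (2 * \<sigma>) / (p - 2)) = 4 * p / (p - 2) * L powr (p - 2) * (norm k powr (2 * \<sigma>) * (cmod (G k))\<^sup>2)"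
        by simp
      also have "ennreal \<dots> = ennreal (4 * p / (p - 2) * L powr (p - 2)) * ennreal (norm k powr (2 * \<sigma>) * (cmod (G k))\<^sup>2)"
        using p2 by (intro ennreal_mult) auto
      finally show "(\<integral>\<^sup>+t. ennreal (4 * p * (cmod (G k))\<^sup>2) * (ennreal (t powr (p - 2 - 1)) * indicator {0..L * norm k powr (?d / p)} t) \<partial>lborel)
        = ennreal (4 * p / (p - 2) * L powr (p - 2)) * ennreal (norm k powr (2 * \<sigma>) * (cmod (G k))\<^sup>2)" .
    qed
    also have "\<dots> = ennreal (4 * p / (p - 2) * L powr (p - 2)) * L2sq (riesz \<sigma> G)"
      unfolding L2sq_riesz by (rule nn_integral_cmult) measurable
    also have "\<dots> \<le> ennreal (4 * p / (p - 2) * L powr (p - 2)) * ennreal (w\<^sup>2)" by (intro mult_left_mono W) simp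
    also have "\<dots> = ennreal (4 * p / (p - 2) * L powr (p - 2) * w\<^sup>2)" using p2 by (intro ennreal_mult[symmetric]) auto
    also have "4 * p / (p - 2) * L powr (p - 2) * w\<^sup>2 = C * w powr p"
    proof -
      have "w powr p = w powr (p - 2) * w\<^sup>2" using w powr_add[of w "p - 2" 2] by (simp add: powr_numeral)
      then show ?thesis using K(1) w by (simp add: C_def L_def powr_mult)
    qed
    finally show ?thesis .
  qed
  then show ?thesis using that C by blast
qed

section \<open>Integrable densities and the supremum norm\<close>

text \<open>
  This integral is a modulus of continuity for the transform of \<open>H\<close> that does not depend on the point.
\<close>

lemma exp_diff_integral_tendsto:
  fixes H :: "'d::finite fn"
  assumes H: "integrable lborel H"
  shows "((\<lambda>h. \<integral>k. cmod ((exp (- \<i> * of_real (h \<bullet> k)) - 1) * H k) \<partial>lborel) \<longlongrightarrow> 0) (at 0)"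
  unfolding tendsto_at_iff_sequentially comp_def
proof (intro allI impI)
  fix X :: "nat \<Rightarrow> real^'d" assume X: "X \<longlonglongrightarrow> 0"
  have Hm[measurable]: "H \<in> borel_measurable borel" using H by auto
  have "(\<lambda>n. \<integral>k. cmod ((exp (- \<i> * of_real (X n \<bullet> k)) - 1) * H k) \<partial>lborel) \<longlonglongrightarrow> (\<integral>k. 0 \<partial>(lborel :: (real^'d) measure))"
  proof (rule integral_dominated_convergence)
    show "integrable lborel (\<lambda>k. 2 * cmod (H k))" using H by simp
    show "(\<lambda>k. cmod ((exp (- \<i> * of_real (X n \<bullet> k)) - 1) * H k)) \<in> borel_measurable lborel" for n
      using measurable_character[of "X n"] by simp
    show "AE k in lborel. (\<lambda>n. cmod ((exp (- \<i> * of_real (X n \<bullet> k)) - 1) * H k)) \<longlonglongrightarrow> 0"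
    proof (rule AE_I2)
      fix k :: "real^'d"
      have "(\<lambda>n. cmod ((exp (- \<i> * of_real (X n \<bullet> k)) - 1) * H k)) \<longlonglongrightarrow> cmod ((exp (- \<i> * of_real (0 \<bullet> k)) - 1) * H k)"
        by (intro tendsto_intros X)
      then show "(\<lambda>n. cmod ((exp (- \<i> * of_real (X n \<bullet> k)) - 1) * H k)) \<longlonglongrightarrow> 0" by simp
    qed
    show "AE k in lborel. norm (cmod ((exp (- \<i> * of_real (X n \<bullet> k)) - 1) * H k)) \<le> 2 * cmod (H k)" for n
    proof (rule AE_I2)
      fix k :: "real^'d"
      have "cmod (exp (- \<i> * of_real (X n \<bullet> k)) - 1) \<le> 2"
        using norm_triangle_ineq4[of "exp (- \<i> * of_real (X n \<bullet> k))" 1] by simp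
      then have "cmod (exp (- \<i> * of_real (X n \<bullet> k)) - 1) * cmod (H k) \<le> 2 * cmod (H k)" by (rule mult_right_mono) simp
      then show "norm (cmod ((exp (- \<i> * of_real (X n \<bullet> k)) - 1) * H k)) \<le> 2 * cmod (H k)" by (simp add: norm_mult)
    qed
  qed simp
  then show "(\<lambda>n. \<integral>k. cmod ((exp (- \<i> * of_real (X n \<bullet> k)) - 1) * H k) \<partial>lborel) \<longlonglongrightarrow> 0" by simp
qed

lemma fourier_diff_bound:
  fixes H :: "'d::finite fn"
  assumes H: "integrable lborel H"
  shows "cmod (fourier H (x + h) - fourier H x) \<le> fconst TYPE('d) * (\<integral>k. cmod ((exp (- \<i> * of_real (h \<bullet> k)) - 1) * H k) \<partial>lborel)"
proof -
  let ?E = "\<lambda>x k. exp (- \<i> * of_real (x \<bullet> k)) :: complex"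
  have split: "?E (x + h) k * H k - ?E x k * H k = ?E x k * ((?E h k - 1) * H k)" for k
  proof -
    have "?E (x + h) k = ?E x k * ?E h k"
      unfolding mult_exp_exp by (rule arg_cong[where f=exp]) (simp add: inner_add_left distrib_left)
    then show ?thesis by (simp add: algebra_simps)
  qed
  have "fourier H (x + h) - fourier H x = of_real (fconst TYPE('d)) * (\<integral>k. ?E (x + h) k * H k - ?E x k * H k \<partial>lborel)"
    using integrable_character[OF H, of "x + h"] integrable_character[OF H, of x]
    unfolding fourier_def by (simp only: Bochner_Integration.integral_diff right_diff_distrib)
  also have "cmod \<dots> = fconst TYPE('d) * cmod (\<integral>k. ?E x k * ((?E h k - 1) * H k) \<partial>lborel)"
    by (simp only: split norm_mult norm_of_real) simp
  also have "\<dots> \<le> fconst TYPE('d) * (\<integral>k. cmod (?E x k * ((?E h k - 1) * H k)) \<partial>lborel)"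
    by (intro mult_left_mono integral_norm_bound) simp
  also have "(\<lambda>k. cmod (?E x k * ((?E h k - 1) * H k))) = (\<lambda>k. cmod ((?E h k - 1) * H k))"
    by (simp add: norm_mult)
  finally show ?thesis .
qed

text \<open>
  If \<open>|\<F>H| \<ge> e\<close> at a far point, then uniform continuity gives \<open>|\<F>H| \<ge> e/2\<close> on a ball of fixed radius around
  it, which contradicts the smallness of the tail of the \<open>L\<^sup>2\<close> norm. Square integrability thus takes the place of the
  Riemann--Lebesgue lemma.
\<close>

lemma fourier_vanishes_at_infinity:
  fixes H :: "'d::finite fn"
  assumes H: "integrable lborel H" and L2: "L2sq (fourier H) < \<infinity>"
  shows "(fourier H \<longlongrightarrow> 0) at_infinity"
  unfolding Lim_at_infinity
proof (intro allI impI)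
  fix e :: real assume e: "e > 0"
  let ?F = "fourier H"
  have Fm: "?F \<in> borel_measurable borel" by (rule fourier_measurable[OF H])
  note Fm[measurable]
  have "((\<lambda>h. fconst TYPE('d) * (\<integral>k. cmod ((exp (- \<i> * of_real (h \<bullet> k)) - 1) * H k) \<partial>lborel)) \<longlongrightarrow> fconst TYPE('d) * 0) (at 0)"
    by (intro tendsto_mult_left exp_diff_integral_tendsto H)
  then have "\<forall>\<^sub>F h in at 0. fconst TYPE('d) * (\<integral>k. cmod ((exp (- \<i> * of_real (h \<bullet> k)) - 1) * H k) \<partial>lborel) < e / 2"
    using e by (intro order_tendstoD(2)) auto
  then obtain \<delta> where \<delta>: "\<delta> > 0" "\<And>h::real^'d. h \<noteq> 0 \<Longrightarrow> norm h < \<delta> \<Longrightarrow>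
      fconst TYPE('d) * (\<integral>k. cmod ((exp (- \<i> * of_real (h \<bullet> k)) - 1) * H k) \<partial>lborel) < e / 2"
    unfolding eventually_at by (auto simp: dist_norm)
  have uc: "cmod (?F y) \<ge> e / 2" if x: "cmod (?F x) \<ge> e" and y: "y \<in> ball x \<delta>" for x y
  proof (cases "y = x")
    case False
    then have "cmod (?F (x + (y - x)) - ?F x) < e / 2"
      using fourier_diff_bound[OF H, of x "y - x"] \<delta>(2)[of "y - x"] y by (simp add: dist_norm norm_minus_commute)
    then show ?thesis using x norm_triangle_ineq2[of "?F x" "?F y"] by (simp add: norm_minus_commute)
  qed (use x e in simp)
  define \<beta> where "\<beta> = (e / 2)\<^sup>2 * (unit_ball_vol (real DIM(real^'d)) * \<delta> ^ DIM(real^'d))"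
  have \<beta>: "\<beta> > 0" using e \<delta>(1) by (simp add: \<beta>_def)
  have "eventually (\<lambda>n. L2sq (\<lambda>x. ?F x - cut (real n) ?F x) < ennreal \<beta>) sequentially"
    by (rule order_tendstoD(2)[OF tail_tendsto_zero[OF Fm L2]]) (use \<beta> in simp)
  then obtain n :: nat where n: "L2sq (\<lambda>x. ?F x - cut (real n) ?F x) < ennreal \<beta>"
    using eventually_happens'[OF sequentially_bot] by blast
  have "cmod (?F x) < e" if x: "norm x \<ge> real n + \<delta>" for x
  proof (rule ccontr)
    assume "\<not> cmod (?F x) < e"
    then have Fx: "cmod (?F x) \<ge> e" by simp
    have "ennreal \<beta> = ennreal ((e / 2)\<^sup>2) * emeasure lborel (ball x \<delta>)"
      using \<delta>(1) by (simp add: \<beta>_def emeasure_ball ennreal_mult')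
    also have "\<dots> = (\<integral>\<^sup>+y. ennreal ((e / 2)\<^sup>2) * indicator (ball x \<delta>) y \<partial>lborel)"
      by (rule nn_integral_cmult_indicator[symmetric]) simp
    also have "\<dots> \<le> L2sq (\<lambda>x. ?F x - cut (real n) ?F x)"
      unfolding L2sq_def
    proof (rule nn_integral_mono)
      fix y
      show "ennreal ((e / 2)\<^sup>2) * indicator (ball x \<delta>) y \<le> ennreal ((cmod (?F y - cut (real n) ?F y))\<^sup>2)"
      proof (cases "y \<in> ball x \<delta>")
        case True
        have "norm x \<le> norm y + norm (x - y)" using norm_triangle_ineq[of y "x - y"] by simp
        moreover have "norm (x - y) < \<delta>" using True by (simp add: dist_norm)
        ultimately have "\<not> norm y \<le> real n" using x by linarith
        moreover have "(e / 2)\<^sup>2 \<le> (cmod (?F y))\<^sup>2" using uc[OF Fx True] e by (intro power_mono) auto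
        ultimately show ?thesis using True by (simp add: cut_def ennreal_leI)
      qed simp
    qed
    finally show False using n by simp
  qed
  then show "\<exists>b. \<forall>x. b \<le> norm x \<longrightarrow> dist (?F x) 0 < e" by (auto simp: dist_norm)
qed

lemma functional_of_fourier_reflect:
  fixes G :: "'d::finite fn"
  assumes G: "integrable lborel G"
  shows "functional_of (fourier (\<lambda>k. G (- k))) = spectral G"
  unfolding functional_of_def spectral_def
proof (rule restrict_ext)
  fix \<phi> :: "'d fn" assume "\<phi> \<in> Phi"
  then have \<phi>: "\<phi> \<in> schwartz" by (rule Phi_schwartz)
  have GR: "integrable lborel (\<lambda>k. G (- k))" using integrable_lborel_scale[of "-1" G 0] G by simp
  have [measurable]: "G \<in> borel_measurable borel" "fourier \<phi> \<in> borel_measurable borel"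
    using G schwartz_measurable[OF fourier_schwartz[OF \<phi>]] by auto
  have "(\<integral>x. fourier (\<lambda>k. G (- k)) x * \<phi> x \<partial>lborel) = (\<integral>k. G (- k) * fourier \<phi> k \<partial>lborel)"
    by (rule multiplication_formula[OF GR schwartz_integrable[OF \<phi>]])
  also have "\<dots> = (\<integral>k. G k * fourier \<phi> (- k) \<partial>lborel)"
    by (subst integral_lborel_scale[of "-1" "\<lambda>k. G (- k) * fourier \<phi> k" 0]) auto
  finally show "(\<integral>x. fourier (\<lambda>k. G (- k)) x * \<phi> x \<partial>lborel) = (\<integral>k. G k * fourier \<phi> (- k) \<partial>lborel)" .
qed

lemma weight_integral_finite:
  fixes n j :: real
  assumes "0 \<le> j" "j + real CARD('d::finite) / 2 < n"
  shows "(\<integral>\<^sup>+k. ennreal (norm k powr (2 * j) / (1 + norm k powr (2 * n))) \<partial>(lborel :: (real^'d) measure)) < \<infinity>"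
proof -
  have n: "n > 0" "n - j > real CARD('d) / 2" "n \<ge> j" using assms by (auto simp: add_nonneg_pos intro: order.strict_trans1[OF add_nonneg_nonneg])
  have le: "norm k powr (2 * j) / (1 + norm k powr (2 * n)) \<le> 2 powr n * (1 + (norm k)\<^sup>2) powr (- (n - j))" for k :: "real^'d"
  proof -
    define t where "t = (norm k)\<^sup>2"
    have t: "t \<ge> 0" by (simp add: t_def)
    have p: "norm k powr (2 * s) = t powr s" for s
    proof (cases "k = 0")
      case False
      then have "t powr s = (norm k powr 2) powr s" by (simp add: t_def)
      then show ?thesis by (simp only: powr_powr)
    qed (simp add: t_def)
    have w: "(1 + t) powr n \<le> 2 powr n * (1 + t powr n)"
    proof (cases "t \<le> 1")
      case True
      have "(1 + t) powr n \<le> 2 powr n" using t True n by (intro powr_mono2) auto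
      also have "\<dots> \<le> 2 powr n * (1 + t powr n)" by (simp add: mult_le_cancel_left1)
      finally show ?thesis .
    next
      case False
      have "(1 + t) powr n \<le> (2 * t) powr n" using t False n by (intro powr_mono2) auto
      also have "\<dots> = 2 powr n * t powr n" using t by (simp add: powr_mult)
      also have "\<dots> \<le> 2 powr n * (1 + t powr n)" by (intro mult_left_mono) auto
      finally show ?thesis .
    qed
    have "t powr j \<le> (1 + t) powr j" using t assms(1) by (intro powr_mono2) auto
    then have "t powr j * (1 + t) powr (n - j) \<le> (1 + t) powr j * (1 + t) powr (n - j)" by (rule mult_right_mono) simp
    also have "\<dots> = (1 + t) powr n" by (simp flip: powr_add)
    also have "\<dots> \<le> 2 powr n * (1 + t powr n)" by (rule w)
    finally have "t powr j * (1 + t) powr (n - j) \<le> 2 powr n * (1 + t powr n)" .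
    moreover have "(1 + t) powr (n - j) > 0" "1 + t powr n > 0" using t by (auto simp: add_pos_nonneg)
    ultimately have "t powr j / (1 + t powr n) \<le> 2 powr n * inverse ((1 + t) powr (n - j))"
      by (simp add: field_simps)
    then show ?thesis unfolding p powr_minus t_def[symmetric] .
  qed
  have "(\<integral>\<^sup>+k. ennreal (norm k powr (2 * j) / (1 + norm k powr (2 * n))) \<partial>(lborel :: (real^'d) measure))
     \<le> (\<integral>\<^sup>+k. ennreal (2 powr n) * ennreal ((1 + (norm k)\<^sup>2) powr (- (n - j))) \<partial>(lborel :: (real^'d) measure))"
    using le by (intro nn_integral_mono) (simp only: ennreal_mult[OF powr_ge_zero powr_ge_zero, symmetric] ennreal_leI)
  also have "\<dots> = ennreal (2 powr n) * (\<integral>\<^sup>+k. ennreal ((1 + (norm k)\<^sup>2) powr (- (n - j))) \<partial>(lborel :: (real^'d) measure))"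
    by (rule nn_integral_cmult) measurable
  also have "\<dots> < \<infinity>" using nn_integral_bracket_powr[OF n(2)] by (simp add: ennreal_mult_less_top)
  finally show ?thesis .
qed

lemma ennreal_le_if_power2_le:
  fixes X :: ennreal
  assumes "X\<^sup>2 \<le> (ennreal c)\<^sup>2" and "0 \<le> c"
  shows "X \<le> ennreal c"
proof (cases X)
  case (real x)
  then have "ennreal (x\<^sup>2) \<le> ennreal (c\<^sup>2)" using assms by (simp add: ennreal_power)
  then have "x\<^sup>2 \<le> c\<^sup>2" by (simp add: ennreal_le_iff)
  then have "x \<le> c" by (rule power2_le_imp_le) (rule assms)
  then show ?thesis using real by (simp add: ennreal_leI)
next
  case top
  then have False using assms by (simp add: ennreal_power top_power_ennreal top_unique)
  then show ?thesis ..
qed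

text \<open>
  Cauchy--Schwarz with the weight \<open>R\<^bsup>2n\<^esup> + |k|\<^bsup>2n\<^esup>\<close>. One factor is at most \<open>R\<^bsup>2n\<^esup> a\<^sup>2 + b\<^sup>2\<close>; the other is
  \<open>\<integral> |k|\<^bsup>2j\<^esup>/(R\<^bsup>2n\<^esup> + |k|\<^bsup>2n\<^esup>)\<close>, finite as \<open>n - j > d/2\<close> and homogeneous in \<open>R\<close>. With \<open>R\<^sup>n = b/a\<close> the two terms of the
  first factor are equal and the powers of \<open>a\<close> and \<open>b\<close> come out as required.
\<close>

lemma L1_riesz_bound:
  fixes n j \<theta> :: real
  assumes j: "0 \<le> j" and n: "j + real CARD('d::finite) / 2 < n" and \<theta>: "\<theta> * n = j + real CARD('d) / 2"
  obtains C where "C \<ge> 0" "\<And>(g :: 'd fn) a b. g \<in> borel_measurable borel \<Longrightarrow> L2sq g \<le> ennreal (a\<^sup>2) \<Longrightarrow> L2sq (riesz n g) \<le> ennreal (b\<^sup>2) \<Longrightarrow> 0 \<le> a \<Longrightarrow> 0 \<le> b \<Longrightarrow>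
      (\<integral>\<^sup>+k. ennreal (cmod (riesz j g k)) \<partial>lborel) \<le> ennreal (C * (rpow a (1 - \<theta>) * rpow b \<theta>))"
proof -
  let ?d = "real CARD('d)"
  let ?q = "\<lambda>R (k::real^'d). norm k powr (2 * j) / (R powr (2 * n) + norm k powr (2 * n))"
  have n0: "n > 0" using j n by (smt (verit) of_nat_0_le_iff divide_nonneg_pos)
  have d0: "?d > 0" by simp
  have \<theta>01: "0 < \<theta>" "\<theta> < 1"
  proof -
    have "\<theta> = (j + ?d / 2) / n" using n0 \<theta> by (simp add: field_simps)
    then show "0 < \<theta>" "\<theta> < 1" using n0 n j d0 by (simp_all add: add_nonneg_pos)
  qed
  define I where "I = enn2real (\<integral>\<^sup>+k. ennreal (?q 1 k) \<partial>lborel)"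
  have I0: "I \<ge> 0" by (simp add: I_def)
  have I: "(\<integral>\<^sup>+k. ennreal (?q 1 k) \<partial>lborel) = ennreal I"
    unfolding I_def using weight_integral_finite[OF j n] by (simp add: less_top)
  have scale: "(\<integral>\<^sup>+k. ennreal (?q R k) \<partial>lborel) = ennreal (R powr (?d + 2 * j - 2 * n) * I)" if R: "R > 0" for R
  proof -
    have q: "?q R (R *\<^sub>R k) = R powr (2 * j - 2 * n) * ?q 1 k" for k
    proof -
      have "?q R (R *\<^sub>R k) = (R powr (2 * j) * norm k powr (2 * j)) / (R powr (2 * n) * (1 + norm k powr (2 * n)))"
        using R by (simp add: powr_mult distrib_left)
      then show ?thesis using R by (simp add: powr_diff)
    qed
    have "(\<integral>\<^sup>+k. ennreal (?q R k) \<partial>lborel) = R ^ CARD('d) * (\<integral>\<^sup>+k. ennreal (?q R (0 + R *\<^sub>R k)) \<partial>lborel)"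
      using R nn_integral_lborel_scale[of "\<lambda>k. ennreal (?q R k)" R 0] by (simp add: ennreal_power)
    also have "(\<integral>\<^sup>+k. ennreal (?q R (0 + R *\<^sub>R k)) \<partial>lborel) = (\<integral>\<^sup>+k. ennreal (R powr (2 * j - 2 * n)) * ennreal (?q 1 k) \<partial>lborel)"
      by (intro nn_integral_cong) (simp only: add_0 q ennreal_mult'[OF powr_ge_zero])
    also have "\<dots> = ennreal (R powr (2 * j - 2 * n)) * ennreal I"
      by (subst nn_integral_cmult) (auto simp only: I, measurable)
    also have "ennreal (R ^ CARD('d)) * (ennreal (R powr (2 * j - 2 * n)) * ennreal I) = ennreal (R ^ CARD('d) * R powr (2 * j - 2 * n) * I)"
      using R I0 by (simp add: ennreal_mult mult.assoc)
    also have "R ^ CARD('d) * R powr (2 * j - 2 * n) = R powr (?d + 2 * j - 2 * n)"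
      using R by (simp add: powr_add[symmetric] add_diff_eq flip: powr_realpow)
    finally show ?thesis .
  qed
  define C where "C = sqrt (2 * I)"
  have main: "(\<integral>\<^sup>+k. ennreal (cmod (riesz j g k)) \<partial>lborel) \<le> ennreal (C * (rpow a (1 - \<theta>) * rpow b \<theta>))"
    if gm[measurable]: "g \<in> borel_measurable borel" and A: "L2sq g \<le> ennreal (a\<^sup>2)" and B: "L2sq (riesz n g) \<le> ennreal (b\<^sup>2)" and ab: "0 \<le> a" "0 \<le> b"
    for g :: "'d fn" and a b
  proof (cases "a = 0 \<or> b = 0")
    case True
    then have "AE k in lborel. g k = 0"
      using AE_zero_of_L2sq[OF gm] AE_zero_of_L2sq_riesz[OF gm, of n] A B by auto
    then have "(\<integral>\<^sup>+k. ennreal (cmod (riesz j g k)) \<partial>lborel) = (\<integral>\<^sup>+k. 0 \<partial>(lborel :: (real^'d) measure))"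
      by (intro nn_integral_cong_AE) auto
    then show ?thesis by simp
  next
    case False
    then have a: "a > 0" and b: "b > 0" using ab by auto
    define R where "R = (b / a) powr (1 / n)"
    have R: "R > 0" using a b by (simp add: R_def)
    have Rn: "R powr (2 * n) * a\<^sup>2 = b\<^sup>2"
    proof -
      have "R powr (2 * n) = (b / a) powr 2" unfolding R_def powr_powr using n0 by simp
      then show ?thesis using a b by (simp add: power_divide)
    qed
    let ?s = "\<lambda>k::real^'d. R powr (2 * n) + norm k powr (2 * n)"
    have s: "?s k > 0" for k using R by (simp add: add_pos_nonneg)
    let ?u = "\<lambda>k::real^'d. ennreal (norm k powr j / sqrt (?s k))" and ?v = "\<lambda>k. ennreal (sqrt (?s k) * cmod (g k))"
    have "(\<integral>\<^sup>+k. ennreal (cmod (riesz j g k)) \<partial>lborel) = (\<integral>\<^sup>+k. ?u k * ?v k \<partial>lborel)"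
    proof (rule nn_integral_cong)
      fix k :: "real^'d"
      have "norm k powr j / sqrt (?s k) * (sqrt (?s k) * cmod (g k)) = cmod (riesz j g k)"
        using s[of k] by (simp add: norm_mult)
      then show "ennreal (cmod (riesz j g k)) = ?u k * ?v k"
        using s[of k] by (simp only: ennreal_mult[symmetric] divide_nonneg_nonneg powr_ge_zero real_sqrt_ge_zero less_imp_le mult_nonneg_nonneg norm_ge_zero)
    qed
    then have "(\<integral>\<^sup>+k. ennreal (cmod (riesz j g k)) \<partial>lborel)\<^sup>2 = (\<integral>\<^sup>+k. ?u k * ?v k \<partial>lborel)\<^sup>2" by simp
    also have "\<dots> \<le> (\<integral>\<^sup>+k. ?u k ^ 2 \<partial>lborel) * (\<integral>\<^sup>+k. ?v k ^ 2 \<partial>lborel)"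
      by (rule Cauchy_Schwarz_nn_integral) measurable
    also have "(\<integral>\<^sup>+k. ?u k ^ 2 \<partial>lborel) = (\<integral>\<^sup>+k. ennreal (?q R k) \<partial>lborel)"
    proof (rule nn_integral_cong)
      fix k :: "real^'d"
      have "(norm k powr j / sqrt (?s k))\<^sup>2 = ?q R k"
        using s[of k] unfolding power_divide powr_squared by (simp add: less_imp_le)
      then show "?u k ^ 2 = ennreal (?q R k)"
        using s[of k] by (subst ennreal_power) (simp_all add: less_imp_le)
    qed
    also have "\<dots> = ennreal (R powr (?d + 2 * j - 2 * n) * I)" by (rule scale[OF R])
    also have "(\<integral>\<^sup>+k. ?v k ^ 2 \<partial>lborel) \<le> ennreal (2 * b\<^sup>2)"
    proof -
      have "(\<integral>\<^sup>+k. ?v k ^ 2 \<partial>lborel) = (\<integral>\<^sup>+k. ennreal (R powr (2 * n)) * ennreal ((cmod (g k))\<^sup>2) + ennreal (norm k powr (2 * n) * (cmod (g k))\<^sup>2) \<partial>lborel)"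
      proof (rule nn_integral_cong)
        fix k :: "real^'d"
        have "(sqrt (?s k) * cmod (g k))\<^sup>2 = R powr (2 * n) * (cmod (g k))\<^sup>2 + norm k powr (2 * n) * (cmod (g k))\<^sup>2"
          using s[of k] by (simp add: power_mult_distrib less_imp_le distrib_right)
        then show "?v k ^ 2 = ennreal (R powr (2 * n)) * ennreal ((cmod (g k))\<^sup>2) + ennreal (norm k powr (2 * n) * (cmod (g k))\<^sup>2)"
          using s[of k] by (subst ennreal_power) (simp_all add: less_imp_le ennreal_mult[symmetric] flip: ennreal_plus)
      qed
      also have "\<dots> = ennreal (R powr (2 * n)) * L2sq g + L2sq (riesz n g)"
        unfolding L2sq_riesz unfolding L2sq_def by (subst nn_integral_add) (simp_all add: nn_integral_cmult)
      also have "\<dots> \<le> ennreal (R powr (2 * n)) * ennreal (a\<^sup>2) + ennreal (b\<^sup>2)"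
        by (intro add_mono mult_left_mono A B) auto
      also have "\<dots> = ennreal (R powr (2 * n) * a\<^sup>2 + b\<^sup>2)"
        by (subst ennreal_plus) (auto simp: ennreal_mult)
      also have "R powr (2 * n) * a\<^sup>2 + b\<^sup>2 = 2 * b\<^sup>2" using Rn by simp
      finally show ?thesis .
    qed
    then have "ennreal (R powr (?d + 2 * j - 2 * n) * I) * (\<integral>\<^sup>+k. ?v k ^ 2 \<partial>lborel) \<le> ennreal (R powr (?d + 2 * j - 2 * n) * I) * ennreal (2 * b\<^sup>2)"
      by (rule mult_left_mono) simp
    also have "\<dots> = ennreal (R powr (?d + 2 * j - 2 * n) * I * (2 * b\<^sup>2))"
      using I0 by (intro ennreal_mult[symmetric]) auto
    also have "R powr (?d + 2 * j - 2 * n) * I * (2 * b\<^sup>2) = (C * (rpow a (1 - \<theta>) * rpow b \<theta>))\<^sup>2"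
    proof -
      have "?d + 2 * j - 2 * n = 2 * n * (\<theta> - 1)" using \<theta> by (simp add: algebra_simps)
      then have "R powr (?d + 2 * j - 2 * n) = ((b / a) powr (\<theta> - 1))\<^sup>2"
        unfolding R_def powr_powr powr_squared using n0 by simp
      moreover have "(b / a) powr (\<theta> - 1) * b = a powr (1 - \<theta>) * b powr \<theta>"
      proof -
        have "(b / a) powr (\<theta> - 1) = b powr (\<theta> - 1) * a powr (1 - \<theta>)"
          using a b powr_minus_divide[of a "\<theta> - 1"] by (simp add: powr_divide)
        moreover have "b powr (\<theta> - 1) * b = b powr \<theta>"
          using b powr_add[of b "\<theta> - 1" 1] by simp
        ultimately show ?thesis by (simp add: mult_ac)
      qed
      ultimately have "R powr (?d + 2 * j - 2 * n) * b\<^sup>2 = (a powr (1 - \<theta>) * b powr \<theta>)\<^sup>2"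
        by (metis power_mult_distrib)
      moreover have "C\<^sup>2 = 2 * I" using I0 by (simp add: C_def)
      ultimately show ?thesis using \<theta>01 by (simp add: rpow_def power_mult_distrib)
    qed
    finally have "(\<integral>\<^sup>+k. ennreal (cmod (riesz j g k)) \<partial>lborel)\<^sup>2 \<le> (ennreal (C * (rpow a (1 - \<theta>) * rpow b \<theta>)))\<^sup>2"
      using I0 by (subst ennreal_power) (auto simp: C_def rpow_def)
    then show ?thesis using I0 by (rule_tac ennreal_le_if_power2_le) (auto simp: C_def rpow_def)
  qed
  have "C \<ge> 0" using I0 by (simp add: C_def)
  then show ?thesis using that main by blast
qed

section \<open>Densities of Sobolev functionals\<close>

lemma Lp_fun_2_L2sq:
  fixes f :: "'d::finite fn"
  assumes "f \<in> Lp_fun 2"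
  shows "f \<in> borel_measurable borel" and "L2sq f = ennreal ((Lp_fun_norm 2 f)\<^sup>2)" and "0 \<le> Lp_fun_norm 2 f"
proof -
  show "f \<in> borel_measurable borel" using assms by (simp add: Lp_fun_def)
  have p: "cmod (f x) powr 2 = (cmod (f x))\<^sup>2" for x by (simp add: powr_numeral)
  have i: "integrable lborel (\<lambda>x. (cmod (f x))\<^sup>2)" using assms by (simp add: Lp_fun_def p)
  have norm: "Lp_fun_norm 2 f = sqrt (\<integral>x. (cmod (f x))\<^sup>2 \<partial>lborel)"
    by (simp add: Lp_fun_norm_def p powr_half_sqrt integral_nonneg_AE)
  show "0 \<le> Lp_fun_norm 2 f" unfolding norm by (simp add: integral_nonneg_AE)
  have "(Lp_fun_norm 2 f)\<^sup>2 = (\<integral>x. (cmod (f x))\<^sup>2 \<partial>lborel)" unfolding norm by (simp add: integral_nonneg_AE)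
  then show "L2sq f = ennreal ((Lp_fun_norm 2 f)\<^sup>2)"
    unfolding L2sq_def using nn_integral_eq_integral[OF i] by simp
qed

lemma Lp_representative:
  assumes "f \<in> Lp r"
  obtains f0 where "f0 \<in> Lp_fun r" "functional_of f0 = f" "Lp_norm r f = Lp_fun_norm r f0"
  using assms inv_into_into[of f functional_of "Lp_fun r"] f_inv_into_f[of f functional_of "Lp_fun r"]
  unfolding Lp_def Lp_norm_def by blast

lemma Lp2_spectral:
  fixes f :: "'d::finite functional"
  assumes "f \<in> Lp 2"
  obtains g :: "'d fn" where "g \<in> borel_measurable borel" "L2sq g \<le> ennreal ((Lp_norm 2 f)\<^sup>2)" "f = spectral g" "0 \<le> Lp_norm 2 f"
proof -
  obtain f0 where f0: "f0 \<in> Lp_fun 2" "functional_of f0 = f" "Lp_norm 2 f = Lp_fun_norm 2 f0"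
    by (rule Lp_representative[OF assms])
  note L = Lp_fun_2_L2sq[OF f0(1)]
  have "L2sq f0 < \<infinity>" by (simp add: L(2))
  then obtain g where g: "g \<in> borel_measurable borel" "L2sq g \<le> L2sq f0" "functional_of f0 = spectral g"
    by (rule functional_of_L2_spectral[OF L(1)])
  show ?thesis by (rule that[OF g(1)]) (use g L f0 in simp_all)
qed

text \<open>
  Both \<open>f\<close> and \<open>D\<^sup>n f\<close> have square integrable densities \<open>g\<close> and \<open>h\<close>. Since \<open>|k|\<^sup>n g\<close> is a density of \<open>D\<^sup>n f\<close> as well,
  uniqueness of densities gives \<open>|k|\<^sup>n g = h\<close> almost everywhere.
\<close>

lemma sobolev_spectral:
  fixes f :: "'d::finite functional"
  assumes f: "f \<in> sobolev_H n" and n: "0 \<le> n"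
  obtains g :: "'d fn" where "g \<in> borel_measurable borel" "f = spectral g"
    "L2sq g \<le> ennreal ((Lp_norm 2 f)\<^sup>2)" "L2sq (riesz n g) \<le> ennreal ((Lp_norm 2 (D n f))\<^sup>2)"
    "0 \<le> Lp_norm 2 f" "0 \<le> Lp_norm 2 (D n f)"
proof -
  have f2: "f \<in> Lp 2" "D n f \<in> Lp 2" using f by (simp_all add: sobolev_H_def)
  obtain g where g: "g \<in> borel_measurable borel" "L2sq g \<le> ennreal ((Lp_norm 2 f)\<^sup>2)" "f = spectral g" "0 \<le> Lp_norm 2 f"
    by (rule Lp2_spectral[OF f2(1)])
  obtain h where h: "h \<in> borel_measurable borel" "L2sq h \<le> ennreal ((Lp_norm 2 (D n f))\<^sup>2)" "D n f = spectral h" "0 \<le> Lp_norm 2 (D n f)"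
    by (rule Lp2_spectral[OF f2(2)])
  have tg: "tempered g" by (rule tempered_L2[OF g(1) order.strict_trans1[OF g(2)]]) simp
  have th: "tempered h" by (rule tempered_L2[OF h(1) order.strict_trans1[OF h(2)]]) simp
  have "spectral (riesz n g) = spectral h" using D_spectral[OF tg n] g(3) h(3) by simp
  then have "AE k in lborel. riesz n g k = h k" by (rule spectral_injective[OF tempered_abs_powr[OF tg n] th])
  then have "L2sq (riesz n g) = L2sq h" by (rule L2sq_cong_AE)
  then show ?thesis using that g h by simp
qed

section \<open>The Gagliardo-Nirenberg and Sobolev inequalities\<close>

lemma Lp_fun_from_nn_integral:
  fixes F :: "'d::finite fn"
  assumes [measurable]: "F \<in> borel_measurable borel" and p: "p > 0" and C: "C \<ge> 0" and t: "t \<ge> 0"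
    and le: "(\<integral>\<^sup>+x. ennreal (cmod (F x) powr p) \<partial>lborel) \<le> ennreal (C * t powr p)"
  shows "F \<in> Lp_fun (ereal p)" and "Lp_fun_norm (ereal p) F \<le> C powr (1 / p) * t"
proof -
  have i: "integrable lborel (\<lambda>x. cmod (F x) powr p)"
    by (rule integrableI_nonneg) (use le in \<open>auto intro: order.strict_trans1\<close>)
  then show "F \<in> Lp_fun (ereal p)" by (simp add: Lp_fun_def)
  have nn: "0 \<le> (\<integral>x. cmod (F x) powr p \<partial>lborel)" by (simp add: integral_nonneg_AE)
  have "ennreal (\<integral>x. cmod (F x) powr p \<partial>lborel) \<le> ennreal (C * t powr p)"
    using le nn_integral_eq_integral[OF i] by simp
  then have "(\<integral>x. cmod (F x) powr p \<partial>lborel) \<le> C * t powr p" using C by (simp add: ennreal_le_iff)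
  then have "(\<integral>x. cmod (F x) powr p \<partial>lborel) powr (1 / p) \<le> (C * t powr p) powr (1 / p)"
    using nn p by (intro powr_mono2) auto
  also have "\<dots> = C powr (1 / p) * t"
    using C t p by (simp add: powr_mult powr_powr)
  finally show "Lp_fun_norm (ereal p) F \<le> C powr (1 / p) * t" by (simp add: Lp_fun_norm_def)
qed

lemma L2sq_riesz_finite:
  fixes g :: "'d::finite fn"
  assumes g: "g \<in> borel_measurable borel" "L2sq g \<le> ennreal (a\<^sup>2)" "L2sq (riesz n g) \<le> ennreal (b\<^sup>2)" "0 \<le> a" "0 \<le> b"
    and j: "0 \<le> j" "j \<le> n"
  shows "L2sq (riesz j g) < \<infinity>"
proof -
  define \<theta> where "\<theta> = (if n = 0 then 0 else j / n)"
  have "0 \<le> \<theta>" "\<theta> \<le> 1" "\<theta> * n = j" using j by (auto simp: \<theta>_def)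
  then have "L2sq (riesz j g) \<le> ennreal ((rpow a (1 - \<theta>) * rpow b \<theta>)\<^sup>2)"
    using L2sq_riesz_interpolation[OF g, of \<theta>] by simp
  then show ?thesis by (rule order.strict_trans1) simp
qed

lemma rpow_nonneg: "0 \<le> rpow x s"
  by (simp add: rpow_def)

text \<open>
  \<open>D\<^sup>j f\<close> has the integrable density \<open>|k|\<^sup>j g\<close>, so it is represented by a continuous function bounded by
  the \<open>L\<^sup>1\<close> norm of the density.
\<close>

lemma sobolev_sup_bound:
  fixes \<theta> n j :: real
  assumes j: "0 \<le> j" and n: "j + real CARD('d::finite) / 2 < n" and \<theta>: "\<theta> * n = j + real CARD('d) / 2"
  shows "\<exists>C\<ge>0. \<forall>f\<in>(sobolev_H n :: 'd functional set). D j f \<in> Lp \<infinity> \<and>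
    Lp_norm \<infinity> (D j f) \<le> C * (rpow (Lp_norm 2 f) (1 - \<theta>) * rpow (Lp_norm 2 (D n f)) \<theta>)"
proof -
  let ?c = "fconst TYPE('d)"
  have jn: "j \<le> n" "0 \<le> n" using n j of_nat_0_le_iff[of "CARD('d)"] by linarith+
  obtain C where C: "C \<ge> 0" "\<And>(g :: 'd fn) a b. g \<in> borel_measurable borel \<Longrightarrow> L2sq g \<le> ennreal (a\<^sup>2) \<Longrightarrow> L2sq (riesz n g) \<le> ennreal (b\<^sup>2) \<Longrightarrow> 0 \<le> a \<Longrightarrow> 0 \<le> b \<Longrightarrow>
      (\<integral>\<^sup>+k. ennreal (cmod (riesz j g k)) \<partial>lborel) \<le> ennreal (C * (rpow a (1 - \<theta>) * rpow b \<theta>))"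
    by (rule L1_riesz_bound[OF j n \<theta>], rule that)
  have "D j f \<in> Lp \<infinity> \<and> Lp_norm \<infinity> (D j f) \<le> (?c * C) * (rpow (Lp_norm 2 f) (1 - \<theta>) * rpow (Lp_norm 2 (D n f)) \<theta>)"
    if f: "f \<in> sobolev_H n" for f :: "'d functional"
  proof -
    obtain g where g: "g \<in> borel_measurable borel" "f = spectral g"
      "L2sq g \<le> ennreal ((Lp_norm 2 f)\<^sup>2)" "L2sq (riesz n g) \<le> ennreal ((Lp_norm 2 (D n f))\<^sup>2)"
      "0 \<le> Lp_norm 2 f" "0 \<le> Lp_norm 2 (D n f)"
      by (rule sobolev_spectral[OF f jn(2)])
    let ?t = "rpow (Lp_norm 2 f) (1 - \<theta>) * rpow (Lp_norm 2 (D n f)) \<theta>"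
    have t: "0 \<le> ?t" by (simp add: rpow_nonneg)
    let ?G = "riesz j g" and ?H = "\<lambda>k. riesz j g (- k)"
    have Gm: "?G \<in> borel_measurable borel" by (rule riesz_measurable[OF g(1)])
    have G1: "(\<integral>\<^sup>+k. ennreal (cmod (?G k)) \<partial>lborel) \<le> ennreal (C * ?t)" by (rule C(2)[OF g(1,3-6)])
    have Gi: "integrable lborel ?G"
      by (rule integrableI_bounded) (use Gm in simp, rule order.strict_trans1[OF G1], simp)
    have Hi: "integrable lborel ?H" using integrable_lborel_scale[of "-1" ?G 0] Gi by simp
    have tg: "tempered g" by (rule tempered_L2[OF g(1) order.strict_trans1[OF g(3)]]) simp
    have Df: "D j f = functional_of (fourier ?H)"
      unfolding g(2) D_spectral[OF tg j] by (rule functional_of_fourier_reflect[OF Gi, symmetric])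
    have "L2sq (fourier ?H) \<le> L2sq ?H" by (rule fourier_L2_contraction[OF Hi])
    also have "\<dots> = L2sq ?G" by (rule L2sq_reflect[OF Gm])
    also have "\<dots> < \<infinity>" by (rule L2sq_riesz_finite[OF g(1,3-6) j jn(1)])
    finally have lim: "(fourier ?H \<longlongrightarrow> 0) at_infinity" by (rule fourier_vanishes_at_infinity[OF Hi])
    have F: "fourier ?H \<in> Lp_fun \<infinity>" using lim fourier_continuous[OF Hi] by (simp add: Lp_fun_def)
    have "ennreal (\<integral>k. cmod (?G k) \<partial>lborel) \<le> ennreal (C * ?t)"
      using G1 nn_integral_eq_integral[of lborel "\<lambda>k. cmod (?G k)"] Gi by simp
    then have I: "(\<integral>k. cmod (?G k) \<partial>lborel) \<le> C * ?t" using C(1) t by (subst (asm) ennreal_le_iff) auto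
    have sup: "cmod (fourier ?H x) \<le> (?c * C) * ?t" for x
    proof -
      have "(\<integral>k. cmod (?H k) \<partial>lborel) = (\<integral>k. cmod (?G k) \<partial>lborel)"
        using Gm integral_lborel_scale[of "-1" "\<lambda>k. cmod (?G k)" 0] by simp
      then have "cmod (fourier ?H x) \<le> ?c * (\<integral>k. cmod (?G k) \<partial>lborel)"
        using norm_fourier_le[OF Hi, of x] by (simp only:)
      also have "\<dots> \<le> ?c * (C * ?t)" by (intro mult_left_mono I) simp
      finally show ?thesis by (simp only: mult.assoc)
    qed
    have "Lp_norm \<infinity> (D j f) = Lp_fun_norm \<infinity> (fourier ?H)"
      unfolding Df by (rule Lp_norm_functional_of[OF F]) simp
    also have "\<dots> = (SUP x. cmod (fourier ?H x))" by (simp add: Lp_fun_norm_def)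
    also have "\<dots> \<le> (?c * C) * ?t" by (rule cSUP_least) (use sup in auto)
    finally show ?thesis using F unfolding Df Lp_def by blast
  qed
  moreover have "?c * C \<ge> 0" using C(1) by simp
  ultimately show ?thesis by blast
qed

text \<open>
  Let \<open>\<sigma> = \<theta> n - j\<close>. For \<open>\<sigma> = 0\<close> the exponent is 2 and the \<open>L\<^sup>2\<close> bound of the transform suffices; for \<open>\<sigma> > 0\<close> the
  fractional Sobolev inequality applies to the density \<open>|k|\<^sup>j g\<close>. In both cases \<open>|k|\<^sup>\<sigma> |k|\<^sup>j g = |k|\<^bsup>\<theta>n\<^esup> g\<close> is
  estimated by interpolation.
\<close>

lemma sobolev_Lp_bound:
  fixes \<theta> n j p :: real
  assumes \<theta>: "0 \<le> \<theta>" "\<theta> \<le> 1" and n: "0 \<le> n" and j: "0 \<le> j" "j \<le> \<theta> * n"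
    and p: "2 \<le> p" "1 / p = 1 / 2 - (\<theta> * n - j) / real CARD('d::finite)"
  shows "\<exists>C\<ge>0. \<forall>f\<in>(sobolev_H n :: 'd functional set). D j f \<in> Lp (ereal p) \<and>
    Lp_norm (ereal p) (D j f) \<le> C * (rpow (Lp_norm 2 f) (1 - \<theta>) * rpow (Lp_norm 2 (D n f)) \<theta>)"
proof -
  let ?d = "real CARD('d)"
  define \<sigma> where "\<sigma> = \<theta> * n - j"
  have d: "?d > 0" by simp
  have \<theta>n: "\<theta> * n \<le> n" using \<theta> n mult_right_mono[of \<theta> 1 n] by simp
  have jn: "j \<le> n" using j \<theta>n by simp
  have \<sigma>0: "0 \<le> \<sigma>" using j by (simp add: \<sigma>_def)
  have p0: "1 / p > 0" using p(1) by simp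
  have \<sigma>d: "2 * \<sigma> < ?d"
  proof -
    have "\<sigma> / ?d < 1 / 2" using p0 p(2) by (simp add: \<sigma>_def)
    then show ?thesis using d by (simp add: field_simps)
  qed
  have peq: "p = 2 * ?d / (?d - 2 * \<sigma>)"
  proof -
    have "1 / p = (?d - 2 * \<sigma>) / (2 * ?d)" unfolding p(2) \<sigma>_def[symmetric] using d by (simp add: field_simps)
    then show ?thesis using p(1) d \<sigma>d by (simp add: field_simps)
  qed
  obtain K where K: "K \<ge> 0" "\<And>(G :: 'd fn) F w. L2_fourier_pair G F \<Longrightarrow> L2sq (riesz \<sigma> G) \<le> ennreal (w\<^sup>2) \<Longrightarrow> 0 \<le> w \<Longrightarrow>
      (\<integral>\<^sup>+x. ennreal (cmod (F x) powr p) \<partial>lborel) \<le> ennreal (K * w powr p)"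
  proof (cases "\<sigma> = 0")
    case True
    then have p2: "p = 2" using peq d by simp
    have "(\<integral>\<^sup>+x. ennreal (cmod (F x) powr p) \<partial>lborel) \<le> ennreal (1 * w powr p)"
      if GF: "L2_fourier_pair G F" and W: "L2sq (riesz \<sigma> G) \<le> ennreal (w\<^sup>2)" and w: "0 \<le> w" for G F :: "'d fn" and w
    proof -
      have "AE k in (lborel :: (real^'d) measure). k \<noteq> 0" by (rule AE_lborel_singleton)
      then have "AE k in lborel. riesz \<sigma> G k = G k" by eventually_elim (simp add: True)
      then have "L2sq (riesz \<sigma> G) = L2sq G" by (rule L2sq_cong_AE)
      then have "L2sq F \<le> ennreal (w\<^sup>2)" using L2_fourier_norm[OF GF] W by simp
      then show ?thesis using w by (simp add: p2 L2sq_def powr_numeral)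
    qed
    then show ?thesis using that[of 1] by simp
  next
    case False
    then have "0 < \<sigma>" using \<sigma>0 by simp
    then show ?thesis by (rule fractional_sobolev[OF _ \<sigma>d peq]) (rule that)
  qed
  have "D j f \<in> Lp (ereal p) \<and> Lp_norm (ereal p) (D j f) \<le> K powr (1 / p) * (rpow (Lp_norm 2 f) (1 - \<theta>) * rpow (Lp_norm 2 (D n f)) \<theta>)"
    if f: "f \<in> sobolev_H n" for f :: "'d functional"
  proof -
    obtain g where g: "g \<in> borel_measurable borel" "f = spectral g"
      "L2sq g \<le> ennreal ((Lp_norm 2 f)\<^sup>2)" "L2sq (riesz n g) \<le> ennreal ((Lp_norm 2 (D n f))\<^sup>2)"
      "0 \<le> Lp_norm 2 f" "0 \<le> Lp_norm 2 (D n f)"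
      by (rule sobolev_spectral[OF f n])
    let ?t = "rpow (Lp_norm 2 f) (1 - \<theta>) * rpow (Lp_norm 2 (D n f)) \<theta>"
    have t: "0 \<le> ?t" by (simp add: rpow_nonneg)
    let ?G = "riesz j g" and ?H = "\<lambda>k. riesz j g (- k)"
    have Gm: "?G \<in> borel_measurable borel" by (rule riesz_measurable[OF g(1)])
    have Hm: "?H \<in> borel_measurable borel" using measurable_compose[OF borel_measurable_uminus[OF measurable_ident] Gm] by simp
    have tg: "tempered g" by (rule tempered_L2[OF g(1) order.strict_trans1[OF g(3)]]) simp
    have "L2sq ?H < \<infinity>"
      unfolding L2sq_reflect[OF Gm] by (rule L2sq_riesz_finite[OF g(1,3-6) j(1) jn])
    then obtain F where F: "L2_fourier_pair ?H F" by (rule L2_fourier_pairE[OF Hm])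
    have Fm: "F \<in> borel_measurable borel" using F by (simp add: L2_fourier_pair_def)
    have Df: "D j f = functional_of F"
      unfolding g(2) D_spectral[OF tg j(1)] by (rule functional_of_L2_pair[OF F, symmetric])
    have "riesz \<sigma> ?H = (\<lambda>k. riesz (\<theta> * n) g (- k))"
      using fun_cong[OF riesz_riesz[of \<sigma> j g]] by (simp add: \<sigma>_def fun_eq_iff) (metis norm_minus_cancel)
    then have "L2sq (riesz \<sigma> ?H) = L2sq (riesz (\<theta> * n) g)"
      using L2sq_reflect[OF riesz_measurable[OF g(1)], of "\<theta> * n"] by simp
    also have "\<dots> \<le> ennreal (?t\<^sup>2)" by (rule L2sq_riesz_interpolation[OF g(1,3-6) \<theta>])
    finally have "(\<integral>\<^sup>+x. ennreal (cmod (F x) powr p) \<partial>lborel) \<le> ennreal (K * ?t powr p)"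
      by (rule K(2)[OF F _ t])
    note bound = Lp_fun_from_nn_integral[OF Fm _ K(1) t this]
    have "p > 0" "1 \<le> ereal p" using p(1) by simp_all
    then show ?thesis
      using bound Lp_norm_functional_of[of F "ereal p"] unfolding Df Lp_def by auto
  qed
  moreover have "K powr (1 / p) \<ge> 0" by simp
  ultimately show ?thesis by blast
qed

text \<open>
  Both factors increase if \<open>a\<close> and \<open>b\<close> are replaced by the common upper bound \<open>sqrt (a\<^sup>2 + b\<^sup>2)\<close>.
\<close>

lemma rpow_mult_le_sqrt:
  assumes "0 \<le> a" "0 \<le> b" "0 \<le> \<theta>" "\<theta> \<le> 1"
  shows "rpow a (1 - \<theta>) * rpow b \<theta> \<le> sqrt (a\<^sup>2 + b\<^sup>2)"
proof -
  define m where "m = sqrt (a\<^sup>2 + b\<^sup>2)"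
  have m: "a \<le> m" "b \<le> m" "0 \<le> m"
    by (auto simp: m_def intro!: real_le_rsqrt)
  have mono: "rpow x s \<le> rpow m s" if "0 \<le> x" "x \<le> m" "0 \<le> s" for x s
    using that by (auto simp: rpow_def intro: powr_mono2)
  have "rpow a (1 - \<theta>) * rpow b \<theta> \<le> rpow m (1 - \<theta>) * rpow m \<theta>"
    using assms m by (intro mult_mono mono rpow_nonneg) auto
  also have "\<dots> = m"
  proof -
    consider "\<theta> = 0" | "\<theta> = 1" | "0 < \<theta>" "\<theta> < 1" using assms by linarith
    then show ?thesis
    proof cases
      case 3
      then show ?thesis using m by (simp add: rpow_def flip: powr_add)
    qed (use m in \<open>simp_all add: rpow_def\<close>)
  qed
  finally show ?thesis by (simp add: m_def)
qed

theorem proposition5p16: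
  fixes \<theta> n j :: real and r :: ereal
  assumes "0 \<le> \<theta>" and "\<theta> \<le> 1"
    and "0 \<le> n" and "0 \<le> j"
    and "0 \<le> \<theta> * n - j" and "\<theta> * n - j \<le> real CARD('d::finite) / 2"
    and "n = j + real CARD('d) / 2 \<Longrightarrow> \<theta> \<noteq> 1"
    and "2 \<le> r" and "1 / r = ereal (1 / 2 - (\<theta> * n - j) / real CARD('d))"
  shows "(sobolev_H n :: 'd functional set) \<subseteq> L2rj r j \<and>
    (\<exists>G::real. G \<ge> 0 \<and> (\<forall>f \<in> (sobolev_H n :: 'd functional set).
       Lp_norm r (D j f) \<le> G * rpow (Lp_norm 2 f) (1 - \<theta>) * rpow (Lp_norm 2 (D n f)) \<theta>)) \<and>
    (\<exists>S::real. S \<ge> 0 \<and> (\<forall>f \<in> (sobolev_H n :: 'd functional set).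
       Lp_norm r (D j f) \<le> S * sqrt ((Lp_norm 2 f)\<^sup>2 + (Lp_norm 2 (D n f))\<^sup>2)))"
proof -
  have "\<exists>C\<ge>0. \<forall>f\<in>(sobolev_H n :: 'd functional set). D j f \<in> Lp r \<and>
    Lp_norm r (D j f) \<le> C * (rpow (Lp_norm 2 f) (1 - \<theta>) * rpow (Lp_norm 2 (D n f)) \<theta>)"
  proof (cases "r = \<infinity>")
    case True
    have d: "real CARD('d) > 0" by simp
    have "1 / r = ereal 0" by (simp add: True zero_ereal_def)
    then have "1 / 2 - (\<theta> * n - j) / real CARD('d) = 0" using assms(9) by (simp only: ereal.inject)
    then have "(\<theta> * n - j) / real CARD('d) = 1 / 2" by linarith
    then have \<theta>n: "\<theta> * n = j + real CARD('d) / 2" using d by (simp add: field_simps)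
    then have pos: "\<theta> * n > 0" using assms(4) d by linarith
    then have "n > 0" using assms(1,3) by (simp add: zero_less_mult_iff)
    moreover have "\<theta> < 1" using assms(2,7) \<theta>n by (cases "\<theta> = 1") auto
    ultimately have "\<theta> * n < n" by simp
    then have "j + real CARD('d) / 2 < n" using \<theta>n by simp
    from sobolev_sup_bound[OF assms(4) this \<theta>n] show ?thesis unfolding True .
  next
    case False
    then obtain p where p: "r = ereal p" using assms(8) by (cases r) auto
    have "2 \<le> p" using assms(8) by (simp add: p)
    moreover have "1 / p = 1 / 2 - (\<theta> * n - j) / real CARD('d)"
      using assms(9) \<open>2 \<le> p\<close> by (simp add: p one_ereal_def)
    ultimately show ?thesis
      unfolding p using assms by (intro sobolev_Lp_bound) auto
  qed
  then obtain C where C: "C \<ge> 0" and bound: "\<And>f. f \<in> (sobolev_H n :: 'd functional set) \<Longrightarrow> D j f \<in> Lp r \<and>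
    Lp_norm r (D j f) \<le> C * (rpow (Lp_norm 2 f) (1 - \<theta>) * rpow (Lp_norm 2 (D n f)) \<theta>)" by blast
  have sob: "Lp_norm r (D j f) \<le> C * sqrt ((Lp_norm 2 f)\<^sup>2 + (Lp_norm 2 (D n f))\<^sup>2)"
    if f: "f \<in> (sobolev_H n :: 'd functional set)" for f
  proof -
    have nn: "0 \<le> Lp_norm 2 f" "0 \<le> Lp_norm 2 (D n f)"
      using sobolev_spectral[OF f assms(3)] by blast+
    have "Lp_norm r (D j f) \<le> C * (rpow (Lp_norm 2 f) (1 - \<theta>) * rpow (Lp_norm 2 (D n f)) \<theta>)" using bound[OF f] by blast
    also have "\<dots> \<le> C * sqrt ((Lp_norm 2 f)\<^sup>2 + (Lp_norm 2 (D n f))\<^sup>2)"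
      by (intro mult_left_mono rpow_mult_le_sqrt nn assms(1,2) C)
    finally show ?thesis .
  qed
  show ?thesis
  proof (intro conjI)
    show "(sobolev_H n :: 'd functional set) \<subseteq> L2rj r j"
      using bound by (auto simp: L2rj_def sobolev_H_def)
    show "\<exists>G::real. G \<ge> 0 \<and> (\<forall>f \<in> (sobolev_H n :: 'd functional set).
       Lp_norm r (D j f) \<le> G * rpow (Lp_norm 2 f) (1 - \<theta>) * rpow (Lp_norm 2 (D n f)) \<theta>)"
      using C bound by (intro exI[of _ C]) (simp add: mult.assoc)
    show "\<exists>S::real. S \<ge> 0 \<and> (\<forall>f \<in> (sobolev_H n :: 'd functional set).
       Lp_norm r (D j f) \<le> S * sqrt ((Lp_norm 2 f)\<^sup>2 + (Lp_norm 2 (D n f))\<^sup>2))"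
      using C sob by blast
  qed
qed

end
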